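(* Let $N$ be a positive integer and let $\mathcal F=(F_1,F_2,F_3)$ be a trio of finite sets of positive integers (the empty set is allowed, in which case we take $\max F=-1$). Write $f_{i,M}=\max F_i$ and $k_i=|F_i|$, $i=1,2,3$. Let $\alpha$ and $\beta$ be real numbers satisfying $$\alpha,\ \alpha+\beta\notin\mathbb Z_{-1},\qquad \beta\notin\mathbb Z_{f_{3,M}},$$ and moreover $\alpha+\beta+2f_{2,M}+1\notin\mathbb N$ if $F_2\neq\emptyset$, and $\alpha-\beta+2f_{3,M}+1\notin\mathbb N$ if $F_3\neq\emptyset$. Let $\lambda(x)=x(x+\alpha+\beta+1)$ and consider the weight $$\rho^{\mathcal F}_{\alpha,\beta,N}=\prod_{f\in F_1}(\lambda-\lambda(N-f))\prod_{f\in F_2}(\lambda-\lambda(f))\prod_{f\in F_3}(\lambda-\lambda(f-\beta))\;\rho_{\alpha,\beta,N},$$ where $\rho_{\alpha,\beta,N}$ is the dual Hahn weight. Let $\mathcal U=(I(F_1),I(F_2),I(F_3))$, let $m_i=|I(F_i)|$, $i=1,2,3$, and assume that $$\Omega^{\mathcal U}_{\alpha+f_{2,M}+f_{3,M}+2,\;\beta+f_{2,M}-f_{3,M},\;N-f_{1,M}-f_{2,M}-2}(n)\neq0,\qquad 0\le n\le N+m_1+m_2+1.$$ Then the measure $\rho^{\mathcal F}_{\alpha,\beta,N}$ has associated a sequence of orthogonal polynomials, and they are eigenfunctions of a higher order difference operator of the form $T=\sum_{j=s}^{r}h_j\,\mathfrak s_{x,j}$, with $h_j$ rational functions of $x$,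 where $$-s=r=\sum_{f\in F_1}f+\sum_{f\in F_2}f+\sum_{f\in F_3}f-\binom{k_1}{2}-\binom{k_2}{2}-\binom{k_3}{2}+1$$ (this operator can be explicitly constructed by the $\mathcal D$-operator procedure described in the context).
   Context: Notation. $\mathbb N=\{0,1,2,\dots\}$; $\mathbb Z_i=\{j\in\mathbb Z:j\le i\}$; $(a)_k=a(a+1)\cdots(a+k-1)$, $(a)_0=1$. Transform of sets. For a finite set $F$ of positive integers, $I(F)=\{1,2,\dots,\max F\}\setminus\{\max F-f:f\in F\}$; in particular $I(\emptyset)=\emptyset$. Hahn polynomials. $$h_n^{a,b,c}(x)=\sum_{j=0}^n\frac{(-n)_j(n+a+b+1)_j(-c+j)_{n-j}(a+j+1)_{n-j}(-x)_j}{j!}.$$ The determinant $\Omega$. For a trio $\mathcal U=(U_1,U_2,U_3)$ of finite sets of nonnegative integers with $m_i=|U_i|$, $m=m_1+m_2+m_3$, and parameters $\alpha,\beta,N$, $\Omega^{\mathcal U}_{\alpha,\beta,N}(x)$ is the $m\times m$ determinant whose rows are indexed by $u\in U_1$, then $u\in U_2$, then $u\in U_3$, and whose $j$-th column entries, $1\le j\le m$, are $$\begin{cases}(-1)^{j}h_{u}^{\beta+N+1,\alpha+N+1,-2-N}(-x+j-1),&u\in U_1,\\[2pt]\dfrac{(\beta+N-x+j+1)_{m-j}}{(\alpha+x-m+1)_{m-j}}\,h_{u}^{-\alpha,-\beta,-2-N}(-x+j-1),&u\in U_2,\\[6pt]\dfrac{(N-x+j+1)_{m-j}}{(\alpha+x-m+1)_{m-j}}\,h_{u}^{-\alpha,\beta,-\beta-2-N}(-x+j-1),&u\in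 U_3.\end{cases}$$ Dual Hahn weight. For a positive integer $N$ and real $\alpha,\beta\ne-1,\dots,-N$ with $\alpha+\beta\ne-1,\dots,-2N-1$, $$\rho_{\alpha,\beta,N}=\sum_{x=0}^Nw_{*;\alpha,\beta,N}(x)\,\delta_x,\qquad w_{*;\alpha,\beta,N}(x)=\frac{(2x+\alpha+\beta+1)(\alpha+1)_x(-N)_xN!}{(-1)^x(x+\alpha+\beta+1)_{N+1}(\beta+1)_x\,x!}.$$ Multiplying a measure in $x$ by a polynomial in $\lambda$ means multiplying by that polynomial evaluated at $\lambda=\lambda(x)$. Orthogonality. Polynomials in $\lambda$ are integrated against measures in $x$ through $\lambda=\lambda(x)$. A sequence of polynomials $(q_n)_n$, with $q_n$ of degree $n$ in $\lambda$, is orthogonal with respect to $\mu$ if $\langle\mu,q_nq_k\rangle=0$ for $n\ne k$ and $\langle\mu,q_n^2\rangle\ne0$. Since the measure here has finite support, the sequence is finite. Difference operators. $\mathfrak s_{x,j}$ is the shift acting on polynomials in $\lambda$ by $\mathfrak s_{x,j}(p)=p(\lambda(x+j))$; $\Delta_x=\mathfrak s_{x,1}-\mathfrak s_{x,0}$, $\nabla_x=\mathfrak s_{x,0}-\mathfrak s_{x,-1}$. Eigenfunctions of $T$: $T(q_n)=\lambda_nq_n$ with $\lambda_n$ independent of $x$. Explicit construction. For parameters $\alpha,\beta,N$ let $R_n=R_n^{\alpha,\beta,N}$ be the dual Hahn polynomials $$R_n(\lambda)=\frac1{n!}\sum_{j=0}^n(-1)^j\frac{(-n)_j(-N+j)_{n-j}}{(\alpha+1)_jj!}\prod_{i=0}^{j-1}(\lambda-i(\alpha+\beta+1+i)).$$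 They satisfy $\Gamma(R_n)=nR_n$, $\Gamma=B\,\mathfrak s_{x,1}-(B+D)\,\mathfrak s_{x,0}+D\,\mathfrak s_{x,-1}$, with $$B(x)=-\tfrac{(x+\alpha+1)(x+\alpha+\beta+1)(N-x)}{(2x+\alpha+\beta+1)(2x+\alpha+\beta+2)},\qquad D(x)=-\tfrac{x(x+\alpha+\beta+N+1)(x+\beta)}{(2x+\alpha+\beta)(2x+\alpha+\beta+1)}.$$ Order the elements of $U_1$, $U_2$, $U_3$ (in this order of sets) as $g_1,\dots,g_m$. According to whether $g_h$ comes from $U_1$, $U_2$ or $U_3$, put $\varepsilon_n^h=-1$, $\frac{\beta+N-n+1}{\alpha+n}$, $\frac{N-n+1}{\alpha+n}$; let $Y_h(x)$ be the Hahn polynomial of degree $g_h$ with parameters $(\beta+N+1,\alpha+N+1,-2-N)$, $(-\alpha,-\beta,-2-N)$, $(-\alpha,\beta,-\beta-2-N)$, respectively, evaluated at $-x-1$; and let $\mathcal D_h$ be the operator defined by $\mathcal D_h(R_n)=\sum_{j=1}^n(-1)^{j+1}\varepsilon^h_n\cdots\varepsilon^h_{n-j+1}R_{n-j}$, which equals respectively $$-\tfrac{(x+\alpha+1)(x+\alpha+\beta+1)}{(2x+\alpha+\beta+1)(2x+\alpha+\beta+2)}\Delta_x+\tfrac{x(x+\beta)}{(2x+\alpha+\beta)(2x+\alpha+\beta+1)}\nabla_x,$$ $$\tfrac{(x+\alpha+1)(N-x)}{(2x+\alpha+\beta+1)(2x+\alpha+\beta+2)}\Delta_x+\tfrac{(x+\beta)(x+\alpha+\beta+N+1)}{(2x+\alpha+\beta)(2x+\alpha+\beta+1)}\nabla_x,$$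 $$\tfrac{(x+\alpha+\beta+1)(N-x)}{(2x+\alpha+\beta+1)(2x+\alpha+\beta+2)}\Delta_x+\tfrac{x(x+\alpha+\beta+N+1)}{(2x+\alpha+\beta)(2x+\alpha+\beta+1)}\nabla_x.$$ Let $\xi^h_{x,i}=\prod_{j=0}^{i-1}\varepsilon^h_{x-j}$ for $i\ge0$, and $\Omega(x)=\det(\xi^l_{x-j,m-j}Y_l(x-j))_{l,j=1}^m$ (which is $\pm\Omega^{\mathcal U}_{\alpha,\beta,N}(x)$). Let $$S(x)=\frac{(-1)^{\binom m2+m_1}\big((\alpha+x-m+1)_{m-1}\big)^{m_2+m_3}}{p(x)},$$ $$p(x)=\prod_{i=0}^{m_2-2}(\beta+N+m-x-i)^{m_2-i-1}\prod_{i=0}^{m_3-2}(N+m-x-i)^{m_3-i-1}\prod_{i=0}^{m_2+m_3-2}(-\alpha-x+i+1)^{m_2+m_3-i-1}.$$ With $\mathbb I_h=\{1,\dots,m\}\setminus\{h\}$ let $$M_h(x)=\sum_{j=1}^m(-1)^{h+j}\xi^h_{x,m-j}S(x+j)\det\big(\xi^l_{x+j-r,m-r}Y_l(x+j-r)\big)_{l\in\mathbb I_h;\,r\in\mathbb I_j},$$ and let $P_S$ be a polynomial with $P_S(x)-P_S(x-1)=S(x)\Omega(x)$. The polynomial $q_n$ is the $(m+1)\times(m+1)$ determinant with first row $(-1)^{j-1}R_{n+1-j}(\lambda)$ and further rows $\xi^h_{n+1-j,m+1-j}Y_h(n+1-j)$, $1\le j\le m+1$, $h=1,\dots,m$, and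 the operator is $P_S(\Gamma)+\sum_{h=1}^mM_h(\Gamma)\,\mathcal D_h\,Y_h(\Gamma)$, with eigenvalues $P_S(n)$. For the result stated, this is applied to $\mathcal U=(I(F_1),I(F_2),I(F_3))$ with $\alpha,\beta,N$ replaced by $\alpha+f_{2,M}+f_{3,M}+2$, $\beta+f_{2,M}-f_{3,M}$, $N-f_{1,M}-f_{2,M}-2$ (also in the quadratic lattice $\lambda$), and with $x$ replaced by $x-f_{2,M}-1$. *)

theory Defs
  imports Complex_Main "HOL-Computational_Algebra.Polynomial" "Jordan_Normal_Form.Determinant"
begin

section \<open>Finite sets of positive integers\<close>

definition integers_upto :: "int \<Rightarrow> real set" where
  "integers_upto i = {real_of_int j | j. j \<le> i}"

definition maxF :: "nat set \<Rightarrow> int" where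
  "maxF F = (if F = {} then -1 else int (Max F))"

definition I_set :: "nat set \<Rightarrow> nat set" where
  "I_set F = (if F = {} then {} else {1..Max F} - (\<lambda>f. Max F - f) ` F)"


section \<open>Hahn and dual Hahn polynomials, the dual Hahn weight\<close>

text \<open>The polynomials are elements of \<^typ>\<open>real poly\<close>, since they are also evaluated at
  difference operators; \<^term>\<open>pochhammer [:0, -1:] j\<close> is the polynomial $(-x)_j$.\<close>

definition hahn :: "nat \<Rightarrow> real \<Rightarrow> real \<Rightarrow> real \<Rightarrow> real poly" where
  "hahn n a b c = (\<Sum>j=0..n.
     smult (pochhammer (- real n) j * pochhammer (real n + a + b + 1) j *
            pochhammer (- c + real j) (n - j) * pochhammer (a + real j + 1) (n - j) / fact j)
       (pochhammer [:0, -1:] j))"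

definition dual_hahn :: "real \<Rightarrow> real \<Rightarrow> real \<Rightarrow> nat \<Rightarrow> real poly" where
  "dual_hahn \<alpha> \<beta> N n = smult (1 / fact n) (\<Sum>j=0..n.
     smult ((-1) ^ j * pochhammer (- real n) j * pochhammer (- N + real j) (n - j) /
            (pochhammer (\<alpha> + 1) j * fact j))
       (\<Prod>i<j. [:- (real i * (\<alpha> + \<beta> + 1 + real i)), 1:]))"

definition lam :: "real \<Rightarrow> real \<Rightarrow> real \<Rightarrow> real" where
  "lam \<alpha> \<beta> x = x * (x + \<alpha> + \<beta> + 1)"

definition dual_hahn_weight :: "real \<Rightarrow> real \<Rightarrow> nat \<Rightarrow> nat \<Rightarrow> real" where
  "dual_hahn_weight \<alpha> \<beta> N x =
     (2 * real x + \<alpha> + \<beta> + 1) * pochhammer (\<alpha> + 1) x * pochhammer (- real N) x * fact N /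
     ((-1) ^ x * pochhammer (real x + \<alpha> + \<beta> + 1) (N + 1) * pochhammer (\<beta> + 1) x * fact x)"

text \<open>A measure supported in $\{0, \dots, N\}$ is given by its (possibly negative) masses; only
  the values at points $x \le N$ are relevant.\<close>

definition rho_F :: "nat set \<Rightarrow> nat set \<Rightarrow> nat set \<Rightarrow> real \<Rightarrow> real \<Rightarrow> nat \<Rightarrow> nat \<Rightarrow> real" where
  "rho_F F1 F2 F3 \<alpha> \<beta> N x =
     (\<Prod>f\<in>F1. lam \<alpha> \<beta> (real x) - lam \<alpha> \<beta> (real N - real f)) *
     (\<Prod>f\<in>F2. lam \<alpha> \<beta> (real x) - lam \<alpha> \<beta> (real f)) *
     (\<Prod>f\<in>F3. lam \<alpha> \<beta> (real x) - lam \<alpha> \<beta> (real f - \<beta>)) *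
     dual_hahn_weight \<alpha> \<beta> N x"

definition integral_lam :: "(nat \<Rightarrow> real) \<Rightarrow> nat \<Rightarrow> (real \<Rightarrow> real) \<Rightarrow> real poly \<Rightarrow> real" where
  "integral_lam \<mu> N l p = (\<Sum>x=0..N. \<mu> x * poly p (l (real x)))"

text \<open>The sequence of orthogonal polynomials of a measure with finite support has as many members
  as the support has points (the lattice \<open>l\<close> is injective on $\{0, \dots, N\}$ where this is used).\<close>

definition orthogonal_sequence ::
    "(nat \<Rightarrow> real) \<Rightarrow> nat \<Rightarrow> (real \<Rightarrow> real) \<Rightarrow> (nat \<Rightarrow> real poly) \<Rightarrow> bool" where
  "orthogonal_sequence \<mu> N l q \<longleftrightarrow>
     (let L = card {x \<in> {0..N}. \<mu> x \<noteq> 0} in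
       (\<forall>n<L. degree (q n) = n) \<and>
       (\<forall>n<L. \<forall>k<L. n \<noteq> k \<longrightarrow> integral_lam \<mu> N l (q n * q k) = 0) \<and>
       (\<forall>n<L. integral_lam \<mu> N l (q n ^ 2) \<noteq> 0))"


section \<open>Difference operators\<close>

text \<open>Operators act on functions of the real variable $x$. Rational functions are treated as real
  functions, identities between them being required outside a finite set; in this way the
  convention \<^prop>\<open>(a::real) / 0 = 0\<close> at the poles has no influence.\<close>

definition rational_function :: "(real \<Rightarrow> real) \<Rightarrow> bool" where
  "rational_function h \<longleftrightarrow>
     (\<exists>p q. q \<noteq> 0 \<and> (\<forall>\<^sub>F x in cofinite. h x = poly p x / poly q x))"

text \<open>$T = \sum_{j=s}^{r} h_j\, \mathfrak s_{x,j}$ with rational $h_j$, of exact order: neither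
  $h_s$ nor $h_r$ is the zero rational function.\<close>

definition difference_operator ::
    "((real \<Rightarrow> real) \<Rightarrow> real \<Rightarrow> real) \<Rightarrow> int \<Rightarrow> int \<Rightarrow> bool" where
  "difference_operator T s r \<longleftrightarrow>
     (\<exists>h :: int \<Rightarrow> real \<Rightarrow> real.
        (\<forall>j\<in>{s..r}. rational_function (h j)) \<and>
        \<not> (\<forall>\<^sub>F x in cofinite. h s x = 0) \<and> \<not> (\<forall>\<^sub>F x in cofinite. h r x = 0) \<and>
        (\<forall>\<^sub>F x in cofinite. \<forall>f. T f x = (\<Sum>j=s..r. h j x * f (x + real_of_int j))))"

definition poly_at_operator ::
    "real poly \<Rightarrow> ((real \<Rightarrow> real) \<Rightarrow> real \<Rightarrow> real) \<Rightarrow> (real \<Rightarrow> real) \<Rightarrow> real \<Rightarrow> real" where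
  "poly_at_operator p G f x = (\<Sum>i\<le>degree p. coeff p i * (G ^^ i) f x)"


section \<open>The determinant \<open>\<Omega>\<close> and the \<open>\<D>\<close>-operator construction\<close>

datatype family = First | Second | Third

text \<open>The elements of \<open>U1\<close>, \<open>U2\<close>, \<open>U3\<close> are listed in this order, tagged by the set they come from.
  Rows and columns of matrices are indexed from 0, whereas $g_1, \dots, g_m$ and the column numbers
  $1 \le j \le m$ in the usual formulas start from 1: \<open>row_labels ! h\<close> is $g_{h+1}$, and the column
  with index \<open>i\<close> is the one with $j = i + 1$. The third parameter \<open>N\<close> is an arbitrary real number;
  it may be a negative integer when the construction is applied.\<close>

context
  fixes \<alpha> \<beta> N :: real and U1 U2 U3 :: "nat set"
begin

definition row_labels :: "(family \<times> nat) list" where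
  "row_labels = map (Pair First) (sorted_list_of_set U1) @ map (Pair Second) (sorted_list_of_set U2) @
          map (Pair Third) (sorted_list_of_set U3)"

definition num_rows :: nat where
  "num_rows = card U1 + card U2 + card U3"

fun hahn_row :: "family \<times> nat \<Rightarrow> real poly" where
  "hahn_row (First, u) = hahn u (\<beta> + N + 1) (\<alpha> + N + 1) (- 2 - N)"
| "hahn_row (Second, u) = hahn u (- \<alpha>) (- \<beta>) (- 2 - N)"
| "hahn_row (Third, u) = hahn u (- \<alpha>) \<beta> (- \<beta> - 2 - N)"

fun Omega_factor :: "family \<Rightarrow> nat \<Rightarrow> real \<Rightarrow> real" where
  "Omega_factor First j x = (-1) ^ j"
| "Omega_factor Second j x = pochhammer (\<beta> + N - x + real j + 1) (num_rows - j) /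
     pochhammer (\<alpha> + x - real num_rows + 1) (num_rows - j)"
| "Omega_factor Third j x = pochhammer (N - x + real j + 1) (num_rows - j) /
     pochhammer (\<alpha> + x - real num_rows + 1) (num_rows - j)"

definition Omega :: "real \<Rightarrow> real" where
  "Omega x = det (mat num_rows num_rows (\<lambda>(l, i). let j = i + 1 in
     Omega_factor (fst (row_labels ! l)) j x * poly (hahn_row (row_labels ! l)) (- x + real j - 1)))"

text \<open>None of the denominators occurring in the entries of \<^term>\<open>Omega x\<close> vanishes.\<close>

definition Omega_defined :: "real \<Rightarrow> bool" where
  "Omega_defined x \<longleftrightarrow> (U2 \<noteq> {} \<or> U3 \<noteq> {} \<longrightarrow>
     (\<forall>j\<in>{1..num_rows}. pochhammer (\<alpha> + x - real num_rows + 1) (num_rows - j) \<noteq> 0))"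

fun eps :: "family \<Rightarrow> real \<Rightarrow> real" where
  "eps First n = -1"
| "eps Second n = (\<beta> + N - n + 1) / (\<alpha> + n)"
| "eps Third n = (N - n + 1) / (\<alpha> + n)"

definition xi :: "nat \<Rightarrow> real \<Rightarrow> nat \<Rightarrow> real" where
  "xi h x i = (\<Prod>j<i. eps (fst (row_labels ! h)) (x - real j))"

definition Y :: "nat \<Rightarrow> real poly" where
  "Y h = pcompose (hahn_row (row_labels ! h)) [:-1, -1:]"

definition Casorati :: "real \<Rightarrow> real mat" where
  "Casorati x = mat num_rows num_rows (\<lambda>(l, i). let j = i + 1 in
     xi l (x - real j) (num_rows - j) * poly (Y l) (x - real j))"

definition Omega_D :: "real \<Rightarrow> real" where
  "Omega_D x = det (Casorati x)"

definition S_den :: "real \<Rightarrow> real" where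
  "S_den x = (let m = num_rows; m2 = card U2; m3 = card U3 in
     (\<Prod>i<m2 - 1. (\<beta> + N + real m - x - real i) ^ (m2 - i - 1)) *
     (\<Prod>i<m3 - 1. (N + real m - x - real i) ^ (m3 - i - 1)) *
     (\<Prod>i<m2 + m3 - 1. (- \<alpha> - x + real i + 1) ^ (m2 + m3 - i - 1)))"

definition S_fun :: "real \<Rightarrow> real" where
  "S_fun x = (-1) ^ ((num_rows choose 2) + card U1) *
     pochhammer (\<alpha> + x - real num_rows + 1) (num_rows - 1) ^ (card U2 + card U3) / S_den x"

definition M_fun :: "nat \<Rightarrow> real \<Rightarrow> real" where
  "M_fun h x = (\<Sum>i<num_rows. let j = i + 1 in
     (-1) ^ (h + i) * xi h x (num_rows - j) * S_fun (x + real j) *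
     det (mat_delete (Casorati (x + real j)) h i))"

definition B_fun :: "real \<Rightarrow> real" where
  "B_fun x = - ((x + \<alpha> + 1) * (x + \<alpha> + \<beta> + 1) * (N - x) /
     ((2 * x + \<alpha> + \<beta> + 1) * (2 * x + \<alpha> + \<beta> + 2)))"

definition D_fun :: "real \<Rightarrow> real" where
  "D_fun x = - (x * (x + \<alpha> + \<beta> + N + 1) * (x + \<beta>) /
     ((2 * x + \<alpha> + \<beta>) * (2 * x + \<alpha> + \<beta> + 1)))"

definition Gamma_op :: "(real \<Rightarrow> real) \<Rightarrow> real \<Rightarrow> real" where
  "Gamma_op f x = B_fun x * f (x + 1) - (B_fun x + D_fun x) * f x + D_fun x * f (x - 1)"

fun D_op :: "family \<Rightarrow> (real \<Rightarrow> real) \<Rightarrow> real \<Rightarrow> real" where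
  "D_op First f x =
     - ((x + \<alpha> + 1) * (x + \<alpha> + \<beta> + 1) / ((2 * x + \<alpha> + \<beta> + 1) * (2 * x + \<alpha> + \<beta> + 2))) *
         (f (x + 1) - f x)
     + x * (x + \<beta>) / ((2 * x + \<alpha> + \<beta>) * (2 * x + \<alpha> + \<beta> + 1)) * (f x - f (x - 1))"
| "D_op Second f x =
     (x + \<alpha> + 1) * (N - x) / ((2 * x + \<alpha> + \<beta> + 1) * (2 * x + \<alpha> + \<beta> + 2)) * (f (x + 1) - f x)
     + (x + \<beta>) * (x + \<alpha> + \<beta> + N + 1) / ((2 * x + \<alpha> + \<beta>) * (2 * x + \<alpha> + \<beta> + 1)) *
         (f x - f (x - 1))"
| "D_op Third f x =
     (x + \<alpha> + \<beta> + 1) * (N - x) / ((2 * x + \<alpha> + \<beta> + 1) * (2 * x + \<alpha> + \<beta> + 2)) *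
         (f (x + 1) - f x)
     + x * (x + \<alpha> + \<beta> + N + 1) / ((2 * x + \<alpha> + \<beta>) * (2 * x + \<alpha> + \<beta> + 1)) *
         (f x - f (x - 1))"

text \<open>The $\mathcal D$-operator procedure needs a polynomial $P_S$ with
  $P_S(x) - P_S(x-1) = S(x)\Omega(x)$ and that the functions $M_h$ are polynomials.\<close>

definition D_procedure_data :: "real poly \<Rightarrow> (nat \<Rightarrow> real poly) \<Rightarrow> bool" where
  "D_procedure_data P M \<longleftrightarrow>
     (\<forall>\<^sub>F x in cofinite. poly P x - poly P (x - 1) = S_fun x * Omega_D x) \<and>
     (\<forall>h<num_rows. \<forall>\<^sub>F x in cofinite. poly (M h) x = M_fun h x)"

definition D_procedure_op ::
    "real poly \<Rightarrow> (nat \<Rightarrow> real poly) \<Rightarrow> (real \<Rightarrow> real) \<Rightarrow> real \<Rightarrow> real" where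
  "D_procedure_op P M f x = poly_at_operator P Gamma_op f x +
     (\<Sum>h<num_rows. poly_at_operator (M h) Gamma_op
        (D_op (fst (row_labels ! h)) (poly_at_operator (Y h) Gamma_op f)) x)"

text \<open>With the usual convention that $R_n = 0$ for $n < 0$.\<close>

definition q_poly :: "nat \<Rightarrow> real poly" where
  "q_poly n = det (mat (num_rows + 1) (num_rows + 1) (\<lambda>(k, i).
     if k = 0 then (if i \<le> n then (-1) ^ i * dual_hahn \<alpha> \<beta> N (n - i) else 0)
     else [: xi (k - 1) (real n - real i) (num_rows - i) *
             poly (Y (k - 1)) (real n - real i) :]))"

end

text \<open>The operator obtained from \<open>T\<close> by replacing the variable $x$ by $x - c$.\<close>

definition translate_operator ::
    "real \<Rightarrow> ((real \<Rightarrow> real) \<Rightarrow> real \<Rightarrow> real) \<Rightarrow> (real \<Rightarrow> real) \<Rightarrow> real \<Rightarrow> real" where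
  "translate_operator c T f x = T (\<lambda>y. f (y + c)) (x - c)"

end

theory Submission
  imports Defs
begin

text \<open>Let $K_n(t)$ be the continuous dual Hahn polynomial with parameters $p, q, r$, which is symmetric
  in them. With $p + q = \alpha + 1$, $p + r = -N$ and $t = (x + p)^2$ it is, up to a factor, the dual
  Hahn polynomial $R_n$, and the three families of rows arise by letting $r$, $p$ or $q$ play the
  distinguished role.

  Eigenfunctions: expanding the operator on the determinant $q_n$, the coefficient of $R_{n-s}$
  telescopes, by Laplace expansion of $\Omega$, to the cofactor times $P_S(n) - P_S(n-s)$.

  Order: since the ratios $\varepsilon$ are $-1 + O(1/n)$, binomial combinations of columns act as
  iterated differences; they exhibit the leading coefficient of $\Omega$ as a Vandermonde determinant
  in numbers attached to the rows. These are distinct, because a coincidence makes two rows of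
  $\Omega(0)$ proportional.

  Orthogonality: let $L_p$ be the functional with $L_p(K_n) = 0$ for $n \ge 1$. Then
  $L_p((t - p^2) f)$ is a multiple of $L_{p+1}(f)$, so that $L$ of the Christoffel factor, the
  Lagrange basis at the nodes of the rows and $K_n$ is an entry of the corresponding row. For generic
  parameters the moments of $q_n$ of order less than $n$ are therefore determinants whose first row is
  a combination of the others; the general case follows by continuity. The dual Hahn weight
  represents $L$ by telescoping. A vanishing norm of $q_n$ would make $q_n$ vanish on the whole
  support of the measure.\<close>

section \<open>Rational functions at infinity\<close>

text \<open>The Christoffel factor multiplies the functional by the nodes \<open>(p + f)^2\<close>
  with f in F2, and likewise for q with F3 and r with F1. Such a product can be absorbed into the
  parameters only when the nodes are consecutive. The gaps of each F in {0, ..., max F} supply the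
  missing nodes, and I(F) records them, counted down from max F. Absorbing all consecutive nodes
  moves p, q, r by max F2 + 1, max F3 + 1, max F1 + 1; this is the change of \<alpha>, \<beta>, N
  and x in the statement. Leaving out one gap yields a functional whose values on K_n are, up to a
  Pochhammer factor, a Hahn polynomial in n; its degree is the number of nodes above the gap. This
  is the origin of the rows.

  The obstacle is that p + r = -N is an integer, so the parameters are not generic: recurrence
  coefficients can vanish, nodes can coincide and Pochhammer quotients can degenerate. The
  identities are therefore proved for almost all values of a variable and reach the given parameters
  by continuity, for which the entries must have no pole there.\<close>

lemma eventually_cofinite_shift:
  fixes h :: real
  assumes "\<forall>\<^sub>F x in cofinite. Q x"
  shows "\<forall>\<^sub>F x in cofinite. Q (x + h)"
proof -
  have "{x. \<not> Q (x + h)} = (\<lambda>y. y - h) ` {x. \<not> Q x}"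
    by (force simp: image_iff algebra_simps)
  then show ?thesis
    using assms by (simp add: eventually_cofinite)
qed

lemma eventually_cofinite_poly_neq_0:
  fixes p :: "real poly"
  shows "p \<noteq> 0 \<Longrightarrow> \<forall>\<^sub>F x in cofinite. poly p x \<noteq> 0"
  by (simp add: eventually_cofinite poly_roots_finite)

lemma eventually_cofinite_linear_neq:
  "b \<noteq> 0 \<Longrightarrow> \<forall>\<^sub>F x in cofinite. a + b * x \<noteq> (0::real)"
  using eventually_cofinite_poly_neq_0[of "[:a, b:]"] by (simp add: mult.commute)

lemma poly_eq_cofinite:
  fixes p q :: "real poly"
  assumes "\<forall>\<^sub>F x in cofinite. poly p x = poly q x"
  shows "p = q"
proof (rule ccontr)
  assume "p \<noteq> q"
  then have "\<forall>\<^sub>F x in cofinite. poly (p - q) x \<noteq> 0"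
    by (intro eventually_cofinite_poly_neq_0) simp
  with assms have "\<forall>\<^sub>F x::real in cofinite. False"
    by eventually_elim simp
  then show False
    by (simp add: eventually_cofinite infinite_UNIV_char_0)
qed

text \<open>\<open>asy f d c\<close>: up to finitely many points, \<open>f\<close> is a rational function with
  $f(x) = c x^d + O(x^{d-1})$ at infinity.\<close>

definition asy :: "(real \<Rightarrow> real) \<Rightarrow> int \<Rightarrow> real \<Rightarrow> bool" where
  "asy f d c \<longleftrightarrow> (\<exists>p q e. lead_coeff q = 1 \<and> int e = d + int (degree q) \<and> degree p \<le> e \<and>
     coeff p e = c \<and> (\<forall>\<^sub>F x in cofinite. f x * poly q x = poly p x))"

lemma asyI:
  assumes "lead_coeff q = 1" "int e = d + int (degree q)" "degree p \<le> e" "coeff p e = c"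
    "\<forall>\<^sub>F x in cofinite. f x * poly q x = poly p x"
  shows "asy f d c"
  using assms unfolding asy_def by blast

lemma asyE:
  assumes "asy f d c"
  obtains p q e where "lead_coeff q = 1" "int e = d + int (degree q)" "degree p \<le> e" "coeff p e = c"
    "\<forall>\<^sub>F x in cofinite. f x * poly q x = poly p x"
  using assms unfolding asy_def by blast

lemma asy_cong:
  assumes "asy f d c" "\<forall>\<^sub>F x in cofinite. f x = g x"
  shows "asy g d c"
proof -
  from assms(1) obtain p q e where *: "lead_coeff q = 1" "int e = d + int (degree q)" "degree p \<le> e"
    "coeff p e = c" and ev: "\<forall>\<^sub>F x in cofinite. f x * poly q x = poly p x"
    by (elim asyE)
  have "\<forall>\<^sub>F x in cofinite. g x * poly q x = poly p x"
    using ev assms(2) by eventually_elim simp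
  with * show ?thesis by (rule asyI)
qed

lemma coeff_mult_degree_le:
  fixes p q :: "'a::comm_semiring_0 poly"
  assumes "degree p \<le> m" "degree q \<le> n"
  shows "coeff (p * q) (m + n) = coeff p m * coeff q n"
proof -
  have "coeff (p * q) (m + n) = (\<Sum>i\<le>m + n. coeff p i * coeff q (m + n - i))"
    by (simp add: coeff_mult)
  also have "\<dots> = (\<Sum>i\<in>{m}. coeff p i * coeff q (m + n - i))"
  proof (rule sum.mono_neutral_right)
    show "\<forall>i\<in>{..m + n} - {m}. coeff p i * coeff q (m + n - i) = 0"
    proof
      fix i assume "i \<in> {..m + n} - {m}"
      then consider "i > m" | "m + n - i > n" by fastforce
      then show "coeff p i * coeff q (m + n - i) = 0"
        using assms by cases (auto simp: coeff_eq_0)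
    qed
  qed auto
  finally show ?thesis by simp
qed

lemma asy_mult:
  assumes "asy f d c" "asy g d' c'"
  shows "asy (\<lambda>x. f x * g x) (d + d') (c * c')"
proof -
  from assms(1) obtain p q e where 1: "lead_coeff q = 1" "int e = d + int (degree q)" "degree p \<le> e"
    "coeff p e = c" and ev: "\<forall>\<^sub>F x in cofinite. f x * poly q x = poly p x"
    by (elim asyE)
  from assms(2) obtain p' q' e' where 2: "lead_coeff q' = 1" "int e' = d' + int (degree q')"
    "degree p' \<le> e'" "coeff p' e' = c'" and ev': "\<forall>\<^sub>F x in cofinite. g x * poly q' x = poly p' x"
    by (elim asyE)
  have nz: "q \<noteq> 0" "q' \<noteq> 0" using 1 2 by auto
  show ?thesis
  proof (rule asyI[of "q * q'" "e + e'" _ "p * p'"])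
    show "lead_coeff (q * q') = 1" using 1 2 by (simp add: lead_coeff_mult)
    show "int (e + e') = d + d' + int (degree (q * q'))"
      using 1 2 nz by (simp add: degree_mult_eq)
    show "degree (p * p') \<le> e + e'"
      using degree_mult_le[of p p'] 1 2 by linarith
    show "coeff (p * p') (e + e') = c * c'"
      using 1 2 by (simp add: coeff_mult_degree_le)
    show "\<forall>\<^sub>F x in cofinite. f x * g x * poly (q * q') x = poly (p * p') x"
      using ev ev'
    proof eventually_elim
      case (elim x)
      have "f x * g x * poly (q * q') x = (f x * poly q x) * (g x * poly q' x)" by simp
      then show ?case using elim by simp
    qed
  qed
qed

lemma asy_add:
  assumes "asy f d c" "asy g d c'"
  shows "asy (\<lambda>x. f x + g x) d (c + c')"
proof -
  from assms(1) obtain p q e where 1: "lead_coeff q = 1" "int e = d + int (degree q)" "degree p \<le> e"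
    "coeff p e = c" and ev: "\<forall>\<^sub>F x in cofinite. f x * poly q x = poly p x"
    by (elim asyE)
  from assms(2) obtain p' q' e' where 2: "lead_coeff q' = 1" "int e' = d + int (degree q')"
    "degree p' \<le> e'" "coeff p' e' = c'" and ev': "\<forall>\<^sub>F x in cofinite. g x * poly q' x = poly p' x"
    by (elim asyE)
  have nz: "q \<noteq> 0" "q' \<noteq> 0" using 1 2 by auto
  have e: "e + degree q' = e' + degree q" using 1 2 by linarith
  show ?thesis
  proof (rule asyI[of "q * q'" "e + degree q'" _ "p * q' + p' * q"])
    show "lead_coeff (q * q') = 1" using 1 2 by (simp add: lead_coeff_mult)
    show "int (e + degree q') = d + int (degree (q * q'))"
      using 1 2 nz by (simp add: degree_mult_eq)
    show "degree (p * q' + p' * q) \<le> e + degree q'"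
      using degree_mult_le[of p q'] degree_mult_le[of p' q] 1 2 e
      by (intro degree_add_le) linarith+
    show "coeff (p * q' + p' * q) (e + degree q') = c + c'"
      using coeff_mult_degree_le[of p e q' "degree q'"] coeff_mult_degree_le[of p' e' q "degree q"] 1 2 e
      by simp
    show "\<forall>\<^sub>F x in cofinite. (f x + g x) * poly (q * q') x = poly (p * q' + p' * q) x"
      using ev ev'
    proof eventually_elim
      case (elim x)
      have "(f x + g x) * poly (q * q') x = (f x * poly q x) * poly q' x + (g x * poly q' x) * poly q x"
        by (simp add: algebra_simps)
      then show ?case using elim by simp
    qed
  qed
qed

lemma asy_poly_le: "degree p \<le> e \<Longrightarrow> asy (poly p) (int e) (coeff p e)"
  by (rule asyI[of 1 e _ p]) auto

lemma asy_const: "asy (\<lambda>_. c) 0 c"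
  by (rule asy_cong[OF asy_poly_le[of "[:c:]" 0, simplified]]) simp

lemma asy_zero: "asy (\<lambda>_. 0) d 0"
proof (cases "d \<ge> 0")
  case True
  then show ?thesis by (intro asyI[of 1 "nat d" d 0]) auto
next
  case False
  \<comment> \<open>The exponent \<open>e\<close> is a natural number, so a denominator of degree
    \<open>- d\<close> is needed to represent the order d.\<close>
  then show ?thesis
    by (intro asyI[of "monom 1 (nat (- d))" 0 d 0]) (auto simp: degree_monom_eq)
qed

lemma asy_linear: "asy (\<lambda>x. s + k * x) 1 k"
  by (rule asyI[of 1 1 _ "[:s, k:]"]) (auto simp: mult.commute)

lemma asy_cmult: "asy f d c \<Longrightarrow> asy (\<lambda>x. k * f x) d (k * c)"
  using asy_mult[OF asy_const, of f d c k] by simp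

lemma asy_minus: "asy f d c \<Longrightarrow> asy (\<lambda>x. - f x) d (- c)"
  using asy_cmult[of f d c "-1"] by simp

text \<open>The order d is only an upper bound once the coefficient is 0; this lets functions of
  different orders be added, as in \<open>ratf_add\<close>.\<close>

lemma asy_mono:
  assumes "asy f d c" "d < d'"
  shows "asy f d' 0"
proof -
  from assms(1) obtain p q e where 1: "lead_coeff q = 1" "int e = d + int (degree q)" "degree p \<le> e"
    "coeff p e = c" and ev: "\<forall>\<^sub>F x in cofinite. f x * poly q x = poly p x"
    by (elim asyE)
  show ?thesis
    by (rule asyI[of q "e + nat (d' - d)" _ p]) (use 1 assms ev in \<open>auto simp: coeff_eq_0\<close>)
qed

lemma asy_sum:
  assumes "finite A" "\<And>i. i \<in> A \<Longrightarrow> asy (f i) d (c i)"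
  shows "asy (\<lambda>x. \<Sum>i\<in>A. f i x) d (\<Sum>i\<in>A. c i)"
  using assms by (induction A rule: finite_induct) (auto intro!: asy_zero asy_add)

lemma asy_prod:
  assumes "finite A" "\<And>i. i \<in> A \<Longrightarrow> asy (f i) (d i) (c i)"
  shows "asy (\<lambda>x. \<Prod>i\<in>A. f i x) (\<Sum>i\<in>A. d i) (\<Prod>i\<in>A. c i)"
  using assms by (induction A rule: finite_induct) (auto intro!: asy_mult simp: asy_const)

lemma asy_power: "asy f d c \<Longrightarrow> asy (\<lambda>x. f x ^ n) (int n * d) (c ^ n)"
  using asy_prod[of "{..<n}" "\<lambda>_. f" "\<lambda>_. d" "\<lambda>_. c"] by simp

lemma asy_inverse_linear:
  assumes "k \<noteq> 0"
  shows "asy (\<lambda>x. 1 / (s + k * x)) (- 1) (1 / k)"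
proof (rule asyI[of "[:s / k, 1:]" 0 _ "[:1 / k:]"])
  show "\<forall>\<^sub>F x in cofinite. 1 / (s + k * x) * poly [:s / k, 1:] x = poly [:1 / k:] x"
    using eventually_cofinite_linear_neq[OF assms, of s]
    by eventually_elim (use assms in \<open>simp add: divide_simps\<close>)
qed auto

text \<open>Horner step: if D is the difference belonging to p, then the one belonging to
  \<open>pCons a p\<close> is \<open>pCons 0 D + smult h (p + D)\<close>, whose top coefficient
  collects one term from D and one from h p.\<close>

lemma coeff_pcompose_shift:
  fixes p :: "real poly"
  assumes "degree p \<le> Suc e"
  shows "coeff (pcompose p [:h, 1:] - p) e = real (Suc e) * h * coeff p (Suc e)"
    and "degree (pcompose p [:h, 1:] - p) \<le> e"
proof -
  have *: "coeff (pcompose p [:h, 1:] - p) e = real (Suc e) * h * coeff p (Suc e) \<and>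
      degree (pcompose p [:h, 1:] - p) \<le> e" if "degree p \<le> Suc e" for p :: "real poly" and e
    using that
  proof (induction p arbitrary: e rule: pCons_induct)
    case 0
    then show ?case by simp
  next
    case (pCons a p)
    define D where "D = pcompose p [:h, 1:] - p"
    have eq: "pcompose (pCons a p) [:h, 1:] - pCons a p = pCons 0 (p + D) + smult h (p + D) - pCons 0 p"
      by (simp add: D_def pcompose_pCons algebra_simps)
    have eq': "\<dots> = pCons 0 D + smult h (p + D)"
      by simp
    show ?case
    proof (cases "degree p = 0")
      case True
      then obtain b where p: "p = [:b:]" by (rule degree_eq_zeroE)
      then have "D = 0" by (simp add: D_def)
      then have "pcompose (pCons a p) [:h, 1:] - pCons a p = [:h * b:]"
        using eq eq' p by simp
      then show ?thesis
        using p by (cases e) (auto simp: coeff_pCons split: nat.splits)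
    next
      case False
      then have "p \<noteq> 0" by auto
      with pCons.prems have "degree p \<le> e" by simp
      with False obtain e' where e: "e = Suc e'" by (cases e) auto
      from pCons.IH[of e'] \<open>degree p \<le> e\<close> e
      have IH: "coeff D e' = real (Suc e') * h * coeff p (Suc e')" "degree D \<le> e'"
        by (auto simp: D_def)
      then have "coeff D e = 0" using e by (simp add: coeff_eq_0)
      then have c: "coeff (pcompose (pCons a p) [:h, 1:] - pCons a p) e = real (Suc e) * h * coeff (pCons a p) (Suc e)"
        unfolding eq eq' using IH e by (simp add: algebra_simps)
      have "degree (pCons 0 D) \<le> e" "degree (smult h (p + D)) \<le> e"
        using IH e \<open>degree p \<le> e\<close> by (auto intro!: degree_add_le order.trans[OF degree_smult_le])
      then have "degree (pcompose (pCons a p) [:h, 1:] - pCons a p) \<le> e"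
        unfolding eq eq' by (intro degree_add_le)
      with c show ?thesis by simp
    qed
  qed
  from *[OF assms] show "coeff (pcompose p [:h, 1:] - p) e = real (Suc e) * h * coeff p (Suc e)"
    and "degree (pcompose p [:h, 1:] - p) \<le> e" by auto
qed

lemma lead_coeff_pcompose_shift:
  fixes q :: "real poly"
  shows "coeff (pcompose q [:h, 1:]) (degree q) = lead_coeff q" "degree (pcompose q [:h, 1:]) = degree q"
proof -
  show *: "degree (pcompose q [:h, 1:]) = degree q" by (simp add: degree_pcompose)
  have "lead_coeff (pcompose q [:h, 1:]) = lead_coeff q" by (simp add: lead_coeff_comp)
  then show "coeff (pcompose q [:h, 1:]) (degree q) = lead_coeff q" by (simp add: *)
qed

lemma asy_shift:
  assumes "asy f d c"
  shows "asy (\<lambda>x. f (x + h)) d c"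
proof -
  from assms(1) obtain p q e where 1: "lead_coeff q = 1" "int e = d + int (degree q)" "degree p \<le> e"
    "coeff p e = c" and ev: "\<forall>\<^sub>F x in cofinite. f x * poly q x = poly p x"
    by (elim asyE)
  have c: "coeff (pcompose p [:h, 1:]) e = c"
  proof (cases "degree p = e")
    case True
    then show ?thesis using lead_coeff_pcompose_shift[of p h] 1 by simp
  next
    case False
    then show ?thesis using 1 lead_coeff_pcompose_shift[of p h] by (simp add: coeff_eq_0)
  qed
  show ?thesis
  proof (rule asyI[of "pcompose q [:h, 1:]" e _ "pcompose p [:h, 1:]"])
    show "\<forall>\<^sub>F x in cofinite. f (x + h) * poly (pcompose q [:h, 1:]) x = poly (pcompose p [:h, 1:]) x"
      using eventually_cofinite_shift[OF ev, of h] by (simp add: poly_pcompose add.commute)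
  qed (use 1 c in \<open>auto simp: lead_coeff_pcompose_shift\<close>)
qed

text \<open>Quotient rule: the numerator \<open>(p' - p) * q - p * (q' - q)\<close> loses one degree
  because both differences do. For d = 0 the coefficient is 0, so the order drops further.\<close>

lemma asy_shift_diff:
  assumes "asy f d c"
  shows "asy (\<lambda>x. f (x + h) - f x) (d - 1) (of_int d * h * c)"
proof -
  from assms(1) obtain p0 q0 e0 where 0: "lead_coeff q0 = 1" "int e0 = d + int (degree q0)" "degree p0 \<le> e0"
    "coeff p0 e0 = c" and ev0: "\<forall>\<^sub>F x in cofinite. f x * poly q0 x = poly p0 x"
    by (elim asyE)
  \<comment> \<open>Numerator and denominator are multiplied by x, so that both degree bounds are
    successors and the difference lemma applies to each.\<close>
  define p q e where "p = pCons 0 p0" and "q = pCons 0 q0" and "e = e0"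
  have nz: "q0 \<noteq> 0" using 0 by auto
  have 1: "lead_coeff q = 1" "int (Suc e) = d + int (degree q)" "degree p \<le> Suc e"
    "coeff p (Suc e) = c" "degree q = Suc (degree q0)"
    using 0 nz by (auto simp: p_def q_def e_def)
  have ev: "\<forall>\<^sub>F x in cofinite. f x * poly q x = poly p x"
    using ev0 by eventually_elim (simp add: p_def q_def)
  have nzq: "q \<noteq> 0" using 1 by auto
  define q' p' where "q' = pcompose q [:h, 1:]" and "p' = pcompose p [:h, 1:]"
  have "coeff q' (degree q') = lead_coeff q"
    unfolding q'_def lead_coeff_pcompose_shift(2) by (rule lead_coeff_pcompose_shift(1))
  then have q': "lead_coeff q' = 1" "degree q' = degree q" "q' \<noteq> 0"
    using 1 nzq by (auto simp: q'_def lead_coeff_pcompose_shift(2) pcompose_eq_0)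
  have P: "coeff (p' - p) e = real (Suc e) * h * c" "degree (p' - p) \<le> e"
    using coeff_pcompose_shift[of p e h] 1 by (auto simp: p'_def)
  have Q: "coeff (q' - q) (degree q0) = real (degree q) * h" "degree (q' - q) \<le> degree q0"
    using coeff_pcompose_shift[of q "degree q0" h] 1 by (auto simp: q'_def)
  show ?thesis
  proof (rule asyI[of "q * q'" "e + degree q" _ "(p' - p) * q - p * (q' - q)"])
    show "lead_coeff (q * q') = 1" using 1 q' by (simp add: lead_coeff_mult)
    show "int (e + degree q) = d - 1 + int (degree (q * q'))"
      using 1 q' nzq by (simp add: degree_mult_eq)
    show "degree ((p' - p) * q - p * (q' - q)) \<le> e + degree q"
      using degree_mult_le[of "p' - p" q] degree_mult_le[of p "q' - q"] P Q 1
      by (intro degree_diff_le) linarith+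
    have "coeff ((p' - p) * q) (e + degree q) = real (Suc e) * h * c"
      using coeff_mult_degree_le[of "p' - p" e q "degree q"] P 1 by simp
    moreover have "coeff (p * (q' - q)) (e + degree q) = c * (real (degree q) * h)"
      using coeff_mult_degree_le[of p "Suc e" "q' - q" "degree q0"] Q 1 by simp
    moreover have d: "of_int d = real (Suc e) - real (degree q)"
      using 1(2) by linarith
    ultimately have "coeff ((p' - p) * q - p * (q' - q)) (e + degree q)
        = real (Suc e) * h * c - c * (real (degree q) * h)"
      unfolding coeff_diff[of "(p' - p) * q"] by (simp only:)
    also have "\<dots> = of_int d * h * c" unfolding d by (simp add: algebra_simps)
    finally show "coeff ((p' - p) * q - p * (q' - q)) (e + degree q) = of_int d * h * c" .
    show "\<forall>\<^sub>F x in cofinite. (f (x + h) - f x) * poly (q * q') x = poly ((p' - p) * q - p * (q' - q)) x"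
      using ev eventually_cofinite_shift[OF ev, of h]
    proof eventually_elim
      case (elim x)
      have "(f (x + h) - f x) * poly (q * q') x
          = (f (x + h) * poly q (x + h)) * poly q x - (f x * poly q x) * poly q' x"
        by (simp add: q'_def poly_pcompose algebra_simps)
      also have "\<dots> = poly p' x * poly q x - poly p x * poly q' x"
        using elim by (simp add: p'_def poly_pcompose add.commute)
      finally show ?case by (simp add: algebra_simps)
    qed
  qed
qed

lemma asy_not_eventually_zero:
  assumes "asy f d c" "c \<noteq> 0"
  shows "\<not> (\<forall>\<^sub>F x in cofinite. f x = 0)"
proof
  assume ev0: "\<forall>\<^sub>F x in cofinite. f x = 0"
  from assms(1) obtain p q e where 1: "coeff p e = c"
    and ev: "\<forall>\<^sub>F x in cofinite. f x * poly q x = poly p x"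
    by (elim asyE)
  have "\<forall>\<^sub>F x in cofinite. poly p x = poly 0 x"
    using ev ev0 by eventually_elim simp
  then have "p = 0" by (rule poly_eq_cofinite)
  with 1 assms show False by simp
qed

lemma asy_polyD:
  assumes "asy (poly P) d c"
  shows "int i > d \<Longrightarrow> coeff P i = 0" and "int i = d \<Longrightarrow> coeff P i = c"
proof -
  from assms obtain p q e where 1: "lead_coeff q = 1" "int e = d + int (degree q)" "degree p \<le> e"
    "coeff p e = c" and ev: "\<forall>\<^sub>F x in cofinite. poly P x * poly q x = poly p x"
    by (elim asyE)
  from ev have "\<forall>\<^sub>F x in cofinite. poly (P * q) x = poly p x" by simp
  then have p: "p = P * q" by (metis poly_eq_cofinite)
  have nz: "q \<noteq> 0" using 1 by auto
  have deg: "P = 0 \<or> int (degree P) \<le> d"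
    using 1 nz p by (cases "P = 0") (auto simp: degree_mult_eq)
  then show "int i > d \<Longrightarrow> coeff P i = 0" by (cases "P = 0") (auto intro!: coeff_eq_0)
  assume i: "int i = d"
  then have "e = i + degree q" "degree P \<le> i" using 1 deg by auto
  then show "coeff P i = c"
    using coeff_mult_degree_le[of P i q "degree q"] 1 p by simp
qed

lemma rational_function_asy: "asy f d c \<Longrightarrow> rational_function f"
proof (elim asyE)
  fix p q :: "real poly"
  assume q: "lead_coeff q = 1" and ev: "\<forall>\<^sub>F x in cofinite. f x * poly q x = poly p x"
  then have "q \<noteq> 0" by auto
  moreover have "\<forall>\<^sub>F x in cofinite. f x = poly p x / poly q x"
    using ev eventually_cofinite_poly_neq_0[OF \<open>q \<noteq> 0\<close>]
    by eventually_elim (simp add: field_simps)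
  ultimately show "rational_function f" unfolding rational_function_def by blast
qed

section \<open>Functions that agree with a polynomial up to finitely many points\<close>

definition polyfun :: "(real \<Rightarrow> real) \<Rightarrow> bool" where
  "polyfun f \<longleftrightarrow> (\<exists>p. \<forall>\<^sub>F x in cofinite. f x = poly p x)"

lemma polyfun_poly: "polyfun (poly p)"
  unfolding polyfun_def by (rule exI[of _ p]) simp

lemma polyfun_const: "polyfun (\<lambda>_. c)"
  unfolding polyfun_def by (rule exI[of _ "[:c:]"]) simp

lemma polyfun_cong: "polyfun f \<Longrightarrow> \<forall>\<^sub>F x in cofinite. g x = f x \<Longrightarrow> polyfun g"
  unfolding polyfun_def by (elim exE, rule exI, erule (1) eventually_elim2) simp

lemma polyfun_mult: "polyfun f \<Longrightarrow> polyfun g \<Longrightarrow> polyfun (\<lambda>x. f x * g x)"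
  unfolding polyfun_def
proof (elim exE)
  fix p q assume "\<forall>\<^sub>F x in cofinite. f x = poly p x" "\<forall>\<^sub>F x in cofinite. g x = poly q x"
  then have "\<forall>\<^sub>F x in cofinite. f x * g x = poly (p * q) x"
    by eventually_elim simp
  then show "\<exists>r. \<forall>\<^sub>F x in cofinite. f x * g x = poly r x" by blast
qed

lemma polyfun_add: "polyfun f \<Longrightarrow> polyfun g \<Longrightarrow> polyfun (\<lambda>x. f x + g x)"
  unfolding polyfun_def
proof (elim exE)
  fix p q assume "\<forall>\<^sub>F x in cofinite. f x = poly p x" "\<forall>\<^sub>F x in cofinite. g x = poly q x"
  then have "\<forall>\<^sub>F x in cofinite. f x + g x = poly (p + q) x"
    by eventually_elim simp
  then show "\<exists>r. \<forall>\<^sub>F x in cofinite. f x + g x = poly r x" by blast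
qed

lemma polyfun_sum: "finite A \<Longrightarrow> (\<And>i. i \<in> A \<Longrightarrow> polyfun (f i)) \<Longrightarrow> polyfun (\<lambda>x. \<Sum>i\<in>A. f i x)"
  by (induction A rule: finite_induct) (auto intro: polyfun_add polyfun_const)

lemma polyfun_prod: "finite A \<Longrightarrow> (\<And>i. i \<in> A \<Longrightarrow> polyfun (f i)) \<Longrightarrow> polyfun (\<lambda>x. \<Prod>i\<in>A. f i x)"
  by (induction A rule: finite_induct) (auto intro: polyfun_mult polyfun_const)

lemma polyfun_power: "polyfun f \<Longrightarrow> polyfun (\<lambda>x. f x ^ n)"
  by (induction n) (auto intro: polyfun_mult polyfun_const)

lemma polyfun_linear: "polyfun (\<lambda>x. s + k * x)"
  unfolding polyfun_def by (rule exI[of _ "[:s, k:]"]) (simp add: mult.commute)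

lemma polyfun_shift: "polyfun f \<Longrightarrow> polyfun (\<lambda>x. f (x + h))"
  unfolding polyfun_def
proof (elim exE)
  fix p assume "\<forall>\<^sub>F x in cofinite. f x = poly p x"
  then have "\<forall>\<^sub>F x in cofinite. f (x + h) = poly (pcompose p [:h, 1:]) x"
    using eventually_cofinite_shift[of "\<lambda>x. f x = poly p x" h] by (simp add: poly_pcompose add.commute)
  then show "\<exists>r. \<forall>\<^sub>F x in cofinite. f (x + h) = poly r x" by blast
qed

text \<open>Supplies P_S. The monomial \<open>P0\<close> is scaled so that its backward difference
  has the top coefficient of W, and the rest has lower degree. The leading coefficient is recorded
  because it decides that the operator has its exact order.\<close>

lemma ex_poly_antidifference:
  fixes W :: "real poly"
  assumes "degree W \<le> n"
  shows "\<exists>P. (\<forall>x. poly P x - poly P (x - 1) = poly W x) \<and> degree P \<le> Suc n \<and>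
    coeff P (Suc n) = coeff W n / real (Suc n)"
  using assms
proof (induction n arbitrary: W)
  case 0
  then obtain w where "W = [:w:]" by (metis degree_eq_zeroE le_zero_eq)
  then show ?case by (intro exI[of _ "[:0, w:]"]) (auto simp: algebra_simps)
next
  case (Suc n)
  define c where "c = coeff W (Suc n) / real (Suc (Suc n))"
  define P0 where "P0 = monom c (Suc (Suc n))"
  define V where "V = W + (pcompose P0 [:-1, 1:] - P0)"
  have P0: "degree P0 \<le> Suc (Suc n)" "coeff P0 (Suc (Suc n)) = c"
    by (auto simp: P0_def degree_monom_le)
  have "coeff V (Suc n) = coeff W (Suc n) + coeff (pcompose P0 [:-1, 1:] - P0) (Suc n)"
    by (simp add: V_def)
  also have "\<dots> = 0"
    unfolding coeff_pcompose_shift(1)[OF P0(1), of "-1"] P0(2) c_def by (simp del: of_nat_Suc)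
  finally have "coeff V (Suc n) = 0" .
  moreover have "degree V \<le> Suc n"
    unfolding V_def using coeff_pcompose_shift(2)[OF P0(1), of "-1"] Suc.prems
    by (intro degree_add_le)
  ultimately have "degree V \<le> n"
    by (metis coeff_0 degree_0 le_SucE leading_coeff_0_iff zero_le)
  from Suc.IH[OF this] obtain P where P: "\<And>x. poly P x - poly P (x - 1) = poly V x" "degree P \<le> Suc n"
    by blast
  show ?case
  proof (intro exI[of _ "P + P0"] conjI allI)
    fix x
    show "poly (P + P0) x - poly (P + P0) (x - 1) = poly W x"
      using P(1)[of x] by (simp add: V_def poly_pcompose algebra_simps)
    show "degree (P + P0) \<le> Suc (Suc n)" using P P0 by (intro degree_add_le) auto
    show "coeff (P + P0) (Suc (Suc n)) = coeff W (Suc n) / real (Suc (Suc n))"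
      using P P0 by (simp add: coeff_eq_0 c_def)
  qed
qed

section \<open>Continuous dual Hahn polynomials\<close>

text \<open>Entries of the Jacobi matrix: \<open>(n + 1) K (n + 1) + jacB n * K n + jacC n * K (n -
  1) = t * K n\<close>, where t is minus the usual spectral variable of the continuous dual Hahn
  polynomials. The index is real because the rows continue this recurrence to negative n.\<close>

definition jacB :: "real \<Rightarrow> real \<Rightarrow> real \<Rightarrow> real \<Rightarrow> real" where
  "jacB p q r n = - (p * q + p * r + q * r) - 2 * n * (p + q + r) - 2 * n\<^sup>2 + n"

definition jacC :: "real \<Rightarrow> real \<Rightarrow> real \<Rightarrow> real \<Rightarrow> real" where
  "jacC p q r n = (n + q + r - 1) * (n + p + q - 1) * (n + p + r - 1)"

text \<open>Normalised to have leading coefficient $1/n!$ and to be symmetric in the three parameters.\<close>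

fun cdh :: "real \<Rightarrow> real \<Rightarrow> real \<Rightarrow> nat \<Rightarrow> real poly" where
  "cdh p q r 0 = 1"
| "cdh p q r (Suc 0) = [:- jacB p q r 0, 1:]"
| "cdh p q r (Suc (Suc n)) = smult (1 / real (n + 2))
     ([:- jacB p q r (real n + 1), 1:] * cdh p q r (Suc n) - smult (jacC p q r (real n + 1)) (cdh p q r n))"

lemma jac_sym: "jacB p q r n = jacB q p r n" "jacC p q r n = jacC q p r n"
  "jacB p q r n = jacB p r q n" "jacC p q r n = jacC p r q n"
  by (auto simp: jacB_def jacC_def algebra_simps)

text \<open>Immediate from the recurrence, while the expansion \<open>cdh_explicit\<close> singles
  out p. Symmetry therefore gives three different Newton expansions of the same polynomial.\<close>

lemma cdh_sym: "cdh p q r n = cdh q p r n" "cdh p q r n = cdh p r q n"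
proof -
  show "cdh p q r n = cdh q p r n"
    by (induction n rule: less_induct, case_tac x rule: cdh.cases[of "(p, q, r, _)", simplified])
       (auto simp: jac_sym(1,2)[of q p])
  show "cdh p q r n = cdh p r q n"
    by (induction n rule: less_induct, case_tac x rule: cdh.cases[of "(p, q, r, _)", simplified])
       (auto simp: jac_sym(3,4)[of p r])
qed

text \<open>Coefficients with respect to the Newton basis at the nodes \<open>(p + i)^2\<close>: the
  hypergeometric 3F2 series multiplied by \<open>(p + q)_n (p + r)_n / n!\<close>, which removes all
  parameter denominators.\<close>

definition cdh_coeff :: "real \<Rightarrow> real \<Rightarrow> real \<Rightarrow> nat \<Rightarrow> nat \<Rightarrow> real" where
  "cdh_coeff p q r n j = (if j \<le> n then pochhammer (p + q + real j) (n - j) *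
     pochhammer (p + r + real j) (n - j) / (fact j * fact (n - j)) else 0)"

definition newton :: "real \<Rightarrow> nat \<Rightarrow> real \<Rightarrow> real" where
  "newton p j t = (\<Prod>i<j. t - (p + real i)\<^sup>2)"

lemma newton_simps: "newton p 0 t = 1" "newton p (Suc j) t = newton p j t * (t - (p + real j)\<^sup>2)"
  "(t - p\<^sup>2) * newton (p + 1) j t = newton p (Suc j) t"
proof -
  have "(p + 1 + real i)\<^sup>2 = (p + real (Suc i))\<^sup>2" for i by (simp add: algebra_simps)
  then show "(t - p\<^sup>2) * newton (p + 1) j t = newton p (Suc j) t"
    by (simp add: newton_def prod.lessThan_Suc_shift del: prod.lessThan_Suc of_nat_Suc)
qed (auto simp: newton_def)

text \<open>Contiguous relation in n; \<open>cdh_coeff_left\<close> is the one in j. Together they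
  replace Pochhammer products in most later coefficient comparisons.\<close>

lemma cdh_coeff_up: "(real n + 1 - real j) * cdh_coeff p q r (Suc n) j
    = (p + q + real n) * (p + r + real n) * cdh_coeff p q r n j"
proof (cases "j \<le> n")
  case True
  then obtain k where n: "n = j + k" by (auto simp: le_iff_add)
  show ?thesis
    by (simp add: cdh_coeff_def n Suc_diff_le pochhammer_Suc divide_simps) (simp add: algebra_simps)
next
  case False
  then show ?thesis by (cases "j = Suc n") (auto simp: cdh_coeff_def)
qed

lemma cdh_coeff_left: "(real n - real j) * cdh_coeff p q r n j
    = (p + q + real j) * (p + r + real j) * (real j + 1) * cdh_coeff p q r n (Suc j)"
proof (cases "j < n")
  case True
  then obtain k where n: "n = Suc (j + k)" by (auto simp: less_iff_Suc_add)
  have *: "n - j = Suc k" "n - Suc j = k" using n by auto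
  have "pochhammer (p + q + real j) (Suc k) = (p + q + real j) * pochhammer (p + q + real (Suc j)) k"
    "pochhammer (p + r + real j) (Suc k) = (p + r + real j) * pochhammer (p + r + real (Suc j)) k"
    by (simp_all add: pochhammer_rec algebra_simps)
  then show ?thesis using True
    unfolding cdh_coeff_def * by (simp add: n divide_simps)
next
  case False
  then show ?thesis by (auto simp: cdh_coeff_def)
qed

lemma cdh_coeff_diag: "cdh_coeff p q r n n = 1 / fact n"
  by (simp add: cdh_coeff_def)

lemma cdh_coeff_gt: "j > n \<Longrightarrow> cdh_coeff p q r n j = 0"
  by (simp add: cdh_coeff_def)

text \<open>Comparison of coefficients in the three-term recurrence: multiplication by t sends the
  basis element j to the basis element j + 1 plus \<open>(p + j)^2\<close> times itself. After
  multiplication by \<open>d\<close> every term is a multiple of the one coefficient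
  \<open>c\<close>.\<close>

lemma cdh_coeff_rec:
  "(if j = 0 then 0 else cdh_coeff p q r n (j - 1)) + ((p + real j)\<^sup>2 - jacB p q r (real n)) * cdh_coeff p q r n j
     - (if n = 0 then 0 else jacC p q r (real n) * cdh_coeff p q r (n - 1) j)
   = (real n + 1) * cdh_coeff p q r (Suc n) j"
proof (cases "j \<le> n")
  case False
  show ?thesis
  proof (cases "j = Suc n")
    case True
    then show ?thesis by (simp add: cdh_coeff_gt cdh_coeff_diag divide_simps)
  next
    case F: False
    with False show ?thesis by (auto simp: cdh_coeff_gt)
  qed
next
  case True
  define c where "c = cdh_coeff p q r n j"
  define d where "d = real n + 1 - real j"
  have d: "d \<noteq> 0" using True by (simp add: d_def)
  have up: "d * cdh_coeff p q r (Suc n) j = (p + q + real n) * (p + r + real n) * c"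
    unfolding d_def c_def by (rule cdh_coeff_up)
  have down: "(if n = 0 then 0 else jacC p q r (real n) * cdh_coeff p q r (n - 1) j)
      = (real n + q + r - 1) * (real n - real j) * c"
  proof (cases n)
    case 0
    then show ?thesis using True by simp
  next
    case (Suc m)
    show ?thesis
    proof -
      have "jacC p q r (real n) = (real n + q + r - 1) * ((p + q + real m) * (p + r + real m))"
        by (simp add: Suc jacC_def algebra_simps)
      moreover have "(p + q + real m) * (p + r + real m) * cdh_coeff p q r m j = (real n - real j) * c"
        using cdh_coeff_up[of m j p q r] by (simp add: c_def Suc add.commute)
      ultimately show ?thesis by (simp add: Suc mult.assoc)
    qed
  qed
  have left: "d * (if j = 0 then 0 else cdh_coeff p q r n (j - 1))
      = (p + q + real j - 1) * (p + r + real j - 1) * real j * c"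
  proof (cases j)
    case (Suc i)
    then show ?thesis using cdh_coeff_left[of n i p q r] by (simp add: c_def d_def algebra_simps)
  qed simp
  have "d * ((if j = 0 then 0 else cdh_coeff p q r n (j - 1)) + ((p + real j)\<^sup>2 - jacB p q r (real n)) * c
     - (if n = 0 then 0 else jacC p q r (real n) * cdh_coeff p q r (n - 1) j))
    = (p + q + real j - 1) * (p + r + real j - 1) * real j * c
      + d * ((p + real j)\<^sup>2 - jacB p q r (real n)) * c - d * ((real n + q + r - 1) * (real n - real j) * c)"
    unfolding down left[symmetric] by (simp add: algebra_simps)
  also have "\<dots> = (real n + 1) * ((p + q + real n) * (p + r + real n) * c)"
    by (simp add: d_def jacB_def power2_eq_square algebra_simps)
  also have "\<dots> = d * ((real n + 1) * cdh_coeff p q r (Suc n) j)"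
    unfolding up[symmetric] by (simp add: algebra_simps)
  finally show ?thesis using d by (simp add: c_def)
qed

lemma cdh_rec: "smult (real n + 1) (cdh p q r (Suc n)) = [:- jacB p q r (real n), 1:] * cdh p q r n
    - (if n = 0 then 0 else smult (jacC p q r (real n)) (cdh p q r (n - 1)))"
  by (cases n) (simp_all add: add.commute)

lemma cdh_explicit: "poly (cdh p q r n) t = (\<Sum>j\<le>n. cdh_coeff p q r n j * newton p j t)"
proof -
  define E where "E n = (\<Sum>j\<le>n. cdh_coeff p q r n j * newton p j t)" for n
  have step: "(real n + 1) * E (Suc n) = (t - jacB p q r (real n)) * E n
      - (if n = 0 then 0 else jacC p q r (real n) * E (n - 1))" for n
  proof -
    have "(real n + 1) * E (Suc n) = (\<Sum>j\<le>Suc n. (real n + 1) * cdh_coeff p q r (Suc n) j * newton p j t)"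
      by (simp only: E_def sum_distrib_left mult.assoc)
    also have "\<dots> = (\<Sum>j\<le>Suc n. (if j = 0 then 0 else cdh_coeff p q r n (j - 1)) * newton p j t)
        + (\<Sum>j\<le>Suc n. ((p + real j)\<^sup>2 - jacB p q r (real n)) * cdh_coeff p q r n j * newton p j t)
        - (\<Sum>j\<le>Suc n. (if n = 0 then 0 else jacC p q r (real n) * cdh_coeff p q r (n - 1) j) * newton p j t)"
      unfolding cdh_coeff_rec[symmetric] by (simp only: sum.distrib sum_subtractf distrib_right left_diff_distrib)
    also have "(\<Sum>j\<le>Suc n. (if j = 0 then 0 else cdh_coeff p q r n (j - 1)) * newton p j t)
        = (\<Sum>j\<le>n. cdh_coeff p q r n j * newton p (Suc j) t)"
      by (simp add: sum.atMost_Suc_shift del: sum.atMost_Suc)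
    also have "(\<Sum>j\<le>Suc n. ((p + real j)\<^sup>2 - jacB p q r (real n)) * cdh_coeff p q r n j * newton p j t)
        = (\<Sum>j\<le>n. ((p + real j)\<^sup>2 - jacB p q r (real n)) * cdh_coeff p q r n j * newton p j t)"
      by (simp add: cdh_coeff_gt)
    also have "(\<Sum>j\<le>n. cdh_coeff p q r n j * newton p (Suc j) t) + \<dots> = (t - jacB p q r (real n)) * E n"
      unfolding E_def sum_distrib_left sum.distrib[symmetric]
      by (intro sum.cong) (auto simp: newton_simps algebra_simps)
    also have "(\<Sum>j\<le>Suc n. (if n = 0 then 0 else jacC p q r (real n) * cdh_coeff p q r (n - 1) j) * newton p j t)
        = (if n = 0 then 0 else jacC p q r (real n) * E (n - 1))"
      by (cases n) (simp_all add: cdh_coeff_gt E_def sum_distrib_left mult.assoc)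
    finally show ?thesis .
  qed
  have "poly (cdh p q r n) t = E n"
  proof (induction n rule: less_induct)
    case (less n)
    consider "n = 0" | "n = Suc 0" | m where "n = Suc (Suc m)" by (metis not0_implies_Suc)
    then show ?case
    proof cases
      case 1
      then show ?thesis by (simp add: E_def cdh_coeff_diag newton_simps)
    next
      case 2
      have "E 0 = 1" by (simp add: E_def cdh_coeff_diag newton_simps)
      then show ?thesis using step[of 0] 2 by simp
    next
      case 3
      have "(real m + 2) * E (Suc (Suc m)) = (t - jacB p q r (real m + 1)) * E (Suc m)
          - jacC p q r (real m + 1) * E m"
        using step[of "Suc m"] by (simp add: add.commute)
      moreover have "(real m + 2) * poly (cdh p q r n) t = (t - jacB p q r (real m + 1)) * E (Suc m)
          - jacC p q r (real m + 1) * E m"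
        using arg_cong[OF cdh_rec[of "Suc m" p q r], of "\<lambda>f. poly f t"] less.IH[of m] less.IH[of "Suc m"] 3
        by (simp add: algebra_simps del: cdh.simps)
      ultimately have "(real m + 2) * poly (cdh p q r n) t = (real m + 2) * E n" by (simp add: 3)
      then show ?thesis by (simp add: mult_left_cancel)
    qed
  qed
  then show ?thesis by (simp add: E_def)
qed

lemma degree_cdh: "degree (cdh p q r n) \<le> n" "coeff (cdh p q r n) n = 1 / fact n"
proof -
  have "degree (cdh p q r n) \<le> n \<and> coeff (cdh p q r n) n = 1 / fact n"
  proof (induction n rule: less_induct)
    case (less n)
    consider "n = 0" | "n = Suc 0" | m where "n = Suc (Suc m)" by (metis not0_implies_Suc)
    then show ?case
    proof cases
      case 3
      define X where "X = [:- jacB p q r (real m + 1), 1:] * cdh p q r (Suc m) - smult (jacC p q r (real m + 1)) (cdh p q r m)"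
      have 1: "degree (cdh p q r (Suc m)) \<le> Suc m" "coeff (cdh p q r (Suc m)) (Suc m) = 1 / fact (Suc m)"
        "degree (cdh p q r m) \<le> m"
        using less.IH 3 by auto
      have "degree X \<le> Suc (Suc m)"
        unfolding X_def using 1
        by (intro degree_diff_le order.trans[OF degree_mult_le] order.trans[OF degree_smult_le]) auto
      moreover have "coeff X (Suc (Suc m)) = 1 / fact (Suc m)"
        using 1 by (simp add: X_def coeff_eq_0)
      moreover have "cdh p q r n = smult (1 / real (m + 2)) X" by (simp add: 3 X_def)
      ultimately show ?thesis using 3 by (auto simp: field_simps intro!: order.trans[OF degree_smult_le])
    qed auto
  qed
  then show "degree (cdh p q r n) \<le> n" "coeff (cdh p q r n) n = 1 / fact n" by auto
qed

text \<open>Both sides are expanded at the nodes of q, which stay fixed when p moves, so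
  coefficients can be compared one by one.\<close>

lemma cdh_shift1: "cdh (p + 1) q r (Suc n) = cdh p q r (Suc n) + smult (real n + q + r) (cdh (p + 1) q r n)"
proof (rule poly_ext)
  fix t
  have c: "cdh_coeff q (p + 1) r (Suc n) j = cdh_coeff q p r (Suc n) j
      + (real n + q + r) * cdh_coeff q (p + 1) r n j" for j
  proof (cases "j \<le> n")
    case True
    then obtain k where n: "n = j + k" by (auto simp: le_iff_add)
    have *: "Suc n - j = Suc k" "n - j = k" using n by auto
    define P where "P = pochhammer (q + (p + 1) + real j) k"
    define Q where "Q = pochhammer (q + r + real j) k"
    have "pochhammer (q + (p + 1) + real j) (Suc k) = P * (q + p + 1 + real j + real k)"
      "pochhammer (q + r + real j) (Suc k) = Q * (q + r + real j + real k)"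
      by (simp_all add: P_def Q_def pochhammer_Suc)
    moreover have "q + p + real j + 1 = q + (p + 1) + real j" by simp
    then have "pochhammer (q + p + real j) (Suc k) = (q + p + real j) * P"
      unfolding pochhammer_rec P_def by (simp only:)
    ultimately show ?thesis using True
      unfolding cdh_coeff_def * by (simp add: n divide_simps flip: P_def Q_def) (simp add: algebra_simps)
  next
    case False
    then show ?thesis by (cases "j = Suc n") (auto simp: cdh_coeff_def)
  qed
  have "poly (cdh q (p + 1) r (Suc n)) t = poly (cdh q p r (Suc n)) t + (real n + q + r) * poly (cdh q (p + 1) r n) t"
    unfolding cdh_explicit c distrib_right sum.distrib
    by (simp add: sum_distrib_left mult.assoc cdh_coeff_gt)
  then show "poly (cdh (p + 1) q r (Suc n)) t = poly (cdh p q r (Suc n) + smult (real n + q + r) (cdh (p + 1) q r n)) t"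
    by (simp add: cdh_sym(1)[of "p + 1"] cdh_sym(1)[of p])
qed

text \<open>The factor \<open>t - p^2\<close> turns the Newton basis at p + 1 into the one at p
  (\<open>newton_simps\<close>). This is the Christoffel transform that raises p.\<close>

lemma cdh_shift2: "[:- p\<^sup>2, 1:] * cdh (p + 1) q r n = smult (real n + 1) (cdh p q r (Suc n))
    - smult ((p + q + real n) * (p + r + real n)) (cdh p q r n)"
proof (rule poly_ext)
  fix t
  have c: "cdh_coeff (p + 1) q r n j = real (Suc j) * cdh_coeff p q r (Suc n) (Suc j)" for j
  proof (cases "j \<le> n")
    case True
    have e: "p + 1 + q + real j = p + q + real (Suc j)" "p + 1 + r + real j = p + r + real (Suc j)" by auto
    show ?thesis using True unfolding cdh_coeff_def e by simp
  qed (simp add: cdh_coeff_def)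
  have "poly ([:- p\<^sup>2, 1:] * cdh (p + 1) q r n) t = (t - p\<^sup>2) * poly (cdh (p + 1) q r n) t"
    by (simp add: algebra_simps)
  also have "\<dots> = (\<Sum>j\<le>n. cdh_coeff (p + 1) q r n j * ((t - p\<^sup>2) * newton (p + 1) j t))"
    by (simp add: cdh_explicit sum_distrib_left mult.left_commute)
  also have "\<dots> = (\<Sum>j\<le>Suc n. real j * cdh_coeff p q r (Suc n) j * newton p j t)"
    unfolding newton_simps(3) c by (simp add: sum.atMost_Suc_shift del: sum.atMost_Suc)
  also have "\<dots> = (\<Sum>j\<le>Suc n. (real n + 1) * cdh_coeff p q r (Suc n) j * newton p j t
      - (real n + 1 - real j) * cdh_coeff p q r (Suc n) j * newton p j t)"
    by (intro sum.cong) (auto simp: algebra_simps)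
  also have "\<dots> = (\<Sum>j\<le>Suc n. (real n + 1) * cdh_coeff p q r (Suc n) j * newton p j t)
      - (\<Sum>j\<le>Suc n. (p + q + real n) * (p + r + real n) * cdh_coeff p q r n j * newton p j t)"
    unfolding sum_subtractf cdh_coeff_up ..
  also have "(\<Sum>j\<le>Suc n. (p + q + real n) * (p + r + real n) * cdh_coeff p q r n j * newton p j t)
      = (\<Sum>j\<le>n. (p + q + real n) * (p + r + real n) * cdh_coeff p q r n j * newton p j t)"
    by (simp add: cdh_coeff_gt)
  also have "(\<Sum>j\<le>Suc n. (real n + 1) * cdh_coeff p q r (Suc n) j * newton p j t) - \<dots>
      = poly (smult (real n + 1) (cdh p q r (Suc n))
      - smult ((p + q + real n) * (p + r + real n)) (cdh p q r n)) t"
    by (simp only: poly_diff poly_smult cdh_explicit sum_distrib_left mult.assoc)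
  finally show "poly ([:- p\<^sup>2, 1:] * cdh (p + 1) q r n) t = \<dots>" .
qed

text \<open>The \<open>cdh p q r n\<close> have degree n with nonzero leading coefficient and hence
  span all polynomials, so a linear identity need only be checked on them, with whichever parameters
  suit.\<close>

lemma cdh_induct:
  assumes add: "\<And>f g. P f \<Longrightarrow> P g \<Longrightarrow> P (f + g)" and smult: "\<And>k f. P f \<Longrightarrow> P (smult k f)"
    and cdh: "\<And>n. P (cdh p q r n)"
  shows "P f"
proof -
  have "P f" if "degree f \<le> n" for n
    using that
  proof (induction n arbitrary: f)
    case 0
    then obtain k where "f = [:k:]" by (metis degree_eq_zeroE le_zero_eq)
    then show ?case using smult[OF cdh[of 0], of k] by simp
  next
    case (Suc n)
    define k where "k = coeff f (Suc n) * fact (Suc n)"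
    define g where "g = f - smult k (cdh p q r (Suc n))"
    have "degree g \<le> Suc n"
      unfolding g_def using Suc.prems degree_cdh(1)[of p q r "Suc n"]
      by (intro degree_diff_le order.trans[OF degree_smult_le])
    moreover have "coeff g (Suc n) = 0"
      unfolding g_def coeff_diff coeff_smult degree_cdh(2) k_def by simp
    ultimately have "degree g \<le> n"
      by (metis coeff_0 degree_0 le_SucE leading_coeff_0_iff zero_le)
    then have "P g" by (rule Suc.IH)
    from add[OF this smult[OF cdh[of "Suc n"], of k]] show ?case by (simp add: g_def)
  qed
  then show ?thesis by blast
qed

section \<open>The orthogonality functional of the continuous dual Hahn polynomials\<close>

text \<open>If \<open>g n\<close> is the value of a functional on f K_n, then
  \<open>jac p q r g n\<close> is its value on t f K_n. Hence \<open>jac_moment p q r k n\<close> is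
  the value on t^k K_n of the functional that sends K_0 to 1 and every other K_n to 0.\<close>

definition jac :: "real \<Rightarrow> real \<Rightarrow> real \<Rightarrow> (nat \<Rightarrow> real) \<Rightarrow> nat \<Rightarrow> real" where
  "jac p q r g n = (real n + 1) * g (Suc n) + jacB p q r (real n) * g n
     + (if n = 0 then 0 else jacC p q r (real n) * g (n - 1))"

definition jac_moment :: "real \<Rightarrow> real \<Rightarrow> real \<Rightarrow> nat \<Rightarrow> nat \<Rightarrow> real" where
  "jac_moment p q r k = (jac p q r ^^ k) (\<lambda>n. if n = 0 then 1 else 0)"

text \<open>The functional is read off from the powers of the Jacobi matrix, so that no positivity or
  regularity of the parameters is needed.\<close>

definition cdh_fun :: "real \<Rightarrow> real \<Rightarrow> real \<Rightarrow> real poly \<Rightarrow> real" where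
  "cdh_fun p q r f = (\<Sum>k\<le>degree f. coeff f k * jac_moment p q r k 0)"

lemma cdh_fun_altdef: "degree f \<le> D \<Longrightarrow> cdh_fun p q r f = (\<Sum>k\<le>D. coeff f k * jac_moment p q r k 0)"
  unfolding cdh_fun_def by (rule sum.mono_neutral_left) (auto simp: coeff_eq_0)

lemma cdh_fun_add: "cdh_fun p q r (f + g) = cdh_fun p q r f + cdh_fun p q r g"
  using cdh_fun_altdef[of f "max (degree f) (degree g)" p q r]
    cdh_fun_altdef[of g "max (degree f) (degree g)" p q r]
    cdh_fun_altdef[of "f + g" "max (degree f) (degree g)" p q r] degree_add_le_max[of f g]
  by (simp add: sum.distrib distrib_right)

lemma cdh_fun_smult: "cdh_fun p q r (smult k f) = k * cdh_fun p q r f"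
  using cdh_fun_altdef[of "smult k f" "degree f" p q r] cdh_fun_altdef[of f "degree f" p q r]
  by (simp add: sum_distrib_left mult.assoc degree_smult_le)

lemma cdh_fun_diff: "cdh_fun p q r (f - g) = cdh_fun p q r f - cdh_fun p q r g"
  using cdh_fun_add[of p q r f "smult (-1) g"] cdh_fun_smult[of p q r "-1" g] by simp

lemma cdh_fun_0: "cdh_fun p q r 0 = 0"
  by (simp add: cdh_fun_def)

lemma cdh_fun_sum: "cdh_fun p q r (\<Sum>i\<in>A. f i) = (\<Sum>i\<in>A. cdh_fun p q r (f i))"
  by (induction A rule: infinite_finite_induct) (auto simp: cdh_fun_add cdh_fun_0)

text \<open>Solving the recurrence for K_(n+1) trades one step in n for one power of t; the
  definition of \<open>jac\<close> is the same relation read on the moments.\<close>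

lemma cdh_fun_monom_cdh: "cdh_fun p q r (monom 1 k * cdh p q r n) = jac_moment p q r k n"
proof (induction n arbitrary: k rule: less_induct)
  case (less n)
  show ?case
  proof (cases n)
    case 0
    have "degree (monom (1::real) k) \<le> k" by (rule degree_monom_le)
    then show ?thesis using 0 by (simp add: cdh_fun_altdef if_distrib if_distribR cong: if_cong)
  next
    case (Suc m)
    define T where "T = (monom 1 k :: real poly)"
    have "smult (real m + 1) (T * cdh p q r (Suc m)) = monom 1 (Suc k) * cdh p q r m
        - smult (jacB p q r (real m)) (T * cdh p q r m)
        - (if m = 0 then 0 else smult (jacC p q r (real m)) (T * cdh p q r (m - 1)))"
    proof -
      have "smult (real m + 1) (T * cdh p q r (Suc m)) = T * smult (real m + 1) (cdh p q r (Suc m))"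
        by simp
      also have lin: "[:- b, 1:] * X = monom 1 1 * X - smult b X" for b :: real and X
        by (simp add: monom_Suc)
      have "T * smult (real m + 1) (cdh p q r (Suc m)) = (T * monom 1 1) * cdh p q r m
          - smult (jacB p q r (real m)) (T * cdh p q r m)
          - (if m = 0 then 0 else smult (jacC p q r (real m)) (T * cdh p q r (m - 1)))"
        unfolding cdh_rec lin by (simp add: algebra_simps)
      finally show ?thesis by (simp add: T_def mult_monom)
    qed
    from arg_cong[OF this, of "cdh_fun p q r"]
    have "(real m + 1) * cdh_fun p q r (T * cdh p q r (Suc m)) = jac_moment p q r (Suc k) m
        - jacB p q r (real m) * jac_moment p q r k m
        - (if m = 0 then 0 else jacC p q r (real m) * jac_moment p q r k (m - 1))"
      using less.IH Suc by (auto simp: cdh_fun_diff cdh_fun_smult cdh_fun_0 T_def)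
    also have "\<dots> = (real m + 1) * jac_moment p q r k (Suc m)"
      by (simp add: jac_moment_def jac_def)
    finally show ?thesis by (simp add: Suc T_def)
  qed
qed

lemma cdh_fun_cdh: "cdh_fun p q r (cdh p q r n) = (if n = 0 then 1 else 0)"
  using cdh_fun_monom_cdh[of p q r 0 n] by (simp add: jac_moment_def)

lemma cdh_fun_sym: "cdh_fun p q r f = cdh_fun q p r f" "cdh_fun p q r f = cdh_fun p r q f"
proof -
  show "cdh_fun p q r f = cdh_fun q p r f"
  proof (induction f rule: cdh_induct[of _ p q r])
    case (3 n)
    have "cdh_fun q p r (cdh p q r n) = (if n = 0 then 1 else 0)"
      by (subst cdh_sym(1)) (rule cdh_fun_cdh)
    then show ?case by (simp only: cdh_fun_cdh)
  qed (auto simp: cdh_fun_add cdh_fun_smult)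
  show "cdh_fun p q r f = cdh_fun p r q f"
  proof (induction f rule: cdh_induct[of _ p q r])
    case (3 n)
    have "cdh_fun p r q (cdh p q r n) = (if n = 0 then 1 else 0)"
      by (subst cdh_sym(2)) (rule cdh_fun_cdh)
    then show ?case by (simp only: cdh_fun_cdh)
  qed (auto simp: cdh_fun_add cdh_fun_smult)
qed

text \<open>Tested on the polynomials with parameter p + 1: by \<open>cdh_shift2\<close> the left
  side involves only K_n and K_(n+1) for p, on which the functional vanishes unless n = 0.\<close>

lemma cdh_fun_shift: "cdh_fun p q r ([:- p\<^sup>2, 1:] * f) = - (p + q) * (p + r) * cdh_fun (p + 1) q r f"
proof (induction f rule: cdh_induct[of _ "p + 1" q r])
  case (3 n)
  show ?case unfolding cdh_shift2 by (simp add: cdh_fun_diff cdh_fun_smult cdh_fun_cdh algebra_simps)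
qed (simp_all only: cdh_fun_add cdh_fun_smult distrib_left mult_smult_right mult.left_commute mult.assoc)

section \<open>Difference operators on dual Hahn polynomials\<close>

text \<open>Apart from the two sums in the overview, \<open>par2 + par3 = - \<beta> - N\<close> and
  \<open>2 * par1 = \<alpha> + \<beta> + 1\<close>; the latter makes \<lambda>(x) equal to
  \<open>(x + par1)^2 - par1^2\<close>.\<close>

definition par1 :: "real \<Rightarrow> real \<Rightarrow> real \<Rightarrow> real" where "par1 \<alpha> \<beta> N = (\<alpha> + \<beta> + 1) / 2"
definition par2 :: "real \<Rightarrow> real \<Rightarrow> real \<Rightarrow> real" where "par2 \<alpha> \<beta> N = (\<alpha> - \<beta> + 1) / 2"
definition par3 :: "real \<Rightarrow> real \<Rightarrow> real \<Rightarrow> real" where "par3 \<alpha> \<beta> N = - N - (\<alpha> + \<beta> + 1) / 2"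

lemmas par_defs = par1_def par2_def par3_def

lemma pochhammer_minus_fact: "j \<le> n \<Longrightarrow> (-1) ^ j * pochhammer (- real n) j * fact (n - j) = fact n"
proof (induction j)
  case (Suc j)
  then have "n - j = Suc (n - Suc j)" by simp
  then have *: "(fact (n - j) :: real) = (real n - real j) * fact (n - Suc j)"
    using Suc.prems by (simp add: of_nat_diff)
  have "(-1) ^ Suc j * pochhammer (- real n) (Suc j) * fact (n - Suc j)
      = (-1) ^ j * pochhammer (- real n) j * ((real n - real j) * fact (n - Suc j))"
    by (simp add: pochhammer_Suc algebra_simps)
  also have "\<dots> = fact n" using Suc unfolding *[symmetric] by simp
  finally show ?case .
qed simp

lemma pochhammer_nz:
  assumes "\<And>k. a + real k \<noteq> 0"
  shows "pochhammer a n \<noteq> 0"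
proof
  assume "pochhammer a n = 0"
  then obtain k where "a = - real k" by (auto simp: pochhammer_eq_0_iff)
  then show False using assms[of k] by simp
qed

text \<open>With p = \<open>par1\<close>, \<open>i * (\<alpha> + \<beta> + 1 + i)\<close> equals
  \<open>(p + i)^2 - p^2\<close>, so the products in R_n are Newton products. The denominator
  \<open>(\<alpha> + 1)_n\<close> arises from completing each \<open>(\<alpha> + 1)_j\<close> to
  index n.\<close>

lemma dual_hahn_cdh:
  assumes "\<And>k. \<alpha> + 1 + real k \<noteq> 0"
  shows "poly (dual_hahn \<alpha> \<beta> N n) (t - (par1 \<alpha> \<beta> N)\<^sup>2)
    = poly (cdh (par1 \<alpha> \<beta> N) (par2 \<alpha> \<beta> N) (par3 \<alpha> \<beta> N) n) t / pochhammer (\<alpha> + 1) n"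
proof -
  define p where "p = par1 \<alpha> \<beta> N"
  define q where "q = par2 \<alpha> \<beta> N"
  define r where "r = par3 \<alpha> \<beta> N"
  have pq: "p + q = \<alpha> + 1" "p + r = - N" by (auto simp: p_def q_def r_def par_defs field_simps)
  have nz: "pochhammer (\<alpha> + 1) k \<noteq> 0" for k
    using assms by (rule pochhammer_nz)
  have th: "poly (\<Prod>i<j. [:- (real i * (\<alpha> + \<beta> + 1 + real i)), 1:]) (t - p\<^sup>2) = newton p j t" for j
    unfolding poly_prod newton_def
    by (intro prod.cong refl) (simp add: p_def par_defs power2_eq_square field_simps)
  have c: "(-1) ^ j * pochhammer (- real n) j * pochhammer (- N + real j) (n - j) /
            (pochhammer (\<alpha> + 1) j * fact j) = fact n * cdh_coeff p q r n j / pochhammer (\<alpha> + 1) n"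
    if "j \<le> n" for j
  proof -
    have "pochhammer (\<alpha> + 1) n = pochhammer (\<alpha> + 1) j * pochhammer (\<alpha> + 1 + real j) (n - j)"
      using that by (rule pochhammer_product)
    moreover have "pochhammer (\<alpha> + 1 + real j) (n - j) \<noteq> 0" using calculation nz[of n] by auto
    moreover note pochhammer_minus_fact[OF that, symmetric]
    ultimately show ?thesis using that nz[of j]
      by (simp add: cdh_coeff_def pq mult.commute)
  qed
  have "poly (dual_hahn \<alpha> \<beta> N n) (t - p\<^sup>2) = (\<Sum>j=0..n. (-1) ^ j * pochhammer (- real n) j * pochhammer (- N + real j) (n - j) /
            (pochhammer (\<alpha> + 1) j * fact j) * newton p j t) / fact n"
    by (simp add: dual_hahn_def poly_sum th)
  also have "\<dots> = (\<Sum>j\<le>n. fact n * cdh_coeff p q r n j / pochhammer (\<alpha> + 1) n * newton p j t) / fact n"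
    unfolding atLeast0AtMost
  proof (intro arg_cong2[where f = "(/)"] sum.cong refl)
    fix j assume "j \<in> {..n}"
    then show "(-1) ^ j * pochhammer (- real n) j * pochhammer (- N + real j) (n - j) /
            (pochhammer (\<alpha> + 1) j * fact j) * newton p j t
        = fact n * cdh_coeff p q r n j / pochhammer (\<alpha> + 1) n * newton p j t"
      by (simp only: c atMost_iff)
  qed
  also have "\<dots> = poly (cdh p q r n) t / pochhammer (\<alpha> + 1) n"
    unfolding cdh_explicit sum_divide_distrib by (intro sum.cong) auto
  finally show ?thesis by (simp add: p_def q_def r_def)
qed

definition regular_pt :: "real \<Rightarrow> real \<Rightarrow> real \<Rightarrow> bool" where
  "regular_pt \<alpha> \<beta> x \<longleftrightarrow> 2 * x + \<alpha> + \<beta> \<noteq> 0 \<and> 2 * x + \<alpha> + \<beta> + 1 \<noteq> 0 \<and> 2 * x + \<alpha> + \<beta> + 2 \<noteq> 0"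

lemma eventually_regular_pt: "\<forall>\<^sub>F x in cofinite. regular_pt \<alpha> \<beta> x"
proof -
  have "\<forall>\<^sub>F x in cofinite. \<alpha> + \<beta> + 2 * x \<noteq> 0" "\<forall>\<^sub>F x in cofinite. \<alpha> + \<beta> + 1 + 2 * x \<noteq> 0"
    "\<forall>\<^sub>F x in cofinite. \<alpha> + \<beta> + 2 + 2 * x \<noteq> 0"
    by (intro eventually_cofinite_linear_neq, simp)+
  then show ?thesis
    unfolding regular_pt_def by eventually_elim (auto simp: algebra_simps)
qed

fun D_plus :: "real \<Rightarrow> real \<Rightarrow> real \<Rightarrow> family \<Rightarrow> real \<Rightarrow> real" where
  "D_plus \<alpha> \<beta> N First x = - ((x + \<alpha> + 1) * (x + \<alpha> + \<beta> + 1) / ((2 * x + \<alpha> + \<beta> + 1) * (2 * x + \<alpha> + \<beta> + 2)))"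
| "D_plus \<alpha> \<beta> N Second x = (x + \<alpha> + 1) * (N - x) / ((2 * x + \<alpha> + \<beta> + 1) * (2 * x + \<alpha> + \<beta> + 2))"
| "D_plus \<alpha> \<beta> N Third x = (x + \<alpha> + \<beta> + 1) * (N - x) / ((2 * x + \<alpha> + \<beta> + 1) * (2 * x + \<alpha> + \<beta> + 2))"

fun D_minus :: "real \<Rightarrow> real \<Rightarrow> real \<Rightarrow> family \<Rightarrow> real \<Rightarrow> real" where
  "D_minus \<alpha> \<beta> N First x = x * (x + \<beta>) / ((2 * x + \<alpha> + \<beta>) * (2 * x + \<alpha> + \<beta> + 1))"
| "D_minus \<alpha> \<beta> N Second x = (x + \<beta>) * (x + \<alpha> + \<beta> + N + 1) / ((2 * x + \<alpha> + \<beta>) * (2 * x + \<alpha> + \<beta> + 1))"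
| "D_minus \<alpha> \<beta> N Third x = x * (x + \<alpha> + \<beta> + N + 1) / ((2 * x + \<alpha> + \<beta>) * (2 * x + \<alpha> + \<beta> + 1))"

lemma D_op_eq: "D_op \<alpha> \<beta> N fam f x = D_plus \<alpha> \<beta> N fam x * (f (x + 1) - f x) + D_minus \<alpha> \<beta> N fam x * (f x - f (x - 1))"
  by (cases fam) simp_all

lemma Gamma_op_eq: "Gamma_op \<alpha> \<beta> N f x = B_fun \<alpha> \<beta> N x * (f (x + 1) - f x) - D_fun \<alpha> \<beta> N x * (f x - f (x - 1))"
  by (simp add: Gamma_op_def algebra_simps)

section \<open>Action of the difference operators on the Newton basis\<close>

definition newton_x :: "real \<Rightarrow> nat \<Rightarrow> real \<Rightarrow> real" where
  "newton_x p j x = newton p j ((x + p)\<^sup>2)"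

lemma newton_x_prod: "newton_x p j x = (\<Prod>i<j. x - real i) * pochhammer (x + 2 * p) j"
  unfolding newton_x_def newton_def pochhammer_prod atLeast0LessThan prod.distrib[symmetric]
  by (intro prod.cong) (auto simp: power2_eq_square algebra_simps)

definition newton_U :: "real \<Rightarrow> nat \<Rightarrow> real \<Rightarrow> real" where
  "newton_U p j x = (\<Prod>i<j. x - real i) * pochhammer (x + 2 * p + 1) j"

text \<open>The forward and backward differences contain the common shape \<open>newton_U\<close>,
  taken at x and at x - 1. The factors \<open>x + 2 * p\<close> and x convert it back into
  \<open>newton_x p j\<close>; they are present in the coefficients of \<Gamma> and of the first and
  third lowering operators.\<close>

lemma newton_x_diff:
  fixes p x :: real and j :: nat
  defines "U \<equiv> newton_U p"
  shows "newton_x p (Suc j) (x + 1) - newton_x p (Suc j) x = (real j + 1) * (2 * x + 2 * p + 1) * U j x"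
    and "newton_x p (Suc j) x - newton_x p (Suc j) (x - 1) = (real j + 1) * (2 * x + 2 * p - 1) * U j (x - 1)"
    and "(x + 2 * p) * U j x = (x + 2 * p + real j) * newton_x p j x"
    and "x * U j (x - 1) = (x - real j) * newton_x p j x"
proof -
  define F where "F = (\<lambda>j x. \<Prod>i<j. x - real i)"
  have F1: "F (Suc j) (x + 1) = (x + 1) * F j x" for j x
    unfolding F_def prod.lessThan_Suc_shift by simp
  have F2: "F (Suc j) x = F j x * (x - real j)" for j x by (simp add: F_def)
  have N: "newton_x p j x = F j x * pochhammer (x + 2 * p) j" for j x by (simp add: newton_x_prod F_def)
  have U: "U j x = F j x * pochhammer (x + 2 * p + 1) j" for x by (simp add: U_def newton_U_def F_def)
  have P: "pochhammer (x + 2 * p) (Suc j) = (x + 2 * p) * pochhammer (x + 2 * p + 1) j" for x j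
    by (simp add: pochhammer_rec)
  have P': "pochhammer (x + 1 + 2 * p) (Suc j) = pochhammer (x + 2 * p + 1) j * (x + 2 * p + 1 + real j)" for x j
    by (simp add: pochhammer_Suc add_ac)
  have 1: "newton_x p (Suc j) (x + 1) - newton_x p (Suc j) x = (real j + 1) * (2 * x + 2 * p + 1) * U j x" for x
  proof -
    have "newton_x p (Suc j) (x + 1) = (x + 1) * F j x * (pochhammer (x + 2 * p + 1) j * (x + 2 * p + 1 + real j))"
      by (simp only: N F1 P')
    moreover have "newton_x p (Suc j) x = F j x * (x - real j) * ((x + 2 * p) * pochhammer (x + 2 * p + 1) j)"
      by (simp only: N F2 P)
    ultimately show ?thesis unfolding U by (simp add: algebra_simps)
  qed
  show "newton_x p (Suc j) (x + 1) - newton_x p (Suc j) x = (real j + 1) * (2 * x + 2 * p + 1) * U j x"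
    by (rule 1)
  show "newton_x p (Suc j) x - newton_x p (Suc j) (x - 1) = (real j + 1) * (2 * x + 2 * p - 1) * U j (x - 1)"
    using 1[of "x - 1"] by simp
  show "(x + 2 * p) * U j x = (x + 2 * p + real j) * newton_x p j x"
  proof -
    have "(x + 2 * p) * U j x = F j x * pochhammer (x + 2 * p) (Suc j)" unfolding U P by simp
    then show ?thesis unfolding N pochhammer_Suc by simp
  qed
  show "x * U j (x - 1) = (x - real j) * newton_x p j x"
  proof -
    have "x * U j (x - 1) = F (Suc j) x * pochhammer (x + 2 * p) j"
      using F1[of j "x - 1"] unfolding U by simp
    then show ?thesis unfolding N F2 by simp
  qed
qed

text \<open>The operators act triangularly on the Newton basis. The difference cancels one factor of
  each denominator; what remains is \<open>2 * x + s + 1\<close>, and it divides the sum of the two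
  numerators. The local fact \<open>frac\<close> isolates this cancellation.\<close>

lemma Gamma_newton_x:
  fixes \<alpha> \<beta> N x :: real and j :: nat
  assumes "regular_pt \<alpha> \<beta> x"
  defines "p \<equiv> par1 \<alpha> \<beta> N" and "q \<equiv> par2 \<alpha> \<beta> N" and "r \<equiv> par3 \<alpha> \<beta> N"
  shows "Gamma_op \<alpha> \<beta> N (newton_x p (Suc j)) x
    = (real j + 1) * (newton_x p (Suc j) x + (p + q + real j) * (p + r + real j) * newton_x p j x)"
    and "D_op \<alpha> \<beta> N First (newton_x p (Suc j)) x = - (real j + 1) * (p + q + real j) * newton_x p j x"
    and "D_op \<alpha> \<beta> N Third (newton_x p (Suc j)) x = - (real j + 1) * (p + r + real j) * newton_x p j x"
proof -
  define U where "U = newton_U p"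
  note * = newton_x_diff[where p = p and x = x and j = j, folded U_def]
  define s where "s = \<alpha> + \<beta>"
  have p2: "2 * p = s + 1" by (simp add: p_def par_defs s_def)
  have pq: "p + q = \<alpha> + 1" "p + r = - N" by (auto simp: p_def q_def r_def par_defs field_simps)
  have nz: "2 * x + s \<noteq> 0" "2 * x + s + 1 \<noteq> 0" "2 * x + s + 2 \<noteq> 0"
    using assms by (auto simp: regular_pt_def s_def)
  have d1: "newton_x p (Suc j) (x + 1) - newton_x p (Suc j) x = (real j + 1) * (2 * x + s + 2) * U j x"
    and d0: "newton_x p (Suc j) x - newton_x p (Suc j) (x - 1) = (real j + 1) * (2 * x + s) * U j (x - 1)"
    and e1: "(x + s + 1) * U j x = (x + s + 1 + real j) * newton_x p j x"
    and e0: "x * U j (x - 1) = (x - real j) * newton_x p j x"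
  proof -
    have e: "2 * x + 2 * p + 1 = 2 * x + s + 2" "2 * x + 2 * p - 1 = 2 * x + s" "x + 2 * p = x + s + 1"
      by (simp_all add: p2)
    note ** = *[unfolded e]
    show "newton_x p (Suc j) (x + 1) - newton_x p (Suc j) x = (real j + 1) * (2 * x + s + 2) * U j x"
      "newton_x p (Suc j) x - newton_x p (Suc j) (x - 1) = (real j + 1) * (2 * x + s) * U j (x - 1)"
      "(x + s + 1) * U j x = (x + s + 1 + real j) * newton_x p j x"
      "x * U j (x - 1) = (x - real j) * newton_x p j x"
      by (fact **)+
  qed
  define T where "T = newton_x p j x"
  have frac: "A / ((2 * x + s + 1) * (2 * x + s + 2)) * ((real j + 1) * (2 * x + s + 2) * U1)
      + A' / ((2 * x + s) * (2 * x + s + 1)) * ((real j + 1) * (2 * x + s) * U0) = R"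
    if "A * U1 + A' * U0 = (2 * x + s + 1) * R'" "R = (real j + 1) * R'" for A A' U1 U0 R R'
  proof -
    have cancel: "A / (k * l) * (J * l * V) = J * (A * V) / k" "A / (l * k) * (J * l * V) = J * (A * V) / k"
      if "l \<noteq> 0" for A J V k l :: real
      using that by simp_all
    have c1: "A / ((2 * x + s + 1) * (2 * x + s + 2)) * ((real j + 1) * (2 * x + s + 2) * U1) = (real j + 1) * (A * U1) / (2 * x + s + 1)"
      using nz(3) by (rule cancel)
    have c2: "A' / ((2 * x + s) * (2 * x + s + 1)) * ((real j + 1) * (2 * x + s) * U0) = (real j + 1) * (A' * U0) / (2 * x + s + 1)"
      using nz(1) by (rule cancel)
    have "(real j + 1) * (A * U1) / (2 * x + s + 1) + (real j + 1) * (A' * U0) / (2 * x + s + 1) = (real j + 1) * (A * U1 + A' * U0) / (2 * x + s + 1)"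
      by (simp add: add_divide_distrib ring_distribs)
    also have "\<dots> = R" using nz that by simp
    finally show ?thesis unfolding c1 c2 .
  qed
  have N1: "newton_x p (Suc j) x = T * ((x - real j) * (x + s + 1 + real j))"
  proof -
    have "(x + p)\<^sup>2 - (p + real j)\<^sup>2 = (x - real j) * (x + 2 * p + real j)" by (simp add: power2_eq_square algebra_simps)
    then show ?thesis by (simp add: newton_x_def newton_simps p2 T_def)
  qed
  have "Gamma_op \<alpha> \<beta> N (newton_x p (Suc j)) x
      = (- ((x + \<alpha> + 1) * (x + s + 1) * (N - x))) / ((2 * x + s + 1) * (2 * x + s + 2)) * ((real j + 1) * (2 * x + s + 2) * U j x)
      + (x * (x + s + N + 1) * (x + \<beta>)) / ((2 * x + s) * (2 * x + s + 1)) * ((real j + 1) * (2 * x + s) * U j (x - 1))"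
    unfolding Gamma_op_eq d1 d0 B_fun_def D_fun_def s_def by (simp add: add.assoc)
  also have "\<dots> = (real j + 1) * (newton_x p (Suc j) x + (p + q + real j) * (p + r + real j) * newton_x p j x)"
  proof (rule frac)
    have "- ((x + \<alpha> + 1) * (x + s + 1) * (N - x)) * U j x + x * (x + s + N + 1) * (x + \<beta>) * U j (x - 1)
       = - ((x + \<alpha> + 1) * (N - x)) * ((x + s + 1) * U j x) + (x + s + N + 1) * (x + \<beta>) * (x * U j (x - 1))"
      by (simp add: algebra_simps)
    also have "\<dots> = (2 * x + s + 1) * (newton_x p (Suc j) x + (p + q + real j) * (p + r + real j) * newton_x p j x)"
      unfolding e1 e0 N1 pq T_def by (simp add: s_def algebra_simps)
    finally show "- ((x + \<alpha> + 1) * (x + s + 1) * (N - x)) * U j x + x * (x + s + N + 1) * (x + \<beta>) * U j (x - 1) = \<dots>" .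
  qed simp
  finally show "Gamma_op \<alpha> \<beta> N (newton_x p (Suc j)) x
    = (real j + 1) * (newton_x p (Suc j) x + (p + q + real j) * (p + r + real j) * newton_x p j x)" .
  have "D_op \<alpha> \<beta> N First (newton_x p (Suc j)) x
      = (- ((x + \<alpha> + 1) * (x + s + 1))) / ((2 * x + s + 1) * (2 * x + s + 2)) * ((real j + 1) * (2 * x + s + 2) * U j x)
      + (x * (x + \<beta>)) / ((2 * x + s) * (2 * x + s + 1)) * ((real j + 1) * (2 * x + s) * U j (x - 1))"
    unfolding D_op_eq d1 d0 D_plus.simps D_minus.simps s_def by (simp add: add.assoc)
  also have "\<dots> = - (real j + 1) * (p + q + real j) * newton_x p j x"
  proof (rule frac)
    have "- ((x + \<alpha> + 1) * (x + s + 1)) * U j x + x * (x + \<beta>) * U j (x - 1)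
       = - (x + \<alpha> + 1) * ((x + s + 1) * U j x) + (x + \<beta>) * (x * U j (x - 1))"
      by (simp add: algebra_simps)
    also have "\<dots> = (2 * x + s + 1) * (- ((p + q + real j) * newton_x p j x))"
      unfolding e1 e0 pq T_def by (simp add: s_def algebra_simps)
    finally show "- ((x + \<alpha> + 1) * (x + s + 1)) * U j x + x * (x + \<beta>) * U j (x - 1) = \<dots>" .
  qed (simp add: algebra_simps)
  finally show "D_op \<alpha> \<beta> N First (newton_x p (Suc j)) x = - (real j + 1) * (p + q + real j) * newton_x p j x" .
  have "D_op \<alpha> \<beta> N Third (newton_x p (Suc j)) x
      = ((x + s + 1) * (N - x)) / ((2 * x + s + 1) * (2 * x + s + 2)) * ((real j + 1) * (2 * x + s + 2) * U j x)
      + (x * (x + s + N + 1)) / ((2 * x + s) * (2 * x + s + 1)) * ((real j + 1) * (2 * x + s) * U j (x - 1))"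
    unfolding D_op_eq d1 d0 D_plus.simps D_minus.simps s_def by (simp add: add.assoc)
  also have "\<dots> = - (real j + 1) * (p + r + real j) * newton_x p j x"
  proof (rule frac)
    have "(x + s + 1) * (N - x) * U j x + x * (x + s + N + 1) * U j (x - 1)
       = (N - x) * ((x + s + 1) * U j x) + (x + s + N + 1) * (x * U j (x - 1))"
      by (simp add: algebra_simps)
    also have "\<dots> = (2 * x + s + 1) * (- ((p + r + real j) * newton_x p j x))"
      unfolding e1 e0 pq T_def by (simp add: s_def algebra_simps)
    finally show "(x + s + 1) * (N - x) * U j x + x * (x + s + N + 1) * U j (x - 1) = \<dots>" .
  qed (simp add: algebra_simps)
  finally show "D_op \<alpha> \<beta> N Third (newton_x p (Suc j)) x = - (real j + 1) * (p + r + real j) * newton_x p j x" .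
qed

lemma Gamma_op_sum: "Gamma_op \<alpha> \<beta> N (\<lambda>x. \<Sum>i\<in>I. c i * f i x) x = (\<Sum>i\<in>I. c i * Gamma_op \<alpha> \<beta> N (f i) x)"
  unfolding Gamma_op_def
  by (simp only: sum_distrib_left sum.distrib[symmetric] sum_subtractf[symmetric])
     (intro sum.cong, auto simp: algebra_simps)

lemma D_op_sum: "D_op \<alpha> \<beta> N fam (\<lambda>x. \<Sum>i\<in>I. c i * f i x) x = (\<Sum>i\<in>I. c i * D_op \<alpha> \<beta> N fam (f i) x)"
  unfolding D_op_eq
  by (simp only: sum_distrib_left sum.distrib[symmetric] sum_subtractf[symmetric])
     (intro sum.cong, auto simp: algebra_simps)

definition cdh_x :: "real \<Rightarrow> real \<Rightarrow> real \<Rightarrow> nat \<Rightarrow> real \<Rightarrow> real" where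
  "cdh_x \<alpha> \<beta> N n x = poly (cdh (par1 \<alpha> \<beta> N) (par2 \<alpha> \<beta> N) (par3 \<alpha> \<beta> N) n) ((x + par1 \<alpha> \<beta> N)\<^sup>2)"

lemma cdh_x_newton: "cdh_x \<alpha> \<beta> N n = (\<lambda>x. \<Sum>j\<le>n. cdh_coeff (par1 \<alpha> \<beta> N) (par2 \<alpha> \<beta> N) (par3 \<alpha> \<beta> N) n j
    * newton_x (par1 \<alpha> \<beta> N) j x)"
  by (simp add: cdh_x_def cdh_explicit newton_x_def fun_eq_iff)

text \<open>In Newton coefficients the eigenvalue equation for n is exactly the two-term relation
  \<open>cdh_coeff_left\<close>.\<close>

lemma Gamma_cdh_x:
  assumes "regular_pt \<alpha> \<beta> x"
  shows "Gamma_op \<alpha> \<beta> N (cdh_x \<alpha> \<beta> N n) x = real n * cdh_x \<alpha> \<beta> N n x"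
proof -
  define p where "p = par1 \<alpha> \<beta> N"
  define q where "q = par2 \<alpha> \<beta> N"
  define r where "r = par3 \<alpha> \<beta> N"
  define c where "c = cdh_coeff p q r n"
  note G = Gamma_newton_x(1)[OF assms, of N, folded p_def q_def r_def]
  have G0: "Gamma_op \<alpha> \<beta> N (newton_x p 0) x = 0" by (simp add: Gamma_op_eq newton_x_def newton_simps)
  have "Gamma_op \<alpha> \<beta> N (cdh_x \<alpha> \<beta> N n) x = (\<Sum>j\<le>n. c j * Gamma_op \<alpha> \<beta> N (newton_x p j) x)"
    unfolding cdh_x_newton by (simp only: Gamma_op_sum p_def q_def r_def c_def)
  also have "\<dots> = (\<Sum>j\<le>Suc n. c j * Gamma_op \<alpha> \<beta> N (newton_x p j) x)"
    by (simp add: c_def cdh_coeff_gt)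
  also have "\<dots> = (\<Sum>j\<le>n. c (Suc j) * ((real j + 1) * (newton_x p (Suc j) x + (p + q + real j) * (p + r + real j) * newton_x p j x)))"
    by (simp add: sum.atMost_Suc_shift G G0 del: sum.atMost_Suc)
  also have "\<dots> = (\<Sum>j\<le>n. real (Suc j) * c (Suc j) * newton_x p (Suc j) x) +
      (\<Sum>j\<le>n. ((p + q + real j) * (p + r + real j) * (real j + 1) * c (Suc j)) * newton_x p j x)"
    unfolding sum.distrib[symmetric] by (intro sum.cong) (auto simp: algebra_simps)
  also have "(\<Sum>j\<le>n. real (Suc j) * c (Suc j) * newton_x p (Suc j) x) = (\<Sum>j\<le>Suc n. real j * c j * newton_x p j x)"
    by (simp add: sum.atMost_Suc_shift del: sum.atMost_Suc)
  also have "\<dots> = (\<Sum>j\<le>n. real j * c j * newton_x p j x)" by (simp add: c_def cdh_coeff_gt)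
  also have "\<dots> + (\<Sum>j\<le>n. ((p + q + real j) * (p + r + real j) * (real j + 1) * c (Suc j)) * newton_x p j x)
      = (\<Sum>j\<le>n. real n * (c j * newton_x p j x))"
    unfolding c_def cdh_coeff_left[symmetric] sum.distrib[symmetric] by (intro sum.cong) (auto simp: algebra_simps)
  finally show ?thesis unfolding cdh_x_newton by (simp add: sum_distrib_left c_def p_def q_def r_def)
qed

text \<open>One-step form of the defining sum of a D-operator. It is stated for any linear D with
  the given action on the Newton basis, so that first and third family share one proof with q and r
  exchanged.\<close>

lemma lowering_cdh_x:
  fixes p q r x :: real and D :: "(real \<Rightarrow> real) \<Rightarrow> real" and n :: nat
  defines "K \<equiv> \<lambda>n x. poly (cdh p q r n) ((x + p)\<^sup>2)"
  assumes lin: "\<And>c f n. D (\<lambda>x. \<Sum>i\<le>n. c i * f i x) = (\<Sum>i\<le>(n::nat). c i * D (f i))"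
    and D0: "D (newton_x p 0) = 0"
    and D: "\<And>j. D (newton_x p (Suc j)) = - (real j + 1) * (p + q + real j) * newton_x p j x"
  shows "D (K (Suc n)) = - (real n + p + q) * (K n x - D (K n))"
proof -
  define c where "c = cdh_coeff p q r"
  have K: "K n = (\<lambda>x. \<Sum>j\<le>n. c n j * newton_x p j x)" for n
    by (simp add: K_def cdh_explicit newton_x_def c_def)
  have DK: "D (K n) = - (\<Sum>j\<le>m. (real j + 1) * (p + q + real j) * c n (Suc j) * newton_x p j x)" if "n \<le> Suc m" for n m
  proof -
    have "D (K n) = (\<Sum>j\<le>n. c n j * D (newton_x p j))" unfolding K lin ..
    also have "\<dots> = (\<Sum>j\<le>Suc m. c n j * D (newton_x p j))"
      using that by (intro sum.mono_neutral_left) (auto simp: c_def cdh_coeff_gt)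
    also have "\<dots> = (\<Sum>j\<le>m. c n (Suc j) * (- (real j + 1) * (p + q + real j) * newton_x p j x))"
      by (simp add: sum.atMost_Suc_shift D D0 del: sum.atMost_Suc)
    also have "\<dots> = - (\<Sum>j\<le>m. (real j + 1) * (p + q + real j) * c n (Suc j) * newton_x p j x)"
      unfolding sum_negf[symmetric] by (intro sum.cong) (auto simp: algebra_simps)
    finally show ?thesis .
  qed
  have co: "(real j + 1) * (p + q + real j) * c (Suc n) (Suc j)
      = (real n + p + q) * (c n j + (real j + 1) * (p + q + real j) * c n (Suc j))" if "j \<le> n" for j
  proof (cases "j = n")
    case True
    then show ?thesis
      by (simp add: c_def cdh_coeff_diag cdh_coeff_gt divide_simps) (simp add: algebra_simps)
  next
    case False
    have up: "(real n - real j) * c (Suc n) (Suc j) = (p + q + real n) * (p + r + real n) * c n (Suc j)"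
      using cdh_coeff_up[of n "Suc j" p q r] by (simp add: c_def)
    have left: "(real n - real j) * c n j = (p + q + real j) * (p + r + real j) * (real j + 1) * c n (Suc j)"
      using cdh_coeff_left[of n j p q r] by (simp add: c_def)
    have "(real n - real j) * ((real j + 1) * (p + q + real j) * c (Suc n) (Suc j))
        = (real j + 1) * (p + q + real j) * ((real n - real j) * c (Suc n) (Suc j))" by simp
    also have "\<dots> = (real n + p + q) * ((p + q + real j) * (p + r + real j) * (real j + 1) * c n (Suc j)
        + (real n - real j) * ((real j + 1) * (p + q + real j) * c n (Suc j)))"
      unfolding up by (simp add: algebra_simps)
    also have "\<dots> = (real n - real j) * ((real n + p + q) * (c n j + (real j + 1) * (p + q + real j) * c n (Suc j)))"
      unfolding left[symmetric] by (simp add: algebra_simps)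
    finally show ?thesis using False by simp
  qed
  have "D (K (Suc n)) = - (\<Sum>j\<le>n. (real n + p + q) * (c n j * newton_x p j x + (real j + 1) * (p + q + real j) * c n (Suc j) * newton_x p j x))"
    unfolding DK[OF order.refl]
  proof (intro arg_cong[where f = uminus] sum.cong refl)
    fix j assume "j \<in> {..n}"
    then show "(real j + 1) * (p + q + real j) * c (Suc n) (Suc j) * newton_x p j x
        = (real n + p + q) * (c n j * newton_x p j x + (real j + 1) * (p + q + real j) * c n (Suc j) * newton_x p j x)"
      using co[of j] by (simp only: atMost_iff distrib_right mult.assoc)
  qed
  also have "\<dots> = - ((real n + p + q) * ((\<Sum>j\<le>n. c n j * newton_x p j x) +
      (\<Sum>j\<le>n. (real j + 1) * (p + q + real j) * c n (Suc j) * newton_x p j x)))"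
    by (simp only: sum_distrib_left[symmetric] sum.distrib)
  also have "(\<Sum>j\<le>n. (real j + 1) * (p + q + real j) * c n (Suc j) * newton_x p j x) = - D (K n)"
    unfolding DK[OF le_SucI[OF order.refl]] by simp
  also have "(\<Sum>j\<le>n. c n j * newton_x p j x) = K n x" by (simp add: K)
  also have "- ((real n + p + q) * (K n x + - D (K n))) = - (real n + p + q) * (K n x - D (K n))"
    by (simp add: algebra_simps)
  finally show ?thesis .
qed

text \<open>The sum of two of the three parameters. By \<open>eps_eq\<close> the ratio \<epsilon>_n
  is \<open>- (n - 1 + gauge_par) / (\<alpha> + n)\<close>, so the products \<xi> are quotients of
  Pochhammer symbols.\<close>

fun gauge_par :: "real \<Rightarrow> real \<Rightarrow> real \<Rightarrow> family \<Rightarrow> real" where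
  "gauge_par \<alpha> \<beta> N First = par1 \<alpha> \<beta> N + par2 \<alpha> \<beta> N"
| "gauge_par \<alpha> \<beta> N Second = par2 \<alpha> \<beta> N + par3 \<alpha> \<beta> N"
| "gauge_par \<alpha> \<beta> N Third = par1 \<alpha> \<beta> N + par3 \<alpha> \<beta> N"

text \<open>The Newton basis at \<open>par1\<close> serves the families whose
  \<open>gauge_par\<close> contains \<open>par1\<close>; the second one needs the basis at
  \<open>par2\<close>.\<close>

lemma D_op_cdh_x:
  assumes "regular_pt \<alpha> \<beta> x"
  shows "D_op \<alpha> \<beta> N fam (cdh_x \<alpha> \<beta> N (Suc n)) x
    = - (real n + gauge_par \<alpha> \<beta> N fam) * (cdh_x \<alpha> \<beta> N n x - D_op \<alpha> \<beta> N fam (cdh_x \<alpha> \<beta> N n) x)"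
proof -
  have zero: "D_op \<alpha> \<beta> N fam (newton_x p 0) x = 0" for \<alpha> \<beta> N fam p and x :: real
    by (simp add: D_op_eq newton_x_def newton_simps)
  have third: "D_op \<alpha> \<beta> N Third (cdh_x \<alpha> \<beta> N (Suc n)) x
    = - (real n + par1 \<alpha> \<beta> N + par3 \<alpha> \<beta> N) * (cdh_x \<alpha> \<beta> N n x - D_op \<alpha> \<beta> N Third (cdh_x \<alpha> \<beta> N n) x)"
    if "regular_pt \<alpha> \<beta> x" for \<alpha> \<beta> N and x :: real
    unfolding cdh_x_def cdh_sym(2)[of "par1 \<alpha> \<beta> N" "par2 \<alpha> \<beta> N"]
    using lowering_cdh_x[of "\<lambda>f. D_op \<alpha> \<beta> N Third f x" "par1 \<alpha> \<beta> N" "par3 \<alpha> \<beta> N" x "par2 \<alpha> \<beta> N" n,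
        OF D_op_sum zero Gamma_newton_x(3)[OF that]] .
  show ?thesis
  proof (cases fam)
    case First
    show ?thesis
      unfolding cdh_x_def First
      using lowering_cdh_x[of "\<lambda>f. D_op \<alpha> \<beta> N First f x" "par1 \<alpha> \<beta> N" "par2 \<alpha> \<beta> N" x "par3 \<alpha> \<beta> N" n,
          OF D_op_sum zero Gamma_newton_x(2)[OF assms]] by (simp add: add.assoc)
  next
    case Third
    then show ?thesis using third[OF assms] by (simp add: add.assoc)
  next
    case Second
    \<comment> \<open>The substitution \<open>(\<alpha>, \<beta>, N, x) \<mapsto> (\<alpha>, -\<beta>, N + \<beta>, x + \<beta>)\<close> exchanges the last two families.\<close>
    have par: "par1 \<alpha> (- \<beta>) (N + \<beta>) = par2 \<alpha> \<beta> N" "par2 \<alpha> (- \<beta>) (N + \<beta>) = par1 \<alpha> \<beta> N"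
      "par3 \<alpha> (- \<beta>) (N + \<beta>) = par3 \<alpha> \<beta> N"
      by (simp_all add: par_defs field_simps)
    have x: "x + \<beta> + par2 \<alpha> \<beta> N = x + par1 \<alpha> \<beta> N" for x by (simp add: par_defs field_simps)
    have cdh: "cdh_x \<alpha> (- \<beta>) (N + \<beta>) n (x + \<beta>) = cdh_x \<alpha> \<beta> N n x" for n x
      unfolding cdh_x_def par x by (simp add: cdh_sym(1))
    have c1: "cdh_x \<alpha> (- \<beta>) (N + \<beta>) n (x + \<beta> + 1) = cdh_x \<alpha> \<beta> N n (x + 1)"
      "cdh_x \<alpha> (- \<beta>) (N + \<beta>) n (x + \<beta> - 1) = cdh_x \<alpha> \<beta> N n (x - 1)" for n x
      using cdh[of n "x + 1"] cdh[of n "x - 1"] by (simp_all add: algebra_simps)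
    have dpm: "D_plus \<alpha> (- \<beta>) (N + \<beta>) Third (x + \<beta>) = D_plus \<alpha> \<beta> N Second x"
      "D_minus \<alpha> (- \<beta>) (N + \<beta>) Third (x + \<beta>) = D_minus \<alpha> \<beta> N Second x"
      by (simp_all add: algebra_simps)
    have D: "D_op \<alpha> (- \<beta>) (N + \<beta>) Third (cdh_x \<alpha> (- \<beta>) (N + \<beta>) n) (x + \<beta>) = D_op \<alpha> \<beta> N Second (cdh_x \<alpha> \<beta> N n) x" for n
      unfolding D_op_eq dpm cdh c1 ..
    have "regular_pt \<alpha> (- \<beta>) (x + \<beta>)" using assms by (simp add: regular_pt_def algebra_simps)
    from third[OF this, of "N + \<beta>"] show ?thesis
      unfolding D par cdh Second by (simp add: add.assoc)
  qed
qed

lemma eps_eq: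
  assumes "\<alpha> + n \<noteq> 0"
  shows "eps \<alpha> \<beta> N fam n = - (n - 1 + gauge_par \<alpha> \<beta> N fam) / (\<alpha> + n)"
proof (cases fam)
  case First
  have "gauge_par \<alpha> \<beta> N First = \<alpha> + 1" by (simp add: par_defs field_simps)
  then show ?thesis using assms First by (simp add: field_simps)
next
  case Second
  have "gauge_par \<alpha> \<beta> N Second = - \<beta> - N" by (simp add: par_defs field_simps)
  then show ?thesis using Second by (simp add: minus_divide_left del: gauge_par.simps)
next
  case Third
  have "gauge_par \<alpha> \<beta> N Third = - N" by (simp add: par_defs field_simps)
  then show ?thesis using Third by (simp add: minus_divide_left del: gauge_par.simps)
qed

definition dual_hahn_x :: "real \<Rightarrow> real \<Rightarrow> real \<Rightarrow> nat \<Rightarrow> real \<Rightarrow> real" where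
  "dual_hahn_x \<alpha> \<beta> N n x = poly (dual_hahn \<alpha> \<beta> N n) (lam \<alpha> \<beta> x)"

lemma lam_eq: "lam \<alpha> \<beta> x = (x + par1 \<alpha> \<beta> N)\<^sup>2 - (par1 \<alpha> \<beta> N)\<^sup>2"
  by (simp add: lam_def par_defs power2_eq_square field_simps)

context
  fixes \<alpha> \<beta> N :: real
  assumes \<alpha>: "\<And>k. \<alpha> + 1 + real k \<noteq> 0"
begin

lemma pochhammer_alpha_nz: "pochhammer (\<alpha> + 1) n \<noteq> 0"
  using \<alpha> by (rule pochhammer_nz)

lemma dual_hahn_x_eq: "dual_hahn_x \<alpha> \<beta> N n = (\<lambda>x. 1 / pochhammer (\<alpha> + 1) n * cdh_x \<alpha> \<beta> N n x)"
  unfolding dual_hahn_x_def lam_eq[of _ _ _ N] cdh_x_def by (simp add: dual_hahn_cdh \<alpha>)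

lemma Gamma_dual_hahn_x:
  assumes "regular_pt \<alpha> \<beta> x"
  shows "Gamma_op \<alpha> \<beta> N (dual_hahn_x \<alpha> \<beta> N n) x = real n * dual_hahn_x \<alpha> \<beta> N n x"
  using Gamma_op_sum[of \<alpha> \<beta> N "\<lambda>_. 1 / pochhammer (\<alpha> + 1) n" "\<lambda>_. cdh_x \<alpha> \<beta> N n" "{0::nat}" x]
  unfolding dual_hahn_x_eq by (simp add: Gamma_cdh_x[OF assms])

lemma D_op_dual_hahn_x_Suc:
  assumes "regular_pt \<alpha> \<beta> x"
  shows "D_op \<alpha> \<beta> N fam (dual_hahn_x \<alpha> \<beta> N (Suc n)) x
    = eps \<alpha> \<beta> N fam (real n + 1) * (dual_hahn_x \<alpha> \<beta> N n x - D_op \<alpha> \<beta> N fam (dual_hahn_x \<alpha> \<beta> N n) x)"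
proof -
  have D: "D_op \<alpha> \<beta> N fam (dual_hahn_x \<alpha> \<beta> N n) x = D_op \<alpha> \<beta> N fam (cdh_x \<alpha> \<beta> N n) x / pochhammer (\<alpha> + 1) n" for n
    using D_op_sum[of \<alpha> \<beta> N fam "\<lambda>_. 1 / pochhammer (\<alpha> + 1) n" "\<lambda>_. cdh_x \<alpha> \<beta> N n" "{0::nat}" x]
    unfolding dual_hahn_x_eq by simp
  have nz: "\<alpha> + (real n + 1) \<noteq> 0" using \<alpha>[of n] by (simp add: algebra_simps)
  show ?thesis
    unfolding D eps_eq[OF nz] D_op_cdh_x[OF assms] pochhammer_Suc
    unfolding dual_hahn_x_eq using nz pochhammer_alpha_nz[of n] by (simp add: field_simps)
qed

text \<open>Iterates the one-step relation down to R_0 = 1, on which the operator vanishes.\<close>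

lemma D_op_dual_hahn_x:
  assumes "regular_pt \<alpha> \<beta> x"
  shows "D_op \<alpha> \<beta> N fam (dual_hahn_x \<alpha> \<beta> N n) x
    = (\<Sum>j<n. (-1) ^ j * (\<Prod>i<Suc j. eps \<alpha> \<beta> N fam (real n - real i)) * dual_hahn_x \<alpha> \<beta> N (n - Suc j) x)"
proof (induction n)
  case 0
  have "dual_hahn_x \<alpha> \<beta> N 0 = (\<lambda>_. 1)" by (simp add: dual_hahn_x_def dual_hahn_def fun_eq_iff)
  then show ?case by (simp add: D_op_eq)
next
  case (Suc n)
  have *: "(\<Prod>i<Suc (Suc j). eps \<alpha> \<beta> N fam (real (Suc n) - real i))
      = eps \<alpha> \<beta> N fam (real n + 1) * (\<Prod>i<Suc j. eps \<alpha> \<beta> N fam (real n - real i))" for j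
    by (subst prod.lessThan_Suc_shift) (simp add: add.commute)
  show ?case
    unfolding D_op_dual_hahn_x_Suc[OF assms] Suc.IH sum.lessThan_Suc_shift *
    by (simp add: sum_distrib_left sum_negf algebra_simps del: prod.lessThan_Suc)
qed

end

section \<open>Determinants\<close>

lemma cofactor_column_orthogonal:
  assumes A: "A \<in> carrier_mat n n" and "i < n" "j < n"
  shows "(\<Sum>h<n. cofactor A h i * A $$ (h, j)) = (if i = j then det A else 0)"
proof -
  have "(adj_mat A * A) $$ (i, j) = (\<Sum>h<n. cofactor A h i * A $$ (h, j))"
    using assms by (auto simp: adj_mat_def times_mat_def scalar_prod_def lessThan_atLeast0)
  then show ?thesis
    using adj_mat(3)[OF A] assms by auto
qed

lemma det_row_combination:
  fixes M :: "'a :: idom mat"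
  assumes M: "M \<in> carrier_mat (Suc m) (Suc m)"
    and comb: "\<And>i. i \<le> m \<Longrightarrow> M $$ (0, i) = (\<Sum>l<m. r l * M $$ (Suc l, i))"
  shows "det M = 0"
proof -
  define v where "v = vec (Suc m) (\<lambda>k. if k = 0 then -1 else r (k - 1))"
  have v: "v \<in> carrier_vec (Suc m)" by (simp add: v_def)
  have "v $ 0 \<noteq> 0\<^sub>v (Suc m) $ 0" by (simp add: v_def)
  then have "v \<noteq> 0\<^sub>v (Suc m)" by metis
  moreover have "M\<^sup>T *\<^sub>v v = 0\<^sub>v (Suc m)"
  proof (rule eq_vecI)
    fix i assume i: "i < dim_vec (0\<^sub>v (Suc m))"
    then have "(M\<^sup>T *\<^sub>v v) $ i = (\<Sum>k<Suc m. M $$ (k, i) * v $ k)"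
      using M v by (simp add: scalar_prod_def lessThan_atLeast0 mult_mat_vec_def)
    also have "\<dots> = 0"
      using i comb[of i] unfolding sum.lessThan_Suc_shift by (simp add: v_def mult.commute)
    finally show "(M\<^sup>T *\<^sub>v v) $ i = 0\<^sub>v (Suc m) $ i" using i by simp
  qed (use M in auto)
  ultimately have "det M\<^sup>T = 0"
    using det_0_iff_vec_prod_zero[of "M\<^sup>T" "Suc m"] M v by auto
  then show ?thesis using det_transpose[OF M] by simp
qed

text \<open>Writes a cofactor as a full determinant, so that column operations and degree estimates
  for determinants also apply to cofactors.\<close>

lemma det_replace_row_unit:
  fixes A :: "'a :: comm_ring_1 mat"
  assumes A: "A \<in> carrier_mat n n" and h: "h < n" and i: "i < n"
  shows "det (mat n n (\<lambda>(l, j). if l = h then (if j = i then 1 else 0) else A $$ (l, j))) = cofactor A h i"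
proof -
  define B where "B = mat n n (\<lambda>(l, j). if l = h then (if j = i then 1 else 0) else A $$ (l, j))"
  have B: "B \<in> carrier_mat n n" by (simp add: B_def)
  have "mat_delete B h i = mat_delete A h i"
    using A h i by (auto simp: mat_delete_def B_def intro!: eq_matI)
  then have "cofactor B h i = cofactor A h i" by (simp add: cofactor_def)
  moreover have "det B = (\<Sum>j<n. B $$ (h, j) * cofactor B h j)"
    by (rule laplace_expansion_row[OF B h])
  moreover have "\<dots> = (\<Sum>j<n. if j = i then cofactor B h i else 0)"
    using h by (intro sum.cong) (auto simp: B_def)
  ultimately show ?thesis using i by (simp add: B_def)
qed

text \<open>Frobenius and Koenig: by the pigeonhole principle no permutation maps R into the
  complement of C, so every Leibniz term has a zero factor.\<close>

lemma det_zero_block: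
  fixes A :: "'a :: comm_ring_1 mat"
  assumes A: "A \<in> carrier_mat n n" and R: "R \<subseteq> {..<n}" and C: "C \<subseteq> {..<n}"
    and zero: "\<And>i j. i \<in> R \<Longrightarrow> j \<in> C \<Longrightarrow> A $$ (i, j) = 0" and card: "card R + card C > n"
  shows "det A = 0"
proof -
  have "(\<Prod>i = 0..<n. A $$ (i, \<pi> i)) = 0" if "\<pi> permutes {0..<n}" for \<pi>
  proof -
    have fin: "finite R" "finite C" using R C finite_subset by blast+
    have "\<pi> ` R \<subseteq> {..<n}" using R permutes_image[OF that] by (auto simp: lessThan_atLeast0)
    have "\<pi> ` R \<inter> C \<noteq> {}"
    proof
      assume "\<pi> ` R \<inter> C = {}"
      then have "card (\<pi> ` R \<union> C) = card R + card C"
        using fin permutes_inj_on[OF that, of R] by (simp add: card_Un_disjoint card_image)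
      moreover have "card (\<pi> ` R \<union> C) \<le> card {..<n}"
        using \<open>\<pi> ` R \<subseteq> {..<n}\<close> C by (intro card_mono) auto
      ultimately show False using card by simp
    qed
    then obtain i where "i \<in> R" "\<pi> i \<in> C" by blast
    then show ?thesis using zero R by (intro prod_zero) (auto simp: lessThan_atLeast0)
  qed
  then show ?thesis unfolding det_def'[OF A] by (intro sum.neutral) auto
qed

section \<open>Maximal minors and the coefficients of the operator\<close>

definition row_minor :: "(nat \<Rightarrow> nat \<Rightarrow> real) \<Rightarrow> nat \<Rightarrow> nat \<Rightarrow> real" where
  "row_minor w m i = (-1) ^ i * det (mat m m (\<lambda>(l, j). w l (if j < i then j else Suc j)))"

text \<open>The homomorphism f covers two uses: constant polynomials for \<open>q_poly\<close>, and
  the identity for real matrices.\<close>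

lemma det_first_row:
  fixes f :: "real \<Rightarrow> 'a :: comm_ring_1"
  assumes "comm_ring_hom f"
  shows "det (mat (Suc m) (Suc m) (\<lambda>(k, i). if k = 0 then a i else f (w (k - 1) i)))
    = (\<Sum>i\<le>m. a i * f (row_minor w m i))"
proof -
  interpret comm_ring_hom f by fact
  define B where "B = mat (Suc m) (Suc m) (\<lambda>(k, i). if k = 0 then a i else f (w (k - 1) i))"
  have B: "B \<in> carrier_mat (Suc m) (Suc m)" by (simp add: B_def)
  have "det B = (\<Sum>i<Suc m. B $$ (0, i) * cofactor B 0 i)"
    by (rule laplace_expansion_row[OF B]) simp
  also have "\<dots> = (\<Sum>i<Suc m. a i * f (row_minor w m i))"
  proof (rule sum.cong)
    fix i assume i: "i \<in> {..<Suc m}"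
    have "mat_delete B 0 i = map_mat f (mat m m (\<lambda>(l, j). w l (if j < i then j else Suc j)))"
      using i by (auto simp: mat_delete_def B_def intro!: eq_matI)
    then have "det (mat_delete B 0 i) = f (det (mat m m (\<lambda>(l, j). w l (if j < i then j else Suc j))))"
      by simp
    then show "B $$ (0, i) * cofactor B 0 i = a i * f (row_minor w m i)"
      using i by (simp add: cofactor_def B_def row_minor_def hom_distribs)
  qed auto
  finally show ?thesis by (simp add: B_def lessThan_Suc_atMost)
qed

text \<open>Putting row h on top of the array repeats a row; the sum is the expansion of that
  determinant along the top row.\<close>

lemma row_minor_orthogonal:
  assumes "h < m"
  shows "(\<Sum>i\<le>m. row_minor w m i * w h i) = 0"
proof -
  define B where "B = mat (Suc m) (Suc m) (\<lambda>(k, i). if k = 0 then w h i else w (k - 1) i)"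
  have "comm_ring_hom (\<lambda>x::real. x)" by unfold_locales auto
  then have "det B = (\<Sum>i\<le>m. w h i * row_minor w m i)"
    using det_first_row[of "\<lambda>x. x" m "w h" w] by (simp add: B_def)
  moreover have "det B = 0"
    by (rule det_row_combination[of _ m "\<lambda>l. if l = h then 1 else 0"])
       (use assms in \<open>auto simp: B_def if_distrib if_distribR sum.delta cong: if_cong\<close>)
  ultimately show ?thesis by (simp add: mult.commute)
qed

context
  fixes m :: nat and \<xi> :: "nat \<Rightarrow> real \<Rightarrow> nat \<Rightarrow> real" and Z :: "nat \<Rightarrow> real \<Rightarrow> real" and S :: "real \<Rightarrow> real"
  assumes \<xi>_add: "\<And>h x i j. \<xi> h x (i + j) = \<xi> h x i * \<xi> h (x - real i) j"
begin

abbreviation (input) "cas x \<equiv> mat m m (\<lambda>(l, i). \<xi> l (x - (real i + 1)) (m - (i + 1)) * Z l (x - (real i + 1)))"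
abbreviation (input) "cas_row x \<equiv> \<lambda>l i. \<xi> l (x - real i) (m - i) * Z l (x - real i)"
abbreviation (input) "mfun h x \<equiv> (\<Sum>i<m. \<xi> h x (m - (i + 1)) * S (x + (real i + 1)) * cofactor (cas (x + (real i + 1))) h i)"

text \<open>The coefficient of the \<open>s\<close>-th term in the expansion of the operator applied to the
  determinantal polynomial telescopes: by Laplace expansion, only those columns survive in which
  the row relation \<open>row_minor_orthogonal\<close> has to be used to flip the range of summation.\<close>

lemma operator_coefficient:
  assumes s: "s \<le> m"
  shows "(\<Sum>h<m. mfun h (x - real s) * (\<Sum>j<s. row_minor (cas_row x) m j * Z h (x - real j) * \<xi> h (x - real j) (s - j)))
    = - row_minor (cas_row x) m s * (\<Sum>i<s. S (x - real s + (real i + 1)) * det (cas (x - real s + (real i + 1))))"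
proof -
  define \<mu> where "\<mu> = row_minor (cas_row x) m"
  define y where "y = (\<lambda>i. x - real s + (real i + 1))"
  define A where "A = (\<lambda>i. cas (y i))"
  have A: "A i \<in> carrier_mat m m" for i by (simp add: A_def)
  define G where "G = (\<lambda>i h. \<Sum>j<s. \<mu> j * (\<xi> h (x - real s) (m - (i + 1)) * \<xi> h (x - real j) (s - j) * Z h (x - real j)))"
  have col: "A i $$ (h, k) = \<xi> h (x - real j) (m - (k + 1)) * Z h (x - real j)"
    if "h < m" "k < m" "i + j = k + s" for i h k j
  proof -
    have "y i - (real k + 1) = x - real j" using that(3) unfolding y_def by linarith
    then show ?thesis using that by (simp add: A_def)
  qed
  \<comment> \<open>The index j meets column k = i + j - s. For i \<ge> s and j < s this is a column
    other than i, and cofactors of column i annihilate it. For i < s the range j < s is first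
    exchanged for s..m, where k is a valid column and equals i only at j = s.\<close>
  have key: "(\<Sum>h<m. cofactor (A i) h i * G i h) = (if i < s then - \<mu> s * det (A i) else 0)" if i: "i < m" for i
  proof (cases "i < s")
    case False
    have "G i h = (\<Sum>j<s. \<mu> j * A i $$ (h, i + j - s))" if h: "h < m" for h
      unfolding G_def
    proof (rule sum.cong)
      fix j assume j: "j \<in> {..<s}"
      have k: "i + j - s < m" "i + j = (i + j - s) + s" using i j False by auto
      have e: "m - (i + j - s + 1) = (s - j) + (m - (i + 1))" using i j False by auto
      have "x - real j - real (s - j) = x - real s" using j by (simp add: of_nat_diff)
      then have "\<xi> h (x - real j) (m - (i + j - s + 1)) = \<xi> h (x - real j) (s - j) * \<xi> h (x - real s) (m - (i + 1))"
        unfolding e \<xi>_add by simp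
      then show "\<mu> j * (\<xi> h (x - real s) (m - (i + 1)) * \<xi> h (x - real j) (s - j) * Z h (x - real j)) = \<mu> j * A i $$ (h, i + j - s)"
        unfolding col[OF h k] by (simp only: mult_ac)
    qed simp
    then have "(\<Sum>h<m. cofactor (A i) h i * G i h) = (\<Sum>h<m. \<Sum>j<s. \<mu> j * (cofactor (A i) h i * A i $$ (h, i + j - s)))"
      by (intro sum.cong refl) (simp add: sum_distrib_left mult.left_commute)
    also have "\<dots> = (\<Sum>j<s. \<mu> j * (\<Sum>h<m. cofactor (A i) h i * A i $$ (h, i + j - s)))"
      by (subst sum.swap) (simp add: sum_distrib_left)
    also have "\<dots> = 0"
    proof (intro sum.neutral ballI)
      fix j assume "j \<in> {..<s}"
      then have "i + j - s < m" "i \<noteq> i + j - s" using i False by auto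
      then show "\<mu> j * (\<Sum>h<m. cofactor (A i) h i * A i $$ (h, i + j - s)) = 0"
        using cofactor_column_orthogonal[OF A i, of "i + j - s" i] by simp
    qed
    finally show ?thesis using False by simp
  next
    case True
    have "G i h = - (\<Sum>j\<in>{s..m}. \<mu> j * A i $$ (h, i + j - s))" if h: "h < m" for h
    proof -
      define X where "X = \<xi> h (x - real m) (s - (i + 1))"
      have mono: "\<xi> h (x - real j) (m - j) * X = \<xi> h (x - real j) (m - j + (s - (i + 1)))" if "j \<le> m" for j
        using \<xi>_add[of h "x - real j" "m - j" "s - (i + 1)"] that by (simp add: X_def of_nat_diff)
      have "G i h = (\<Sum>j<s. X * (\<mu> j * cas_row x h j))"
        unfolding G_def
      proof (rule sum.cong)
        fix j assume j: "j \<in> {..<s}"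
        have "m - j + (s - (i + 1)) = (s - j) + (m - (i + 1))" using i j True s by auto
        then have "\<xi> h (x - real j) (m - j) * X = \<xi> h (x - real j) (s - j) * \<xi> h (x - real s) (m - (i + 1))"
          using mono[of j] \<xi>_add[of h "x - real j" "s - j" "m - (i + 1)"] j s by (simp add: of_nat_diff)
        then show "\<mu> j * (\<xi> h (x - real s) (m - (i + 1)) * \<xi> h (x - real j) (s - j) * Z h (x - real j)) = X * (\<mu> j * cas_row x h j)"
          by (simp add: mult_ac)
      qed simp
      also have "\<dots> = X * (\<Sum>j<s. \<mu> j * cas_row x h j)" by (simp add: sum_distrib_left)
      also have "(\<Sum>j<s. \<mu> j * cas_row x h j) = - (\<Sum>j\<in>{s..m}. \<mu> j * cas_row x h j)"
      proof -
        have "{..m} = {..<s} \<union> {s..m}" using s by auto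
        then have "(\<Sum>j\<le>m. \<mu> j * cas_row x h j) = (\<Sum>j<s. \<mu> j * cas_row x h j) + (\<Sum>j\<in>{s..m}. \<mu> j * cas_row x h j)"
          by (simp add: sum.union_disjoint ivl_disj_int)
        then show ?thesis using row_minor_orthogonal[OF h, of "cas_row x"] by (simp add: \<mu>_def)
      qed
      also have "X * - (\<Sum>j\<in>{s..m}. \<mu> j * cas_row x h j) = - (\<Sum>j\<in>{s..m}. \<mu> j * A i $$ (h, i + j - s))"
        unfolding mult_minus_right sum_distrib_left
      proof (intro arg_cong[where f = uminus] sum.cong refl)
        fix j assume j: "j \<in> {s..m}"
        then have k: "i + j - s < m" "i + j = i + j - s + s" using True by auto
        have "m - (i + j - s + 1) = m - j + (s - (i + 1))" using j True by auto
        then show "X * (\<mu> j * cas_row x h j) = \<mu> j * A i $$ (h, i + j - s)"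
          unfolding col[OF h k] using mono[of j] j by (simp add: mult_ac)
      qed
      finally show ?thesis .
    qed
    then have "(\<Sum>h<m. cofactor (A i) h i * G i h) = - (\<Sum>h<m. \<Sum>j\<in>{s..m}. \<mu> j * (cofactor (A i) h i * A i $$ (h, i + j - s)))"
      unfolding sum_negf[symmetric] by (intro sum.cong refl) (simp add: sum_distrib_left mult.left_commute)
    also have "\<dots> = - (\<Sum>j\<in>{s..m}. \<mu> j * (\<Sum>h<m. cofactor (A i) h i * A i $$ (h, i + j - s)))"
      by (subst sum.swap) (simp add: sum_distrib_left)
    also have "\<dots> = - (\<Sum>j\<in>{s..m}. if j = s then \<mu> s * det (A i) else 0)"
    proof (intro arg_cong[where f = uminus] sum.cong refl)
      fix j assume j: "j \<in> {s..m}"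
      then have k: "i + j - s < m" "(i = i + j - s) = (j = s)" using True by auto
      show "\<mu> j * (\<Sum>h<m. cofactor (A i) h i * A i $$ (h, i + j - s)) = (if j = s then \<mu> s * det (A i) else 0)"
        using cofactor_column_orthogonal[OF A i k(1), of i] k(2) by simp
    qed
    finally show ?thesis using True s by simp
  qed
  have "(\<Sum>h<m. mfun h (x - real s) * (\<Sum>j<s. \<mu> j * Z h (x - real j) * \<xi> h (x - real j) (s - j)))
      = (\<Sum>h<m. \<Sum>i<m. S (y i) * (cofactor (A i) h i * G i h))"
  proof (rule sum.cong[OF refl])
    fix h
    define B where "B = (\<Sum>j<s. \<mu> j * Z h (x - real j) * \<xi> h (x - real j) (s - j))"
    have G: "G i h = \<xi> h (x - real s) (m - (i + 1)) * B" for i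
      unfolding G_def B_def sum_distrib_left by (intro sum.cong) (auto simp: mult_ac)
    have "mfun h (x - real s) * B = (\<Sum>i<m. S (y i) * (cofactor (A i) h i * G i h))"
      unfolding sum_distrib_right G y_def A_def by (intro sum.cong refl) (simp only: mult_ac)
    then show "mfun h (x - real s) * (\<Sum>j<s. \<mu> j * Z h (x - real j) * \<xi> h (x - real j) (s - j))
        = (\<Sum>i<m. S (y i) * (cofactor (A i) h i * G i h))" by (simp add: B_def)
  qed
  also have "\<dots> = (\<Sum>i<m. S (y i) * (\<Sum>h<m. cofactor (A i) h i * G i h))"
    by (subst sum.swap) (simp add: sum_distrib_left)
  also have "\<dots> = (\<Sum>i<m. if i < s then - \<mu> s * (S (y i) * det (A i)) else 0)"
    by (intro sum.cong refl) (simp add: key)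
  also have "\<dots> = (\<Sum>i<s. - \<mu> s * (S (y i) * det (A i)))"
    using s by (intro sum.mono_neutral_cong_right) auto
  finally show ?thesis by (simp add: \<mu>_def y_def A_def sum_distrib_left)
qed

text \<open>Once s reaches m, \<open>\<xi> h (x - j) (s - j)\<close> splits off a factor independent
  of j, and the relation between the row and its minors is left.\<close>

lemma operator_coefficient_vanishes:
  assumes "m \<le> s" "h < m"
  shows "(\<Sum>j\<le>m. row_minor (cas_row x) m j * Z h (x - real j) * \<xi> h (x - real j) (s - j)) = 0"
proof -
  have "(\<Sum>j\<le>m. row_minor (cas_row x) m j * Z h (x - real j) * \<xi> h (x - real j) (s - j))
      = (\<Sum>j\<le>m. \<xi> h (x - real m) (s - m) * (row_minor (cas_row x) m j * cas_row x h j))"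
  proof (rule sum.cong)
    fix j assume "j \<in> {..m}"
    then have "\<xi> h (x - real j) (s - j) = \<xi> h (x - real j) (m - j) * \<xi> h (x - real m) (s - m)"
      using \<xi>_add[of h "x - real j" "m - j" "s - m"] assms(1) by (simp add: of_nat_diff)
    then show "row_minor (cas_row x) m j * Z h (x - real j) * \<xi> h (x - real j) (s - j)
      = \<xi> h (x - real m) (s - m) * (row_minor (cas_row x) m j * cas_row x h j)"
      by (simp add: mult_ac)
  qed simp
  also have "\<dots> = 0"
    unfolding sum_distrib_left[symmetric] using row_minor_orthogonal[OF assms(2), of "cas_row x"] by simp
  finally show ?thesis .
qed

end

section \<open>Continuity, and equality up to finitely many points\<close>

lemma permutes_less: "p permutes {0..<n::nat} \<Longrightarrow> i < n \<Longrightarrow> p i < n"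
  using permutes_in_image[of p "{0..<n}" i] by simp

lemma isCont_det:
  fixes A :: "real \<Rightarrow> nat \<Rightarrow> nat \<Rightarrow> real"
  assumes "\<And>i j. i < m \<Longrightarrow> j < m \<Longrightarrow> isCont (\<lambda>x. A x i j) a"
  shows "isCont (\<lambda>x. det (mat m m (\<lambda>(i, j). A x i j))) a"
proof -
  have "det (mat m m (\<lambda>(i, j). A x i j)) = (\<Sum>p | p permutes {0..<m}. signof p * (\<Prod>i = 0..<m. A x i (p i)))" for x
    by (subst det_def'[of _ m]) (auto intro!: sum.cong prod.cong simp: permutes_less)
  then show ?thesis
    by (simp only:) (intro continuous_intros assms, auto simp: permutes_less)
qed

text \<open>The transfer principle: an identity known outside a finite set holds at every point
  where both sides are continuous.\<close>

lemma isCont_eq_0: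
  fixes F :: "real \<Rightarrow> real"
  assumes "isCont F a" "\<forall>\<^sub>F x in cofinite. F x = 0"
  shows "F a = 0"
proof -
  have "\<forall>\<^sub>F x in at a. F x = 0"
    unfolding eventually_at_topological
  proof (intro exI conjI ballI impI)
    let ?S = "- ({x. F x \<noteq> 0} - {a})"
    show "open ?S" using assms(2) by (intro open_Compl finite_imp_closed) (simp add: eventually_cofinite)
  qed auto
  then have "(F \<longlongrightarrow> 0) (at a)" by (simp add: tendsto_eventually)
  with assms(1) show ?thesis
    unfolding isCont_def by (rule LIM_unique)
qed

definition ceq :: "(real \<Rightarrow> real) \<Rightarrow> (real \<Rightarrow> real) \<Rightarrow> bool" where
  "ceq f g \<longleftrightarrow> (\<forall>\<^sub>F x in cofinite. f x = g x)"

lemma ceq_shift: "ceq f g \<Longrightarrow> \<forall>\<^sub>F x in cofinite. f (x + h) = g (x + h)"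
  unfolding ceq_def by (rule eventually_cofinite_shift)

lemma ceq_refl: "ceq f f"
  by (simp add: ceq_def)

lemma ceq_trans: "ceq f g \<Longrightarrow> ceq g h \<Longrightarrow> ceq f h"
  unfolding ceq_def by (erule (1) eventually_elim2) simp

lemma Gamma_op_ceq: assumes "ceq f g" shows "ceq (Gamma_op \<alpha> \<beta> N f) (Gamma_op \<alpha> \<beta> N g)"
  using assms[unfolded ceq_def] ceq_shift[OF assms, of 1] ceq_shift[OF assms, of "-1"]
  unfolding ceq_def Gamma_op_def by eventually_elim simp

lemma D_op_ceq: assumes "ceq f g" shows "ceq (D_op \<alpha> \<beta> N fam f) (D_op \<alpha> \<beta> N fam g)"
  using assms[unfolded ceq_def] ceq_shift[OF assms, of 1] ceq_shift[OF assms, of "-1"]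
  unfolding ceq_def D_op_eq by eventually_elim simp

lemma eventually_cofinite_ball:
  "finite A \<Longrightarrow> (\<And>i. i \<in> A \<Longrightarrow> \<forall>\<^sub>F x in cofinite. Q i x) \<Longrightarrow> \<forall>\<^sub>F x in cofinite. \<forall>i\<in>A. Q i x"
  by (simp add: eventually_ball_finite)

text \<open>The eigenvalue equations of \<Gamma> fail at finitely many points, and each application
  of \<Gamma> adds the translates of the exceptional set by 1 and -1. A polynomial in \<Gamma>
  applies it finitely often, so the exceptional set stays finite.\<close>

lemma poly_at_operator_eigen:
  assumes f: "ceq f (\<lambda>x. \<Sum>i\<in>I. c i * \<phi> i x)" and I: "finite I"
    and eig: "\<And>i. i \<in> I \<Longrightarrow> ceq (Gamma_op \<alpha> \<beta> N (\<phi> i)) (\<lambda>x. ev i * \<phi> i x)"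
  shows "ceq (poly_at_operator p (Gamma_op \<alpha> \<beta> N) f) (\<lambda>x. \<Sum>i\<in>I. c i * poly p (ev i) * \<phi> i x)"
proof -
  have pow: "ceq ((Gamma_op \<alpha> \<beta> N ^^ k) f) (\<lambda>x. \<Sum>i\<in>I. c i * ev i ^ k * \<phi> i x)" for k
  proof (induction k)
    case 0
    then show ?case using f by simp
  next
    case (Suc k)
    have "ceq (Gamma_op \<alpha> \<beta> N ((Gamma_op \<alpha> \<beta> N ^^ k) f)) (Gamma_op \<alpha> \<beta> N (\<lambda>x. \<Sum>i\<in>I. c i * ev i ^ k * \<phi> i x))"
      by (rule Gamma_op_ceq) (rule Suc)
    moreover have "ceq (Gamma_op \<alpha> \<beta> N (\<lambda>x. \<Sum>i\<in>I. c i * ev i ^ k * \<phi> i x)) (\<lambda>x. \<Sum>i\<in>I. c i * ev i ^ Suc k * \<phi> i x)"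
    proof -
      have "\<forall>\<^sub>F x in cofinite. \<forall>i\<in>I. Gamma_op \<alpha> \<beta> N (\<phi> i) x = ev i * \<phi> i x"
        by (rule eventually_cofinite_ball[OF I]) (use eig in \<open>auto simp: ceq_def\<close>)
      then show ?thesis
        unfolding ceq_def Gamma_op_sum by eventually_elim (simp add: mult_ac)
    qed
    ultimately show ?case by (simp add: ceq_trans)
  qed
  have "\<forall>\<^sub>F x in cofinite. \<forall>k\<in>{..degree p}. (Gamma_op \<alpha> \<beta> N ^^ k) f x = (\<Sum>i\<in>I. c i * ev i ^ k * \<phi> i x)"
    by (rule eventually_cofinite_ball) (use pow in \<open>auto simp: ceq_def\<close>)
  then show ?thesis
    unfolding ceq_def poly_at_operator_def
  proof eventually_elim
    case (elim x)
    have "(\<Sum>k\<le>degree p. coeff p k * (Gamma_op \<alpha> \<beta> N ^^ k) f x)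
        = (\<Sum>k\<le>degree p. \<Sum>i\<in>I. coeff p k * (c i * ev i ^ k * \<phi> i x))"
      using elim by (simp add: sum_distrib_left)
    also have "\<dots> = (\<Sum>i\<in>I. \<Sum>k\<le>degree p. c i * (coeff p k * ev i ^ k) * \<phi> i x)"
      by (subst sum.swap) (simp add: mult_ac)
    also have "\<dots> = (\<Sum>i\<in>I. c i * poly p (ev i) * \<phi> i x)"
      by (simp add: poly_altdef sum_distrib_left sum_distrib_right)
    finally show ?case .
  qed
qed

lemma xi_add: "xi \<alpha> \<beta> N U1 U2 U3 h x (i + j) = xi \<alpha> \<beta> N U1 U2 U3 h x i * xi \<alpha> \<beta> N U1 U2 U3 h (x - real i) j"
proof -
  have "(\<Prod>k<i + j. g k) = (\<Prod>k<i. g k) * (\<Prod>k<j. g (i + k))" for g :: "nat \<Rightarrow> real"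
    by (induction j) (auto simp: mult.assoc)
  then show ?thesis by (simp add: xi_def algebra_simps)
qed

lemma isCont_eps: "a + n \<noteq> 0 \<or> fam = First \<Longrightarrow> isCont (eps a b c fam) n"
proof (cases fam)
  case First
  then have "eps a b c fam = (\<lambda>_. -1)" by (simp add: fun_eq_iff)
  then show ?thesis by simp
next
  case Second
  then have "eps a b c fam = (\<lambda>n. (b + c - n + 1) / (a + n))" by (simp add: fun_eq_iff)
  then show "a + n \<noteq> 0 \<or> fam = First \<Longrightarrow> ?thesis" using Second by (auto intro!: continuous_intros)
next
  case Third
  then have "eps a b c fam = (\<lambda>n. (c - n + 1) / (a + n))" by (simp add: fun_eq_iff)
  then show "a + n \<noteq> 0 \<or> fam = First \<Longrightarrow> ?thesis" using Third by (auto intro!: continuous_intros)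
qed

lemma isCont_xi:
  assumes "\<And>i. i < k \<Longrightarrow> a + (y - real i) \<noteq> 0 \<or> fst (row_labels U1 U2 U3 ! h) = First"
  shows "isCont (\<lambda>x. xi a b c U1 U2 U3 h (x - t) k) (y + t)"
proof -
  have "isCont (\<lambda>x. eps a b c (fst (row_labels U1 U2 U3 ! h)) (x - t - real i)) (y + t)" if "i < k" for i
    by (rule isCont_o2[where f = "\<lambda>x. x - t - real i"])
       (use assms[OF that] in \<open>auto intro!: continuous_intros isCont_eps\<close>)
  then show ?thesis unfolding xi_def by (intro continuous_intros) auto
qed

section \<open>Rows, gauge factors and degrees of determinants\<close>

lemma comm_ring_hom_const: "comm_ring_hom (\<lambda>c :: real. [:c:])"
  by unfold_locales (auto simp: one_pCons)

lemma length_row_labels: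
  assumes "finite U1" "finite U2" "finite U3"
  shows "length (row_labels U1 U2 U3) = num_rows U1 U2 U3"
  using assms by (simp add: row_labels_def num_rows_def)

lemma card_family_rows:
  assumes "finite U1" "finite U2" "finite U3"
  shows "card {l. l < num_rows U1 U2 U3 \<and> fst (row_labels U1 U2 U3 ! l) = fam}
    = (case fam of First \<Rightarrow> card U1 | Second \<Rightarrow> card U2 | Third \<Rightarrow> card U3)"
proof -
  have "card {l. l < num_rows U1 U2 U3 \<and> fst (row_labels U1 U2 U3 ! l) = fam}
      = length (filter (\<lambda>p. fst p = fam) (row_labels U1 U2 U3))"
    using length_row_labels[OF assms] by (simp add: length_filter_conv_card)
  also have "\<dots> = (case fam of First \<Rightarrow> card U1 | Second \<Rightarrow> card U2 | Third \<Rightarrow> card U3)"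
    using assms by (cases fam) (simp_all add: row_labels_def filter_map comp_def)
  finally show ?thesis .
qed

lemma xi_prod: "i < m \<Longrightarrow> xi a b c U1 U2 U3 l (x - (real i + 1)) (m - (i + 1))
    = (\<Prod>t\<in>{Suc i..<m}. eps a b c (fst (row_labels U1 U2 U3 ! l)) (x - real t))"
  unfolding xi_def
  by (rule prod.reindex_bij_witness[of _ "\<lambda>t. t - Suc i" "\<lambda>k. Suc i + k"]) (auto simp: algebra_simps of_nat_diff)

fun gauge_num :: "real \<Rightarrow> real \<Rightarrow> family \<Rightarrow> real" where
  "gauge_num b c First = 0"
| "gauge_num b c Second = b + c"
| "gauge_num b c Third = c"

lemma eps_not_First: "fam \<noteq> First \<Longrightarrow> eps a b c fam n = (gauge_num b c fam - n + 1) / (a + n)"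
  by (cases fam) auto

lemma polyfun_power_quotient:
  assumes "finite T" "\<And>t. t \<in> T \<Longrightarrow> polyfun (g t)" "\<And>t. t \<in> T \<Longrightarrow> \<forall>\<^sub>F x in cofinite. g t x \<noteq> 0"
    "\<And>t. t \<in> T \<Longrightarrow> e t \<le> n t"
  shows "polyfun (\<lambda>x. (\<Prod>t\<in>T. g t x ^ n t) / (\<Prod>t\<in>T. g t x ^ e t))"
proof (rule polyfun_cong)
  show "polyfun (\<lambda>x. \<Prod>t\<in>T. g t x ^ (n t - e t))"
    using assms by (intro polyfun_prod polyfun_power) auto
  have "\<forall>\<^sub>F x in cofinite. \<forall>t\<in>T. g t x \<noteq> 0"
    using assms by (intro eventually_cofinite_ball) auto
  then show "\<forall>\<^sub>F x in cofinite. (\<Prod>t\<in>T. g t x ^ n t) / (\<Prod>t\<in>T. g t x ^ e t) = (\<Prod>t\<in>T. g t x ^ (n t - e t))"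
    by eventually_elim (use assms(4) in \<open>simp add: power_diff flip: prod_dividef\<close>)
qed

lemma polyfun_poly_minus: "polyfun (\<lambda>x. poly p (x - h))"
  using polyfun_shift[OF polyfun_poly[of p], of "- h"] by simp

lemma prod_power_card:
  fixes g :: "nat \<Rightarrow> 'b :: comm_monoid_mult"
  assumes "finite L" "finite T"
  shows "(\<Prod>l\<in>L. \<Prod>t\<in>{t\<in>T. Q l t}. g t) = (\<Prod>t\<in>T. g t ^ card {l\<in>L. Q l t})"
proof -
  have "(\<Prod>l\<in>L. \<Prod>t\<in>{t\<in>T. Q l t}. g t) = (\<Prod>l\<in>L. \<Prod>t\<in>T. if Q l t then g t else 1)"
    by (simp add: prod.inter_filter[OF assms(2)])
  also have "\<dots> = (\<Prod>t\<in>T. \<Prod>l\<in>L. if Q l t then g t else 1)" by (rule prod.swap)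
  also have "\<dots> = (\<Prod>t\<in>T. g t ^ card {l\<in>L. Q l t})"
    by (simp add: prod.inter_filter[OF assms(1), symmetric])
  finally show ?thesis .
qed

lemma asy_sum_ex:
  assumes "finite A" "\<And>i. i \<in> A \<Longrightarrow> \<exists>c. asy (f i) d c"
  shows "\<exists>c. asy (\<lambda>x. \<Sum>i\<in>A. f i x) d c"
  using assms
proof (induction A rule: finite_induct)
  case empty
  then show ?case using asy_zero by auto
next
  case (insert i A)
  then obtain c c' where "asy (f i) d c" "asy (\<lambda>x. \<Sum>i\<in>A. f i x) d c'" by blast
  then show ?case using asy_add[of "f i" d c] insert.hyps by auto
qed

text \<open>When the order of an entry is a row weight minus a column weight, all Leibniz terms have
  the same total order, and their leading coefficients add up to a determinant.\<close>

lemma asy_det: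
  assumes "\<And>l k. l < m \<Longrightarrow> k < m \<Longrightarrow> asy (\<lambda>x. A x l k) (\<alpha> l - \<beta> k) (c l k)"
  shows "asy (\<lambda>x. det (mat m m (\<lambda>(l, k). A x l k))) ((\<Sum>l<m. \<alpha> l) - (\<Sum>k<m. \<beta> k)) (det (mat m m (\<lambda>(l, k). c l k)))"
proof -
  have det: "det (mat m m (\<lambda>(i, j). B i j)) = (\<Sum>p | p permutes {0..<m}. signof p * (\<Prod>i<m. B i (p i)))"
    for B :: "nat \<Rightarrow> nat \<Rightarrow> real"
    by (subst det_def'[of _ m]) (auto intro!: sum.cong prod.cong simp: permutes_less lessThan_atLeast0)
  have "asy (\<lambda>x. \<Prod>i<m. A x i (p i)) ((\<Sum>l<m. \<alpha> l) - (\<Sum>k<m. \<beta> k)) (\<Prod>i<m. c i (p i))"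
    if p: "p permutes {0..<m}" for p
  proof -
    have "asy (\<lambda>x. \<Prod>i<m. A x i (p i)) (\<Sum>i<m. \<alpha> i - \<beta> (p i)) (\<Prod>i<m. c i (p i))"
      by (intro asy_prod assms) (auto simp: permutes_less[OF p])
    moreover have "(\<Sum>i<m. \<beta> (p i)) = (\<Sum>k<m. \<beta> k)"
      using sum.permute[OF p, of \<beta>] by (simp add: lessThan_atLeast0 comp_def)
    ultimately show ?thesis by (simp add: sum_subtractf)
  qed
  then show ?thesis
    unfolding det by (intro asy_sum asy_cmult) (auto simp: finite_permutations)
qed

lemma asy_poly_degree:
  assumes "asy (poly P) d c" "c \<noteq> 0"
  shows "d = int (degree P)" "lead_coeff P = c"
proof -
  from assms obtain p q e where 1: "lead_coeff q = 1" "int e = d + int (degree q)" "degree p \<le> e"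
    "coeff p e = c" and ev: "\<forall>\<^sub>F x in cofinite. poly P x * poly q x = poly p x"
    by (elim asyE)
  from ev have "\<forall>\<^sub>F x in cofinite. poly (P * q) x = poly p x" by simp
  then have p: "p = P * q" by (metis poly_eq_cofinite)
  have "q \<noteq> 0" using 1 by auto
  have e: "degree p = e" using 1 assms(2) by (metis le_antisym le_degree)
  then have "P \<noteq> 0" using p 1 assms(2) by auto
  then have "e = degree P + degree q" using e p \<open>q \<noteq> 0\<close> by (simp add: degree_mult_eq)
  then show "d = int (degree P)" using 1 by simp
  show "lead_coeff P = c" using 1 e p by (metis lead_coeff_mult mult.right_neutral)
qed

lemma pochhammer_poly_lead:
  "degree (pochhammer [:0, 1 :: real:] n) = n" "coeff (pochhammer [:0, 1 :: real:] n) n = 1"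
proof -
  have "degree (pochhammer [:0, 1 :: real:] n) = n \<and> lead_coeff (pochhammer [:0, 1 :: real:] n) = 1"
  proof (induction n)
    case (Suc n)
    have "pochhammer [:0, 1 :: real:] (Suc n) = pochhammer [:0, 1:] n * [:real n, 1:]"
      by (simp add: pochhammer_Suc of_nat_poly)
    moreover from Suc have "pochhammer [:0, 1 :: real:] n \<noteq> 0" by auto
    then have "degree (pochhammer [:0, 1 :: real:] n * [:real n, 1:]) = Suc n"
      using Suc by (subst degree_mult_eq) auto
    moreover have "lead_coeff (pochhammer [:0, 1 :: real:] n * [:real n, 1:]) = 1"
      using Suc by (subst lead_coeff_mult) auto
    ultimately show ?case by (simp only:)
  qed simp
  then show "degree (pochhammer [:0, 1 :: real:] n) = n" "coeff (pochhammer [:0, 1 :: real:] n) n = 1" by auto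
qed

lemma poly_pochhammer: "poly (pochhammer [:0, 1 :: real:] n) z = pochhammer z n"
  by (induction n) (auto simp: pochhammer_Suc of_nat_poly algebra_simps)

text \<open>A Vandermonde determinant in the basis of rising factorials: a kernel vector would be a
  polynomial of degree less than m with m distinct zeros.\<close>

lemma det_pochhammer_nz:
  fixes z k :: "nat \<Rightarrow> real"
  assumes inj: "inj_on z {..<m}" and k: "\<And>l. l < m \<Longrightarrow> k l \<noteq> 0"
  shows "det (mat m m (\<lambda>(l, j). k l * pochhammer (z l) (m - 1 - j))) \<noteq> 0"
proof
  define A where "A = mat m m (\<lambda>(l, j). k l * pochhammer (z l) (m - 1 - j))"
  have A: "A \<in> carrier_mat m m" by (simp add: A_def)
  assume "det (mat m m (\<lambda>(l, j). k l * pochhammer (z l) (m - 1 - j))) = 0"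
  then obtain v where v: "v \<in> carrier_vec m" "v \<noteq> 0\<^sub>v m" "A *\<^sub>v v = 0\<^sub>v m"
    using det_0_iff_vec_prod_zero[OF A] by (auto simp: A_def)
  define p where "p = (\<Sum>j<m. smult (v $ j) (pochhammer [:0, 1:] (m - 1 - j)))"
  have "poly p (z l) = 0" if "l < m" for l
  proof -
    have "(A *\<^sub>v v) $ l = (\<Sum>j<m. k l * pochhammer (z l) (m - 1 - j) * v $ j)"
      using that v(1) by (simp add: A_def scalar_prod_def lessThan_atLeast0)
    also have "\<dots> = k l * poly p (z l)"
      by (simp add: p_def poly_sum poly_pochhammer sum_distrib_left mult_ac)
    finally show ?thesis using v(3) k[OF that] that by simp
  qed
  then have roots: "z ` {..<m} \<subseteq> {x. poly p x = 0}" by auto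
  have "p = 0"
  proof (rule ccontr)
    assume "p \<noteq> 0"
    have "card (z ` {..<m}) \<le> card {x. poly p x = 0}"
      using roots \<open>p \<noteq> 0\<close> by (intro card_mono poly_roots_finite)
    also have "\<dots> \<le> degree p" using \<open>p \<noteq> 0\<close> by (rule card_poly_roots_bound)
    finally have "m \<le> degree p" using inj by (simp add: card_image)
    moreover have "degree p \<le> m - 1"
      unfolding p_def by (intro degree_sum_le order.trans[OF degree_smult_le]) (auto simp: pochhammer_poly_lead)
    ultimately have "m = 0" by linarith
    then show False using \<open>p \<noteq> 0\<close> by (simp add: p_def)
  qed
  obtain j where j: "j < m" "v $ j \<noteq> 0"
    using v(1,2) by (metis carrier_vecD eq_vecI index_zero_vec(1,2))
  \<comment> \<open>Degrees decrease with j, so the least index with a nonzero entry carries the top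
    coefficient, to which nothing else contributes.\<close>
  define j0 where "j0 = (LEAST j. j < m \<and> v $ j \<noteq> 0)"
  have j0: "j0 < m" "v $ j0 \<noteq> 0" using LeastI[of "\<lambda>j. j < m \<and> v $ j \<noteq> 0" j] j by (auto simp: j0_def)
  have less: "v $ i = 0" if "i < j0" for i
    using not_less_Least[of i "\<lambda>j. j < m \<and> v $ j \<noteq> 0"] that j0(1) by (auto simp: j0_def)
  have "coeff p (m - 1 - j0) = (\<Sum>j<m. v $ j * coeff (pochhammer [:0, 1:] (m - 1 - j)) (m - 1 - j0))"
    by (simp add: p_def coeff_sum)
  also have "\<dots> = (\<Sum>j<m. if j = j0 then v $ j0 else 0)"
  proof (intro sum.cong refl)
    fix j assume j: "j \<in> {..<m}"
    consider "j < j0" | "j = j0" | "j > j0" by linarith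
    then show "v $ j * coeff (pochhammer [:0, 1:] (m - 1 - j)) (m - 1 - j0) = (if j = j0 then v $ j0 else 0)"
    proof cases
      case 3
      then have "m - 1 - j < m - 1 - j0" using j by auto
      then show ?thesis using 3 by (simp add: coeff_eq_0 pochhammer_poly_lead)
    qed (auto simp: less pochhammer_poly_lead)
  qed
  finally have "coeff p (m - 1 - j0) = v $ j0" using j0 by simp
  then show False using \<open>p = 0\<close> j0 by simp
qed

lemma pascal_sum:
  fixes g :: "nat \<Rightarrow> real"
  shows "(\<Sum>i\<le>Suc k. real (Suc k choose i) * g i) = (\<Sum>i\<le>k. real (k choose i) * (g i + g (Suc i)))"
proof -
  have "(\<Sum>i\<le>Suc k. real (Suc k choose i) * g i) = g 0 + (\<Sum>i\<le>k. real (k choose Suc i) * g (Suc i)) + (\<Sum>i\<le>k. real (k choose i) * g (Suc i))"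
    by (simp add: sum.atMost_Suc_shift distrib_right sum.distrib del: sum.atMost_Suc)
  also have "g 0 + (\<Sum>i\<le>k. real (k choose Suc i) * g (Suc i)) = (\<Sum>i\<le>Suc k. real (k choose i) * g i)"
    by (simp add: sum.atMost_Suc_shift del: sum.atMost_Suc)
  also have "\<dots> = (\<Sum>i\<le>k. real (k choose i) * g i)" by simp
  finally show ?thesis by (simp add: distrib_left sum.distrib)
qed

lemma two_choose_two: "2 * int (n choose 2) = int n * (int n - 1)"
  by (induction n) (auto simp: numeral_2_eq_2 algebra_simps)

lemma sum_nat_minus_choose:
  assumes "k \<le> m"
  shows "(\<Sum>t<m. k - (m - t)) = k choose 2" "(\<Sum>t\<in>{1..<m}. k - t) = k choose 2"
proof -
  have g: "(\<Sum>i<k. i) = k choose 2" by (induction k) (auto simp: numeral_2_eq_2)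
  have "(\<Sum>t<m. k - (m - t)) = (\<Sum>t\<in>{m - k..<m}. k - (m - t))"
    by (rule sum.mono_neutral_right) auto
  also have "\<dots> = (\<Sum>i<k. i)"
    by (rule sum.reindex_bij_witness[of _ "\<lambda>i. i + (m - k)" "\<lambda>t. t - (m - k)"]) (use assms in auto)
  finally show "(\<Sum>t<m. k - (m - t)) = k choose 2" using g by simp
  have "(\<Sum>t\<in>{1..<m}. k - t) = (\<Sum>t\<in>{1..<k}. k - t)"
    by (rule sum.mono_neutral_right) (use assms in auto)
  also have "\<dots> = (\<Sum>i\<in>{1..<k}. i)"
    by (rule sum.reindex_bij_witness[of _ "\<lambda>i. k - i" "\<lambda>t. k - t"]) auto
  also have "\<dots> = (\<Sum>i<k. i)" by (rule sum.mono_neutral_left) auto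
  finally show "(\<Sum>t\<in>{1..<m}. k - t) = k choose 2" using g by simp
qed

text \<open>The first correction of the ratio: \<open>eps = - 1 + kap / (a + n)\<close>. With u the
  index of a row, the number attached to the row is \<open>kap - u\<close>.\<close>

fun kap :: "real \<Rightarrow> real \<Rightarrow> real \<Rightarrow> family \<Rightarrow> real" where
  "kap a b c First = 0"
| "kap a b c Second = a + b + c + 1"
| "kap a b c Third = a + c + 1"

lemma eps_kap: "a + n \<noteq> 0 \<Longrightarrow> eps a b c fam n = - 1 + kap a b c fam / (a + n)"
  by (cases fam) (auto simp: divide_simps)

text \<open>The constant -1 produces a negated difference, contributing \<open>- d * k\<close>, and
  the correction of order 1/n contributes \<open>kap * k\<close>.\<close>

lemma asy_eps_step:
  assumes "asy f d k"
  shows "asy (\<lambda>y. f y + eps a b c fam (y + 1) * f (y + 1)) (d - 1) ((kap a b c fam - of_int d) * k)"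
proof (rule asy_cong)
  have 1: "asy (\<lambda>y. - (f (y + 1) - f y)) (d - 1) (- (of_int d * 1 * k))"
    by (intro asy_minus asy_shift_diff assms)
  have 2: "asy (\<lambda>y. kap a b c fam * (1 / (a + 1 + 1 * y)) * f (y + 1)) (- 1 + d) (kap a b c fam * (1 / 1) * k)"
    by (intro asy_mult[OF asy_cmult] asy_inverse_linear asy_shift assms) auto
  have "(kap a b c fam - of_int d) * k = - (of_int d * 1 * k) + kap a b c fam * (1 / 1) * k"
    by (simp add: algebra_simps)
  then show "asy (\<lambda>y. - (f (y + 1) - f y) + kap a b c fam * (1 / (a + 1 + 1 * y)) * f (y + 1)) (d - 1) ((kap a b c fam - of_int d) * k)"
    using asy_add[OF 1] 2 by simp
  have "\<forall>\<^sub>F y in cofinite. a + 1 + 1 * y \<noteq> 0" by (intro eventually_cofinite_linear_neq) simp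
  then show "\<forall>\<^sub>F y in cofinite. - (f (y + 1) - f y) + kap a b c fam * (1 / (a + 1 + 1 * y)) * f (y + 1)
      = f y + eps a b c fam (y + 1) * f (y + 1)"
  proof eventually_elim
    case (elim y)
    then show ?case by (simp add: eps_kap add_ac algebra_simps)
  qed
qed

section \<open>The determinantal polynomials and their operator\<close>

context
  fixes a b c :: real and U1 U2 U3 :: "nat set"
begin

private abbreviation (input) "m \<equiv> num_rows U1 U2 U3"
private abbreviation (input) "xih \<equiv> xi a b c U1 U2 U3"
private abbreviation (input) "Yh \<equiv> Y a b c U1 U2 U3"
private abbreviation (input) "fam h \<equiv> fst (row_labels U1 U2 U3 ! h)"
private abbreviation (input) "idx h \<equiv> snd (row_labels U1 U2 U3 ! h)"
private abbreviation (input) "Cas \<equiv> Casorati a b c U1 U2 U3"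
private abbreviation (input) "SS \<equiv> S_fun a b c U1 U2 U3"

text \<open>The rows of the matrix of \<open>q_poly\<close> below the first one. Their columns 1,
  ..., m form the Casorati matrix at the same point, whence \<open>row_minor_0\<close>.\<close>

definition q_row :: "real \<Rightarrow> nat \<Rightarrow> nat \<Rightarrow> real" where
  "q_row x l i = xih l (x - real i) (m - i) * poly (Yh l) (x - real i)"

lemma Casorati_eq: "Casorati a b c U1 U2 U3 x = mat m m (\<lambda>(l, i). xih l (x - (real i + 1)) (m - (i + 1)) * poly (Yh l) (x - (real i + 1)))"
  unfolding Casorati_def by (intro cong_mat) (auto simp: Let_def add.commute)

lemma M_fun_eq: "M_fun a b c U1 U2 U3 h x = (\<Sum>i<m. xih h x (m - (i + 1)) * S_fun a b c U1 U2 U3 (x + (real i + 1)) *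
    cofactor (Casorati a b c U1 U2 U3 (x + (real i + 1))) h i)"
  unfolding M_fun_def by (intro sum.cong refl) (simp add: Let_def cofactor_def add.commute mult_ac)

lemma q_poly_eq: "q_poly a b c U1 U2 U3 n
    = (\<Sum>i\<le>m. if i \<le> n then smult ((-1) ^ i * row_minor (q_row (real n)) m i) (dual_hahn a b c (n - i)) else 0)"
proof -
  have "q_poly a b c U1 U2 U3 n = (\<Sum>i\<le>m. (if i \<le> n then (-1) ^ i * dual_hahn a b c (n - i) else 0) * [:row_minor (q_row (real n)) m i:])"
    unfolding q_poly_def det_first_row[OF comm_ring_hom_const, symmetric] q_row_def by simp
  also have "\<dots> = (\<Sum>i\<le>m. if i \<le> n then smult ((-1) ^ i * row_minor (q_row (real n)) m i) (dual_hahn a b c (n - i)) else 0)"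
  proof (intro sum.cong refl)
    fix i
    have "(-1 :: real poly) ^ i = [:(-1) ^ i:]" by (induction i) (auto simp: one_pCons)
    then show "(if i \<le> n then (-1) ^ i * dual_hahn a b c (n - i) else 0) * [:row_minor (q_row (real n)) m i:]
      = (if i \<le> n then smult ((-1) ^ i * row_minor (q_row (real n)) m i) (dual_hahn a b c (n - i)) else 0)"
      by (simp add: mult_ac)
  qed
  finally show ?thesis .
qed

text \<open>The telescoping holds for the rational functions S and M_h, with which P and M are
  linked only outside a finite set. The hypothesis \<open>den\<close> excludes poles of the products
  \<xi> at n, so continuity gives the identity at n itself.\<close>

lemma coefficient_identity:
  assumes data: "D_procedure_data a b c U1 U2 U3 P M" and s: "s \<le> m"
    and den: "\<And>h i. h < m \<Longrightarrow> i < m \<Longrightarrow> a + (n - real i) \<noteq> 0 \<or> fam h = First"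
  shows "(\<Sum>h<m. poly (M h) (n - real s) * (\<Sum>j<s. row_minor (q_row n) m j * poly (Yh h) (n - real j) * xih h (n - real j) (s - j)))
    = - row_minor (q_row n) m s * (poly P n - poly P (n - real s))"
proof -
  define F where "F x = (\<Sum>h<m. poly (M h) (x - real s) * (\<Sum>j<s. row_minor (q_row x) m j * poly (Yh h) (x - real j) * xih h (x - real j) (s - j)))
    + row_minor (q_row x) m s * (poly P x - poly P (x - real s))" for x
  have "\<forall>\<^sub>F x in cofinite. \<forall>h\<in>{..<m}. poly (M h) (x - real s) = M_fun a b c U1 U2 U3 h (x - real s)"
  proof (intro eventually_cofinite_ball)
    fix h assume "h \<in> {..<m}"
    then show "\<forall>\<^sub>F x in cofinite. poly (M h) (x - real s) = M_fun a b c U1 U2 U3 h (x - real s)"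
      using data eventually_cofinite_shift[of "\<lambda>x. poly (M h) x = M_fun a b c U1 U2 U3 h x" "- real s"]
      unfolding D_procedure_data_def by simp
  qed simp
  moreover have "\<forall>\<^sub>F x in cofinite. \<forall>i\<in>{..<s}. poly P (x - real s + (real i + 1)) - poly P (x - real s + (real i + 1) - 1)
      = S_fun a b c U1 U2 U3 (x - real s + (real i + 1)) * Omega_D a b c U1 U2 U3 (x - real s + (real i + 1))"
  proof (intro eventually_cofinite_ball)
    fix i
    show "\<forall>\<^sub>F x in cofinite. poly P (x - real s + (real i + 1)) - poly P (x - real s + (real i + 1) - 1)
      = S_fun a b c U1 U2 U3 (x - real s + (real i + 1)) * Omega_D a b c U1 U2 U3 (x - real s + (real i + 1))"
      using data eventually_cofinite_shift[of "\<lambda>x. poly P x - poly P (x - 1) = S_fun a b c U1 U2 U3 x * Omega_D a b c U1 U2 U3 x" "- real s + (real i + 1)"]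
      unfolding D_procedure_data_def by (simp only: add.assoc[symmetric] diff_conv_add_uminus)
  qed auto
  ultimately have "\<forall>\<^sub>F x in cofinite. F x = 0"
  proof eventually_elim
    case (elim x)
    have "poly P x - poly P (x - real s) = (\<Sum>i<s. poly P (x - real s + (real i + 1)) - poly P (x - real s + (real i + 1) - 1))"
      using sum_lessThan_telescope[of "\<lambda>i. poly P (x - real s + real i)" s] by (simp add: add_ac)
    also have "\<dots> = (\<Sum>i<s. S_fun a b c U1 U2 U3 (x - real s + (real i + 1)) * det (Casorati a b c U1 U2 U3 (x - real s + (real i + 1))))"
      using elim by (intro sum.cong) (auto simp: Omega_D_def)
    finally have P: "poly P x - poly P (x - real s) = \<dots>" .
    have "(\<Sum>h<m. poly (M h) (x - real s) * (\<Sum>j<s. row_minor (q_row x) m j * poly (Yh h) (x - real j) * xih h (x - real j) (s - j)))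
      = (\<Sum>h<m. M_fun a b c U1 U2 U3 h (x - real s) * (\<Sum>j<s. row_minor (q_row x) m j * poly (Yh h) (x - real j) * xih h (x - real j) (s - j)))"
      using elim by (intro sum.cong) auto
    also have "\<dots> = - row_minor (q_row x) m s * (poly P x - poly P (x - real s))"
      unfolding P M_fun_eq Casorati_eq q_row_def
      by (rule operator_coefficient[where \<xi> = xih and Z = "\<lambda>l. poly (Yh l)" and S = "S_fun a b c U1 U2 U3", OF xi_add s])
    finally show ?case by (simp add: F_def)
  qed
  moreover have "isCont F n"
  proof -
    have xi: "isCont (\<lambda>x. xih h (x - real j) k) n" if "h < m" "j + k \<le> m" for h j k
    proof -
      have "isCont (\<lambda>x. xih h (x - real j) k) (n - real j + real j)"
      proof (rule isCont_xi)
        fix i assume "i < k"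
        then have "j + i < m" using that by simp
        from den[OF that(1) this] show "a + (n - real j - real i) \<noteq> 0 \<or> fam h = First"
          by (simp add: algebra_simps)
      qed
      then show ?thesis by simp
    qed
    have minor: "isCont (\<lambda>x. row_minor (q_row x) m i) n" if "i \<le> m" for i
      unfolding row_minor_def q_row_def
      by (intro continuous_intros isCont_det xi) auto
    show ?thesis unfolding F_def
      by (intro continuous_intros minor xi) (use s in auto)
  qed
  ultimately have "F n = 0" by (intro isCont_eq_0)
  then show ?thesis by (simp add: F_def)
qed

theorem D_procedure_eigenfunction:
  assumes data: "D_procedure_data a b c U1 U2 U3 P M"
    and a: "\<And>k. a + 1 + real k \<noteq> 0"
    and den: "\<And>h i. h < m \<Longrightarrow> i < m \<Longrightarrow> a + (real n - real i) \<noteq> 0 \<or> fam h = First"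
  shows "\<forall>\<^sub>F x in cofinite. D_procedure_op a b c U1 U2 U3 P M (\<lambda>y. poly (q_poly a b c U1 U2 U3 n) (lam a b y)) x
    = poly P (real n) * poly (q_poly a b c U1 U2 U3 n) (lam a b x)"
proof -
  define \<mu> where "\<mu> i = (if i \<le> m then row_minor (q_row (real n)) m i else 0)" for i
  define R where "R k = dual_hahn_x a b c (n - k)" for k
  define Q where "Q = (\<lambda>y. poly (q_poly a b c U1 U2 U3 n) (lam a b y))"
  have Q: "Q = (\<lambda>x. \<Sum>i\<le>n. (-1) ^ i * \<mu> i * R i x)"
  proof
    fix x
    have "Q x = (\<Sum>i\<le>m. if i \<le> n then (-1) ^ i * \<mu> i * R i x else 0)"
      unfolding Q_def q_poly_eq poly_sum
      by (intro sum.cong) (auto simp: \<mu>_def R_def dual_hahn_x_def)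
    also have "\<dots> = (\<Sum>i\<in>{..m} \<inter> {..n}. (-1) ^ i * \<mu> i * R i x)"
      by (subst sum.inter_restrict) auto
    also have "\<dots> = (\<Sum>i\<le>n. (-1) ^ i * \<mu> i * R i x)"
      by (rule sum.mono_neutral_left) (auto simp: \<mu>_def)
    finally show "Q x = (\<Sum>i\<le>n. (-1) ^ i * \<mu> i * R i x)" .
  qed
  have eig: "ceq (Gamma_op a b c (R i)) (\<lambda>x. real (n - i) * R i x)" for i
    unfolding ceq_def R_def using eventually_regular_pt[of a b]
    by eventually_elim (rule Gamma_dual_hahn_x[OF a])
  have P: "ceq (poly_at_operator P (Gamma_op a b c) Q) (\<lambda>x. \<Sum>i\<le>n. (-1) ^ i * \<mu> i * poly P (real (n - i)) * R i x)"
    by (rule poly_at_operator_eigen[OF _ _ eig]) (auto simp: Q ceq_refl)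
  \<comment> \<open>The coefficient of R_(n-s) after Y_h(\<Gamma>) and the h-th D-operator have been
    applied to the determinant.\<close>
  define d where "d h s = (\<Sum>i<s. (-1) ^ i * \<mu> i * poly (Yh h) (real (n - i)) * ((-1) ^ (s - Suc i) * xih h (real (n - i)) (s - i)))" for h s
  have D: "ceq (D_op a b c (fam h) (poly_at_operator (Yh h) (Gamma_op a b c) Q)) (\<lambda>x. \<Sum>s\<le>n. d h s * R s x)" for h
  proof -
    have "ceq (poly_at_operator (Yh h) (Gamma_op a b c) Q) (\<lambda>x. \<Sum>i\<le>n. (-1) ^ i * \<mu> i * poly (Yh h) (real (n - i)) * R i x)"
      by (rule poly_at_operator_eigen[OF _ _ eig]) (auto simp: Q ceq_refl)
    then have "ceq (D_op a b c (fam h) (poly_at_operator (Yh h) (Gamma_op a b c) Q))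
        (D_op a b c (fam h) (\<lambda>x. \<Sum>i\<le>n. (-1) ^ i * \<mu> i * poly (Yh h) (real (n - i)) * R i x))"
      by (rule D_op_ceq)
    moreover have "ceq (D_op a b c (fam h) (\<lambda>x. \<Sum>i\<le>n. (-1) ^ i * \<mu> i * poly (Yh h) (real (n - i)) * R i x)) (\<lambda>x. \<Sum>s\<le>n. d h s * R s x)"
      unfolding ceq_def D_op_sum using eventually_regular_pt[of a b]
    proof eventually_elim
      case (elim x)
      define e where "e i = (-1) ^ i * \<mu> i * poly (Yh h) (real (n - i))" for i
      have DR: "D_op a b c (fam h) (R i) x = (\<Sum>s\<in>{Suc i..n}. (-1) ^ (s - Suc i) * xih h (real (n - i)) (s - i) * R s x)"
        if "i \<le> n" for i
      proof -
        have "D_op a b c (fam h) (R i) x = (\<Sum>j<n - i. (-1) ^ j * xih h (real (n - i)) (Suc j) * R (Suc i + j) x)"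
          unfolding R_def D_op_dual_hahn_x[OF a elim] xi_def by (intro sum.cong) auto
        also have "\<dots> = (\<Sum>s\<in>{Suc i..n}. (-1) ^ (s - Suc i) * xih h (real (n - i)) (s - i) * R s x)"
          by (rule sum.reindex_bij_witness[of _ "\<lambda>s. s - Suc i" "\<lambda>j. Suc i + j"])
             (use that in \<open>auto simp: Suc_diff_le Suc_diff_Suc\<close>)
        finally show ?thesis .
      qed
      have "(\<Sum>i\<le>n. e i * D_op a b c (fam h) (R i) x)
          = (\<Sum>i\<le>n. \<Sum>s\<in>{Suc i..n}. e i * ((-1) ^ (s - Suc i) * xih h (real (n - i)) (s - i)) * R s x)"
        by (intro sum.cong refl) (simp add: DR sum_distrib_left mult_ac)
      also have "\<dots> = (\<Sum>s\<le>n. \<Sum>i<s. e i * ((-1) ^ (s - Suc i) * xih h (real (n - i)) (s - i)) * R s x)"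
        unfolding sum.Sigma[OF finite_atMost ballI[OF finite_atLeastAtMost]] sum.Sigma[OF finite_atMost ballI[OF finite_lessThan]]
        by (rule sum.reindex_bij_witness[of _ "\<lambda>(s, i). (i, s)" "\<lambda>(i, s). (s, i)"]) auto
      also have "\<dots> = (\<Sum>s\<le>n. d h s * R s x)"
        by (simp add: d_def e_def sum_distrib_right)
      finally show ?case by (simp add: e_def)
    qed
    ultimately show ?thesis by (rule ceq_trans)
  qed
  have MD: "ceq (poly_at_operator (M h) (Gamma_op a b c) (D_op a b c (fam h) (poly_at_operator (Yh h) (Gamma_op a b c) Q)))
      (\<lambda>x. \<Sum>s\<le>n. d h s * poly (M h) (real (n - s)) * R s x)" for h
    by (rule poly_at_operator_eigen[OF D _ eig]) auto
  \<comment> \<open>For s \<le> m this is \<open>coefficient_identity\<close>. For larger s there is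
    no term R_(n-s) in the determinant, and the contribution of each row vanishes
    separately.\<close>
  have coef: "(-1) ^ s * \<mu> s * poly P (real (n - s)) + (\<Sum>h<m. d h s * poly (M h) (real (n - s))) = poly P (real n) * ((-1) ^ s * \<mu> s)"
    if "s \<le> n" for s
  proof -
    have d: "d h s = - ((-1) ^ s * (\<Sum>j<s. \<mu> j * poly (Yh h) (real n - real j) * xih h (real n - real j) (s - j)))" for h
      unfolding d_def sum_distrib_left sum_negf[symmetric]
    proof (intro sum.cong refl)
      fix i assume i: "i \<in> {..<s}"
      then have "s = Suc (i + (s - Suc i))" by auto
      then have "(-1 :: real) ^ s = - ((-1) ^ i * (-1) ^ (s - Suc i))"
        by (metis power_Suc power_add mult_minus_left mult_1)
      then show "(-1) ^ i * \<mu> i * poly (Yh h) (real (n - i)) * ((-1) ^ (s - Suc i) * xih h (real (n - i)) (s - i))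
        = - ((-1) ^ s * (\<mu> i * poly (Yh h) (real n - real i) * xih h (real n - real i) (s - i)))"
        using i that by (simp add: of_nat_diff)
    qed
    have ns: "real (n - s) = real n - real s" using that by (simp add: of_nat_diff)
    show ?thesis
    proof (cases "s \<le> m")
      case True
      have e1: "(\<Sum>h<m. poly (M h) (real n - real s) * (\<Sum>j<s. \<mu> j * poly (Yh h) (real n - real j) * xih h (real n - real j) (s - j)))
        = - \<mu> s * (poly P n - poly P (real n - real s))"
        using coefficient_identity[OF data True, of "real n"] den True by (simp add: \<mu>_def)
      have e2: "(\<Sum>h<m. d h s * poly (M h) (real (n - s))) = - ((-1) ^ s) *
          (\<Sum>h<m. poly (M h) (real n - real s) * (\<Sum>j<s. \<mu> j * poly (Yh h) (real n - real j) * xih h (real n - real j) (s - j)))"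
        unfolding d ns sum_distrib_left by (intro sum.cong refl) (simp add: sum_distrib_left sum_negf mult_ac)
      show ?thesis unfolding e2 e1 by (simp add: ns algebra_simps)
    next
      case False
      have "(\<Sum>j<s. \<mu> j * poly (Yh h) (real n - real j) * xih h (real n - real j) (s - j)) = 0" if h: "h < m" for h
      proof -
        have "(\<Sum>j<s. \<mu> j * poly (Yh h) (real n - real j) * xih h (real n - real j) (s - j))
          = (\<Sum>j\<le>m. row_minor (q_row (real n)) m j * poly (Yh h) (real n - real j) * xih h (real n - real j) (s - j))"
          using False by (intro sum.mono_neutral_cong_right) (auto simp: \<mu>_def)
        also have "\<dots> = 0"
          unfolding q_row_def
          by (rule operator_coefficient_vanishes[where \<xi> = xih and Z = "\<lambda>l. poly (Yh l)", OF xi_add _ h]) (use False in auto)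
        finally show ?thesis .
      qed
      then show ?thesis using False by (simp add: d \<mu>_def)
    qed
  qed
  have "\<forall>\<^sub>F x in cofinite. \<forall>h\<in>{..<m}. poly_at_operator (M h) (Gamma_op a b c) (D_op a b c (fam h) (poly_at_operator (Yh h) (Gamma_op a b c) Q)) x
      = (\<Sum>s\<le>n. d h s * poly (M h) (real (n - s)) * R s x)"
    by (rule eventually_cofinite_ball) (use MD in \<open>auto simp: ceq_def\<close>)
  with P[unfolded ceq_def] show ?thesis
    unfolding Q_def[symmetric]
  proof eventually_elim
    case (elim x)
    have "D_procedure_op a b c U1 U2 U3 P M Q x = (\<Sum>s\<le>n. (-1) ^ s * \<mu> s * poly P (real (n - s)) * R s x)
        + (\<Sum>h<m. \<Sum>s\<le>n. d h s * poly (M h) (real (n - s)) * R s x)"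
      unfolding D_procedure_op_def using elim by simp
    also have "\<dots> = (\<Sum>s\<le>n. ((-1) ^ s * \<mu> s * poly P (real (n - s)) + (\<Sum>h<m. d h s * poly (M h) (real (n - s)))) * R s x)"
      by (subst sum.swap) (simp add: distrib_right sum.distrib sum_distrib_right)
    also have "\<dots> = (\<Sum>s\<le>n. poly P (real n) * ((-1) ^ s * \<mu> s) * R s x)"
      by (intro sum.cong refl) (simp only: coef atMost_iff)
    also have "\<dots> = poly P (real n) * Q x" by (simp add: Q sum_distrib_left mult_ac)
    also have "Q x = poly (q_poly a b c U1 U2 U3 n) (lam a b x)" by (simp add: Q_def)
    finally show ?case .
  qed
qed

section \<open>Polynomiality of the product of S and Omega, and of the M\<close>

context
  assumes fin: "finite U1" "finite U2" "finite U3"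
begin

lemma card_le_rows: "card U2 \<le> m" "card U3 \<le> m" "card U2 + card U3 \<le> m"
  by (auto simp: num_rows_def)

text \<open>Reindexed by the column t, where the truncated subtractions make absent factors
  harmless; the exponents can now be compared with the counts in
  \<open>polyfun_S_gauge\<close>.\<close>

lemma S_den_eq: "S_den a b c U1 U2 U3 x = (\<Prod>t<m. (b + c - x + real t + 1) ^ (card U2 - (m - t))) *
    (\<Prod>t<m. (c - x + real t + 1) ^ (card U3 - (m - t))) *
    (\<Prod>t\<in>{1..<m}. (- (a + x - real t)) ^ (card U2 + card U3 - t))"
proof -
  have 1: "(\<Prod>i<k - 1. (s + real m - x - real i) ^ (k - i - 1)) = (\<Prod>t<m. (s - x + real t + 1) ^ (k - (m - t)))"
    if "k \<le> m" for s k
  proof -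
    have "(\<Prod>i<k - 1. (s + real m - x - real i) ^ (k - i - 1)) = (\<Prod>t\<in>{m - (k - 1)..<m}. (s - x + real t + 1) ^ (k - (m - t)))"
      by (rule prod.reindex_bij_witness[of _ "\<lambda>t. m - 1 - t" "\<lambda>i. m - 1 - i"])
         (use that in \<open>auto simp: of_nat_diff algebra_simps intro!: arg_cong2[where f = "(^)"]\<close>)
    also have "\<dots> = (\<Prod>t<m. (s - x + real t + 1) ^ (k - (m - t)))"
      by (rule prod.mono_neutral_left) auto
    finally show ?thesis .
  qed
  have 2: "(\<Prod>i<k - 1. (- a - x + real i + 1) ^ (k - i - 1)) = (\<Prod>t\<in>{1..<m}. (- (a + x - real t)) ^ (k - t))"
    if "k \<le> m" for k
  proof -
    have "(\<Prod>i<k - 1. (- a - x + real i + 1) ^ (k - i - 1)) = (\<Prod>t\<in>{1..<k}. (- (a + x - real t)) ^ (k - t))"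
      by (rule prod.reindex_bij_witness[of _ "\<lambda>t. t - 1" Suc]) (auto simp: algebra_simps of_nat_diff)
    also have "\<dots> = (\<Prod>t\<in>{1..<m}. (- (a + x - real t)) ^ (k - t))"
      by (rule prod.mono_neutral_left) (use that in auto)
    finally show ?thesis .
  qed
  show ?thesis
    unfolding S_den_def Let_def 1[OF card_le_rows(1), of "b + c"] 1[OF card_le_rows(2)] 2[OF card_le_rows(3)] ..
qed

lemma pochhammer_S: "pochhammer (a + x - real m + 1) (m - 1) = (\<Prod>t\<in>{1..<m}. a + x - real t)"
  unfolding pochhammer_prod
  by (rule prod.reindex_bij_witness[of _ "\<lambda>t. m - 1 - t" "\<lambda>i. m - 1 - i"]) (auto simp: of_nat_diff)

text \<open>This is what S is designed for. Its numerator clears the denominators of \<xi> in every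
  Leibniz term. Among the rows of one family at most m - t are sent to columns \<ge> t, so the
  numerator factor of column t occurs at least \<open>card U - (m - t)\<close> times. Among the rows
  of the second and third family at most t are sent to columns < t, so \<open>a + x - t\<close>
  survives at least \<open>card U2 + card U3 - t\<close> times. These are the exponents in
  \<open>S_den\<close>.\<close>

lemma polyfun_S_gauge:
  assumes \<pi>: "\<pi> permutes {0..<m}"
  shows "polyfun (\<lambda>x. S_fun a b c U1 U2 U3 x * (\<Prod>l<m. xih l (x - (real (\<pi> l) + 1)) (m - (\<pi> l + 1))))"
proof -
  define L where "L f = {l. l < m \<and> fam l = f}" for f
  define L23 where "L23 = L Second \<union> L Third"
  have finL: "finite (L f)" for f by (simp add: L_def)
  have cardL: "card (L Second) = card U2" "card (L Third) = card U3"
    unfolding L_def using card_family_rows[OF fin] by simp_all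
  have card23: "card L23 = card U2 + card U3"
    unfolding L23_def by (subst card_Un_disjoint) (auto simp: finL cardL, auto simp: L_def)
  have part: "{..<m} = L First \<union> L23" "L First \<inter> L23 = {}" "L Second \<inter> L Third = {}"
    by (auto simp: L_def L23_def) (metis family.exhaust)
  have \<pi>m: "\<pi> l < m" if "l < m" for l using permutes_less[OF \<pi> that] .
  have inj: "inj_on \<pi> A" for A using permutes_inj_on[OF \<pi>] .
  define A where "A x = (\<Prod>t\<in>{1..<m}. a + x - real t)" for x
  define sg where "sg = (\<Prod>l\<in>L First. \<Prod>t\<in>{Suc (\<pi> l)..<m}. (-1 :: real))"
  define G2 where "G2 x = (\<Prod>t<m. (b + c - x + real t + 1) ^ card {l\<in>L Second. \<pi> l < t})" for x
  define G3 where "G3 x = (\<Prod>t<m. (c - x + real t + 1) ^ card {l\<in>L Third. \<pi> l < t})" for x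
  define Ga where "Ga x = (\<Prod>t\<in>{1..<m}. (a + x - real t) ^ card {l\<in>L23. t \<le> \<pi> l})" for x
  define E2 where "E2 x = (\<Prod>t<m. (b + c - x + real t + 1) ^ (card U2 - (m - t)))" for x
  define E3 where "E3 x = (\<Prod>t<m. (c - x + real t + 1) ^ (card U3 - (m - t)))" for x
  define Ea where "Ea x = (\<Prod>t\<in>{1..<m}. (a + x - real t) ^ (card U2 + card U3 - t))" for x
  define sa where "sa = (\<Prod>t\<in>{1..<m}. (-1 :: real) ^ (card U2 + card U3 - t))"
  have num: "A x ^ card L23 * (\<Prod>l<m. xih l (x - (real (\<pi> l) + 1)) (m - (\<pi> l + 1))) = sg * (G2 x * G3 x * Ga x)"
    if nz: "\<forall>t\<in>{1..<m}. a + x - real t \<noteq> 0" for x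
  proof -
    have "(\<Prod>l<m. xih l (x - (real (\<pi> l) + 1)) (m - (\<pi> l + 1))) = (\<Prod>l<m. \<Prod>t\<in>{Suc (\<pi> l)..<m}. eps a b c (fam l) (x - real t))"
      by (intro prod.cong refl xi_prod) (use \<pi>m in auto)
    also have "\<dots> = sg * (\<Prod>l\<in>L23. \<Prod>t\<in>{Suc (\<pi> l)..<m}. eps a b c (fam l) (x - real t))"
    proof -
      have "(\<Prod>l\<in>L First. \<Prod>t\<in>{Suc (\<pi> l)..<m}. eps a b c (fam l) (x - real t)) = sg"
        unfolding sg_def by (intro prod.cong) (auto simp: L_def)
      then show ?thesis
        unfolding part(1) by (subst prod.union_disjoint) (use part finL in \<open>auto simp: L23_def\<close>)
    qed
    finally have 1: "A x ^ card L23 * (\<Prod>l<m. xih l (x - (real (\<pi> l) + 1)) (m - (\<pi> l + 1)))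
        = sg * (\<Prod>l\<in>L23. A x * (\<Prod>t\<in>{Suc (\<pi> l)..<m}. eps a b c (fam l) (x - real t)))"
      by (simp add: prod.distrib)
    have row: "A x * (\<Prod>t\<in>{Suc (\<pi> l)..<m}. eps a b c (fam l) (x - real t))
        = (\<Prod>t\<in>{t\<in>{..<m}. \<pi> l < t}. gauge_num b c (fam l) - x + real t + 1) * (\<Prod>t\<in>{t\<in>{1..<m}. t \<le> \<pi> l}. a + x - real t)"
      if l: "l \<in> L23" for l
    proof -
      have f: "fam l \<noteq> First" and lm: "l < m" using l by (auto simp: L23_def L_def)
      have s1: "{t\<in>{..<m}. \<pi> l < t} = {Suc (\<pi> l)..<m}" by auto
      have s2: "{1..<m} = {Suc (\<pi> l)..<m} \<union> {t\<in>{1..<m}. t \<le> \<pi> l}" by auto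
      have A: "A x = (\<Prod>t\<in>{Suc (\<pi> l)..<m}. a + x - real t) * (\<Prod>t\<in>{t\<in>{1..<m}. t \<le> \<pi> l}. a + x - real t)"
        unfolding A_def by (subst s2, subst prod.union_disjoint) auto
      have "(\<Prod>t\<in>{Suc (\<pi> l)..<m}. a + x - real t) * (\<Prod>t\<in>{Suc (\<pi> l)..<m}. eps a b c (fam l) (x - real t))
          = (\<Prod>t\<in>{Suc (\<pi> l)..<m}. gauge_num b c (fam l) - x + real t + 1)"
        unfolding prod.distrib[symmetric]
      proof (intro prod.cong refl)
        fix t assume "t \<in> {Suc (\<pi> l)..<m}"
        then have "a + x - real t \<noteq> 0" using nz by auto
        then show "(a + x - real t) * eps a b c (fam l) (x - real t) = gauge_num b c (fam l) - x + real t + 1"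
          unfolding eps_not_First[OF f] by (simp add: field_simps)
      qed
      then show ?thesis unfolding A s1 by (simp add: mult_ac)
    qed
    have "(\<Prod>l\<in>L23. A x * (\<Prod>t\<in>{Suc (\<pi> l)..<m}. eps a b c (fam l) (x - real t)))
        = (\<Prod>l\<in>L23. \<Prod>t\<in>{t\<in>{..<m}. \<pi> l < t}. gauge_num b c (fam l) - x + real t + 1)
          * (\<Prod>l\<in>L23. \<Prod>t\<in>{t\<in>{1..<m}. t \<le> \<pi> l}. a + x - real t)"
      unfolding prod.distrib[symmetric] by (intro prod.cong refl row)
    also have "(\<Prod>l\<in>L23. \<Prod>t\<in>{t\<in>{1..<m}. t \<le> \<pi> l}. a + x - real t) = Ga x"
      unfolding Ga_def by (rule prod_power_card) (auto simp: L23_def finL)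
    also have "(\<Prod>l\<in>L23. \<Prod>t\<in>{t\<in>{..<m}. \<pi> l < t}. gauge_num b c (fam l) - x + real t + 1) = G2 x * G3 x"
    proof -
      have "(\<Prod>l\<in>L Second. \<Prod>t\<in>{t\<in>{..<m}. \<pi> l < t}. gauge_num b c (fam l) - x + real t + 1) = G2 x"
        unfolding G2_def by (subst prod_power_card[symmetric]) (auto simp: L_def intro!: prod.cong)
      moreover have "(\<Prod>l\<in>L Third. \<Prod>t\<in>{t\<in>{..<m}. \<pi> l < t}. gauge_num b c (fam l) - x + real t + 1) = G3 x"
        unfolding G3_def by (subst prod_power_card[symmetric]) (auto simp: L_def intro!: prod.cong)
      ultimately show ?thesis
        unfolding L23_def by (subst prod.union_disjoint) (use part finL in auto)
    qed
    finally show ?thesis unfolding 1 by simp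
  qed
  have count1: "card (L f) - (m - t) \<le> card {l\<in>L f. \<pi> l < t}" if "t < m" for f t
  proof -
    have "card {l\<in>L f. t \<le> \<pi> l} \<le> card {t..<m}"
      by (rule card_inj_on_le[of \<pi>]) (use \<pi>m inj in \<open>auto simp: L_def\<close>)
    moreover have "card (L f) = card {l\<in>L f. t \<le> \<pi> l} + card {l\<in>L f. \<pi> l < t}"
      by (subst card_Un_disjoint[symmetric]) (auto simp: finL intro!: arg_cong[where f = card])
    ultimately show ?thesis by simp
  qed
  have count2: "card U2 + card U3 - t \<le> card {l\<in>L23. t \<le> \<pi> l}" for t
  proof -
    have "card {l\<in>L23. \<pi> l < t} \<le> card {..<t}"
      by (rule card_inj_on_le[of \<pi>]) (use inj in auto)
    moreover have "card L23 = card {l\<in>L23. t \<le> \<pi> l} + card {l\<in>L23. \<pi> l < t}"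
      by (subst card_Un_disjoint[symmetric]) (auto simp: finL L23_def intro!: arg_cong[where f = card])
    ultimately show ?thesis using card23 by simp
  qed
  define sgn where "sgn = (-1 :: real) ^ ((m choose 2) + card U1)"
  have lin: "polyfun (\<lambda>x. s - x + real t + 1)" "\<forall>\<^sub>F x in cofinite. s - x + real t + 1 \<noteq> 0"
    "polyfun (\<lambda>x. a + x - real t)" "\<forall>\<^sub>F x in cofinite. a + x - real t \<noteq> 0" for s t
    using polyfun_linear[of "s + real t + 1" "-1"] polyfun_linear[of "a - real t" 1]
      eventually_cofinite_linear_neq[of "-1" "s + real t + 1"] eventually_cofinite_linear_neq[of 1 "a - real t"]
    by (simp_all add: algebra_simps)
  have poly: "polyfun (\<lambda>x. sgn * sg / sa * ((G2 x / E2 x) * (G3 x / E3 x) * (Ga x / Ea x)))"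
    unfolding G2_def E2_def G3_def E3_def Ga_def Ea_def
    by (intro polyfun_mult polyfun_const polyfun_power_quotient lin)
       (use count1[of _ Second] count1[of _ Third] count2 cardL in auto)
  have Ea: "(\<Prod>t\<in>{1..<m}. (- (a + x - real t)) ^ (card U2 + card U3 - t)) = sa * Ea x" for x
    unfolding sa_def Ea_def prod.distrib[symmetric] power_mult_distrib[symmetric] by simp
  have "\<forall>\<^sub>F x in cofinite. \<forall>t\<in>{1..<m}. a + x - real t \<noteq> 0"
    by (intro eventually_cofinite_ball lin) auto
  then have "\<forall>\<^sub>F x in cofinite. S_fun a b c U1 U2 U3 x * (\<Prod>l<m. xih l (x - (real (\<pi> l) + 1)) (m - (\<pi> l + 1)))
      = sgn * sg / sa * ((G2 x / E2 x) * (G3 x / E3 x) * (Ga x / Ea x))"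
  proof eventually_elim
    case (elim x)
    have "S_fun a b c U1 U2 U3 x * (\<Prod>l<m. xih l (x - (real (\<pi> l) + 1)) (m - (\<pi> l + 1)))
      = sgn * (A x ^ card L23 * (\<Prod>l<m. xih l (x - (real (\<pi> l) + 1)) (m - (\<pi> l + 1)))) / (E2 x * E3 x * (sa * Ea x))"
      unfolding S_fun_def S_den_eq pochhammer_S Ea card23 by (simp add: sgn_def A_def E2_def E3_def)
    also have "\<dots> = sgn * sg / sa * ((G2 x / E2 x) * (G3 x / E3 x) * (Ga x / Ea x))"
      unfolding num[OF elim] by (simp add: mult_ac)
    finally show ?case .
  qed
  with poly show ?thesis by (rule polyfun_cong)
qed

text \<open>The factors \<open>Z\<close> may vary with the column, so that a row can also be
  replaced by a unit row.\<close>

lemma polyfun_S_det: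
  assumes Z: "\<And>l i. l < m \<Longrightarrow> i < m \<Longrightarrow> polyfun (Z l i)"
  shows "polyfun (\<lambda>x. S_fun a b c U1 U2 U3 x *
    det (mat m m (\<lambda>(l, i). xih l (x - (real i + 1)) (m - (i + 1)) * Z l i x)))"
proof -
  have eq: "S_fun a b c U1 U2 U3 x * det (mat m m (\<lambda>(l, i). xih l (x - (real i + 1)) (m - (i + 1)) * Z l i x))
     = (\<Sum>\<pi> | \<pi> permutes {0..<m}. signof \<pi> * ((S_fun a b c U1 U2 U3 x *
         (\<Prod>l<m. xih l (x - (real (\<pi> l) + 1)) (m - (\<pi> l + 1)))) * (\<Prod>l<m. Z l (\<pi> l) x)))" for x
    by (subst det_def'[of _ m])
       (auto intro!: sum.cong prod.cong simp: permutes_less sum_distrib_left lessThan_atLeast0 prod.distrib[symmetric])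
  show ?thesis unfolding eq
    by (intro polyfun_sum polyfun_mult polyfun_const polyfun_S_gauge polyfun_prod Z)
       (auto simp: finite_permutations permutes_less)
qed

lemma polyfun_S_Omega: "polyfun (\<lambda>x. S_fun a b c U1 U2 U3 x * Omega_D a b c U1 U2 U3 x)"
  unfolding Omega_D_def Casorati_eq
  by (intro polyfun_S_det polyfun_poly_minus)

text \<open>A cofactor times the factor \<xi> of its deleted entry is the determinant whose row h
  has a single nonzero entry, namely that factor. Each summand of M_h is, up to a shift, S times
  such a determinant.\<close>

lemma polyfun_M_fun:
  assumes h: "h < m"
  shows "polyfun (M_fun a b c U1 U2 U3 h)"
proof -
  have pf: "polyfun (\<lambda>x. xih h (x - (real i + 1)) (m - (i + 1)) * S_fun a b c U1 U2 U3 x * cofactor (Casorati a b c U1 U2 U3 x) h i)"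
    if i: "i < m" for i
  proof -
    define Z where "Z l j x = (if l = h then if j = i then 1 else 0 else poly (Yh l) (x - (real j + 1)))" for l j x
    have Z: "polyfun (Z l j)" for l j
    proof (cases "l = h")
      case True
      then show ?thesis using polyfun_const[of "if j = i then 1 else 0"] by (simp add: Z_def[abs_def])
    next
      case False
      then show ?thesis using polyfun_poly_minus[of "Yh l" "real j + 1"] by (simp add: Z_def[abs_def])
    qed
    have "det (mat m m (\<lambda>(l, j). xih l (x - (real j + 1)) (m - (j + 1)) * Z l j x))
        = xih h (x - (real i + 1)) (m - (i + 1)) * cofactor (Casorati a b c U1 U2 U3 x) h i" for x
    proof -
      define B where "B = mat m m (\<lambda>(l, j). xih l (x - (real j + 1)) (m - (j + 1)) * Z l j x)"
      have B: "B \<in> carrier_mat m m" by (simp add: B_def)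
      have "mat_delete B h i = mat_delete (Casorati a b c U1 U2 U3 x) h i"
        by (rule eq_matI) (auto simp: B_def mat_delete_def Casorati_eq Z_def)
      then have cof: "cofactor B h i = cofactor (Casorati a b c U1 U2 U3 x) h i" by (simp add: cofactor_def)
      have "det B = (\<Sum>j<m. B $$ (h, j) * cofactor B h j)" by (rule laplace_expansion_row[OF B h])
      also have "\<dots> = (\<Sum>j<m. if j = i then B $$ (h, i) * cofactor B h i else 0)"
        by (intro sum.cong refl) (use h in \<open>auto simp: B_def Z_def\<close>)
      finally show ?thesis using i h by (simp add: cof) (simp add: B_def Z_def)
    qed
    then have "(\<lambda>x. xih h (x - (real i + 1)) (m - (i + 1)) * S_fun a b c U1 U2 U3 x * cofactor (Casorati a b c U1 U2 U3 x) h i)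
      = (\<lambda>x. S_fun a b c U1 U2 U3 x * det (mat m m (\<lambda>(l, j). xih l (x - (real j + 1)) (m - (j + 1)) * Z l j x)))"
      by (simp add: fun_eq_iff mult_ac)
    then show ?thesis using polyfun_S_det[of Z, OF Z] by simp
  qed
  have "polyfun (\<lambda>x. xih h x (m - (i + 1)) * S_fun a b c U1 U2 U3 (x + (real i + 1)) * cofactor (Casorati a b c U1 U2 U3 (x + (real i + 1))) h i)"
    if "i < m" for i
    using polyfun_shift[OF pf[OF that], of "real i + 1"] by simp
  then show ?thesis
    unfolding M_fun_eq[abs_def] by (intro polyfun_sum) auto
qed

end

section \<open>Degrees of Omega and of the M\<close>

context
  assumes fin: "finite U1" "finite U2" "finite U3"
begin

text \<open>A binomial combination of consecutive columns; as $\varepsilon = -1 + O(1/n)$ it behaves like a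
  difference of order \<open>k\<close> and lowers the degree by \<open>k\<close>.\<close>

definition E_fun :: "nat \<Rightarrow> nat \<Rightarrow> real \<Rightarrow> real" where
  "E_fun l k y = (\<Sum>i\<le>k. real (k choose i) * (xih l (y + real i) i * poly (Yh l) (y + real i)))"

lemma xi_one: "xih h x 1 = eps a b c (fam h) x"
  by (simp add: xi_def)

lemma E_fun_Suc: "E_fun l (Suc k) y = E_fun l k y + eps a b c (fam l) (y + 1) * E_fun l k (y + 1)"
proof -
  define g where "g i = xih l (y + real i) i * poly (Yh l) (y + real i)" for i
  have "g (Suc i) = eps a b c (fam l) (y + 1) * (xih l (y + 1 + real i) i * poly (Yh l) (y + 1 + real i))" for i
  proof -
    have "xih l (y + real (Suc i)) (i + 1) = xih l (y + real (Suc i)) i * xih l (y + real (Suc i) - real i) 1"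
      by (rule xi_add)
    then show ?thesis by (simp add: g_def xi_one[unfolded One_nat_def] add_ac mult_ac)
  qed
  then show ?thesis
    unfolding E_fun_def g_def[symmetric] pascal_sum
    by (simp add: distrib_left sum.distrib sum_distrib_left mult_ac)
qed

lemma asy_E_fun:
  assumes "degree (Yh l) \<le> u"
  shows "asy (E_fun l k) (int u - int k) (coeff (Yh l) u * pochhammer (kap a b c (fam l) - real u) k)"
proof (induction k)
  case 0
  have "E_fun l 0 = poly (Yh l)" by (simp add: E_fun_def xi_def fun_eq_iff)
  then show ?case using asy_poly_le[OF assms] by simp
next
  case (Suc k)
  have "(kap a b c (fam l) - of_int (int u - int k)) * (coeff (Yh l) u * pochhammer (kap a b c (fam l) - real u) k)
      = coeff (Yh l) u * pochhammer (kap a b c (fam l) - real u) (Suc k)"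
    by (simp add: pochhammer_Suc algebra_simps)
  moreover have "E_fun l (Suc k) = (\<lambda>y. E_fun l k y + eps a b c (fam l) (y + 1) * E_fun l k (y + 1))"
    by (simp add: E_fun_Suc fun_eq_iff)
  ultimately show ?case
    using asy_eps_step[OF Suc, of a b c "fam l"] by (simp add: algebra_simps)
qed

text \<open>The unimodular change of columns that performs all binomial combinations at once; the
  indices are reversed because the last column of the Casorati matrix has no factor \<xi>.\<close>

definition U_mat :: "real mat" where
  "U_mat = mat m m (\<lambda>(i, k). real ((m - 1 - k) choose (m - 1 - i)))"

definition E_mat :: "real \<Rightarrow> real mat" where
  "E_mat x = mat m m (\<lambda>(l, k). E_fun l (m - 1 - k) (x - real m))"

lemma U_mat: "U_mat \<in> carrier_mat m m" "det U_mat = 1"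
proof -
  show U: "U_mat \<in> carrier_mat m m" by (simp add: U_mat_def)
  have "det U_mat = prod_list (diag_mat U_mat)"
    by (rule det_lower_triangular[OF _ U]) (auto simp: U_mat_def)
  also have "diag_mat U_mat = map (\<lambda>i. 1) [0..<m]"
    by (auto simp: diag_mat_def U_mat_def)
  finally show "det U_mat = 1" by (simp add: map_replicate_const prod_list_replicate)
qed

lemma sum_rev_binomial:
  fixes F :: "nat \<Rightarrow> real"
  assumes "k < m"
  shows "(\<Sum>i<m. F (m - 1 - i) * real ((m - 1 - k) choose (m - 1 - i))) = (\<Sum>i\<le>m - 1 - k. real ((m - 1 - k) choose i) * F i)"
proof -
  have "(\<Sum>i<m. F (m - 1 - i) * real ((m - 1 - k) choose (m - 1 - i))) = (\<Sum>i<m. real ((m - 1 - k) choose i) * F i)"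
    by (rule sum.reindex_bij_witness[of _ "\<lambda>i. m - 1 - i" "\<lambda>i. m - 1 - i"]) auto
  also have "\<dots> = (\<Sum>i\<le>m - 1 - k. real ((m - 1 - k) choose i) * F i)"
    by (rule sum.mono_neutral_right) (use assms in auto)
  finally show ?thesis .
qed

lemma E_mat_eq: "E_mat x = Cas x * U_mat"
proof (rule eq_matI)
  fix l k assume "l < dim_row (Cas x * U_mat)" "k < dim_col (Cas x * U_mat)"
  then have lk: "l < m" "k < m" by (simp_all add: Casorati_eq U_mat_def)
  have "(Cas x * U_mat) $$ (l, k) = (\<Sum>i<m. (xih l (x - (real i + 1)) (m - (i + 1)) * poly (Yh l) (x - (real i + 1))) * real ((m - 1 - k) choose (m - 1 - i)))"
    using lk by (simp add: Casorati_eq U_mat_def scalar_prod_def lessThan_atLeast0)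
  also have "\<dots> = (\<Sum>i<m. (xih l (x - real m + real (m - 1 - i)) (m - 1 - i) * poly (Yh l) (x - real m + real (m - 1 - i))) * real ((m - 1 - k) choose (m - 1 - i)))"
  proof (intro sum.cong refl)
    fix i assume "i \<in> {..<m}"
    then have e: "x - real m + real (m - 1 - i) = x - (real i + 1)" "m - (i + 1) = m - 1 - i"
      by (simp_all add: of_nat_diff)
    show "xih l (x - (real i + 1)) (m - (i + 1)) * poly (Yh l) (x - (real i + 1)) * real ((m - 1 - k) choose (m - 1 - i))
      = xih l (x - real m + real (m - 1 - i)) (m - 1 - i) * poly (Yh l) (x - real m + real (m - 1 - i)) * real ((m - 1 - k) choose (m - 1 - i))"
      unfolding e ..
  qed
  also have "\<dots> = E_mat x $$ (l, k)"
    using sum_rev_binomial[OF lk(2), of "\<lambda>i. xih l (x - real m + real i) i * poly (Yh l) (x - real m + real i)"] lk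
    by (simp add: E_mat_def E_fun_def)
  finally show "E_mat x $$ (l, k) = (Cas x * U_mat) $$ (l, k)" ..
qed (auto simp: E_mat_def Casorati_eq U_mat_def)

lemma Omega_D_E_mat: "Omega_D a b c U1 U2 U3 x = det (E_mat x)"
  unfolding Omega_D_def E_mat_eq by (subst det_mult[of _ m]) (auto simp: Casorati_eq U_mat)

text \<open>A single cofactor is not invariant under column operations. Written as a determinant
  with a unit row, it can be multiplied by \<open>U_mat\<close> and expanded again along the
  transformed row.\<close>

lemma cofactor_Casorati:
  assumes h: "h < m" and i: "i < m"
  shows "cofactor (Cas y) h i = (\<Sum>k<m. real ((m - 1 - k) choose (m - 1 - i)) * cofactor (E_mat y) h k)"
proof -
  have C: "Cas y \<in> carrier_mat m m" and E: "E_mat y \<in> carrier_mat m m" by (auto simp: Casorati_eq E_mat_def)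
  define B where "B = mat m m (\<lambda>(l, j). if l = h then (if j = i then 1 else 0) else Cas y $$ (l, j))"
  have B: "B \<in> carrier_mat m m" by (simp add: B_def)
  have BU: "B * U_mat \<in> carrier_mat m m" using B U_mat by auto
  have "cofactor (Cas y) h i = det B"
    unfolding B_def by (rule det_replace_row_unit[OF C h i, symmetric])
  also have "\<dots> = det (B * U_mat)" using det_mult[OF B U_mat(1)] U_mat(2) by simp
  also have "\<dots> = (\<Sum>k<m. (B * U_mat) $$ (h, k) * cofactor (B * U_mat) h k)"
    by (rule laplace_expansion_row[OF BU h])
  also have "\<dots> = (\<Sum>k<m. real ((m - 1 - k) choose (m - 1 - i)) * cofactor (E_mat y) h k)"
  proof (intro sum.cong refl)
    fix k assume k: "k \<in> {..<m}"
    have row: "(B * U_mat) $$ (l, j) = E_mat y $$ (l, j)" if "l < m" "j < m" "l \<noteq> h" for l j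
    proof -
      have "row B l = row (Cas y) l" using that C by (intro eq_vecI) (auto simp: B_def)
      then show ?thesis unfolding E_mat_eq using that B C U_mat(1) by simp
    qed
    have del: "mat_delete V h k = mat_delete W h k" if "V \<in> carrier_mat m m" "W \<in> carrier_mat m m"
      "\<And>l j. l < m \<Longrightarrow> j < m \<Longrightarrow> l \<noteq> h \<Longrightarrow> V $$ (l, j) = W $$ (l, j)" for V W :: "real mat"
      by (rule eq_matI) (use that in \<open>auto simp: mat_delete_def\<close>)
    have "mat_delete (B * U_mat) h k = mat_delete (E_mat y) h k"
      by (rule del[OF BU E row])
    then have cof: "cofactor (B * U_mat) h k = cofactor (E_mat y) h k" by (simp add: cofactor_def)
    have "(B * U_mat) $$ (h, k) = (\<Sum>j<m. (if j = i then 1 else 0) * U_mat $$ (j, k))"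
      using h k B U_mat(1) by (simp add: scalar_prod_def lessThan_atLeast0 B_def)
    moreover have "\<dots> = (\<Sum>j<m. if j = i then U_mat $$ (i, k) else 0)"
      by (intro sum.cong) auto
    ultimately have "(B * U_mat) $$ (h, k) = real ((m - 1 - k) choose (m - 1 - i))"
      using i k by (simp add: U_mat_def)
    then show "(B * U_mat) $$ (h, k) * cofactor (B * U_mat) h k = real ((m - 1 - k) choose (m - 1 - i)) * cofactor (E_mat y) h k"
      by (simp add: cof)
  qed
  finally show ?thesis .
qed

text \<open>After regrouping, the inner sum is again a binomial combination with factors \<xi>. By
  \<open>asy_binomial_xi\<close> it lowers the order by m - 1 - k, exactly the excess of the
  cofactor (h, k) in \<open>asy_cofactor_E_mat\<close>.\<close>

lemma M_fun_E_mat: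
  assumes h: "h < m"
  shows "M_fun a b c U1 U2 U3 h x = (\<Sum>k<m. \<Sum>i\<le>m - 1 - k. real ((m - 1 - k) choose i) *
    (xih h x i * (SS (x - real i + real m) * cofactor (E_mat (x - real i + real m)) h k)))"
proof -
  have "M_fun a b c U1 U2 U3 h x = (\<Sum>i<m. \<Sum>k<m. (xih h x (m - 1 - i) * (SS (x - real (m - 1 - i) + real m) *
      cofactor (E_mat (x - real (m - 1 - i) + real m)) h k)) * real ((m - 1 - k) choose (m - 1 - i)))"
    unfolding M_fun_eq
  proof (intro sum.cong refl)
    fix i assume i: "i \<in> {..<m}"
    then have e: "x - real (m - 1 - i) + real m = x + (real i + 1)" by (simp add: of_nat_diff)
    show "xih h x (m - (i + 1)) * SS (x + (real i + 1)) * cofactor (Cas (x + (real i + 1))) h i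
      = (\<Sum>k<m. (xih h x (m - 1 - i) * (SS (x - real (m - 1 - i) + real m) *
      cofactor (E_mat (x - real (m - 1 - i) + real m)) h k)) * real ((m - 1 - k) choose (m - 1 - i)))"
      unfolding e using i by (simp add: cofactor_Casorati[OF h] sum_distrib_left mult_ac)
  qed
  also have "\<dots> = (\<Sum>k<m. \<Sum>i<m. (xih h x (m - 1 - i) * (SS (x - real (m - 1 - i) + real m) *
      cofactor (E_mat (x - real (m - 1 - i) + real m)) h k)) * real ((m - 1 - k) choose (m - 1 - i)))"
    by (rule sum.swap)
  also have "\<dots> = (\<Sum>k<m. \<Sum>i\<le>m - 1 - k. real ((m - 1 - k) choose i) *
    (xih h x i * (SS (x - real i + real m) * cofactor (E_mat (x - real i + real m)) h k)))"
    by (intro sum.cong refl sum_rev_binomial) simp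
  finally show ?thesis .
qed

lemma asy_binomial_xi:
  assumes "asy g d k"
  shows "\<exists>k'. asy (\<lambda>x. \<Sum>i\<le>n. real (n choose i) * (xih h x i * g (x - real i))) (d - int n) k'"
  using assms
proof (induction n arbitrary: g d k)
  case 0
  then show ?case by (auto simp: xi_def)
next
  case (Suc n)
  define g' where "g' x = g x + eps a b c (fam h) x * g (x - 1)" for x
  have "asy g' (d - 1) (of_int d * k + kap a b c (fam h) * k)"
  proof (rule asy_cong)
    have 1: "asy (\<lambda>y. - (g (y + (-1)) - g y)) (d - 1) (- (of_int d * (-1) * k))"
      by (intro asy_minus asy_shift_diff Suc.prems)
    have 2: "asy (\<lambda>y. kap a b c (fam h) * (1 / (a + 1 * y)) * g (y + (-1))) (- 1 + d) (kap a b c (fam h) * (1 / 1) * k)"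
      by (intro asy_mult[OF asy_cmult] asy_inverse_linear asy_shift Suc.prems) auto
    show "asy (\<lambda>y. - (g (y + (-1)) - g y) + kap a b c (fam h) * (1 / (a + 1 * y)) * g (y + (-1))) (d - 1)
        (of_int d * k + kap a b c (fam h) * k)"
      using asy_add[OF 1] 2 by simp
    have "\<forall>\<^sub>F y in cofinite. a + 1 * y \<noteq> 0" by (intro eventually_cofinite_linear_neq) simp
    then show "\<forall>\<^sub>F y in cofinite. - (g (y + (-1)) - g y) + kap a b c (fam h) * (1 / (a + 1 * y)) * g (y + (-1)) = g' y"
      by eventually_elim (simp add: g'_def eps_kap algebra_simps)
  qed
  from Suc.IH[OF this] obtain k' where "asy (\<lambda>x. \<Sum>i\<le>n. real (n choose i) * (xih h x i * g' (x - real i))) (d - 1 - int n) k'"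
    by blast
  moreover have "(\<Sum>i\<le>n. real (n choose i) * (xih h x i * g' (x - real i)))
      = (\<Sum>i\<le>Suc n. real (Suc n choose i) * (xih h x i * g (x - real i)))" for x
  proof -
    have "xih h x (Suc i) = xih h x i * eps a b c (fam h) (x - real i)" for i
      using xi_add[of a b c U1 U2 U3 h x i 1] xi_one[of h "x - real i"] by simp
    then show ?thesis unfolding pascal_sum g'_def by (intro sum.cong refl) (simp add: algebra_simps)
  qed
  ultimately show ?case by (auto simp: algebra_simps)
qed

lemma asy_S_fun:
  "\<exists>k. k \<noteq> 0 \<and> asy SS (int (card U2 + card U3) * (int m - 1) - int (card U2 choose 2) - int (card U3 choose 2)
    - int ((card U2 + card U3) choose 2)) k"
proof -
  define M where "M = card U2 + card U3"
  define sgn where "sgn = (-1 :: real) ^ ((m choose 2) + card U1)"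
  have lin: "asy (\<lambda>x. a + x - real t) 1 1" for t
    using asy_linear[of "a - real t" 1] by (simp add: algebra_simps)
  have inv: "asy (\<lambda>x. 1 / (s - x + real t + 1)) (- 1) (- 1)" for s t
    using asy_inverse_linear[of "-1" "s + real t + 1"] by (simp add: algebra_simps)
  have inva: "asy (\<lambda>x. 1 / (- (a + x - real t))) (- 1) (- 1)" for t
    using asy_inverse_linear[of "-1" "- a + real t"] by (simp add: algebra_simps)
  define k where "k = sgn * (\<Prod>t\<in>{1..<m}. 1 :: real) ^ M *
      ((\<Prod>t<m. (- 1) ^ (card U2 - (m - t))) * (\<Prod>t<m. (- 1) ^ (card U3 - (m - t))) * (\<Prod>t\<in>{1..<m}. (- 1) ^ (M - t)))"
  have S: "SS x = sgn * (\<Prod>t\<in>{1..<m}. a + x - real t) ^ M *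
      ((\<Prod>t<m. (1 / (b + c - x + real t + 1)) ^ (card U2 - (m - t))) *
       (\<Prod>t<m. (1 / (c - x + real t + 1)) ^ (card U3 - (m - t))) *
       (\<Prod>t\<in>{1..<m}. (1 / (- (a + x - real t))) ^ (M - t)))" for x
  proof -
    have inverse: "(\<Prod>t\<in>T. (1 / g t) ^ e t) = 1 / (\<Prod>t\<in>T. g t ^ e t)" for T :: "nat set" and g :: "nat \<Rightarrow> real" and e
      by (simp add: power_one_over prod_dividef)
    show ?thesis
      unfolding S_fun_def S_den_eq[OF fin] pochhammer_S[OF fin] M_def[symmetric] sgn_def[symmetric] inverse by simp
  qed
  have "asy SS (0 + int M * (\<Sum>t\<in>{1..<m}. 1) + ((\<Sum>t<m. int (card U2 - (m - t)) * - 1) + (\<Sum>t<m. int (card U3 - (m - t)) * - 1)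
      + (\<Sum>t\<in>{1..<m}. int (M - t) * - 1))) k"
    unfolding S[abs_def] k_def
    by (intro asy_mult asy_const asy_power asy_prod lin inv inva) auto
  moreover have "(\<Sum>t<m. int (card U2 - (m - t)) * - 1) = - int (card U2 choose 2)"
    unfolding mult_minus1_right sum_negf of_nat_sum[symmetric] sum_nat_minus_choose(1)[OF card_le_rows(1)[OF fin]] ..
  moreover have "(\<Sum>t<m. int (card U3 - (m - t)) * - 1) = - int (card U3 choose 2)"
    unfolding mult_minus1_right sum_negf of_nat_sum[symmetric] sum_nat_minus_choose(1)[OF card_le_rows(2)[OF fin]] ..
  moreover have "(\<Sum>t\<in>{1..<m}. int (M - t) * - 1) = - int (M choose 2)"
    unfolding mult_minus1_right sum_negf of_nat_sum[symmetric] M_def sum_nat_minus_choose(2)[OF card_le_rows(3)[OF fin]] ..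
  moreover have "int M * (\<Sum>t\<in>{1..<m}. 1) = int M * (int m - 1)"
    using card_le_rows(3)[OF fin] by (cases "m = 0") (auto simp: M_def)
  moreover have "k \<noteq> 0" by (simp add: k_def sgn_def)
  ultimately have "asy SS (0 + int M * (int m - 1) + (- int (card U2 choose 2) + - int (card U3 choose 2) + - int (M choose 2))) k" "k \<noteq> 0"
    by (simp_all only: not_False_eq_True)
  then show ?thesis
    by (intro exI[of _ k]) (simp add: M_def algebra_simps)
qed

text \<open>In \<open>asy_det\<close> the unit row receives the weight m - 1 - k, which gives order
  0 to its only nonzero entry.\<close>

lemma asy_cofactor_E_mat:
  assumes deg: "\<And>l. l < m \<Longrightarrow> degree (Yh l) \<le> idx l" and h: "h < m" and k: "k < m"
  shows "\<exists>K. asy (\<lambda>x. cofactor (E_mat x) h k) (int (\<Sum>l<m. idx l) - int (idx h) - int (m choose 2) + int (m - 1 - k)) K"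
proof -
  define c0 where "c0 l j = (if l = h then (if j = k then 1 else 0)
      else coeff (Yh l) (idx l) * pochhammer (kap a b c (fam l) - real (idx l)) (m - 1 - j))" for l j
  have "asy (\<lambda>x. det (mat m m (\<lambda>(l, j). if l = h then (if j = k then 1 else 0) else E_fun l (m - 1 - j) (x - real m))))
     ((\<Sum>l<m. if l = h then int (m - 1 - k) else int (idx l)) - (\<Sum>j<m. int (m - 1 - j))) (det (mat m m (\<lambda>(l, j). c0 l j)))"
  proof (rule asy_det)
    fix l j assume l: "l < m" and j: "j < m"
    show "asy (\<lambda>x. if l = h then (if j = k then 1 else 0) else E_fun l (m - 1 - j) (x - real m))
        ((if l = h then int (m - 1 - k) else int (idx l)) - int (m - 1 - j)) (c0 l j)"
      using asy_const[of 1] asy_zero asy_shift[OF asy_E_fun[OF deg[OF l], of "m - 1 - j"], of "- real m"]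
      by (auto simp: c0_def)
  qed
  moreover have "det (mat m m (\<lambda>(l, j). if l = h then (if j = k then 1 else 0) else E_fun l (m - 1 - j) (x - real m))) = cofactor (E_mat x) h k" for x
  proof -
    have "E_mat x \<in> carrier_mat m m" by (simp add: E_mat_def)
    from det_replace_row_unit[OF this h k] show ?thesis
      by (rule trans[rotated]) (rule arg_cong[where f = det], rule eq_matI, auto simp: E_mat_def)
  qed
  moreover have "(\<Sum>l<m. if l = h then int (m - 1 - k) else int (idx l)) = int (\<Sum>l<m. idx l) - int (idx h) + int (m - 1 - k)"
  proof -
    have "(\<Sum>l<m. if l = h then int (m - 1 - k) else int (idx l)) = int (m - 1 - k) + (\<Sum>l\<in>{..<m} - {h}. int (idx l))"
      using h by (subst sum.remove[of _ h]) (auto intro!: sum.cong)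
    moreover have "(\<Sum>l<m. int (idx l)) = int (idx h) + (\<Sum>l\<in>{..<m} - {h}. int (idx l))"
      using h by (subst sum.remove[of _ h]) auto
    ultimately show ?thesis by simp
  qed
  moreover have "(\<Sum>j<m. int (m - 1 - j)) = int (m choose 2)"
  proof -
    have "(\<Sum>j<m. m - 1 - j) = (\<Sum>i<m. i)"
      by (rule sum.reindex_bij_witness[of _ "\<lambda>i. m - 1 - i" "\<lambda>i. m - 1 - i"]) auto
    moreover have "(\<Sum>i<n. i) = n choose 2" for n by (induction n) (auto simp: numeral_2_eq_2)
    ultimately show ?thesis by (metis of_nat_sum)
  qed
  ultimately show ?thesis by (auto simp: algebra_simps)
qed

lemma asy_Omega_D:
  assumes deg: "\<And>l. l < m \<Longrightarrow> degree (Yh l) \<le> idx l" and lc: "\<And>l. l < m \<Longrightarrow> coeff (Yh l) (idx l) \<noteq> 0"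
    and inj: "inj_on (\<lambda>l. kap a b c (fam l) - real (idx l)) {..<m}"
  shows "\<exists>K. K \<noteq> 0 \<and> asy (Omega_D a b c U1 U2 U3) (int (\<Sum>l<m. idx l) - int (m choose 2)) K"
proof -
  have "asy (\<lambda>x. det (mat m m (\<lambda>(l, j). E_fun l (m - 1 - j) (x - real m))))
     ((\<Sum>l<m. int (idx l)) - (\<Sum>j<m. int (m - 1 - j)))
     (det (mat m m (\<lambda>(l, j). coeff (Yh l) (idx l) * pochhammer (kap a b c (fam l) - real (idx l)) (m - 1 - j))))"
    (is "asy _ _ ?K")
  proof (rule asy_det)
    fix l j assume l: "l < m" and j: "j < m"
    show "asy (\<lambda>x. E_fun l (m - 1 - j) (x - real m)) (int (idx l) - int (m - 1 - j))
      (coeff (Yh l) (idx l) * pochhammer (kap a b c (fam l) - real (idx l)) (m - 1 - j))"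
      using asy_shift[OF asy_E_fun[OF deg[OF l], of "m - 1 - j"], of "- real m"] by simp
  qed
  moreover have "?K \<noteq> 0" by (rule det_pochhammer_nz[OF inj lc])
  moreover have "(\<Sum>j<m. int (m - 1 - j)) = int (m choose 2)"
  proof -
    have "(\<Sum>j<m. m - 1 - j) = (\<Sum>i<m. i)"
      by (rule sum.reindex_bij_witness[of _ "\<lambda>i. m - 1 - i" "\<lambda>i. m - 1 - i"]) auto
    moreover have "(\<Sum>i<n. i) = n choose 2" for n by (induction n) (auto simp: numeral_2_eq_2)
    ultimately show ?thesis by (metis of_nat_sum)
  qed
  ultimately show ?thesis
    unfolding Omega_D_E_mat[abs_def] E_mat_def by auto
qed

text \<open>D is the degree of the product of S and \<Omega>, so P has degree D + 1. The bound D - u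
  for M_h, with u the index of row h, leaves room for the order u of Y_h(\<Gamma>) and the order 1
  of the D-operator within D + 1.\<close>

theorem D_procedure_data_exists:
  assumes deg: "\<And>l. l < m \<Longrightarrow> degree (Yh l) \<le> idx l" and lc: "\<And>l. l < m \<Longrightarrow> coeff (Yh l) (idx l) \<noteq> 0"
    and inj: "inj_on (\<lambda>l. kap a b c (fam l) - real (idx l)) {..<m}"
    and D: "D = int (\<Sum>l<m. idx l) - int (card U1 choose 2) - int (card U2 choose 2) - int (card U3 choose 2)"
  shows "\<exists>P M. D_procedure_data a b c U1 U2 U3 P M \<and> D \<ge> 0 \<and> degree P \<le> Suc (nat D) \<and> coeff P (Suc (nat D)) \<noteq> 0 \<and>
    (\<forall>h<m. \<forall>i. int i > D - int (idx h) \<longrightarrow> coeff (M h) i = 0)"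
proof -
  obtain kS where kS: "kS \<noteq> 0" "asy SS (int (card U2 + card U3) * (int m - 1) - int (card U2 choose 2) - int (card U3 choose 2)
    - int ((card U2 + card U3) choose 2)) kS"
    using asy_S_fun by blast
  define dS where "dS = int (card U2 + card U3) * (int m - 1) - int (card U2 choose 2) - int (card U3 choose 2)
    - int ((card U2 + card U3) choose 2)"
  \<comment> \<open>With m = card U1 + M and M = card U2 + card U3, the contributions of M to the
    two binomial coefficients cancel against M (m - 1); only that of the first family is
    left.\<close>
  have "2 * (int (card U2 + card U3) * (int m - 1) - int ((card U2 + card U3) choose 2) - int (m choose 2)) = - 2 * int (card U1 choose 2)"
    using two_choose_two[of "card U2 + card U3"] two_choose_two[of m] two_choose_two[of "card U1"]
    by (simp add: num_rows_def algebra_simps)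
  then have D': "D = dS + int (\<Sum>l<m. idx l) - int (m choose 2)" unfolding D dS_def by simp
  obtain K where K: "K \<noteq> 0" "asy (Omega_D a b c U1 U2 U3) (int (\<Sum>l<m. idx l) - int (m choose 2)) K"
    using asy_Omega_D[OF deg lc inj] by blast
  have SO: "asy (\<lambda>x. SS x * Omega_D a b c U1 U2 U3 x) D (kS * K)"
    using asy_mult[OF kS(2) K(2)] unfolding D' dS_def by (simp add: algebra_simps)
  obtain W where W: "\<forall>\<^sub>F x in cofinite. SS x * Omega_D a b c U1 U2 U3 x = poly W x"
    using polyfun_S_Omega[OF fin] unfolding polyfun_def by blast
  have "asy (poly W) D (kS * K)" using asy_cong[OF SO W] .
  from asy_poly_degree[OF this] kS K have dW: "D = int (degree W)" "lead_coeff W \<noteq> 0" by auto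
  obtain P where P: "\<And>x. poly P x - poly P (x - 1) = poly W x" "degree P \<le> Suc (degree W)"
      "coeff P (Suc (degree W)) = coeff W (degree W) / real (Suc (degree W))"
    using ex_poly_antidifference[of W "degree W"] by blast
  define Q where "Q h Mh \<longleftrightarrow> (\<forall>\<^sub>F x in cofinite. poly Mh x = M_fun a b c U1 U2 U3 h x) \<and> (\<forall>i. int i > D - int (idx h) \<longrightarrow> coeff Mh i = 0)" for h Mh
  have ex: "\<exists>Mh. Q h Mh" if h: "h < m" for h
  proof -
    obtain Mh where Mh: "\<forall>\<^sub>F x in cofinite. M_fun a b c U1 U2 U3 h x = poly Mh x"
      using polyfun_M_fun[OF fin h] unfolding polyfun_def by blast
    have "\<exists>k'. asy (\<lambda>x. \<Sum>i\<le>m - 1 - k. real ((m - 1 - k) choose i) *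
        (xih h x i * (SS (x - real i + real m) * cofactor (E_mat (x - real i + real m)) h k))) (D - int (idx h)) k'"
      if k: "k < m" for k
    proof -
      obtain K' where K': "asy (\<lambda>x. cofactor (E_mat x) h k) (int (\<Sum>l<m. idx l) - int (idx h) - int (m choose 2) + int (m - 1 - k)) K'"
        using asy_cofactor_E_mat[OF deg h k] by blast
      have "asy (\<lambda>x. SS (x + real m) * cofactor (E_mat (x + real m)) h k)
          (dS + (int (\<Sum>l<m. idx l) - int (idx h) - int (m choose 2) + int (m - 1 - k))) (kS * K')"
        by (rule asy_mult[OF asy_shift asy_shift]) (use kS K' in \<open>simp_all add: dS_def\<close>)
      from asy_binomial_xi[OF this, of "m - 1 - k" h] show ?thesis
        unfolding D' by (simp add: algebra_simps)
    qed
    then have "\<exists>k'. asy (M_fun a b c U1 U2 U3 h) (D - int (idx h)) k'"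
      unfolding M_fun_E_mat[OF h, abs_def] by (rule asy_sum_ex[OF finite_lessThan]) auto
    then obtain k' where "asy (M_fun a b c U1 U2 U3 h) (D - int (idx h)) k'" ..
    from asy_polyD(1)[OF asy_cong[OF this Mh]] have "\<forall>i. int i > D - int (idx h) \<longrightarrow> coeff Mh i = 0" by blast
    moreover have "\<forall>\<^sub>F x in cofinite. poly Mh x = M_fun a b c U1 U2 U3 h x"
      using Mh by eventually_elim simp
    ultimately show ?thesis unfolding Q_def by blast
  qed
  define M where "M h = (SOME Mh. Q h Mh)" for h
  have "Q h (M h)" if "h < m" for h
    unfolding M_def using ex[OF that] by (rule someI_ex)
  then have M: "h < m \<Longrightarrow> \<forall>\<^sub>F x in cofinite. poly (M h) x = M_fun a b c U1 U2 U3 h x"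
    "h < m \<Longrightarrow> int i > D - int (idx h) \<Longrightarrow> coeff (M h) i = 0" for h i
    unfolding Q_def by blast+
  have "\<forall>\<^sub>F x in cofinite. poly P x - poly P (x - 1) = SS x * Omega_D a b c U1 U2 U3 x"
    using W by eventually_elim (simp add: P)
  then have "D_procedure_data a b c U1 U2 U3 P M"
    unfolding D_procedure_data_def using M(1) by blast
  moreover have "nat D = degree W" using dW by simp
  ultimately show ?thesis using P dW M(2) by (intro exI[of _ P] exI[of _ M]) auto
qed

end

end

section \<open>The order of a difference operator\<close>

definition ratf :: "(real \<Rightarrow> real) \<Rightarrow> bool" where
  "ratf f \<longleftrightarrow> (\<exists>d c. asy f d c)"

lemma ratf_asy: "asy f d c \<Longrightarrow> ratf f"
  by (auto simp: ratf_def)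

lemma ratf_mult: "ratf f \<Longrightarrow> ratf g \<Longrightarrow> ratf (\<lambda>x. f x * g x)"
  unfolding ratf_def using asy_mult by blast

lemma ratf_add: "ratf f \<Longrightarrow> ratf g \<Longrightarrow> ratf (\<lambda>x. f x + g x)"
proof -
  assume "ratf f" "ratf g"
  then obtain d c d' c' where "asy f d c" "asy g d' c'" by (auto simp: ratf_def)
  then have "asy f (max d d' + 1) 0" "asy g (max d d' + 1) 0" by (auto intro: asy_mono)
  then show ?thesis by (blast intro: ratf_asy asy_add)
qed

lemma ratf_shift: "ratf f \<Longrightarrow> ratf (\<lambda>x. f (x + h))"
  unfolding ratf_def using asy_shift by blast

lemma ratf_zero: "ratf (\<lambda>_. 0)"
  using asy_zero by (rule ratf_asy)

lemma ratf_sum: "finite A \<Longrightarrow> (\<And>i. i \<in> A \<Longrightarrow> ratf (f i)) \<Longrightarrow> ratf (\<lambda>x. \<Sum>i\<in>A. f i x)"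
  by (induction A rule: finite_induct) (auto intro: ratf_add ratf_zero)

text \<open>\<open>dop T d t b\<close>: \<open>T\<close> is a difference operator of order \<open>d\<close> with rational coefficients, the
  extreme ones of which behave like $t x^d$ and $b x^d$ at infinity.\<close>

definition dop :: "((real \<Rightarrow> real) \<Rightarrow> real \<Rightarrow> real) \<Rightarrow> nat \<Rightarrow> real \<Rightarrow> real \<Rightarrow> bool" where
  "dop T d t b \<longleftrightarrow> (\<exists>h :: int \<Rightarrow> real \<Rightarrow> real. (\<forall>j. ratf (h j)) \<and> (\<forall>j. \<bar>j\<bar> > int d \<longrightarrow> h j = (\<lambda>_. 0)) \<and>
     asy (h (int d)) (int d) t \<and> asy (h (- int d)) (int d) b \<and>
     (\<forall>f x. T f x = (\<Sum>j=- int d..int d. h j x * f (x + of_int j))))"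

lemma dopE:
  assumes "dop T d t b"
  obtains h where "\<And>j. ratf (h j)" "\<And>j. \<bar>j\<bar> > int d \<Longrightarrow> h j = (\<lambda>_. 0)"
    "asy (h (int d)) (int d) t" "asy (h (- int d)) (int d) b"
    "\<And>f x. T f x = (\<Sum>j=- int d..int d. h j x * f (x + of_int j))"
  using assms unfolding dop_def by blast

lemma dop_mono:
  assumes "dop T d t b" "d < e"
  shows "dop T e 0 0"
proof -
  from assms(1) obtain h where h: "\<And>j. ratf (h j)" "\<And>j. \<bar>j\<bar> > int d \<Longrightarrow> h j = (\<lambda>_. 0)"
    "\<And>f x. T f x = (\<Sum>j=- int d..int d. h j x * f (x + of_int j))"
    by (elim dopE) blast
  have "T f x = (\<Sum>j=- int e..int e. h j x * f (x + of_int j))" for f x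
    unfolding h(3) by (rule sum.mono_neutral_left) (use assms(2) h(2) in auto)
  moreover have "h (int e) = (\<lambda>_. 0)" "h (- int e) = (\<lambda>_. 0)" "\<And>j. \<bar>j\<bar> > int e \<Longrightarrow> h j = (\<lambda>_. 0)"
    using assms(2) by (auto intro!: h(2))
  ultimately show ?thesis
    unfolding dop_def using h(1) by (intro exI[of _ h]) (auto simp: asy_zero)
qed

lemma dop_add:
  assumes "dop S d t b" "dop T d t' b'"
  shows "dop (\<lambda>f x. S f x + T f x) d (t + t') (b + b')"
proof -
  from assms(1) obtain h where h: "\<And>j. ratf (h j)" "\<And>j. \<bar>j\<bar> > int d \<Longrightarrow> h j = (\<lambda>_. 0)"
    "asy (h (int d)) (int d) t" "asy (h (- int d)) (int d) b"
    "\<And>f x. S f x = (\<Sum>j=- int d..int d. h j x * f (x + of_int j))" by (elim dopE) blast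
  from assms(2) obtain g where g: "\<And>j. ratf (g j)" "\<And>j. \<bar>j\<bar> > int d \<Longrightarrow> g j = (\<lambda>_. 0)"
    "asy (g (int d)) (int d) t'" "asy (g (- int d)) (int d) b'"
    "\<And>f x. T f x = (\<Sum>j=- int d..int d. g j x * f (x + of_int j))" by (elim dopE) blast
  show ?thesis
    unfolding dop_def
    by (rule exI[of _ "\<lambda>j x. h j x + g j x"])
       (use h g in \<open>auto intro!: ratf_add asy_add simp: distrib_right sum.distrib\<close>)
qed

lemma dop_cmult:
  assumes "dop T d t b"
  shows "dop (\<lambda>f x. k * T f x) d (k * t) (k * b)"
proof -
  from assms(1) obtain h where h: "\<And>j. ratf (h j)" "\<And>j. \<bar>j\<bar> > int d \<Longrightarrow> h j = (\<lambda>_. 0)"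
    "asy (h (int d)) (int d) t" "asy (h (- int d)) (int d) b"
    "\<And>f x. T f x = (\<Sum>j=- int d..int d. h j x * f (x + of_int j))" by (elim dopE) blast
  have "k * T f x = (\<Sum>j=- int d..int d. k * h j x * f (x + of_int j))" for f x
    by (simp add: h(5) sum_distrib_left mult.assoc)
  then show ?thesis
    unfolding dop_def using h(1-4)
    by (intro exI[of _ "\<lambda>j x. k * h j x"]) (auto intro!: ratf_mult ratf_asy[OF asy_const] asy_cmult)
qed

lemma dop_id: "dop (\<lambda>f. f) 0 1 1"
  unfolding dop_def
  by (rule exI[of _ "\<lambda>j x. if j = 0 then 1 else 0"])
     (use asy_const[of 1] in \<open>auto simp: asy_zero intro: ratf_asy ratf_zero\<close>)

lemma dop_zero: "dop (\<lambda>f x. 0) d 0 0"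
  unfolding dop_def by (rule exI[of _ "\<lambda>j x. 0"]) (auto simp: asy_zero ratf_zero)

lemma dop_sum:
  assumes "finite A" "\<And>i. i \<in> A \<Longrightarrow> dop (T i) d (t i) (b i)"
  shows "dop (\<lambda>f x. \<Sum>i\<in>A. T i f x) d (\<Sum>i\<in>A. t i) (\<Sum>i\<in>A. b i)"
  using assms by (induction A rule: finite_induct) (auto intro: dop_add dop_zero)

text \<open>The extreme coefficient of a composition is the product of the extreme coefficients, one
  of them shifted, since no other pair of shifts adds up to d + e.\<close>

lemma dop_comp:
  assumes "dop S d t b" "dop T e t' b'"
  shows "dop (\<lambda>f. S (T f)) (d + e) (t * t') (b * b')"
proof -
  from assms(1) obtain h where h: "\<And>j. ratf (h j)" "\<And>j. \<bar>j\<bar> > int d \<Longrightarrow> h j = (\<lambda>_. 0)"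
    "asy (h (int d)) (int d) t" "asy (h (- int d)) (int d) b"
    "\<And>f x. S f x = (\<Sum>j=- int d..int d. h j x * f (x + of_int j))" by (elim dopE) blast
  from assms(2) obtain g where g: "\<And>j. ratf (g j)" "\<And>j. \<bar>j\<bar> > int e \<Longrightarrow> g j = (\<lambda>_. 0)"
    "asy (g (int e)) (int e) t'" "asy (g (- int e)) (int e) b'"
    "\<And>f x. T f x = (\<Sum>j=- int e..int e. g j x * f (x + of_int j))" by (elim dopE) blast
  define k where "k l x = (\<Sum>i=- int d..int d. h i x * g (l - i) (x + of_int i))" for l x
  have g0: "g j x = 0" if "\<bar>j\<bar> > int e" for j x using g(2)[OF that] by simp
  have h0: "h j x = 0" if "\<bar>j\<bar> > int d" for j x using h(2)[OF that] by simp
  have eq: "S (T f) x = (\<Sum>l=- int (d + e)..int (d + e). k l x * f (x + of_int l))" for f x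
  proof -
    have "S (T f) x = (\<Sum>i=- int d..int d. \<Sum>j=- int e..int e. h i x * g j (x + of_int i) * f (x + of_int (i + j)))"
      unfolding h(5) g(5) by (simp add: sum_distrib_left mult.assoc add.assoc)
    also have "\<dots> = (\<Sum>i=- int d..int d. \<Sum>l=- int (d + e)..int (d + e). h i x * g (l - i) (x + of_int i) * f (x + of_int l))"
    proof (rule sum.cong[OF refl])
      fix i assume i: "i \<in> {- int d..int d}"
      have "(\<Sum>j=- int e..int e. h i x * g j (x + of_int i) * f (x + of_int (i + j)))
          = (\<Sum>l=i - int e..i + int e. h i x * g (l - i) (x + of_int i) * f (x + of_int l))"
        by (rule sum.reindex_bij_witness[of _ "\<lambda>l. l - i" "\<lambda>j. i + j"]) auto
      also have "\<dots> = (\<Sum>l=- int (d + e)..int (d + e). h i x * g (l - i) (x + of_int i) * f (x + of_int l))"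
        by (rule sum.mono_neutral_left) (use i in \<open>auto intro!: g0\<close>)
      finally show "(\<Sum>j=- int e..int e. h i x * g j (x + of_int i) * f (x + of_int (i + j)))
          = (\<Sum>l=- int (d + e)..int (d + e). h i x * g (l - i) (x + of_int i) * f (x + of_int l))" .
    qed
    also have "\<dots> = (\<Sum>l=- int (d + e)..int (d + e). k l x * f (x + of_int l))"
      by (subst sum.swap) (simp add: k_def sum_distrib_right)
    finally show ?thesis .
  qed
  have rat: "ratf (k l)" for l
    unfolding k_def[abs_def] by (intro ratf_sum ratf_mult ratf_shift h g) simp
  have top: "k (int (d + e)) = (\<lambda>x. h (int d) x * g (int e) (x + of_int (int d)))"
  proof
    fix x
    have "k (int (d + e)) x = (\<Sum>i\<in>{int d}. h i x * g (int (d + e) - i) (x + of_int i))"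
      unfolding k_def by (rule sum.mono_neutral_right) (auto intro!: g0)
    then show "k (int (d + e)) x = h (int d) x * g (int e) (x + of_int (int d))" by simp
  qed
  have bot: "k (- int (d + e)) = (\<lambda>x. h (- int d) x * g (- int e) (x + of_int (- int d)))"
  proof
    fix x
    have "k (- int (d + e)) x = (\<Sum>i\<in>{- int d}. h i x * g (- int (d + e) - i) (x + of_int i))"
      unfolding k_def by (rule sum.mono_neutral_right) (auto intro!: g0)
    then show "k (- int (d + e)) x = h (- int d) x * g (- int e) (x + of_int (- int d))" by simp
  qed
  have "asy (k (int (d + e))) (int d + int e) (t * t')"
    unfolding top by (intro asy_mult asy_shift h g)
  then have "asy (k (int (d + e))) (int (d + e)) (t * t')" by (simp only: of_nat_add)
  moreover have "asy (k (- int (d + e))) (int d + int e) (b * b')"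
    unfolding bot by (intro asy_mult asy_shift h g)
  then have "asy (k (- int (d + e))) (int (d + e)) (b * b')" by (simp only: of_nat_add)
  moreover have "k j = (\<lambda>_. 0)" if "\<bar>j\<bar> > int (d + e)" for j
  proof
    fix x
    show "k j x = 0" unfolding k_def
    proof (intro sum.neutral ballI)
      fix i assume "i \<in> {- int d..int d}"
      with that have "\<bar>j - i\<bar> > int e" by auto
      then show "h i x * g (j - i) (x + of_int i) = 0" by (simp add: g0)
    qed
  qed
  ultimately show ?thesis unfolding dop_def using rat eq by blast
qed

lemma dop_three_term:
  assumes "\<And>f x. T f x = u x * f (x + 1) + v x * f x + w x * f (x - 1)"
    "asy u 1 t" "ratf v" "asy w 1 b"
  shows "dop T 1 t b"
proof -
  define h where "h j = (if j = 1 then u else if j = 0 then v else if j = - 1 then w else (\<lambda>_. 0))" for j :: int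
  have "{- 1..1 :: int} = {- 1, 0, 1}" by auto
  then show ?thesis
    unfolding dop_def using assms
    by (intro exI[of _ h]) (auto simp: h_def ratf_zero intro: ratf_asy)
qed

lemma dop_power:
  assumes "dop T 1 t b"
  shows "dop (T ^^ n) n (t ^ n) (b ^ n)"
proof (induction n)
  case 0
  have "(T ^^ 0) = (\<lambda>f. f)" by (simp add: fun_eq_iff)
  then show ?case using dop_id by simp
next
  case (Suc n)
  have "(T ^^ Suc n) = (\<lambda>f. T ((T ^^ n) f))" by (simp add: fun_eq_iff)
  then show ?case using dop_comp[OF assms Suc] by simp
qed

lemma dop_poly_at_operator:
  assumes "dop T 1 t b" "degree p \<le> n"
  shows "dop (poly_at_operator p T) n (coeff p n * t ^ n) (coeff p n * b ^ n)"
proof -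
  have "dop (\<lambda>f x. coeff p i * (T ^^ i) f x) n (if i = n then coeff p n * t ^ n else 0) (if i = n then coeff p n * b ^ n else 0)"
    if "i \<le> n" for i
    using that dop_cmult[OF dop_power[OF assms(1)], of "coeff p i" i]
    by (cases "i = n") (auto intro: dop_mono)
  then have "dop (\<lambda>f x. \<Sum>i\<le>n. coeff p i * (T ^^ i) f x) n (\<Sum>i\<le>n. if i = n then coeff p n * t ^ n else 0)
      (\<Sum>i\<le>n. if i = n then coeff p n * b ^ n else 0)"
    by (intro dop_sum) auto
  moreover have "(\<Sum>i\<le>n. coeff p i * (T ^^ i) f x) = poly_at_operator p T f x" for f x
    unfolding poly_at_operator_def by (rule sum.mono_neutral_right) (use assms(2) in \<open>auto simp: coeff_eq_0\<close>)
  ultimately show ?thesis by simp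
qed

section \<open>Extreme coefficients of the operator\<close>

lemma asy_sq_quotient:
  assumes "asy n d k" "e = d - 2"
  shows "asy (\<lambda>x. n x / ((2 * x + s) * (2 * x + s'))) e (k / 4)"
proof -
  have "asy (\<lambda>x. n x * (1 / (s + 2 * x) * (1 / (s' + 2 * x)))) (d + (- 1 + - 1)) (k * (1 / 2 * (1 / 2)))"
    by (intro asy_mult asy_inverse_linear assms) auto
  then show ?thesis by (simp add: assms(2) add.commute[of s] add.commute[of s'])
qed

lemma asy_plus: "asy (\<lambda>x. x + s) 1 1" "asy (\<lambda>x. s - x) 1 (- 1)" "asy (\<lambda>x. x) 1 1"
  using asy_linear[of s 1] asy_linear[of s "-1"] asy_linear[of 0 1] by (simp_all add: add.commute)

lemma asy_B_fun: "asy (B_fun a b c) 1 (1 / 4)"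
proof -
  have "asy (\<lambda>x. - ((x + (a + 1)) * (x + (a + b + 1)) * (c - x) / ((2 * x + (a + b + 1)) * (2 * x + (a + b + 2))))) 1 (- (1 * 1 * - 1 / 4))"
    using asy_mult[OF asy_mult[OF asy_plus(1) asy_plus(1)] asy_plus(2), of "a + 1" "a + b + 1" c]
    by (intro asy_minus asy_sq_quotient[where d = 3]) simp_all
  then show ?thesis by (simp add: B_fun_def[abs_def] add.assoc)
qed

lemma asy_D_fun: "asy (D_fun a b c) 1 (- 1 / 4)"
proof -
  have "asy (\<lambda>x. - (x * (x + (a + b + c + 1)) * (x + b) / ((2 * x + (a + b)) * (2 * x + (a + b + 1))))) 1 (- (1 * 1 * 1 / 4))"
    using asy_mult[OF asy_mult[OF asy_plus(3) asy_plus(1)] asy_plus(1), of "a + b + c + 1" b]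
    by (intro asy_minus asy_sq_quotient[where d = 3]) simp_all
  then show ?thesis by (simp add: D_fun_def[abs_def] add.assoc)
qed

lemma dop_Gamma_op: "dop (Gamma_op a b c) 1 (1 / 4) (- 1 / 4)"
proof (rule dop_three_term)
  show "Gamma_op a b c f x = B_fun a b c x * f (x + 1) + (- (B_fun a b c x + D_fun a b c x)) * f x + D_fun a b c x * f (x - 1)" for f x
    by (simp add: Gamma_op_def algebra_simps)
  show "ratf (\<lambda>x. - (B_fun a b c x + D_fun a b c x))"
    using asy_minus[OF asy_add[OF asy_B_fun asy_D_fun]] by (rule ratf_asy)
qed (rule asy_B_fun asy_D_fun)+

lemma ratf_diff: "ratf f \<Longrightarrow> ratf g \<Longrightarrow> ratf (\<lambda>x. f x - g x)"
  using ratf_add[of f "\<lambda>x. - 1 * g x"] ratf_mult[of "\<lambda>_. - 1" g] ratf_asy[OF asy_const, of "- 1"] by simp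

lemma asy_D_plus: "\<exists>k. asy (D_plus a b c fam) 0 k"
proof (cases fam)
  case First
  have "asy (\<lambda>x. - ((x + (a + 1)) * (x + (a + b + 1)) / ((2 * x + (a + b + 1)) * (2 * x + (a + b + 2))))) 0 (- (1 / 4))"
    using asy_mult[OF asy_plus(1) asy_plus(1), of "a + 1" "a + b + 1"]
    by (intro asy_minus asy_sq_quotient[where d = 2]) simp_all
  then show ?thesis unfolding First D_plus.simps(1)[abs_def] by (auto simp: add.assoc)
next
  case Second
  have "asy (\<lambda>x. (x + (a + 1)) * (c - x) / ((2 * x + (a + b + 1)) * (2 * x + (a + b + 2)))) 0 (- 1 / 4)"
    using asy_mult[OF asy_plus(1) asy_plus(2), of "a + 1" c]
    by (intro asy_sq_quotient[where d = 2]) simp_all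
  then show ?thesis unfolding Second D_plus.simps(2)[abs_def] by (auto simp: add.assoc)
next
  case Third
  have "asy (\<lambda>x. (x + (a + b + 1)) * (c - x) / ((2 * x + (a + b + 1)) * (2 * x + (a + b + 2)))) 0 (- 1 / 4)"
    using asy_mult[OF asy_plus(1) asy_plus(2), of "a + b + 1" c]
    by (intro asy_sq_quotient[where d = 2]) simp_all
  then show ?thesis unfolding Third D_plus.simps(3)[abs_def] by (auto simp: add.assoc)
qed

lemma asy_D_minus: "\<exists>k. asy (D_minus a b c fam) 0 k"
proof (cases fam)
  case First
  have "asy (\<lambda>x. x * (x + b) / ((2 * x + (a + b)) * (2 * x + (a + b + 1)))) 0 (1 / 4)"
    using asy_mult[OF asy_plus(3) asy_plus(1), of b]
    by (intro asy_sq_quotient[where d = 2]) simp_all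
  then show ?thesis unfolding First D_minus.simps(1)[abs_def] by (auto simp: add.assoc)
next
  case Second
  have "asy (\<lambda>x. (x + b) * (x + (a + b + c + 1)) / ((2 * x + (a + b)) * (2 * x + (a + b + 1)))) 0 (1 / 4)"
    using asy_mult[OF asy_plus(1) asy_plus(1), of b "a + b + c + 1"]
    by (intro asy_sq_quotient[where d = 2]) simp_all
  then show ?thesis unfolding Second D_minus.simps(2)[abs_def] by (auto simp: add.assoc)
next
  case Third
  have "asy (\<lambda>x. x * (x + (a + b + c + 1)) / ((2 * x + (a + b)) * (2 * x + (a + b + 1)))) 0 (1 / 4)"
    using asy_mult[OF asy_plus(3) asy_plus(1), of "a + b + c + 1"]
    by (intro asy_sq_quotient[where d = 2]) simp_all
  then show ?thesis unfolding Third D_minus.simps(3)[abs_def] by (auto simp: add.assoc)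
qed

text \<open>The coefficients of a D-operator are bounded at infinity, one order below those of
  \<Gamma>, so its extreme coefficients count as 0. Hence the summands with M_h and Y_h cannot
  affect the extreme coefficients coming from P(\<Gamma>).\<close>

lemma dop_D_op: "dop (D_op a b c fam) 1 0 0"
proof (rule dop_three_term)
  show "D_op a b c fam f x = D_plus a b c fam x * f (x + 1) + (D_minus a b c fam x - D_plus a b c fam x) * f x + (- D_minus a b c fam x) * f (x - 1)" for f x
    by (simp add: D_op_eq algebra_simps)
  obtain k k' where k: "asy (D_plus a b c fam) 0 k" "asy (D_minus a b c fam) 0 k'"
    using asy_D_plus asy_D_minus by meson
  then show "asy (D_plus a b c fam) 1 0" "asy (\<lambda>x. - D_minus a b c fam x) 1 0"
    using asy_mono[OF asy_minus[OF k(2)]] by (auto intro: asy_mono)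
  show "ratf (\<lambda>x. D_minus a b c fam x - D_plus a b c fam x)"
    using k by (intro ratf_diff) (auto intro: ratf_asy)
qed

lemma dop_D_procedure_op:
  assumes D: "D \<ge> 0" and P: "degree P \<le> Suc (nat D)"
    and Y: "\<And>h. h < num_rows U1 U2 U3 \<Longrightarrow> degree (Y a b c U1 U2 U3 h) \<le> u h"
    and M: "\<And>h i. h < num_rows U1 U2 U3 \<Longrightarrow> int i > D - int (u h) \<Longrightarrow> coeff (M h) i = 0"
  shows "dop (D_procedure_op a b c U1 U2 U3 P M) (Suc (nat D))
    (coeff P (Suc (nat D)) * (1 / 4) ^ Suc (nat D)) (coeff P (Suc (nat D)) * (- 1 / 4) ^ Suc (nat D))"
proof -
  let ?T = "\<lambda>h f. poly_at_operator (M h) (Gamma_op a b c) (D_op a b c (fst (row_labels U1 U2 U3 ! h))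
    (poly_at_operator (Y a b c U1 U2 U3 h) (Gamma_op a b c) f))"
  have "dop (?T h) (Suc (nat D)) 0 0" if h: "h < num_rows U1 U2 U3" for h
  proof (cases "D \<ge> int (u h)")
    \<comment> \<open>A negative degree bound forces \<open>M h = 0\<close>, so the summand
      disappears.\<close>
    case False
    then have "M h = 0" by (intro poly_eqI) (simp add: M[OF h])
    then have "?T h = (\<lambda>f x. 0)" by (simp add: poly_at_operator_def fun_eq_iff)
    then show ?thesis using dop_zero by simp
  next
    case True
    have "degree (M h) \<le> nat (D - int (u h))"
      using M[OF h] True by (intro degree_le) auto
    from dop_comp[OF dop_poly_at_operator[OF dop_Gamma_op this] dop_comp[OF dop_D_op dop_poly_at_operator[OF dop_Gamma_op Y[OF h]]]]
    have "dop (?T h) (nat (D - int (u h)) + (1 + u h)) 0 0" by simp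
    moreover have "nat (D - int (u h)) + (1 + u h) = Suc (nat D)" using True by simp
    ultimately show ?thesis by simp
  qed
  then have "dop (\<lambda>f x. \<Sum>h<num_rows U1 U2 U3. ?T h f x) (Suc (nat D)) (\<Sum>h<num_rows U1 U2 U3. 0) (\<Sum>h<num_rows U1 U2 U3. 0)"
    by (intro dop_sum) auto
  from dop_add[OF dop_poly_at_operator[OF dop_Gamma_op P] this] show ?thesis
    by (simp add: D_procedure_op_def[abs_def])
qed

lemma difference_operator_translate:
  assumes "dop T d t b" "t \<noteq> 0" "b \<noteq> 0"
  shows "difference_operator (translate_operator s T) (- int d) (int d)"
proof -
  from assms(1) obtain h where h: "\<And>j. ratf (h j)" "\<And>j. \<bar>j\<bar> > int d \<Longrightarrow> h j = (\<lambda>_. 0)"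
    "asy (h (int d)) (int d) t" "asy (h (- int d)) (int d) b"
    "\<And>f x. T f x = (\<Sum>j=- int d..int d. h j x * f (x + of_int j))" by (elim dopE) blast
  have "rational_function (\<lambda>x. h j (x + - s))" for j
    using ratf_shift[OF h(1), of j "- s"] unfolding ratf_def by (auto intro: rational_function_asy)
  moreover have "translate_operator s T f x = (\<Sum>j=- int d..int d. h j (x + - s) * f (x + of_int j))" for f x
    unfolding translate_operator_def h(5) by (intro sum.cong refl) (simp add: algebra_simps)
  ultimately show ?thesis
    unfolding difference_operator_def
    using asy_not_eventually_zero[OF asy_shift[OF h(3), of "- s"] assms(2)]
      asy_not_eventually_zero[OF asy_shift[OF h(4), of "- s"] assms(3)]
    by (intro exI[of _ "\<lambda>j x. h j (x + - s)"]) simp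
qed

section \<open>Hahn polynomials\<close>

text \<open>Hahn coefficients written in the parameters of \<open>cdh\<close> through
  \<open>- c = 2 - p - q\<close>, \<open>a + 1 = 2 - p - r\<close> and
  \<open>a + b + 1 = 2 - 2 * p\<close>; p is distinguished, while q and r enter
  symmetrically.\<close>

definition hahn_coeff :: "real \<Rightarrow> real \<Rightarrow> real \<Rightarrow> nat \<Rightarrow> nat \<Rightarrow> real" where
  "hahn_coeff p q r u j = pochhammer (- real u) j * pochhammer (real u + 2 - 2 * p) j *
     pochhammer (2 - p - q + real j) (u - j) * pochhammer (2 - p - r + real j) (u - j) / fact j"

definition hahn3 :: "real \<Rightarrow> real \<Rightarrow> real \<Rightarrow> nat \<Rightarrow> real \<Rightarrow> real" where
  "hahn3 p q r u x = (\<Sum>j\<le>u. hahn_coeff p q r u j * pochhammer (- x) j)"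

lemma poly_pochhammer_neg: "poly (pochhammer [:0, -1 :: real:] n) x = pochhammer (- x) n"
  by (induction n) (auto simp: pochhammer_Suc of_nat_poly algebra_simps)

lemma poly_hahn:
  assumes "- c = 2 - p - q" "a + 1 = 2 - p - r" "a + b + 1 = 2 - 2 * p"
  shows "poly (hahn u a b c) x = hahn3 p q r u x"
proof -
  have e: "real u + a + b + 1 = real u + 2 - 2 * p" "a + real j + 1 = 2 - p - r + real j" for j
    using assms(2,3) by linarith+
  show ?thesis
    unfolding hahn_def hahn3_def hahn_coeff_def poly_sum poly_smult poly_pochhammer_neg e assms(1) atLeast0AtMost ..
qed

lemma hahn_coeff_gt: "j > u \<Longrightarrow> hahn_coeff p q r u j = 0"
  by (simp add: hahn_coeff_def pochhammer_of_nat_eq_0_iff)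

lemma hahn_coeff_rec:
  "(real j + 1) * (p + q - 2 - real j) * (p + r - 2 - real j) * hahn_coeff p q r u (Suc j)
    = (real j - real u) * (real u + 2 - 2 * p + real j) * hahn_coeff p q r u j"
proof (cases "j < u")
  case True
  then obtain k where k: "u - j = Suc k" "u - Suc j = k" by (metis Suc_diff_Suc)
  have "pochhammer (2 - p - q + real j) (Suc k) = (2 - p - q + real j) * pochhammer (2 - p - q + real (Suc j)) k"
    "pochhammer (2 - p - r + real j) (Suc k) = (2 - p - r + real j) * pochhammer (2 - p - r + real (Suc j)) k"
    by (simp_all add: pochhammer_rec algebra_simps)
  then have e: "hahn_coeff p q r u j = pochhammer (- real u) j * pochhammer (real u + 2 - 2 * p) j *
     ((2 - p - q + real j) * pochhammer (2 - p - q + real (Suc j)) k) * ((2 - p - r + real j) * pochhammer (2 - p - r + real (Suc j)) k) / fact j"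
    unfolding hahn_coeff_def k by (simp only:)
  have e': "hahn_coeff p q r u (Suc j) = (pochhammer (- real u) j * (- real u + real j)) * (pochhammer (real u + 2 - 2 * p) j * (real u + 2 - 2 * p + real j)) *
     pochhammer (2 - p - q + real (Suc j)) k * pochhammer (2 - p - r + real (Suc j)) k / ((real j + 1) * fact j)"
    unfolding hahn_coeff_def k pochhammer_Suc by (simp add: mult.commute add.commute)
  have "(real j + 1) * X / ((real j + 1) * Y) = X / Y" for X Y :: real by simp
  then have "(real j + 1) * hahn_coeff p q r u (Suc j) = (pochhammer (- real u) j * (- real u + real j)) * (pochhammer (real u + 2 - 2 * p) j * (real u + 2 - 2 * p + real j)) *
     pochhammer (2 - p - q + real (Suc j)) k * pochhammer (2 - p - r + real (Suc j)) k / fact j"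
    unfolding e' by (simp only: times_divide_eq_right)
  then have "(p + q - 2 - real j) * (p + r - 2 - real j) * ((real j + 1) * hahn_coeff p q r u (Suc j))
     = (real j - real u) * (real u + 2 - 2 * p + real j) * hahn_coeff p q r u j"
    unfolding e by (simp add: algebra_simps)
  then show ?thesis by (simp add: mult_ac)
next
  case False
  then show ?thesis by (cases "j = u") (auto simp: hahn_coeff_gt)
qed

lemma hahn_coeff_raise:
  "hahn_coeff p q r (Suc u) j = (if j = 0 then 0 else hahn_coeff (p - 1) q r u (j - 1) * (2 * p - 2 - real j))
    + (p + q - 2 - real j) * (p + r - 2 - real j) * hahn_coeff (p - 1) q r u j"
proof (cases "j \<le> Suc u")
  case False
  then show ?thesis by (auto simp: hahn_coeff_gt)
next
  case True
  define W where "W = pochhammer (2 - p - q + real j) (Suc u - j) * pochhammer (2 - p - r + real j) (Suc u - j)"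
  define B where "B = real u + 4 - 2 * p"
  have B1: "real (Suc u) + 2 - 2 * p = B - 1" "real u + 2 - 2 * (p - 1) = B" by (auto simp: B_def)
  have second: "(p + q - 2 - real j) * (p + r - 2 - real j) * hahn_coeff (p - 1) q r u j
      = pochhammer (- real u) j * pochhammer B j * W / fact j"
  proof (cases "j \<le> u")
    case True
    have "Suc u - j = Suc (u - j)" using True by simp
    then have "W = ((2 - p - q + real j) * pochhammer (2 - p - q + real j + 1) (u - j)) * ((2 - p - r + real j) * pochhammer (2 - p - r + real j + 1) (u - j))"
      unfolding W_def by (simp only: pochhammer_rec)
    note Wexp = this
    have e: "2 - (p - 1) - q + real j = 2 - p - q + real j + 1" "2 - (p - 1) - r + real j = 2 - p - r + real j + 1" by auto
    have s: "(p + q - 2 - real j) * (p + r - 2 - real j) = (2 - p - q + real j) * (2 - p - r + real j)"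
      by (simp add: algebra_simps)
    show ?thesis unfolding hahn_coeff_def B1 e s Wexp by (simp only: times_divide_eq_right mult_ac)
  next
    case False
    then show ?thesis by (simp add: hahn_coeff_gt pochhammer_of_nat_eq_0_iff)
  qed
  have lhs: "hahn_coeff p q r (Suc u) j = pochhammer (- real u - 1) j * pochhammer (B - 1) j * W / fact j"
  proof -
    have "- real (Suc u) = - real u - 1" by simp
    then show ?thesis unfolding hahn_coeff_def B1 W_def by (simp only: mult.assoc)
  qed
  show ?thesis
  proof (cases j)
    case 0
    then show ?thesis unfolding second lhs by simp
  next
    case (Suc i)
    have "2 - (p - 1) - q + real i = 2 - p - q + real j" "2 - (p - 1) - r + real i = 2 - p - r + real j" "u - i = Suc u - j"
      using Suc by auto
    then have first: "hahn_coeff (p - 1) q r u i = pochhammer (- real u) i * pochhammer B i * W / fact i"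
      unfolding hahn_coeff_def B1 W_def by (simp only: mult.assoc)
    have pm: "pochhammer (- real u - 1) j * pochhammer (B - 1) j = (- real u - 1) * (B - 1) * (pochhammer (- real u) i * pochhammer B i)"
      unfolding Suc by (simp add: pochhammer_rec)
    have pp: "pochhammer (- real u) j * pochhammer B j = (- real u + real i) * (B + real i) * (pochhammer (- real u) i * pochhammer B i)"
      unfolding Suc by (simp add: pochhammer_Suc)
    have alg: "(- real u - 1) * (B - 1) = (real i + 1) * (2 * p - 2 - real j) + (- real u + real i) * (B + real i)"
      by (simp add: B_def Suc algebra_simps)
    have fct: "(fact j :: real) = (real i + 1) * fact i" by (simp add: Suc add.commute)
    define X where "X = pochhammer (- real u) i * pochhammer B i * W"
    have "(if j = 0 then 0 else hahn_coeff (p - 1) q r u (j - 1) * (2 * p - 2 - real j)) = (real i + 1) * (2 * p - 2 - real j) * X / fact j"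
      unfolding fct by (simp add: Suc first X_def)
    moreover have "(p + q - 2 - real j) * (p + r - 2 - real j) * hahn_coeff (p - 1) q r u j = (- real u + real i) * (B + real i) * X / fact j"
      unfolding second pp X_def by simp
    moreover have "hahn_coeff p q r (Suc u) j = (- real u - 1) * (B - 1) * X / fact j"
      unfolding lhs pm X_def by simp
    ultimately show ?thesis unfolding alg by (simp add: add_divide_distrib distrib_right)
  qed
qed

text \<open>Raises the degree while lowering p by one. It is the counterpart, on the values of the
  functional, of multiplying by one more node.\<close>

lemma hahn3_raise: "hahn3 p q r (Suc u) x = x * (q + r - 1 - x) * hahn3 (p - 1) q r u (x - 1)
    + (p + q - 2 - x) * (p + r - 2 - x) * hahn3 (p - 1) q r u x"
proof -
  define h where "h = hahn_coeff (p - 1) q r u"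
  define e where "e j = pochhammer (- x) j" for j
  have e: "x * (q + r - 1 - x) * pochhammer (- (x - 1)) j + (p + q - 2 - x) * (p + r - 2 - x) * e j
      = (2 * p - 3 - real j) * e (Suc j) + (p + q - 2 - real j) * (p + r - 2 - real j) * e j" for j
  proof -
    have "x * pochhammer (- (x - 1)) j = - e (Suc j)" by (simp add: e_def pochhammer_rec)
    moreover have eS: "e (Suc j) = e j * (- x + real j)" by (simp add: e_def pochhammer_Suc)
    ultimately have "x * pochhammer (- (x - 1)) j = e j * (x - real j)" by (simp add: algebra_simps)
    then have "x * (q + r - 1 - x) * pochhammer (- (x - 1)) j = (q + r - 1 - x) * (e j * (x - real j))"
      by (metis mult.assoc mult.commute)
    then show ?thesis unfolding eS by (simp only:) (simp add: algebra_simps)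
  qed
  have "x * (q + r - 1 - x) * hahn3 (p - 1) q r u (x - 1) + (p + q - 2 - x) * (p + r - 2 - x) * hahn3 (p - 1) q r u x
      = (\<Sum>j\<le>u. h j * (x * (q + r - 1 - x) * pochhammer (- (x - 1)) j + (p + q - 2 - x) * (p + r - 2 - x) * e j))"
    unfolding hahn3_def sum_distrib_left sum.distrib[symmetric]
    by (intro sum.cong refl) (simp add: h_def e_def algebra_simps)
  also have "\<dots> = (\<Sum>j\<le>u. h j * (2 * p - 3 - real j) * e (Suc j)) + (\<Sum>j\<le>u. (p + q - 2 - real j) * (p + r - 2 - real j) * h j * e j)"
    unfolding e sum.distrib[symmetric] by (intro sum.cong refl) (simp add: algebra_simps)
  also have "(\<Sum>j\<le>u. h j * (2 * p - 3 - real j) * e (Suc j)) = (\<Sum>j\<le>Suc u. (if j = 0 then 0 else h (j - 1) * (2 * p - 2 - real j)) * e j)"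
    by (simp add: sum.atMost_Suc_shift algebra_simps del: sum.atMost_Suc)
  also have "(\<Sum>j\<le>u. (p + q - 2 - real j) * (p + r - 2 - real j) * h j * e j) = (\<Sum>j\<le>Suc u. (p + q - 2 - real j) * (p + r - 2 - real j) * h j * e j)"
    by (simp add: h_def hahn_coeff_gt)
  finally show ?thesis
    unfolding hahn3_def hahn_coeff_raise h_def e_def by (simp only: distrib_right sum.distrib)
qed

text \<open>Both shifts of x preserve the span of two neighbouring basis elements, so the equation
  reduces to \<open>hahn_coeff_rec\<close>. Its middle coefficient is \<open>jacB\<close> at n = -x
  - 1, which links it to the recurrence of \<open>cdh\<close>.\<close>

lemma hahn3_difference:
  "- x * (q + r - 1 - x) * hahn3 p q r u (x - 1) + (p + q - 2 - x) * (p + r - 2 - x) * hahn3 p q r u (x + 1)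
    + jacB p q r (- x - 1) * hahn3 p q r u x = (p - 1 - real u)\<^sup>2 * hahn3 p q r u x"
proof -
  define h where "h = hahn_coeff p q r u"
  define e where "e j = pochhammer (- x) j" for j
  define k where "k j = (real j - real u) * (real u + 2 - 2 * p + real j)" for j
  have e: "- x * (q + r - 1 - x) * pochhammer (- (x - 1)) j + (p + q - 2 - x) * (p + r - 2 - x) * pochhammer (- (x + 1)) j
      + (jacB p q r (- x - 1) - (p - 1 - real u)\<^sup>2) * e j
      = k j * e j - real j * (p + q - 1 - real j) * (p + r - 1 - real j) * e (j - 1)" for j
  proof -
    have 1: "e (Suc j) = e j * (- x + real j)" by (simp add: e_def pochhammer_Suc)
    have 2: "- x * pochhammer (- (x - 1)) j = e j * (- x + real j)"
      unfolding 1[symmetric] by (simp add: e_def pochhammer_rec)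
    show ?thesis
    proof (cases j)
      case 0
      then show ?thesis by (simp add: e_def jacB_def k_def power2_eq_square algebra_simps)
    next
      case (Suc i)
      have z: "e j = e i * (- x + real i)" by (simp add: Suc e_def pochhammer_Suc)
      have 3: "pochhammer (- (x + 1)) j = e i * (- x - 1)"
        by (simp add: Suc e_def pochhammer_rec mult.commute)
      have "- x * (q + r - 1 - x) * pochhammer (- (x - 1)) j = (q + r - 1 - x) * (e j * (- x + real j))"
        unfolding 2[symmetric] by simp
      then show ?thesis
        unfolding 3 z by (simp only:) (simp add: Suc jacB_def k_def power2_eq_square algebra_simps)
    qed
  qed
  have "- x * (q + r - 1 - x) * hahn3 p q r u (x - 1) + (p + q - 2 - x) * (p + r - 2 - x) * hahn3 p q r u (x + 1)
    + (jacB p q r (- x - 1) - (p - 1 - real u)\<^sup>2) * hahn3 p q r u x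
    = (\<Sum>j\<le>u. h j * (- x * (q + r - 1 - x) * pochhammer (- (x - 1)) j + (p + q - 2 - x) * (p + r - 2 - x) * pochhammer (- (x + 1)) j
      + (jacB p q r (- x - 1) - (p - 1 - real u)\<^sup>2) * e j))"
    unfolding hahn3_def sum_distrib_left sum.distrib[symmetric] h_def e_def
    by (intro sum.cong refl) (simp only: distrib_left mult.left_commute)
  also have "\<dots> = (\<Sum>j\<le>u. k j * h j * e j) - (\<Sum>j\<le>u. real j * (p + q - 1 - real j) * (p + r - 1 - real j) * h j * e (j - 1))"
    unfolding e sum_subtractf[symmetric] by (intro sum.cong refl) (simp add: algebra_simps)
  also have "(\<Sum>j\<le>u. real j * (p + q - 1 - real j) * (p + r - 1 - real j) * h j * e (j - 1))
      = (\<Sum>j\<le>Suc u. real j * (p + q - 1 - real j) * (p + r - 1 - real j) * h j * e (j - 1))"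
    by (simp add: h_def hahn_coeff_gt)
  also have "\<dots> = (\<Sum>j\<le>u. ((real j + 1) * (p + q - 2 - real j) * (p + r - 2 - real j) * h (Suc j)) * e j)"
    by (simp add: sum.atMost_Suc_shift algebra_simps del: sum.atMost_Suc)
  also have "\<dots> = (\<Sum>j\<le>u. k j * h j * e j)"
    unfolding h_def hahn_coeff_rec k_def ..
  finally show ?thesis by (simp add: algebra_simps)
qed

text \<open>The argument is the one used in Y_h; the sign gives the leading coefficient
  \<open>(u + 2 - 2 * p)_u\<close>, see \<open>hahn_n_poly_lead\<close>.\<close>

definition hahn_n :: "real \<Rightarrow> real \<Rightarrow> real \<Rightarrow> nat \<Rightarrow> real \<Rightarrow> real" where
  "hahn_n p q r u n = (-1) ^ u * hahn3 p q r u (- n - 1)"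

lemma hahn_n_raise: "hahn_n p q r (Suc u) n = (n + 1) * (q + r + n) * hahn_n (p - 1) q r u (n + 1)
    - (p - 1 + q + n) * (p - 1 + r + n) * hahn_n (p - 1) q r u n"
proof -
  have "- n - 1 - 1 = - (n + 1) - 1" by simp
  then show ?thesis unfolding hahn_n_def hahn3_raise[of p] by (simp only:) (simp add: algebra_simps)
qed

text \<open>Multiplied by the Pochhammer symbol \<open>(q + r)_n\<close> it becomes the three-term
  recurrence of \<open>cdh\<close> with t equal to the node \<open>(p - 1 - u)^2\<close>.\<close>

lemma hahn_n_difference:
  "(n + 1) * (n + q + r) * hahn_n p q r u (n + 1) + jacB p q r n * hahn_n p q r u n
    + (n + p + q - 1) * (n + p + r - 1) * hahn_n p q r u (n - 1) = (p - 1 - real u)\<^sup>2 * hahn_n p q r u n"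
proof -
  have "- n - 1 - 1 = - (n + 1) - 1" "- n - 1 + 1 = - (n - 1) - 1" "- (- n - 1) - 1 = n" by simp_all
  with hahn3_difference[of "- n - 1" q r p u]
  have "(n + 1) * (n + q + r) * hahn3 p q r u (- (n + 1) - 1) + (n + p + q - 1) * (n + p + r - 1) * hahn3 p q r u (- (n - 1) - 1)
      + jacB p q r n * hahn3 p q r u (- n - 1) = (p - 1 - real u)\<^sup>2 * hahn3 p q r u (- n - 1)"
    by (simp only:) (simp add: algebra_simps)
  then have "(-1) ^ u * ((n + 1) * (n + q + r) * hahn3 p q r u (- (n + 1) - 1) + (n + p + q - 1) * (n + p + r - 1) * hahn3 p q r u (- (n - 1) - 1)
      + jacB p q r n * hahn3 p q r u (- n - 1)) = (-1) ^ u * ((p - 1 - real u)\<^sup>2 * hahn3 p q r u (- n - 1))"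
    by (simp only:)
  then show ?thesis unfolding hahn_n_def by (simp add: algebra_simps)
qed

section \<open>The functional on products of consecutive nodes\<close>

definition node_prod :: "real \<Rightarrow> nat set \<Rightarrow> real poly" where
  "node_prod p A = (\<Prod>i\<in>A. [:- (p + real i)\<^sup>2, 1:])"

text \<open>The factor is left unspecified and may be zero for special parameters; a row need only
  be related to the functional by some multiple.\<close>

lemma cdh_fun_node_prod:
  "\<exists>k. \<forall>f. cdh_fun p q r (node_prod p {..<n} * f) = k * cdh_fun (p + real n) q r f"
proof (induction n)
  case 0
  then show ?case by (intro exI[of _ 1]) (simp add: node_prod_def)
next
  case (Suc n)
  then obtain k where k: "\<And>f. cdh_fun p q r (node_prod p {..<n} * f) = k * cdh_fun (p + real n) q r f" by blast
  have "cdh_fun p q r (node_prod p {..<Suc n} * f) = k * (- (p + real n + q) * (p + real n + r)) * cdh_fun (p + real (Suc n)) q r f" for f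
  proof -
    have "node_prod p {..<Suc n} = node_prod p {..<n} * [:- (p + real n)\<^sup>2, 1:]"
      by (simp add: node_prod_def del: mult_pCons_right)
    then have "node_prod p {..<Suc n} * f = node_prod p {..<n} * ([:- (p + real n)\<^sup>2, 1:] * f)"
      by (simp only: mult.assoc)
    then show ?thesis using cdh_fun_shift[of "p + real n" q r f] by (simp add: k add.assoc add.commute[of 1])
  qed
  then show ?case by blast
qed

text \<open>The u nodes are those directly above the base node \<open>(p - 1 - u)^2\<close> of the
  functional. Each further node is absorbed by \<open>cdh_shift2\<close> on the left and by
  \<open>hahn_n_raise\<close> on the right.\<close>

lemma cdh_fun_hahn_n:
  "cdh_fun (p - 1 - real u) q r (node_prod (p - real u) {..<u} * cdh p q r n) = pochhammer (q + r) n * hahn_n p q r u (real n)"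
proof (induction u arbitrary: p n)
  case 0
  have "cdh_fun (p - 1) q r (cdh p q r n) = pochhammer (q + r) n"
  proof (induction n)
    case (Suc n)
    have "cdh p q r (Suc n) = cdh (p - 1) q r (Suc n) + smult (real n + q + r) (cdh p q r n)"
      using cdh_shift1[of "p - 1" q r n] by simp
    then show ?case using Suc by (simp add: cdh_fun_add cdh_fun_smult cdh_fun_cdh pochhammer_Suc algebra_simps)
  qed (use cdh_fun_cdh[of "p - 1" q r 0] in simp)
  then show ?case by (simp add: node_prod_def hahn_n_def hahn3_def hahn_coeff_def)
next
  case (Suc u)
  have pr: "node_prod (p - real (Suc u)) {..<Suc u} = node_prod (p - 1 - real u) {..<u} * [:- (p - 1)\<^sup>2, 1:]"
  proof -
    have g: "node_prod s {..<Suc u} = node_prod s {..<u} * [:- (s + real u)\<^sup>2, 1:]" for s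
      by (simp add: node_prod_def del: mult_pCons_right)
    have e: "p - real (Suc u) = p - 1 - real u" "p - 1 - real u + real u = p - 1" by simp_all
    show ?thesis unfolding g e ..
  qed
  have "cdh_fun (p - 1 - real (Suc u)) q r (node_prod (p - real (Suc u)) {..<Suc u} * cdh p q r n)
     = cdh_fun (p - 1 - 1 - real u) q r (node_prod (p - 1 - real u) {..<u} * ([:- (p - 1)\<^sup>2, 1:] * cdh (p - 1 + 1) q r n))"
  proof -
    have "p - 1 - real (Suc u) = p - 1 - 1 - real u" "p - 1 + 1 = p" by simp_all
    then show ?thesis unfolding pr by (simp only: mult.assoc)
  qed
  also have "\<dots> = (real n + 1) * (pochhammer (q + r) (Suc n) * hahn_n (p - 1) q r u (real (Suc n)))
      - (p - 1 + q + real n) * (p - 1 + r + real n) * (pochhammer (q + r) n * hahn_n (p - 1) q r u (real n))"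
    unfolding cdh_shift2 Suc.IH[symmetric] by (simp add: right_diff_distrib cdh_fun_diff cdh_fun_smult)
  also have "\<dots> = pochhammer (q + r) n * hahn_n p q r (Suc u) (real n)"
    unfolding hahn_n_raise pochhammer_Suc by (simp add: algebra_simps)
  finally show ?case .
qed

text \<open>With the node f = Np - 1 - u left out, the nodes below f and those of q and r are
  absorbed by raising parameters; the u nodes above f cannot be absorbed and produce the Hahn
  polynomial of degree u.\<close>

lemma cdh_fun_row:
  assumes u: "u < Np"
  shows "\<exists>k. \<forall>n. cdh_fun p q r (node_prod q {..<Nq} * node_prod r {..<Nr} * node_prod p ({..<Np} - {Np - 1 - u}) *
      cdh (p + real Np) (q + real Nq) (r + real Nr) n)
    = k * (pochhammer (q + real Nq + (r + real Nr)) n * hahn_n (p + real Np) (q + real Nq) (r + real Nr) u (real n))"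
proof -
  define P where "P = p + real Np"
  define Q where "Q = q + real Nq"
  define R where "R = r + real Nr"
  define f where "f = Np - 1 - u"
  obtain k1 where k1: "\<And>g. cdh_fun q p r (node_prod q {..<Nq} * g) = k1 * cdh_fun Q p r g"
    using cdh_fun_node_prod[of q p r Nq] by (auto simp: Q_def)
  obtain k2 where k2: "\<And>g. cdh_fun r p Q (node_prod r {..<Nr} * g) = k2 * cdh_fun R p Q g"
    using cdh_fun_node_prod[of r p Q Nr] by (auto simp: R_def)
  obtain k3 where k3: "\<And>g. cdh_fun p Q R (node_prod p {..<f} * g) = k3 * cdh_fun (p + real f) Q R g"
    using cdh_fun_node_prod[of p Q R f] by auto
  have f: "p + real f = P - 1 - real u" using u by (simp add: f_def P_def of_nat_diff)
  have split: "node_prod p ({..<Np} - {f}) = node_prod p {..<f} * node_prod (P - real u) {..<u}"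
  proof -
    have "f < Np" using u by (simp add: f_def)
    then have "{..<Np} - {f} = {..<f} \<union> {Suc f..<Np}" by auto
    moreover have "node_prod p ({..<f} \<union> {Suc f..<Np}) = node_prod p {..<f} * node_prod p {Suc f..<Np}"
      unfolding node_prod_def by (rule prod.union_disjoint) auto
    ultimately have "node_prod p ({..<Np} - {f}) = node_prod p {..<f} * node_prod p {Suc f..<Np}"
      by (simp only:)
    also have "node_prod p {Suc f..<Np} = node_prod (P - real u) {..<u}"
      unfolding node_prod_def
      by (rule prod.reindex_bij_witness[of _ "\<lambda>i. Suc f + i" "\<lambda>i. i - Suc f"])
         (use u in \<open>auto simp: f_def P_def of_nat_diff algebra_simps\<close>)
    finally show ?thesis .
  qed
  have "cdh_fun p q r (node_prod q {..<Nq} * node_prod r {..<Nr} * node_prod p ({..<Np} - {f}) * g)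
      = k1 * (k2 * (k3 * cdh_fun (P - 1 - real u) Q R (node_prod (P - real u) {..<u} * g)))" for g
  proof -
    have "cdh_fun p q r (node_prod q {..<Nq} * node_prod r {..<Nr} * node_prod p ({..<Np} - {f}) * g)
        = cdh_fun q p r (node_prod q {..<Nq} * (node_prod r {..<Nr} * (node_prod p ({..<Np} - {f}) * g)))"
      by (subst cdh_fun_sym(1)) (simp only: mult.assoc)
    also have "\<dots> = k1 * cdh_fun r p Q (node_prod r {..<Nr} * (node_prod p ({..<Np} - {f}) * g))"
      unfolding k1 cdh_fun_sym(1)[of Q p r] cdh_fun_sym(2)[of p Q r] cdh_fun_sym(1)[of p r Q] ..
    also have "\<dots> = k1 * (k2 * cdh_fun p Q R (node_prod p {..<f} * (node_prod (P - real u) {..<u} * g)))"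
      unfolding k2 split cdh_fun_sym(1)[of R p Q] cdh_fun_sym(2)[of p R Q] by (simp only: mult.assoc)
    finally show ?thesis unfolding k3 f .
  qed
  then show ?thesis
    unfolding f_def P_def[symmetric] Q_def[symmetric] R_def[symmetric] cdh_fun_hahn_n
    by (intro exI[of _ "k1 * (k2 * k3)"]) (simp only: mult.assoc cdh_fun_hahn_n simp_thms)
qed

section \<open>Lagrange interpolation and the dependence between the rows\<close>

lemma poly_eq_0_roots:
  fixes p :: "real poly"
  assumes "inj_on T {..<m}" "p = 0 \<or> degree p < m" "\<And>l. l < m \<Longrightarrow> poly p (T l) = 0"
  shows "p = 0"
proof (rule ccontr)
  assume p: "p \<noteq> 0"
  have "card (T ` {..<m}) \<le> card {x. poly p x = 0}"
    using assms(3) p by (intro card_mono poly_roots_finite) auto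
  also have "\<dots> \<le> degree p" using p by (rule card_poly_roots_bound)
  finally show False using assms(1,2) p by (simp add: card_image)
qed

context
  fixes m :: nat and T :: "nat \<Rightarrow> real"
begin

definition lagrange_basis :: "nat \<Rightarrow> real poly" where
  "lagrange_basis l = (\<Prod>l'\<in>{..<m} - {l}. [:- T l', 1:])"

definition lagrange_den :: "nat \<Rightarrow> real" where
  "lagrange_den l = (\<Prod>l'\<in>{..<m} - {l}. T l - T l')"

context
  assumes inj: "inj_on T {..<m}"
begin

lemma degree_lagrange_basis:
  assumes "l < m"
  shows "degree (lagrange_basis l) = m - 1" "coeff (lagrange_basis l) (m - 1) = 1"
proof -
  have "degree (\<Prod>l'\<in>A. [:- T l', 1:]) = card A \<and> lead_coeff (\<Prod>l'\<in>A. [:- T l', 1:]) = 1" if "finite A" for A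
    using that
  proof (induction A rule: finite_induct)
    case (insert x A)
    have "(\<Prod>l'\<in>A. [:- T l', 1:]) \<noteq> 0" using insert.IH by auto
    then have "degree ([:- T x, 1:] * (\<Prod>l'\<in>A. [:- T l', 1:])) = Suc (card A)"
      using insert.IH by (subst degree_mult_eq) auto
    moreover have "lead_coeff ([:- T x, 1:] * (\<Prod>l'\<in>A. [:- T l', 1:])) = 1"
      using insert.IH by (subst lead_coeff_mult) auto
    ultimately show ?case using insert.hyps by (simp only: prod.insert card_insert_disjoint simp_thms)
  qed simp
  from this[of "{..<m} - {l}"] show "degree (lagrange_basis l) = m - 1" "coeff (lagrange_basis l) (m - 1) = 1"
    using assms by (auto simp: lagrange_basis_def)
qed

lemma lagrange_den_nz: "l < m \<Longrightarrow> lagrange_den l \<noteq> 0"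
  using inj by (auto simp: lagrange_den_def inj_on_def)

lemma lagrange_interpolation:
  assumes "degree f < m"
  shows "f = (\<Sum>l<m. smult (poly f (T l) / lagrange_den l) (lagrange_basis l))"
proof -
  define g where "g = f - (\<Sum>l<m. smult (poly f (T l) / lagrange_den l) (lagrange_basis l))"
  have "degree (\<Sum>l<m. smult (poly f (T l) / lagrange_den l) (lagrange_basis l)) \<le> m - 1"
    by (intro degree_sum_le order.trans[OF degree_smult_le]) (auto simp: degree_lagrange_basis)
  then have "degree g \<le> m - 1"
    unfolding g_def using assms by (intro degree_diff_le) auto
  moreover have "poly g (T k) = 0" if k: "k < m" for k
  proof -
    have "poly (lagrange_basis l) (T k) = (if l = k then lagrange_den k else 0)" if "l < m" for l
      using that k by (auto simp: lagrange_basis_def lagrange_den_def poly_prod)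
    then have "(\<Sum>l<m. poly f (T l) / lagrange_den l * poly (lagrange_basis l) (T k))
        = (\<Sum>l<m. if l = k then poly f (T k) else 0)"
      using lagrange_den_nz by (intro sum.cong) auto
    then show ?thesis using k by (simp add: g_def poly_sum)
  qed
  ultimately have "g = 0"
    using assms by (intro poly_eq_0_roots[OF inj]) auto
  then show ?thesis by (simp add: g_def)
qed

text \<open>Comparison of the coefficients of degree m - 1 in the interpolation formula.\<close>

lemma lagrange_sum_zero:
  assumes "degree f < m - 1"
  shows "(\<Sum>l<m. poly f (T l) / lagrange_den l) = 0"
proof -
  have "coeff f (m - 1) = (\<Sum>l<m. poly f (T l) / lagrange_den l * coeff (lagrange_basis l) (m - 1))"
    using arg_cong[OF lagrange_interpolation[of f], of "\<lambda>p. coeff p (m - 1)"] assms by (simp add: coeff_sum)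
  also have "\<dots> = (\<Sum>l<m. poly f (T l) / lagrange_den l)"
    by (intro sum.cong refl) (simp add: degree_lagrange_basis[unfolded One_nat_def])
  finally show ?thesis using assms by (simp add: coeff_eq_0)
qed

text \<open>All rows solve the three-term recurrence of the \<open>cdh\<close>, continued to negative indices, where
  their entries are polynomials in the nodes; the coefficients of the combination are the Lagrange
  weights.\<close>

lemma row_combination:
  fixes p q r P Q R :: real and \<Psi> :: "nat \<Rightarrow> nat \<Rightarrow> real" and \<Theta> :: "real poly" and cc :: "nat \<Rightarrow> real"
  defines "L \<equiv> cdh_fun p q r" and "K \<equiv> cdh P Q R"
  assumes J: "\<And>l k. l < m \<Longrightarrow> 1 \<le> k \<Longrightarrow> (real k - real m + 1) * \<Psi> l (Suc k) + jacB P Q R (real k - real m) * \<Psi> l k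
      + jacC P Q R (real k - real m) * \<Psi> l (k - 1) = T l * \<Psi> l k"
    and C: "\<And>k. 1 \<le> k \<Longrightarrow> k \<le> m \<Longrightarrow> jacC P Q R (real k - real m) \<noteq> 0"
    and row: "\<And>l n. l < m \<Longrightarrow> L (\<Theta> * lagrange_basis l * K n) = cc l * \<Psi> l (n + m)"
    and zero: "\<And>n. m = 0 \<Longrightarrow> 1 \<le> n \<Longrightarrow> L (\<Theta> * K n) = 0"
  shows "\<exists>\<rho>. \<forall>j k. 1 + j \<le> k \<longrightarrow> (\<Sum>l<m. \<rho> l * T l ^ j * \<Psi> l k) = (if m \<le> k then L (\<Theta> * monom 1 j * K (k - m)) else 0)"
proof -
  define \<rho> where "\<rho> l = cc l / lagrange_den l" for l
  define G where "G j k = (if m \<le> k then L (\<Theta> * monom 1 j * K (k - m)) else 0)" for j k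
  note lin = cdh_fun_add cdh_fun_smult cdh_fun_diff cdh_fun_sum
  have base: "(\<Sum>l<m. \<rho> l * \<Psi> l k) = G 0 k" if k: "1 \<le> k" for k
  proof (cases "m \<le> k")
    case True
    then obtain n where n: "k = n + m" by (metis le_add_diff_inverse2)
    show ?thesis
    proof (cases "m = 0")
      case True
      then show ?thesis using zero[of n] k n by (simp add: G_def)
    next
      case False
      then have "1 = (\<Sum>l<m. smult (1 / lagrange_den l) (lagrange_basis l))"
        using lagrange_interpolation[of 1] by simp
      then have "\<Theta> * K n = (\<Sum>l<m. smult (1 / lagrange_den l) (lagrange_basis l)) * (\<Theta> * K n)" by simp
      also have "\<dots> = (\<Sum>l<m. smult (1 / lagrange_den l) (\<Theta> * lagrange_basis l * K n))"
        unfolding sum_distrib_right by (intro sum.cong refl) (simp add: mult_ac)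
      finally have "L (\<Theta> * K n) = (\<Sum>l<m. 1 / lagrange_den l * L (\<Theta> * lagrange_basis l * K n))"
        unfolding L_def by (metis (no_types, lifting) cdh_fun_sum cdh_fun_smult sum.cong)
      also have "\<dots> = (\<Sum>l<m. \<rho> l * \<Psi> l k)"
        by (intro sum.cong refl) (simp add: row \<rho>_def n)
      finally show ?thesis using n by (simp add: G_def)
    qed
  next
    case False
    \<comment> \<open>The recurrence is run downwards from index m, dividing by \<open>jacC\<close>;
      each step raises the degree in the node by at most one.\<close>
    have "\<exists>f. degree f \<le> i \<and> (\<forall>l<m. cc l * \<Psi> l (m - 1 - i) = poly f (T l))" if "i < m" for i
      using that
    proof (induction i rule: less_induct)
      case (less i)
      show ?case
      proof (cases i)
        case 0
        \<comment> \<open>Below index m the recurrence yields minus the functional on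
          \<open>\<Theta> * (t - T l) * lagrange_basis l\<close>, that is on
          \<open>\<Theta> * W\<close>, which no longer depends on the row l.\<close>
        define W where "W = (\<Prod>l<m. [:- T l, 1:])"
        have "cc l * \<Psi> l (m - 1) = - L (\<Theta> * W) / jacC P Q R 0" if l: "l < m" for l
        proof -
          have W: "W = [:- T l, 1:] * lagrange_basis l"
            unfolding W_def lagrange_basis_def using l by (subst prod.remove[of _ l]) auto
          have "cc l * \<Psi> l (Suc m) + jacB P Q R 0 * (cc l * \<Psi> l m) + jacC P Q R 0 * (cc l * \<Psi> l (m - 1)) = T l * (cc l * \<Psi> l m)"
            using J[OF l, of m] l by (simp add: mult_ac distrib_left flip: distrib_left)
          then have "jacC P Q R 0 * (cc l * \<Psi> l (m - 1)) = (T l - jacB P Q R 0) * L (\<Theta> * lagrange_basis l * K 0) - L (\<Theta> * lagrange_basis l * K 1)"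
            using row[OF l, of 0] row[OF l, of 1] by (simp add: algebra_simps)
          also have "\<dots> = L (smult (T l - jacB P Q R 0) (\<Theta> * lagrange_basis l * K 0) - \<Theta> * lagrange_basis l * K 1)"
            by (simp add: L_def lin)
          also have "smult (T l - jacB P Q R 0) (\<Theta> * lagrange_basis l * K 0) - \<Theta> * lagrange_basis l * K 1 = smult (-1) (\<Theta> * W)"
          proof -
            have "smult (T l - jacB P Q R 0) (\<Theta> * lagrange_basis l * K 0) - \<Theta> * lagrange_basis l * K 1
                = \<Theta> * lagrange_basis l * ([:T l - jacB P Q R 0:] - [:- jacB P Q R 0, 1:])"
            proof -
              have s: "smult s X = X * [:s:]" for s and X :: "real poly" by simp
              have K: "K 0 = 1" "K 1 = [:- jacB P Q R 0, 1:]" by (simp_all add: K_def)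
              show ?thesis unfolding K mult_1_right s right_diff_distrib ..
            qed
            also have "[:T l - jacB P Q R 0:] - [:- jacB P Q R 0, 1:] = smult (- 1) [:- T l, 1:]" by simp
            finally show ?thesis unfolding W by (simp only: mult_smult_right mult_ac)
          qed
          finally have "jacC P Q R 0 * (cc l * \<Psi> l (m - 1)) = - L (\<Theta> * W)"
            using cdh_fun_smult[of p q r "- 1" "\<Theta> * W"] by (simp add: L_def)
          then show ?thesis using C[of m] l by (simp add: field_simps)
        qed
        then show ?thesis using 0 by (intro exI[of _ "[:- L (\<Theta> * W) / jacC P Q R 0:]"]) simp
      next
        case (Suc i')
        from less.IH[of i'] Suc less.prems obtain f where f: "degree f \<le> i'" "\<And>l. l < m \<Longrightarrow> cc l * \<Psi> l (m - 1 - i') = poly f (T l)"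
          by auto
        have "\<exists>g. degree g \<le> i' \<and> (\<forall>l<m. real i' * (cc l * \<Psi> l (m - i')) = poly g (T l))"
        proof (cases i')
          case 0
          then show ?thesis by (intro exI[of _ 0]) simp
        next
          case (Suc i'')
          from less.IH[of i''] Suc \<open>i = Suc i'\<close> less.prems obtain g where g: "degree g \<le> i''" "\<And>l. l < m \<Longrightarrow> cc l * \<Psi> l (m - 1 - i'') = poly g (T l)"
            by auto
          have "m - 1 - i'' = m - i'" using Suc by simp
          then show ?thesis using g Suc
            by (intro exI[of _ "smult (real i') g"]) (auto intro: order.trans[OF degree_smult_le])
        qed
        then obtain g where g: "degree g \<le> i'" "\<And>l. l < m \<Longrightarrow> real i' * (cc l * \<Psi> l (m - i')) = poly g (T l)" by blast
        define k where "k = m - 1 - i'"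
        have k: "1 \<le> k" "k \<le> m" "Suc k = m - i'" "k - 1 = m - 1 - i" "real k - real m = - 1 - real i'"
          using less.prems Suc by (auto simp: k_def of_nat_diff)
        define Cn where "Cn = jacC P Q R (- 1 - real i')"
        have Cn: "Cn \<noteq> 0" using C[OF k(1,2)] by (simp add: Cn_def k(5))
        have "cc l * \<Psi> l (m - 1 - i) = poly (smult (1 / Cn) ([:- jacB P Q R (- 1 - real i'), 1:] * f + g)) (T l)" if l: "l < m" for l
        proof -
          have "- real i' * \<Psi> l (m - i') + jacB P Q R (- 1 - real i') * \<Psi> l k + Cn * \<Psi> l (m - 1 - i) = T l * \<Psi> l k"
            using J[OF l k(1)] unfolding k(3,4,5) Cn_def by simp
          then have "Cn * \<Psi> l (m - 1 - i) = (T l - jacB P Q R (- 1 - real i')) * \<Psi> l k + real i' * \<Psi> l (m - i')"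
            by (simp add: algebra_simps)
          then have "Cn * (cc l * \<Psi> l (m - 1 - i)) = (T l - jacB P Q R (- 1 - real i')) * (cc l * \<Psi> l k) + real i' * (cc l * \<Psi> l (m - i'))"
            by (metis (no_types, opaque_lifting) distrib_left mult.left_commute)
          also have "\<dots> = (T l - jacB P Q R (- 1 - real i')) * poly f (T l) + poly g (T l)"
            using f(2)[OF l] g(2)[OF l] by (simp add: k_def)
          finally show ?thesis using Cn by (simp add: field_simps)
        qed
        moreover have "degree (smult (1 / Cn) ([:- jacB P Q R (- 1 - real i'), 1:] * f + g)) \<le> i"
          using f(1) g(1) Suc
          by (intro order.trans[OF degree_smult_le] degree_add_le order.trans[OF degree_mult_le]) auto
        ultimately show ?thesis by blast
      qed
    qed
    from this[of "m - 1 - k"] False obtain f where f: "degree f \<le> m - 1 - k" "\<And>l. l < m \<Longrightarrow> cc l * \<Psi> l k = poly f (T l)"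
      by auto
    have "(\<Sum>l<m. \<rho> l * \<Psi> l k) = (\<Sum>l<m. poly f (T l) / lagrange_den l)"
      by (intro sum.cong refl) (use f(2) in \<open>auto simp: \<rho>_def\<close>)
    \<comment> \<open>Here 1 \<le> k matters: it keeps the degree m - 1 - k strictly below m -
      1.\<close>
    also have "\<dots> = 0" by (rule lagrange_sum_zero) (use f(1) False k in auto)
    finally show ?thesis using False by (simp add: G_def)
  qed
  \<comment> \<open>Each power of the node costs one use of the recurrence, which reaches down to k
    - 1; hence the bound 1 + j \<le> k.\<close>
  have "(\<Sum>l<m. \<rho> l * T l ^ j * \<Psi> l k) = G j k" if "1 + j \<le> k" for j k
    using that
  proof (induction j arbitrary: k)
    case 0
    then show ?case using base[of k] by simp
  next
    case (Suc j)
    have "(\<Sum>l<m. \<rho> l * T l ^ Suc j * \<Psi> l k) = (\<Sum>l<m. \<rho> l * T l ^ j * ((real k - real m + 1) * \<Psi> l (Suc k) + jacB P Q R (real k - real m) * \<Psi> l k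
      + jacC P Q R (real k - real m) * \<Psi> l (k - 1)))"
      using J Suc.prems by (intro sum.cong refl) (simp add: mult_ac)
    also have "\<dots> = (real k - real m + 1) * (\<Sum>l<m. \<rho> l * T l ^ j * \<Psi> l (Suc k)) + jacB P Q R (real k - real m) * (\<Sum>l<m. \<rho> l * T l ^ j * \<Psi> l k)
      + jacC P Q R (real k - real m) * (\<Sum>l<m. \<rho> l * T l ^ j * \<Psi> l (k - 1))"
      unfolding sum_distrib_left sum.distrib[symmetric] by (intro sum.cong refl) (simp add: algebra_simps)
    also have "\<dots> = (real k - real m + 1) * G j (Suc k) + jacB P Q R (real k - real m) * G j k + jacC P Q R (real k - real m) * G j (k - 1)"
      using Suc.prems by (simp add: Suc.IH)
    also have "\<dots> = G (Suc j) k"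
    proof (cases "m \<le> k")
      case True
      then obtain n where n: "k = n + m" by (metis le_add_diff_inverse2)
      define X where "X = \<Theta> * monom 1 j"
      have "smult (real n + 1) (X * K (Suc n)) = \<Theta> * monom 1 (Suc j) * K n - smult (jacB P Q R (real n)) (X * K n)
          - (if n = 0 then 0 else smult (jacC P Q R (real n)) (X * K (n - 1)))"
      proof -
        have "smult (real n + 1) (X * K (Suc n)) = X * smult (real n + 1) (K (Suc n))" by simp
        also have "\<dots> = X * (monom 1 1 * K n - smult (jacB P Q R (real n)) (K n)
            - (if n = 0 then 0 else smult (jacC P Q R (real n)) (K (n - 1))))"
          unfolding K_def cdh_rec by (simp add: monom_Suc)
        also have "\<dots> = \<Theta> * (monom 1 j * monom 1 1) * K n - smult (jacB P Q R (real n)) (X * K n)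
          - (if n = 0 then 0 else smult (jacC P Q R (real n)) (X * K (n - 1)))"
          by (simp add: X_def algebra_simps)
        finally show ?thesis by (simp add: mult_monom)
      qed
      from arg_cong[OF this, of L]
      have "(real n + 1) * L (X * K (Suc n)) = L (\<Theta> * monom 1 (Suc j) * K n) - jacB P Q R (real n) * L (X * K n)
          - (if n = 0 then 0 else jacC P Q R (real n) * L (X * K (n - 1)))"
        unfolding L_def by (cases "n = 0") (simp_all add: lin)
      then show ?thesis
        using Suc.prems n by (cases n) (simp_all add: G_def n X_def add.commute)
    next
      case False
      show ?thesis
      proof (cases "Suc k = m")
        case True
        \<comment> \<open>At the border between negative and nonnegative indices the coefficient of
          the upper neighbour vanishes, so the zero part of G is not disturbed.\<close>
        then have "real k - real m + 1 = 0" by linarith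
        then show ?thesis using False by (simp add: G_def)
      next
        case F: False
        then show ?thesis using False by (simp add: G_def)
      qed
    qed
    finally show ?case .
  qed
  then show ?thesis unfolding G_def by blast
qed

end

end

section \<open>The rows in terms of the three parameters\<close>

fun fam_p :: "real \<Rightarrow> real \<Rightarrow> real \<Rightarrow> family \<Rightarrow> real" where
  "fam_p a b c First = par3 a b c" | "fam_p a b c Second = par1 a b c" | "fam_p a b c Third = par2 a b c"

fun fam_q :: "real \<Rightarrow> real \<Rightarrow> real \<Rightarrow> family \<Rightarrow> real" where
  "fam_q a b c First = par1 a b c" | "fam_q a b c Second = par3 a b c" | "fam_q a b c Third = par3 a b c"

fun fam_r :: "real \<Rightarrow> real \<Rightarrow> real \<Rightarrow> family \<Rightarrow> real" where
  "fam_r a b c First = par2 a b c" | "fam_r a b c Second = par2 a b c" | "fam_r a b c Third = par1 a b c"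

lemma poly_hahn_row: "poly (hahn_row a b c (fam, u)) x = hahn3 (fam_p a b c fam) (fam_q a b c fam) (fam_r a b c fam) u x"
  by (cases fam; simp only: hahn_row.simps fam_p.simps fam_q.simps fam_r.simps; rule poly_hahn; simp add: par_defs field_simps)

lemma poly_Y:
  assumes "row_labels U1 U2 U3 ! l = (fam, u)"
  shows "poly (Y a b c U1 U2 U3 l) n = (-1) ^ u * hahn_n (fam_p a b c fam) (fam_q a b c fam) (fam_r a b c fam) u n"
proof -
  have "poly (Y a b c U1 U2 U3 l) n = hahn3 (fam_p a b c fam) (fam_q a b c fam) (fam_r a b c fam) u (- n - 1)"
  proof -
    have e: "poly [:- 1, - 1:] n = - n - 1" by simp
    show ?thesis unfolding Y_def assms poly_pcompose poly_hahn_row e ..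
  qed
  moreover have "(-1 :: real) ^ u * (-1) ^ u = 1" by (simp flip: power_add)
  ultimately show ?thesis by (simp add: hahn_n_def mult.assoc[symmetric])
qed

lemma gauge_par_fam: "gauge_par a b c fam = fam_q a b c fam + fam_r a b c fam"
  by (cases fam) auto

text \<open>With the symbols started at index -m, the row entry is a factor of the row alone, times
  a factor of the column alone, times the solution of the recurrence at index n + m - i used in
  \<open>row_combination\<close>.\<close>

lemma row_entry_pochhammer:
  assumes lab: "row_labels U1 U2 U3 ! l = (fam, u)" and i: "i \<le> m"
    and a: "pochhammer (a + 1 - real m) (n + m) \<noteq> 0" and g: "pochhammer (gauge_par a b c fam - real m) n \<noteq> 0"
  shows "xi a b c U1 U2 U3 l (real n - real i) (m - i) * poly (Y a b c U1 U2 U3 l) (real n - real i)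
    = (-1) ^ (m - i) * (-1) ^ u * (pochhammer (a + 1 - real m) n / pochhammer (gauge_par a b c fam - real m) n) *
      (pochhammer (gauge_par a b c fam - real m) (n + m - i) / pochhammer (a + 1 - real m) (n + m - i)) *
      hahn_n (fam_p a b c fam) (fam_q a b c fam) (fam_r a b c fam) u (real n - real i)"
proof -
  define G where "G = gauge_par a b c fam"
  have anz: "a + (real n - real i - real s) \<noteq> 0" if "s < m - i" for s
  proof
    assume "a + (real n - real i - real s) = 0"
    then have "a + 1 - real m = - of_nat (n + m - 1 - i - s)" using that by (simp add: of_nat_diff)
    moreover have "n + m - 1 - i - s < n + m" using that by simp
    ultimately show False using a unfolding pochhammer_eq_0_iff by blast
  qed
  have pr: "(\<Prod>s<m - i. z + (real n - real i - real s)) = pochhammer (z + 1 - real m + real n) (m - i)" for z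
    unfolding pochhammer_prod
    by (rule prod.reindex_bij_witness[of _ "\<lambda>s. m - i - 1 - s" "\<lambda>s. m - i - 1 - s"]) (use i in \<open>auto simp: of_nat_diff\<close>)
  have "xi a b c U1 U2 U3 l (real n - real i) (m - i) = (\<Prod>s<m - i. - ((G - 1 + (real n - real i - real s)) / (a + (real n - real i - real s))))"
    unfolding xi_def lab
  proof (intro prod.cong refl)
    fix s assume "s \<in> {..<m - i}"
    then have nz: "a + (real n - real i - real s) \<noteq> 0" using anz by simp
    have e: "G - 1 + (real n - real i - real s) = real n - real i - real s - 1 + G" by simp
    show "eps a b c (fst (fam, u)) (real n - real i - real s) = - ((G - 1 + (real n - real i - real s)) / (a + (real n - real i - real s)))"
      by (simp only: fst_conv eps_eq[OF nz] e G_def[symmetric] minus_divide_left)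
  qed
  also have "\<dots> = (\<Prod>s<m - i. (-1) * ((G - 1 + (real n - real i - real s)) / (a + (real n - real i - real s))))"
    by (simp only: mult_minus1)
  also have "\<dots> = (-1) ^ (m - i) * (pochhammer (G - real m + real n) (m - i) / pochhammer (a + 1 - real m + real n) (m - i))"
    unfolding prod.distrib prod_dividef pr by simp
  also have "pochhammer (G - real m + real n) (m - i) = pochhammer (G - real m) (n + m - i) / pochhammer (G - real m) n"
    using pochhammer_product[of n "n + m - i" "G - real m"] g i by (simp add: G_def)
  also have "pochhammer (a + 1 - real m + real n) (m - i) = pochhammer (a + 1 - real m) (n + m - i) / pochhammer (a + 1 - real m) n"
  proof -
    have "pochhammer (a + 1 - real m) n \<noteq> 0"
      using a pochhammer_product[of n "n + m" "a + 1 - real m"] by auto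
    then show ?thesis using pochhammer_product[of n "n + m - i" "a + 1 - real m"] i by simp
  qed
  finally show ?thesis unfolding poly_Y[OF lab] G_def by simp
qed

section \<open>Sets of nodes\<close>

lemma prod_rows:
  fixes g :: "family \<times> nat \<Rightarrow> 'b :: comm_monoid_mult"
  assumes "finite U1" "finite U2" "finite U3"
  shows "(\<Prod>l<num_rows U1 U2 U3. g (row_labels U1 U2 U3 ! l)) = (\<Prod>u\<in>U1. g (First, u)) * (\<Prod>u\<in>U2. g (Second, u)) * (\<Prod>u\<in>U3. g (Third, u))"
proof -
  have s: "prod_list (map h (sorted_list_of_set A)) = prod h A" if "finite A" for h :: "nat \<Rightarrow> 'b" and A
    using prod.distinct_set_conv_list[of "sorted_list_of_set A" h] that by simp
  have "(\<Prod>l<num_rows U1 U2 U3. g (row_labels U1 U2 U3 ! l)) = prod_list (map g (row_labels U1 U2 U3))"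
    using length_row_labels[OF assms] by (simp add: prod.list_conv_set_nth lessThan_atLeast0)
  also have "\<dots> = (\<Prod>u\<in>U1. g (First, u)) * (\<Prod>u\<in>U2. g (Second, u)) * (\<Prod>u\<in>U3. g (Third, u))"
    using s[OF assms(1), of "\<lambda>u. g (First, u)"] s[OF assms(2), of "\<lambda>u. g (Second, u)"] s[OF assms(3), of "\<lambda>u. g (Third, u)"]
    by (simp add: row_labels_def comp_def mult.assoc)
  finally show ?thesis .
qed

lemma sum_rows:
  fixes g :: "family \<times> nat \<Rightarrow> 'b :: comm_monoid_add"
  assumes "finite U1" "finite U2" "finite U3"
  shows "(\<Sum>l<num_rows U1 U2 U3. g (row_labels U1 U2 U3 ! l)) = (\<Sum>u\<in>U1. g (First, u)) + (\<Sum>u\<in>U2. g (Second, u)) + (\<Sum>u\<in>U3. g (Third, u))"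
proof -
  have s: "sum_list (map h (sorted_list_of_set A)) = sum h A" if "finite A" for h :: "nat \<Rightarrow> 'b" and A
    using sum.distinct_set_conv_list[of "sorted_list_of_set A" h] that by simp
  have "(\<Sum>l<num_rows U1 U2 U3. g (row_labels U1 U2 U3 ! l)) = sum_list (map g (row_labels U1 U2 U3))"
    using length_row_labels[OF assms] by (simp add: sum.list_conv_set_nth lessThan_atLeast0)
  also have "\<dots> = (\<Sum>u\<in>U1. g (First, u)) + (\<Sum>u\<in>U2. g (Second, u)) + (\<Sum>u\<in>U3. g (Third, u))"
    using s[OF assms(1), of "\<lambda>u. g (First, u)"] s[OF assms(2), of "\<lambda>u. g (Second, u)"] s[OF assms(3), of "\<lambda>u. g (Third, u)"]
    by (simp add: row_labels_def comp_def add.assoc)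
  finally show ?thesis .
qed

lemma row_label_in:
  assumes "finite U1" "finite U2" "finite U3" "l < num_rows U1 U2 U3" "row_labels U1 U2 U3 ! l = (fam, u)"
  shows "u \<in> (case fam of First \<Rightarrow> U1 | Second \<Rightarrow> U2 | Third \<Rightarrow> U3)"
proof -
  have "(fam, u) \<in> set (row_labels U1 U2 U3)"
    using assms length_row_labels[OF assms(1-3)] nth_mem[of l "row_labels U1 U2 U3"] by simp
  then show ?thesis using assms(1-3) by (auto simp: row_labels_def)
qed

lemma row_labels_inj:
  assumes "finite U1" "finite U2" "finite U3" "l < num_rows U1 U2 U3" "l' < num_rows U1 U2 U3"
    "row_labels U1 U2 U3 ! l = row_labels U1 U2 U3 ! l'"
  shows "l = l'"
proof -
  have "distinct (row_labels U1 U2 U3)"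
    using assms(1-3) by (auto simp: row_labels_def distinct_map inj_on_def)
  then show ?thesis using assms length_row_labels[OF assms(1-3)] by (simp add: nth_eq_iff_index_eq)
qed

text \<open>This is max F + 1, and the convention max = -1 for the empty set gives 0: the number of
  consecutive nodes absorbed, and so the shift of a parameter, as a natural number.\<close>

definition set_len :: "nat set \<Rightarrow> nat" where
  "set_len F = (if F = {} then 0 else Suc (Max F))"

lemma maxF_set_len: "maxF F = int (set_len F) - 1"
  by (simp add: maxF_def set_len_def)

text \<open>I(F) consists of the numbers max F - g for the gaps g of F in {0, ..., max F}. For
  nonempty F, the gap g = 0 gives the element max F, while u = 0 is excluded because max F is no
  gap.\<close>

lemma I_set_iff:
  assumes "finite F" "0 \<notin> F"
  shows "u \<in> I_set F \<longleftrightarrow> u < set_len F \<and> set_len F - 1 - u \<notin> F"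
proof (cases "F = {}")
  case False
  have M: "Max F \<in> F" "\<And>f. f \<in> F \<Longrightarrow> f \<le> Max F" using False assms by auto
  have "u \<in> (\<lambda>f. Max F - f) ` F \<longleftrightarrow> Max F - u \<in> F" if "u \<le> Max F"
  proof
    assume "u \<in> (\<lambda>f. Max F - f) ` F"
    then obtain f where "f \<in> F" "u = Max F - f" by blast
    then show "Max F - u \<in> F" using M(2)[of f] by simp
  next
    assume "Max F - u \<in> F"
    then show "u \<in> (\<lambda>f. Max F - f) ` F" using that by (intro image_eqI[of _ _ "Max F - u"]) auto
  qed
  then show ?thesis using False M by (cases "u = 0") (auto simp: I_set_def set_len_def)
qed (auto simp: I_set_def set_len_def)

lemma finite_I_set: "finite F \<Longrightarrow> 0 \<notin> F \<Longrightarrow> finite (I_set F)"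
  by (rule finite_subset[of _ "{..<set_len F}"]) (auto simp: I_set_iff)

lemma set_len_split:
  assumes "finite F" "0 \<notin> F"
  shows "{..<set_len F} = F \<union> (\<lambda>u. set_len F - 1 - u) ` I_set F" "F \<inter> (\<lambda>u. set_len F - 1 - u) ` I_set F = {}"
    "inj_on (\<lambda>u. set_len F - 1 - u) (I_set F)"
proof -
  have F: "f < set_len F" if "f \<in> F" for f using that assms(1) by (auto simp: set_len_def less_Suc_eq_le)
  show "{..<set_len F} = F \<union> (\<lambda>u. set_len F - 1 - u) ` I_set F"
  proof (intro equalityI subsetI)
    fix x assume x: "x \<in> {..<set_len F}"
    show "x \<in> F \<union> (\<lambda>u. set_len F - 1 - u) ` I_set F"
    proof (cases "x \<in> F")
      case False
      then show ?thesis using x by (intro UnI2 image_eqI[of _ _ "set_len F - 1 - x"]) (auto simp: I_set_iff[OF assms])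
    qed simp
  next
    fix x assume "x \<in> F \<union> (\<lambda>u. set_len F - 1 - u) ` I_set F"
    then show "x \<in> {..<set_len F}" using F by (auto simp: I_set_iff[OF assms])
  qed
  show "F \<inter> (\<lambda>u. set_len F - 1 - u) ` I_set F = {}" by (auto simp: I_set_iff[OF assms])
  show "inj_on (\<lambda>u. set_len F - 1 - u) (I_set F)"
  proof (rule inj_onI)
    fix u v assume "u \<in> I_set F" "v \<in> I_set F" "set_len F - 1 - u = set_len F - 1 - v"
    moreover from this have "u < set_len F" "v < set_len F" by (simp_all add: I_set_iff[OF assms])
    ultimately show "u = v" by linarith
  qed
qed

text \<open>F and its gaps make up consecutive nodes, so the Christoffel factor completed by the
  nodes of the rows is a product that the functional can absorb.\<close>

lemma node_prod_split:
  assumes "finite F" "0 \<notin> F"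
  shows "node_prod p {..<set_len F} = node_prod p F * (\<Prod>u\<in>I_set F. [:- (p + real (set_len F) - 1 - real u)\<^sup>2, 1:])"
proof -
  have "node_prod p {..<set_len F} = node_prod p F * node_prod p ((\<lambda>u. set_len F - 1 - u) ` I_set F)"
    unfolding node_prod_def using set_len_split[OF assms] assms(1) finite_I_set[OF assms]
    by (subst set_len_split(1)[OF assms], subst prod.union_disjoint) auto
  also have "node_prod p ((\<lambda>u. set_len F - 1 - u) ` I_set F) = (\<Prod>u\<in>I_set F. [:- (p + real (set_len F) - 1 - real u)\<^sup>2, 1:])"
    unfolding node_prod_def
    by (subst prod.reindex[OF set_len_split(3)[OF assms]]) (auto intro!: prod.cong simp: I_set_iff[OF assms] of_nat_diff algebra_simps)
  finally show ?thesis .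
qed

text \<open>The Christoffel factor in the variable t, where \<lambda>(N - f), \<lambda>(f) and
  \<lambda>(f - \<beta>) correspond to the nodes \<open>(p3 + f)^2\<close>,
  \<open>(p1 + f)^2\<close> and \<open>(p2 + f)^2\<close>.\<close>

definition theta :: "nat set \<Rightarrow> nat set \<Rightarrow> nat set \<Rightarrow> real \<Rightarrow> real \<Rightarrow> real \<Rightarrow> real poly" where
  "theta F1 F2 F3 p1 p2 p3 = node_prod p3 F1 * node_prod p1 F2 * node_prod p2 F3"

text \<open>Plays two roles that must agree: the eigenvalue of the row in
  \<open>hahn_n_difference\<close>, and the gap completed by \<open>node_prod_split\<close>.\<close>

definition row_node :: "nat set \<Rightarrow> nat set \<Rightarrow> nat set \<Rightarrow> real \<Rightarrow> real \<Rightarrow> real \<Rightarrow> nat \<Rightarrow> real" where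
  "row_node F1 F2 F3 a b c l = (fam_p a b c (fst (row_labels (I_set F1) (I_set F2) (I_set F3) ! l)) - 1 -
     real (snd (row_labels (I_set F1) (I_set F2) (I_set F3) ! l)))\<^sup>2"

section \<open>Continuous dependence on the parameters\<close>

text \<open>The uniform bound on the degree turns the functional into one fixed finite sum of
  continuous terms.\<close>

definition cont_poly :: "(real \<Rightarrow> real poly) \<Rightarrow> real \<Rightarrow> bool" where
  "cont_poly f a \<longleftrightarrow> (\<exists>D. \<forall>x. degree (f x) \<le> D) \<and> (\<forall>k. isCont (\<lambda>x. coeff (f x) k) a)"

lemma cont_poly_const: "cont_poly (\<lambda>_. f) a"
  by (auto simp: cont_poly_def)

lemma cont_poly_mult:
  assumes "cont_poly f a" "cont_poly g a"
  shows "cont_poly (\<lambda>x. f x * g x) a"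
proof -
  from assms obtain D D' where "\<And>x. degree (f x) \<le> D" "\<And>x. degree (g x) \<le> D'" by (auto simp: cont_poly_def)
  then have "degree (f x * g x) \<le> D + D'" for x by (meson add_mono degree_mult_le order.trans)
  moreover have "isCont (\<lambda>x. coeff (f x * g x) k) a" for k
    unfolding coeff_mult using assms by (intro continuous_intros) (auto simp: cont_poly_def)
  ultimately show ?thesis by (auto simp: cont_poly_def)
qed

lemma cont_poly_smult: "isCont c a \<Longrightarrow> cont_poly f a \<Longrightarrow> cont_poly (\<lambda>x. smult (c x) (f x)) a"
  unfolding cont_poly_def coeff_smult by (auto intro!: continuous_intros dest: order.trans[OF degree_smult_le])

lemma cont_poly_diff: "cont_poly f a \<Longrightarrow> cont_poly g a \<Longrightarrow> cont_poly (\<lambda>x. f x - g x) a"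
proof -
  assume f: "cont_poly f a" and g: "cont_poly g a"
  then obtain D D' where "\<And>x. degree (f x) \<le> D" "\<And>x. degree (g x) \<le> D'" by (auto simp: cont_poly_def)
  then have "degree (f x - g x) \<le> max D D'" for x by (intro degree_diff_le) (auto simp: le_max_iff_disj)
  then show ?thesis using f g by (auto simp: cont_poly_def intro!: continuous_intros)
qed

lemma cont_poly_linear: assumes "isCont c a" shows "cont_poly (\<lambda>x. [:c x, 1:]) a"
proof -
  have "isCont (\<lambda>x. coeff [:c x, 1:] k) a" for k using assms by (cases k) auto
  then show ?thesis by (auto simp: cont_poly_def intro!: exI[of _ 1])
qed

lemma cont_poly_prod: "(\<And>i. i \<in> A \<Longrightarrow> cont_poly (f i) a) \<Longrightarrow> cont_poly (\<lambda>x. \<Prod>i\<in>A. f i x) a"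
  by (induction A rule: infinite_finite_induct) (auto simp: cont_poly_const cont_poly_mult)

lemma isCont_pochhammer: "isCont f a \<Longrightarrow> isCont (\<lambda>x. pochhammer (f x) n :: real) a"
  by (simp add: pochhammer_prod) (intro continuous_intros)

context
  fixes p q r :: "real \<Rightarrow> real" and a :: real
  assumes pqr: "isCont p a" "isCont q a" "isCont r a"
begin

lemma isCont_jac: "isCont (\<lambda>x. jacB (p x) (q x) (r x) n) a" "isCont (\<lambda>x. jacC (p x) (q x) (r x) n) a"
  unfolding jacB_def jacC_def by (intro continuous_intros pqr)+

lemma cont_poly_cdh: "cont_poly (\<lambda>x. cdh (p x) (q x) (r x) n) a"
proof (induction n rule: less_induct)
  case (less n)
  consider "n = 0" | "n = Suc 0" | k where "n = Suc (Suc k)" by (metis not0_implies_Suc)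
  then show ?case
  proof cases
    case 1
    then show ?thesis by (simp add: cont_poly_const)
  next
    case 2
    then show ?thesis by (simp add: cont_poly_linear isCont_minus isCont_jac)
  next
    case 3
    then show ?thesis unfolding 3 cdh.simps(3)
      by (intro cont_poly_smult cont_poly_diff cont_poly_mult cont_poly_linear isCont_minus isCont_jac less.IH)
         (auto intro: continuous_intros simp: 3)
  qed
qed

lemma isCont_jac_moment: "isCont (\<lambda>x. jac_moment (p x) (q x) (r x) k n) a"
proof (induction k arbitrary: n)
  case (Suc k)
  have "isCont (\<lambda>x. jac (p x) (q x) (r x) ((jac (p x) (q x) (r x) ^^ k) (\<lambda>n. if n = 0 then 1 else 0)) n) a"
    unfolding jac_def[of _ _ _ _ n] using Suc[unfolded jac_moment_def] isCont_jac by (cases "n = 0") (auto intro!: continuous_intros)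
  then show ?case by (simp add: jac_moment_def)
qed (simp add: jac_moment_def)

lemma isCont_cdh_fun: "cont_poly f a \<Longrightarrow> isCont (\<lambda>x. cdh_fun (p x) (q x) (r x) (f x)) a"
proof -
  assume f: "cont_poly f a"
  then obtain D where D: "\<And>x. degree (f x) \<le> D" by (auto simp: cont_poly_def)
  show ?thesis unfolding cdh_fun_altdef[OF D] using f
    by (intro continuous_intros isCont_jac_moment) (auto simp: cont_poly_def)
qed

lemma isCont_hahn_n: "isCont (\<lambda>x. hahn_n (p x) (q x) (r x) u n) a"
  unfolding hahn_n_def hahn3_def hahn_coeff_def by (intro continuous_intros isCont_pochhammer pqr) auto

end

lemma cont_poly_node_prod: "isCont p a \<Longrightarrow> cont_poly (\<lambda>x. node_prod (p x) A) a"
  unfolding node_prod_def by (intro cont_poly_prod cont_poly_linear continuous_intros)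

lemma eventually_pochhammer_neq_0:
  assumes "k \<noteq> 0"
  shows "\<forall>\<^sub>F x in cofinite. pochhammer (s + k * x) n \<noteq> (0 :: real)"
proof -
  have "\<forall>\<^sub>F x in cofinite. \<forall>i\<in>{0..<n}. s + k * x + real i \<noteq> 0"
  proof (intro eventually_cofinite_ball)
    fix i
    show "\<forall>\<^sub>F x in cofinite. s + k * x + real i \<noteq> 0"
      using eventually_cofinite_linear_neq[OF assms, of "s + real i"] by (simp add: add_ac)
  qed simp
  then show ?thesis by eventually_elim (simp add: pochhammer_prod)
qed

lemma pcompose_dual_hahn:
  assumes "\<And>k. a + 1 + real k \<noteq> 0"
  shows "pcompose (dual_hahn a b c n) [:- (par1 a b c)\<^sup>2, 1:]
    = smult (1 / pochhammer (a + 1) n) (cdh (par1 a b c) (par2 a b c) (par3 a b c) n)"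
  by (rule poly_ext) (simp add: poly_pcompose dual_hahn_cdh[OF assms, symmetric])

section \<open>The dual Hahn weight\<close>

lemma cdh_fun_node_prod_Suc:
  "cdh_fun p q r (node_prod p {..<Suc n}) = - (p + q + real n) * (p + r + real n) * cdh_fun p q r (node_prod p {..<n})"
proof -
  obtain k where k: "\<And>f. cdh_fun p q r (node_prod p {..<n} * f) = k * cdh_fun (p + real n) q r f"
    using cdh_fun_node_prod by blast
  have "node_prod p {..<Suc n} = node_prod p {..<n} * [:- (p + real n)\<^sup>2, 1:]"
    by (simp add: node_prod_def del: mult_pCons_right)
  moreover have "cdh_fun (p + real n) q r 1 = 1" using cdh_fun_cdh[of "p + real n" q r 0] by simp
  moreover have "cdh_fun (p + real n + 1) q r 1 = 1" using cdh_fun_cdh[of "p + real n + 1" q r 0] by simp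
  ultimately show ?thesis
    using k[of 1] cdh_fun_shift[of "p + real n" q r 1] by (simp only: k mult_1_right) (simp add: algebra_simps)
qed

lemma poly_node_prod: "poly (node_prod p A) t = (\<Prod>i\<in>A. t - (p + real i)\<^sup>2)"
  by (simp add: node_prod_def poly_prod)

context
  fixes \<alpha> \<beta> :: real and N :: nat
  assumes \<alpha>: "\<And>k. \<alpha> + 1 + real k \<noteq> 0" and \<beta>: "\<And>k. \<beta> + 1 + real k \<noteq> 0" and \<alpha>\<beta>: "\<And>k. \<alpha> + \<beta> + 1 + real k \<noteq> 0"
begin

private abbreviation (input) "w \<equiv> dual_hahn_weight \<alpha> \<beta> N"
private abbreviation (input) "P1 \<equiv> par1 \<alpha> \<beta> (real N)"
private abbreviation (input) "P2 \<equiv> par2 \<alpha> \<beta> (real N)"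
private abbreviation (input) "P3 \<equiv> par3 \<alpha> \<beta> (real N)"

text \<open>Detailed balance: with respect to the weight, the steps of \<Gamma> from x to x + 1 and
  back have equal coefficients.\<close>

lemma weight_symmetric: "w x * B_fun \<alpha> \<beta> (real N) (real x) = w (Suc x) * D_fun \<alpha> \<beta> (real N) (real (Suc x))"
proof -
  define s where "s = \<alpha> + \<beta>"
  define y where "y = real x"
  define X where "X = pochhammer (y + s + 2) N"
  have nz: "s + 1 + real k \<noteq> 0" for k using \<alpha>\<beta>[of k] by (simp add: s_def)
  have n: "2 * y + s + 1 \<noteq> 0" "2 * y + s + 2 \<noteq> 0" "2 * y + s + 3 \<noteq> 0" "y + s + 1 \<noteq> 0" "y + s + 2 + real N \<noteq> 0" "\<beta> + 1 + y \<noteq> 0" "y + 1 \<noteq> 0"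
    using nz[of "2 * x"] nz[of "2 * x + 1"] nz[of "2 * x + 2"] nz[of x] nz[of "x + 1 + N"] \<beta>[of x]
    by (auto simp: y_def algebra_simps)
  have X: "X \<noteq> 0" unfolding X_def
    by (rule pochhammer_nz) (use nz[of "x + 1 + _"] in \<open>simp add: y_def algebra_simps\<close>)
  have p: "pochhammer (y + s + 1) (N + 1) = (y + s + 1) * X" "pochhammer (y + 1 + s + 1) (N + 1) = X * (y + s + 2 + real N)"
    using pochhammer_rec[of "y + s + 1" N] pochhammer_Suc[of "y + s + 2" N] by (simp_all add: X_def add_ac)
  define b where "b = pochhammer (\<beta> + 1) x"
  have b: "b \<noteq> 0" unfolding b_def by (rule pochhammer_nz[OF \<beta>])
  define e where "e = pochhammer (\<alpha> + 1) x * pochhammer (- real N) x * fact N / ((-1) ^ x * b * fact x)"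
  have w: "w x = (2 * y + s + 1) * e / ((y + s + 1) * X)"
    unfolding dual_hahn_weight_def e_def b_def y_def[symmetric] using p(1) by (simp add: s_def add.assoc mult_ac)
  have e1: "pochhammer (\<alpha> + 1) (Suc x) * pochhammer (- real N) (Suc x) * fact N / ((-1) ^ Suc x * pochhammer (\<beta> + 1) (Suc x) * fact (Suc x))
     = e * ((\<alpha> + 1 + y) * (real N - y) / ((\<beta> + 1 + y) * (y + 1)))"
  proof -
    have g: "(A * k1) * (B * k2) * F / ((- 1 * S) * (b * k3) * (k4 * f)) = A * B * F / (S * b * f) * (k1 * (- k2) / (k3 * k4))" for A B F S b f k1 k2 k3 k4 :: real
      by (simp add: mult_ac)
    have f: "(fact (Suc x) :: real) = (y + 1) * fact x" by (simp add: y_def)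
    show ?thesis unfolding e_def b_def pochhammer_Suc y_def[symmetric] power_Suc f g by simp
  qed
  have "w (Suc x) = (2 * (y + 1) + s + 1) * (pochhammer (\<alpha> + 1) (Suc x) * pochhammer (- real N) (Suc x) * fact N / ((-1) ^ Suc x * pochhammer (\<beta> + 1) (Suc x) * fact (Suc x)))
      / pochhammer (y + 1 + s + 1) (N + 1)"
    unfolding dual_hahn_weight_def by (simp add: y_def s_def add_ac mult_ac del: power_Suc fact_Suc)
  then have w1: "w (Suc x) = (2 * y + s + 3) * (e * ((\<alpha> + 1 + y) * (real N - y) / ((\<beta> + 1 + y) * (y + 1)))) / (X * (y + s + 2 + real N))"
    unfolding e1 p by (simp add: algebra_simps)
  have B: "B_fun \<alpha> \<beta> (real N) (real x) = - ((y + \<alpha> + 1) * (y + s + 1) * (real N - y)) / ((2 * y + s + 1) * (2 * y + s + 2))"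
    unfolding B_fun_def by (simp add: y_def s_def add_ac)
  have D: "D_fun \<alpha> \<beta> (real N) (real (Suc x)) = - ((y + 1) * (y + s + 2 + real N) * (\<beta> + 1 + y)) / ((2 * y + s + 2) * (2 * y + s + 3))"
  proof -
    have e: "real (Suc x) = y + 1" "y + 1 + \<alpha> + \<beta> + real N + 1 = y + s + 2 + real N" "y + 1 + \<beta> = \<beta> + 1 + y"
      "2 * (y + 1) + \<alpha> + \<beta> = 2 * y + s + 2" "2 * y + s + 2 + 1 = 2 * y + s + 3" by (simp_all add: y_def s_def)
    show ?thesis unfolding D_fun_def e by simp
  qed
  have "w x * B_fun \<alpha> \<beta> (real N) (real x) = - (e * (y + \<alpha> + 1) * (real N - y) / (X * (2 * y + s + 2)))"
    unfolding w B using n X by (simp add: divide_simps)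
  moreover have "w (Suc x) * D_fun \<alpha> \<beta> (real N) (real (Suc x)) = - (e * (y + \<alpha> + 1) * (real N - y) / (X * (2 * y + s + 2)))"
    unfolding w1 D using n X by (simp add: divide_simps)
  ultimately show ?thesis by simp
qed

text \<open>By detailed balance the sum telescopes; the boundary terms vanish because D is zero at 0
  and B is zero at N.\<close>

lemma weight_Gamma_sum: "(\<Sum>x=0..N. w x * Gamma_op \<alpha> \<beta> (real N) f (real x)) = 0"
proof -
  define V where "V x = w x * B_fun \<alpha> \<beta> (real N) (real x) * (f (real x + 1) - f (real x))" for x
  have 0: "w 0 * Gamma_op \<alpha> \<beta> (real N) f (real 0) = V 0"
    by (simp add: Gamma_op_eq V_def D_fun_def)
  have S: "w (Suc x) * Gamma_op \<alpha> \<beta> (real N) f (real (Suc x)) = V (Suc x) - V x" for x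
  proof -
    have e: "real (Suc x) - 1 = real x" "real x + 1 = real (Suc x)" by simp_all
    show ?thesis unfolding Gamma_op_eq V_def weight_symmetric[of x] right_diff_distrib mult.assoc[symmetric] e ..
  qed
  have "(\<Sum>x=0..n. w x * Gamma_op \<alpha> \<beta> (real N) f (real x)) = V n" for n
    by (induction n) (simp_all only: sum.atLeast0_atMost_Suc 0 S, simp_all add: 0[simplified])
  then show ?thesis by (simp add: V_def B_fun_def)
qed

text \<open>The point x = 0 is irregular when \<alpha> + \<beta> = 0. It is harmless because the
  numerator of D contains x, but it needs the separate computation below.\<close>

lemma Gamma_newton_x_nat: "Gamma_op \<alpha> \<beta> (real N) (newton_x P1 (Suc j)) (real x)
    = (real j + 1) * (newton_x P1 (Suc j) (real x) + (P1 + P2 + real j) * (P1 + P3 + real j) * newton_x P1 j (real x))"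
proof (cases "x = 0")
  case False
  then have "regular_pt \<alpha> \<beta> (real x)"
    using \<alpha>\<beta>[of "2 * x - 1"] \<alpha>\<beta>[of "2 * x"] \<alpha>\<beta>[of "2 * x + 1"] by (auto simp: regular_pt_def of_nat_diff algebra_simps)
  then show ?thesis by (rule Gamma_newton_x(1))
next
  case True
  define s where "s = \<alpha> + \<beta>"
  have nz: "s + 1 \<noteq> 0" "s + 2 \<noteq> 0" using \<alpha>\<beta>[of 0] \<alpha>\<beta>[of 1] by (auto simp: s_def)
  have p: "2 * P1 = s + 1" "P1 + P2 = \<alpha> + 1" "P1 + P3 = - real N" by (auto simp: par_defs s_def field_simps)
  have U: "newton_U P1 j 0 = (if j = 0 then 1 else 0)" and X: "newton_x P1 j 0 = (if j = 0 then 1 else 0)" for j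
    by (auto simp: newton_U_def newton_x_prod)
  have d: "newton_x P1 (Suc j) (0 + 1) - newton_x P1 (Suc j) 0 = (real j + 1) * (s + 2) * (if j = 0 then 1 else 0)"
    unfolding newton_x_diff(1)[of P1 j 0] U p(1) by simp
  have B: "B_fun \<alpha> \<beta> (real N) 0 = - ((\<alpha> + 1) * real N / (s + 2))"
    using nz by (simp add: B_fun_def s_def)
  have "Gamma_op \<alpha> \<beta> (real N) (newton_x P1 (Suc j)) 0 = B_fun \<alpha> \<beta> (real N) 0 * ((real j + 1) * (s + 2) * (if j = 0 then 1 else 0))"
    unfolding Gamma_op_eq d by (simp add: D_fun_def)
  then show ?thesis unfolding True p(2,3) X of_nat_0 B using nz X[of "Suc j"] by simp
qed

text \<open>Summing \<Gamma> of a Newton product to zero gives a one-step recursion for the Newton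
  moments of the weight, and \<open>cdh_fun_node_prod_Suc\<close> is the same recursion. The total
  mass appears because the functional is normalised to 1 on constants.\<close>

lemma weight_functional:
  "(\<Sum>x=0..N. w x * poly f ((real x + P1)\<^sup>2)) = (\<Sum>x=0..N. w x) * cdh_fun P1 P2 P3 f"
proof (induction f rule: cdh_induct[of _ P1 P2 P3])
  case (1 f g)
  then show ?case by (simp add: cdh_fun_add sum.distrib distrib_left)
next
  case (2 k f)
  have "(\<Sum>x=0..N. w x * poly (smult k f) ((real x + P1)\<^sup>2)) = k * (\<Sum>x=0..N. w x * poly f ((real x + P1)\<^sup>2))"
    by (simp add: sum_distrib_left mult_ac)
  then show ?case by (simp add: 2 cdh_fun_smult)
next
  case (3 n)
  have M: "(\<Sum>x=0..N. w x * newton_x P1 j (real x)) = (\<Sum>x=0..N. w x) * cdh_fun P1 P2 P3 (node_prod P1 {..<j})" for j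
  proof (induction j)
    case 0
    then show ?case using cdh_fun_cdh[of P1 P2 P3 0] by (simp add: newton_x_def newton_def node_prod_def)
  next
    case (Suc j)
    have "0 = (\<Sum>x=0..N. (real j + 1) * (w x * newton_x P1 (Suc j) (real x) + (P1 + P2 + real j) * (P1 + P3 + real j) * (w x * newton_x P1 j (real x))))"
      using weight_Gamma_sum[of "newton_x P1 (Suc j)"] unfolding Gamma_newton_x_nat by (simp add: algebra_simps)
    also have "\<dots> = (real j + 1) * ((\<Sum>x=0..N. w x * newton_x P1 (Suc j) (real x))
        + (P1 + P2 + real j) * (P1 + P3 + real j) * (\<Sum>x=0..N. w x * newton_x P1 j (real x)))"
      by (simp only: sum_distrib_left[symmetric] sum.distrib)
    finally have "(\<Sum>x=0..N. w x * newton_x P1 (Suc j) (real x)) = - ((P1 + P2 + real j) * (P1 + P3 + real j)) * (\<Sum>x=0..N. w x * newton_x P1 j (real x))"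
      by (simp add: eq_neg_iff_add_eq_0)
    then show ?case unfolding cdh_fun_node_prod_Suc Suc by (simp only: minus_mult_left[symmetric]) (simp add: mult_ac)
  qed
  have K: "cdh P1 P2 P3 n = (\<Sum>j\<le>n. smult (cdh_coeff P1 P2 P3 n j) (node_prod P1 {..<j}))"
    by (rule poly_ext) (simp add: cdh_explicit poly_sum poly_node_prod newton_def)
  have "(\<Sum>x=0..N. w x * poly (cdh P1 P2 P3 n) ((real x + P1)\<^sup>2)) = (\<Sum>x=0..N. \<Sum>j\<le>n. cdh_coeff P1 P2 P3 n j * (w x * newton_x P1 j (real x)))"
    unfolding cdh_explicit newton_x_def by (simp add: sum_distrib_left mult_ac)
  also have "\<dots> = (\<Sum>j\<le>n. cdh_coeff P1 P2 P3 n j * ((\<Sum>x=0..N. w x) * cdh_fun P1 P2 P3 (node_prod P1 {..<j})))"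
    unfolding M[symmetric] by (subst sum.swap) (simp add: sum_distrib_left)
  also have "\<dots> = (\<Sum>x=0..N. w x) * cdh_fun P1 P2 P3 (cdh P1 P2 P3 n)"
    unfolding K cdh_fun_sum cdh_fun_smult by (simp add: sum_distrib_left mult_ac)
  finally show ?case .
qed

lemma rho_F_theta: "rho_F F1 F2 F3 \<alpha> \<beta> N x = poly (theta F1 F2 F3 P1 P2 P3) ((real x + P1)\<^sup>2) * w x"
proof -
  have e: "(P3 + f)\<^sup>2 = (real N - f + P1)\<^sup>2" "(P2 + f)\<^sup>2 = (f - \<beta> + P1)\<^sup>2" for f
  proof -
    have "P3 + f = - (real N - f + P1)" "P2 + f = f - \<beta> + P1" by (simp_all add: par_defs field_simps)
    then show "(P3 + f)\<^sup>2 = (real N - f + P1)\<^sup>2" "(P2 + f)\<^sup>2 = (f - \<beta> + P1)\<^sup>2" by (simp_all only: power2_minus)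
  qed
  show ?thesis
    unfolding rho_F_def theta_def poly_mult poly_node_prod e lam_eq[of _ _ _ "real N"] by (simp add: add.commute)
qed

end

section \<open>Degrees of the determinantal polynomials and a criterion for orthogonality\<close>

lemma degree_eq_coeff: "degree f \<le> n \<Longrightarrow> coeff f n \<noteq> 0 \<Longrightarrow> degree f = n"
  by (simp add: le_antisym le_degree)

lemma degree_dual_hahn:
  assumes "\<And>k. a + 1 + real k \<noteq> 0"
  shows "degree (dual_hahn a b c n) = n" "dual_hahn a b c n \<noteq> 0"
proof -
  have d: "degree (cdh (par1 a b c) (par2 a b c) (par3 a b c) n) = n" by (rule degree_eq_coeff) (auto simp: degree_cdh)
  have p: "pochhammer (a + 1) n \<noteq> 0" using assms by (rule pochhammer_nz)
  then have "degree (pcompose (dual_hahn a b c n) [:- (par1 a b c)\<^sup>2, 1:]) = n"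
    unfolding pcompose_dual_hahn[OF assms] using d by simp
  then show "degree (dual_hahn a b c n) = n" by (simp add: degree_pcompose)
  have "cdh (par1 a b c) (par2 a b c) (par3 a b c) n \<noteq> 0" using degree_cdh(2)[of "par1 a b c" "par2 a b c" "par3 a b c" n] by auto
  with p pcompose_dual_hahn[OF assms, of b c n] show "dual_hahn a b c n \<noteq> 0" by auto
qed

lemma row_minor_0: "row_minor (q_row a b c U1 U2 U3 x) (num_rows U1 U2 U3) 0 = Omega_D a b c U1 U2 U3 x"
  unfolding row_minor_def Omega_D_def Casorati_eq q_row_def
  by (simp, intro arg_cong[where f = det] cong_mat) (auto simp: add.commute)

text \<open>The coefficient of R_n in the determinant is \<Omega>(n), and all other terms have
  smaller degree.\<close>

lemma degree_q_poly:
  assumes a: "\<And>k. a + 1 + real k \<noteq> 0" and O: "Omega_D a b c U1 U2 U3 (real n) \<noteq> 0"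
  shows "degree (q_poly a b c U1 U2 U3 n) = n" "q_poly a b c U1 U2 U3 n \<noteq> 0"
proof -
  define m where "m = num_rows U1 U2 U3"
  define f where "f i = (if i \<le> n then smult ((-1) ^ i * row_minor (q_row a b c U1 U2 U3 (real n)) m i) (dual_hahn a b c (n - i)) else 0)" for i
  have "coeff (f i) n = 0" if "i \<noteq> 0" for i
    using that degree_dual_hahn(1)[OF a, of b c "n - i"] by (auto simp: f_def intro!: coeff_eq_0)
  then have "(\<Sum>i\<le>m. coeff (f i) n) = (\<Sum>i\<in>{0}. coeff (f i) n)"
    by (intro sum.mono_neutral_right) auto
  then have c: "coeff (q_poly a b c U1 U2 U3 n) n = Omega_D a b c U1 U2 U3 (real n) * coeff (dual_hahn a b c n) n"
    unfolding q_poly_eq coeff_sum m_def[symmetric] f_def[symmetric] by (simp add: f_def m_def row_minor_0)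
  have nz: "coeff (q_poly a b c U1 U2 U3 n) n \<noteq> 0"
    unfolding c using O degree_dual_hahn[OF a, of b c n] by (metis leading_coeff_0_iff mult_eq_0_iff)
  have "degree (q_poly a b c U1 U2 U3 n) \<le> n"
    unfolding q_poly_eq using degree_dual_hahn(1)[OF a]
    by (intro degree_sum_le) (auto intro!: order.trans[OF degree_smult_le])
  then show "degree (q_poly a b c U1 U2 U3 n) = n" using nz by (rule degree_eq_coeff)
  show "q_poly a b c U1 U2 U3 n \<noteq> 0" using nz by auto
qed

text \<open>Read backwards, the products \<xi> are the Pochhammer quotients in
  \<open>Omega_factor\<close>. The two matrices differ only by the sign \<open>(-1) ^ m\<close> in
  the rows of the first family.\<close>

lemma Omega_D_nz:
  assumes "Omega a b c U1 U2 U3 x \<noteq> 0"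
  shows "Omega_D a b c U1 U2 U3 x \<noteq> 0"
proof
  assume D: "Omega_D a b c U1 U2 U3 x = 0"
  define m where "m = num_rows U1 U2 U3"
  define lab where "lab = row_labels U1 U2 U3"
  define r :: "nat \<Rightarrow> real" where "r l = (if fst (lab ! l) = First then (-1) ^ m else 1)" for l
  have fac: "Omega_factor a b c U1 U2 U3 (fst (lab ! l)) j x = r l * xi a b c U1 U2 U3 l (x - real j) (m - j)" if "j \<le> m" for j l
  proof -
    have rev: "(\<Prod>k<m - j. a + (x - real j - real k)) = pochhammer (a + x - real m + 1) (m - j)"
      unfolding pochhammer_prod
      by (rule prod.reindex_bij_witness[of _ "\<lambda>s. m - j - 1 - s" "\<lambda>s. m - j - 1 - s"]) (use that in \<open>auto simp: of_nat_diff\<close>)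
    have num: "(\<Prod>k<m - j. z - (x - real j - real k) + 1) = pochhammer (z - x + real j + 1) (m - j)" for z
      unfolding pochhammer_prod by (rule prod.cong) auto
    show ?thesis
    proof (cases "fst (lab ! l)")
      case First
      have "(-1 :: real) ^ m * (-1) ^ (m - j) = (-1) ^ j" using that by (simp add: power_add[symmetric] uminus_power_if)
      then show ?thesis using First by (simp add: r_def xi_def lab_def[symmetric])
    qed (simp_all add: r_def xi_def lab_def[symmetric] m_def[symmetric] prod_dividef rev num)
  qed
  have Y: "poly (hahn_row a b c (lab ! l)) (- x + real j - 1) = poly (Y a b c U1 U2 U3 l) (x - real j)" for l j
  proof -
    have e: "poly [:- 1, - 1:] (x - real j) = - x + real j - 1" by simp
    show ?thesis unfolding Y_def poly_pcompose e lab_def ..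
  qed
  have "Omega a b c U1 U2 U3 x = det (mat_diag m r * Casorati a b c U1 U2 U3 x)"
    unfolding Omega_def
    by (subst mat_diag_mult_left[of _ m m])
       (simp_all add: Casorati_def m_def[symmetric] lab_def[symmetric] Let_def Y[symmetric],
        intro arg_cong[where f = det] cong_mat, auto simp: fac[of "Suc _", simplified] simp del: of_nat_Suc)
  also have "\<dots> = det (mat_diag m r) * Omega_D a b c U1 U2 U3 x"
    unfolding Omega_D_def by (rule det_mult[of _ m]) (auto simp: Casorati_def m_def)
  finally show False using assms D by simp
qed

lemma orthogonal_sequenceI:
  assumes inj: "inj_on (\<lambda>x. l (real x)) {0..N}"
    and deg: "\<And>n. n \<le> N \<Longrightarrow> degree (q n) = n" and nz: "\<And>n. n \<le> N \<Longrightarrow> q n \<noteq> 0"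
    and orth: "\<And>n g. n \<le> N \<Longrightarrow> degree g < n \<Longrightarrow> integral_lam \<mu> N l (q n * g) = 0"
  shows "orthogonal_sequence \<mu> N l q"
proof -
  define I where "I = integral_lam \<mu> N l"
  have add: "I (f + g) = I f + I g" and smult: "I (smult k f) = k * I f" for f g k
    by (simp_all add: I_def integral_lam_def distrib_left sum.distrib sum_distrib_left mult_ac)
  define supp where "supp = {x \<in> {0..N}. \<mu> x \<noteq> 0}"
  have "card supp \<le> card {0..N}" unfolding supp_def by (intro card_mono) auto
  then have L: "n \<le> N" if "n < card supp" for n using that by simp
  have off: "I (q n * q k) = 0" if "n \<le> N" "k \<le> N" "n \<noteq> k" for n k
  proof (cases "k < n")
    case True
    then show ?thesis using orth[of n "q k"] deg that by (simp add: I_def)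
  next
    case False
    then show ?thesis using orth[of k "q n"] deg that by (simp add: I_def mult.commute)
  qed
  have "I (q n ^ 2) \<noteq> 0" if n: "n < card supp" for n
  proof
    assume "I (q n ^ 2) = 0"
    then have q: "I (q n * q k) = 0" if "k \<le> N" for k
      using off[OF L[OF n] that] by (cases "n = k") (simp_all add: power2_eq_square)
    \<comment> \<open>The polynomials q_k are available up to k = N, beyond the number of support
      points; they span everything of degree at most N, in particular the Lagrange products used
      next.\<close>
    have all: "I (q n * g) = 0" if "degree g \<le> k" "k \<le> N" for g k
      using that
    proof (induction k arbitrary: g rule: less_induct)
      case (less k)
      define c where "c = coeff g k / lead_coeff (q k)"
      define g' where "g' = g - smult c (q k)"
      have "degree g' \<le> k" unfolding g'_def using less.prems deg[of k]
        by (intro degree_diff_le order.trans[OF degree_smult_le]) auto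
      moreover have "coeff g' k = 0"
        using less.prems deg[of k] nz[of k] by (auto simp: g'_def c_def dest: leading_coeff_neq_0)
      ultimately have "g' = 0 \<or> degree g' < k"
        by (metis le_neq_implies_less leading_coeff_0_iff)
      then have "I (q n * g') = 0"
      proof
        assume "degree g' < k"
        then show ?thesis using less.IH[of "degree g'" g'] less.prems by simp
      qed (simp add: I_def integral_lam_def)
      moreover have "q n * g = q n * g' + smult c (q n * q k)" by (simp add: g'_def algebra_simps)
      ultimately show ?case using q[OF less.prems(2)] by (simp add: add smult)
    qed
    have root: "poly (q n) (l (real x)) = 0" if x: "x \<in> supp" for x
    proof -
      define g where "g = (\<Prod>y\<in>{0..N} - {x}. [:- l (real y), 1:])"
      have "degree g \<le> (\<Sum>y\<in>{0..N} - {x}. 1)" unfolding g_def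
        by (rule order.trans[OF degree_prod_sum_le]) auto
      then have "degree g \<le> N" using x by (simp add: supp_def)
      then have "0 = I (q n * g)" using all[of g N] by simp
      also have "\<dots> = (\<Sum>y\<in>{0..N}. if y = x then \<mu> x * poly (q n * g) (l (real x)) else 0)"
        unfolding I_def integral_lam_def
      proof (intro sum.cong refl)
        fix y assume "y \<in> {0..N}"
        then show "\<mu> y * poly (q n * g) (l (real y)) = (if y = x then \<mu> x * poly (q n * g) (l (real x)) else 0)"
          by (auto simp: g_def poly_prod)
      qed
      also have "\<dots> = \<mu> x * poly (q n * g) (l (real x))" using x by (simp add: supp_def)
      finally have "\<mu> x * poly (q n) (l (real x)) * poly g (l (real x)) = 0" by simp
      moreover have "poly g (l (real x)) \<noteq> 0" "\<mu> x \<noteq> 0"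
        using inj x by (auto simp: g_def poly_prod supp_def inj_on_def)
      ultimately show ?thesis by simp
    qed
    have "card ((\<lambda>x. l (real x)) ` supp) \<le> card {t. poly (q n) t = 0}"
      using root nz[OF L[OF n]] by (intro card_mono poly_roots_finite) auto
    also have "\<dots> \<le> n" using card_poly_roots_bound[OF nz[OF L[OF n]]] deg[OF L[OF n]] by simp
    also have "card ((\<lambda>x. l (real x)) ` supp) = card supp"
      by (rule card_image) (rule inj_on_subset[OF inj], auto simp: supp_def)
    finally show False using n by simp
  qed
  then show ?thesis
    using off deg L unfolding orthogonal_sequence_def Let_def supp_def[symmetric] I_def by auto
qed

section \<open>The Hahn difference equation\<close>

text \<open>Rewritten with a second difference, a first difference and the function itself, the
  equation has three terms of the same order; their leading coefficients sum to
  \<open>(degree + 1 - p)^2 - t\<close> times that of F.\<close>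

lemma hahn_difference_degree:
  fixes F :: "real poly"
  assumes F: "F \<noteq> 0"
    and eq: "\<And>n. (n + 1) * (n + q + r) * poly F (n + 1) + jacB p q r n * poly F n
      + (n + p + q - 1) * (n + p + r - 1) * poly F (n - 1) = t * poly F n"
  shows "(real (degree F) + 1 - p)\<^sup>2 = t"
proof -
  define d where "d = int (degree F)"
  define l where "l = lead_coeff F"
  define S where "S n = poly F (n + 1) - poly F n" for n
  have 0: "asy (poly F) d l" unfolding d_def l_def by (rule asy_poly_le) simp
  have 1: "asy S (d - 1) (of_int d * l)" using asy_shift_diff[OF 0, of 1] by (simp add: S_def[abs_def])
  have 2: "asy (\<lambda>n. - (S (n + -1) - S n)) (d - 1 - 1) (- (of_int (d - 1) * (-1) * (of_int d * l)))"
    by (rule asy_minus[OF asy_shift_diff[OF 1, of "-1"]])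
  have 3: "asy (\<lambda>n. (1 + 1 * n) * (q + r + 1 * n) * (- (S (n + -1) - S n))) (1 + 1 + (d - 1 - 1)) (1 * 1 * (- (of_int (d - 1) * (-1) * (of_int d * l))))"
    by (rule asy_mult[OF asy_mult[OF asy_linear asy_linear] 2])
  have 4: "asy (\<lambda>n. ((q + r) - (p + q - 1) * (p + r - 1) + (3 - 2 * p) * n) * S (n + -1)) (1 + (d - 1)) ((3 - 2 * p) * (of_int d * l))"
    by (rule asy_mult[OF asy_linear asy_shift[OF 1]])
  have 5: "asy (\<lambda>n. ((p - 1)\<^sup>2 - t) * poly F n) d (((p - 1)\<^sup>2 - t) * l)" by (rule asy_cmult[OF 0])
  define c where "c = of_int (d - 1) * (of_int d * l) + (3 - 2 * p) * (of_int d * l) + ((p - 1)\<^sup>2 - t) * l"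
  have "asy (\<lambda>n. (1 + 1 * n) * (q + r + 1 * n) * (- (S (n + -1) - S n))
      + ((q + r) - (p + q - 1) * (p + r - 1) + (3 - 2 * p) * n) * S (n + -1) + ((p - 1)\<^sup>2 - t) * poly F n) d c"
    using asy_add[OF asy_add[OF 3[simplified] 4[simplified]] 5] unfolding c_def by (simp add: algebra_simps)
  moreover have "(1 + 1 * n) * (q + r + 1 * n) * (- (S (n + -1) - S n))
      + ((q + r) - (p + q - 1) * (p + r - 1) + (3 - 2 * p) * n) * S (n + -1) + ((p - 1)\<^sup>2 - t) * poly F n = 0" for n
    using eq[of n] by (simp add: S_def jacB_def power2_eq_square algebra_simps)
  ultimately have "asy (\<lambda>n. 0) d c" by simp
  from asy_not_eventually_zero[OF this] have "c = 0" by auto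
  moreover have "c = ((real (degree F) + 1 - p)\<^sup>2 - t) * l"
    by (simp add: c_def d_def power2_eq_square algebra_simps)
  ultimately show ?thesis using F by (simp add: l_def)
qed

text \<open>A combination that cancels the coefficients of degree u solves the same equation with a
  smaller degree d, so \<open>(d + 1 - p)^2 = (p - 1 - u)^2\<close>. As d < u this means
  \<open>u + d + 2 = 2 * p\<close>, a zero of the Pochhammer symbol in
  \<open>nonres\<close>.\<close>

lemma hahn_difference_unique:
  fixes F G :: "real poly"
  assumes F: "degree F \<le> u" and G: "degree G \<le> u"
    and eq: "\<And>H n. H \<in> {F, G} \<Longrightarrow> (n + 1) * (n + q + r) * poly H (n + 1) + jacB p q r n * poly H n
      + (n + p + q - 1) * (n + p + r - 1) * poly H (n - 1) = (p - 1 - real u)\<^sup>2 * poly H n"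
    and nonres: "pochhammer (real u + 2 - 2 * p) u \<noteq> 0"
  shows "smult (coeff G u) F = smult (coeff F u) G"
proof (rule ccontr)
  define D where "D = smult (coeff G u) F - smult (coeff F u) G"
  assume "smult (coeff G u) F \<noteq> smult (coeff F u) G"
  then have D: "D \<noteq> 0" by (simp add: D_def)
  have "degree D \<le> u" unfolding D_def using F G by (intro degree_diff_le order.trans[OF degree_smult_le])
  moreover have "coeff D u = 0" by (simp add: D_def)
  ultimately have d: "degree D < u" using D by (metis le_neq_implies_less leading_coeff_0_iff)
  have "(real (degree D) + 1 - p)\<^sup>2 = (p - 1 - real u)\<^sup>2"
  proof (rule hahn_difference_degree[OF D, of q r p])
    fix n
    define E where "E H = (n + 1) * (n + q + r) * poly H (n + 1) + jacB p q r n * poly H n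
      + (n + p + q - 1) * (n + p + r - 1) * poly H (n - 1) - (p - 1 - real u)\<^sup>2 * poly H n" for H
    have "E D = coeff G u * E F - coeff F u * E G" by (simp add: E_def D_def algebra_simps)
    moreover have "E F = 0" "E G = 0" using eq[of F n] eq[of G n] by (simp_all add: E_def)
    ultimately show "(n + 1) * (n + q + r) * poly D (n + 1) + jacB p q r n * poly D n
      + (n + p + q - 1) * (n + p + r - 1) * poly D (n - 1) = (p - 1 - real u)\<^sup>2 * poly D n"
      by (simp add: E_def)
  qed
  then have "(real u - real (degree D)) * (real u + real (degree D) + 2 - 2 * p) = 0"
    by (simp add: power2_eq_square algebra_simps)
  then have "real u + 2 - 2 * p = - real (degree D)" using d by auto
  then show False using nonres d unfolding pochhammer_eq_0_iff by blast
qed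

definition hahn_n_poly :: "real \<Rightarrow> real \<Rightarrow> real \<Rightarrow> nat \<Rightarrow> real poly" where
  "hahn_n_poly p q r u = (\<Sum>j\<le>u. smult ((-1) ^ u * hahn_coeff p q r u j) (pcompose (pochhammer [:0, 1:] j) [:1, 1:]))"

lemma poly_hahn_n: "poly (hahn_n_poly p q r u) n = hahn_n p q r u n"
  by (simp add: hahn_n_poly_def poly_sum poly_pcompose poly_pochhammer hahn_n_def hahn3_def sum_distrib_left mult.assoc add.commute)

lemma pochhammer_linear_lead:
  "degree (pcompose (pochhammer [:0, 1 :: real:] j) [:s, 1:]) = j" "coeff (pcompose (pochhammer [:0, 1 :: real:] j) [:s, 1:]) j = 1"
proof -
  show 1: "degree (pcompose (pochhammer [:0, 1 :: real:] j) [:s, 1:]) = j"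
    by (simp add: degree_pcompose pochhammer_poly_lead)
  have "lead_coeff (pcompose (pochhammer [:0, 1 :: real:] j) [:s, 1:]) = 1"
    by (simp add: lead_coeff_comp pochhammer_poly_lead)
  then show "coeff (pcompose (pochhammer [:0, 1 :: real:] j) [:s, 1:]) j = 1" unfolding 1 .
qed

lemma hahn_n_poly_lead: "degree (hahn_n_poly p q r u) \<le> u" "coeff (hahn_n_poly p q r u) u = pochhammer (real u + 2 - 2 * p) u"
proof -
  show "degree (hahn_n_poly p q r u) \<le> u"
    unfolding hahn_n_poly_def
    by (intro degree_sum_le) (auto intro!: order.trans[OF degree_smult_le] simp: pochhammer_linear_lead)
  have "coeff (hahn_n_poly p q r u) u = (\<Sum>j\<in>{u}. (-1) ^ u * hahn_coeff p q r u j * coeff (pcompose (pochhammer [:0, 1:] j) [:1, 1:]) u)"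
    unfolding hahn_n_poly_def coeff_sum coeff_smult
    by (intro sum.mono_neutral_right) (auto intro!: coeff_eq_0 simp: pochhammer_linear_lead)
  also have "\<dots> = (-1) ^ u * pochhammer (- real u) u / fact u * pochhammer (real u + 2 - 2 * p) u"
    by (simp add: pochhammer_linear_lead hahn_coeff_def)
  also have "(-1) ^ u * pochhammer (- real u) u / fact u = 1"
    using pochhammer_minus_fact[of u u] by simp
  finally show "coeff (hahn_n_poly p q r u) u = pochhammer (real u + 2 - 2 * p) u" by simp
qed

lemma hahn_n_commute: "hahn_n p q r u n = hahn_n p r q u n"
  by (simp add: hahn_n_def hahn3_def hahn_coeff_def mult_ac)

text \<open>Both sides solve the same difference equation, and nonresonance makes its polynomial solution
  of degree \<open>w + e\<close> unique up to a factor.\<close>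

lemma hahn_n_resonance:
  assumes nonres: "pochhammer (real (w + e) + 2 - 2 * (p + real e)) (w + e) \<noteq> 0"
    and lead: "pochhammer (real w + 2 - 2 * p) w \<noteq> 0"
  shows "\<exists>k. \<forall>n. hahn_n (p + real e) p r (w + e) n = k * (pochhammer (n + p + r) e * hahn_n p (p + real e) r w n)"
proof -
  define H where "H = hahn_n_poly p (p + real e) r w"
  define L where "L = pcompose (pochhammer [:0, 1 :: real:] e) [:p + r, 1:]"
  define F where "F = hahn_n_poly (p + real e) p r (w + e)"
  define G where "G = L * H"
  have H: "degree H = w" "coeff H w = pochhammer (real w + 2 - 2 * p) w"
  proof -
    show c: "coeff H w = pochhammer (real w + 2 - 2 * p) w" unfolding H_def by (rule hahn_n_poly_lead(2))
    show "degree H = w" by (rule degree_eq_coeff) (use hahn_n_poly_lead(1) c lead in \<open>auto simp: H_def\<close>)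
  qed
  have L: "degree L = e" "coeff L e = 1" unfolding L_def by (rule pochhammer_linear_lead)+
  have nz: "L \<noteq> 0" "H \<noteq> 0" using L H lead by auto
  have G: "degree G = w + e" "coeff G (w + e) = pochhammer (real w + 2 - 2 * p) w"
  proof -
    show "degree G = w + e" unfolding G_def using nz H L by (simp add: degree_mult_eq)
    have "coeff G (degree L + degree H) = coeff L (degree L) * coeff H (degree H)"
      unfolding G_def by (rule coeff_mult_degree_sum)
    then show "coeff G (w + e) = pochhammer (real w + 2 - 2 * p) w" unfolding H(1) L(1) by (simp add: H L add.commute)
  qed
  have poly_L: "poly L n = pochhammer (n + p + r) e" for n
    by (simp add: L_def poly_pcompose poly_pochhammer add_ac)
  have "smult (coeff G (w + e)) F = smult (coeff F (w + e)) G"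
  proof (rule hahn_difference_unique[OF _ _ _ nonres])
    fix X n assume "X \<in> {F, G}"
    then consider "X = F" | "X = G" by blast
    then show "(n + 1) * (n + p + r) * poly X (n + 1) + jacB (p + real e) p r n * poly X n
      + (n + (p + real e) + p - 1) * (n + (p + real e) + r - 1) * poly X (n - 1) = (p + real e - 1 - real (w + e))\<^sup>2 * poly X n"
    proof cases
      case 1
      show ?thesis unfolding 1 F_def poly_hahn_n by (rule hahn_n_difference)
    next
      case 2
      \<comment> \<open>\<open>up\<close> and \<open>down\<close> carry the Pochhammer factor
        through the two shifts, which turns the equation with p + e distinguished into the one with
        p distinguished. The eigenvalues agree because
        \<open>(p + e) - 1 - (w + e) = p - 1 - w\<close>.\<close>
      have up: "(n + p + r) * pochhammer (n + 1 + p + r) e = pochhammer (n + p + r) e * (n + p + r + real e)"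
        using pochhammer_rec[of "n + p + r" e] pochhammer_Suc[of "n + p + r" e] by (simp add: add_ac)
      have down: "(n + (p + real e) + r - 1) * pochhammer (n - 1 + p + r) e = (n + p + r - 1) * pochhammer (n + p + r) e"
        using pochhammer_rec[of "n + p + r - 1" e] pochhammer_Suc[of "n + p + r - 1" e] by (simp add: algebra_simps)
      have j: "jacB (p + real e) p r n = jacB p (p + real e) r n" by (rule jac_sym)
      have "(n + 1) * (n + p + r) * poly X (n + 1) + jacB (p + real e) p r n * poly X n
          + (n + (p + real e) + p - 1) * (n + (p + real e) + r - 1) * poly X (n - 1)
        = (n + 1) * ((n + p + r) * pochhammer (n + 1 + p + r) e) * hahn_n p (p + real e) r w (n + 1)
          + jacB p (p + real e) r n * (pochhammer (n + p + r) e * hahn_n p (p + real e) r w n)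
          + (n + (p + real e) + p - 1) * ((n + (p + real e) + r - 1) * pochhammer (n - 1 + p + r) e) * hahn_n p (p + real e) r w (n - 1)"
        unfolding 2 G_def H_def poly_mult poly_hahn_n poly_L j by (simp add: mult_ac)
      also have "\<dots> = pochhammer (n + p + r) e * ((n + 1) * (n + (p + real e) + r) * hahn_n p (p + real e) r w (n + 1)
          + jacB p (p + real e) r n * hahn_n p (p + real e) r w n
          + (n + p + (p + real e) - 1) * (n + p + r - 1) * hahn_n p (p + real e) r w (n - 1))"
        unfolding up down by (simp add: algebra_simps)
      also have "\<dots> = pochhammer (n + p + r) e * ((p - 1 - real w)\<^sup>2 * hahn_n p (p + real e) r w n)"
        unfolding hahn_n_difference ..
      also have "\<dots> = (p + real e - 1 - real (w + e))\<^sup>2 * poly X n"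
      proof -
        have e: "p + real e - 1 - real (w + e) = p - 1 - real w" by simp
        show ?thesis unfolding 2 G_def H_def poly_mult poly_hahn_n poly_L e by simp
      qed
      finally show ?thesis .
    qed
  qed (use hahn_n_poly_lead[of "p + real e" p r "w + e"] G in \<open>auto simp: F_def\<close>)
  then have *: "coeff G (w + e) * poly F n = coeff F (w + e) * poly G n" for n
    by (metis poly_smult)
  have "coeff G (w + e) \<noteq> 0" using lead by (simp add: G(2))
  then have "poly F n = coeff F (w + e) / coeff G (w + e) * poly G n" for n
    using *[of n] by (simp add: field_simps)
  then show ?thesis
    unfolding F_def G_def H_def poly_mult poly_hahn_n poly_L by blast
qed

lemma Y_hahn_n_poly:
  assumes "row_labels U1 U2 U3 ! l = (fam, u)"
  shows "Y a b c U1 U2 U3 l = smult ((-1) ^ u) (hahn_n_poly (fam_p a b c fam) (fam_q a b c fam) (fam_r a b c fam) u)"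
  by (rule poly_ext) (simp add: poly_Y[OF assms] poly_hahn_n)

lemma det_proportional_rows:
  fixes A :: "real mat"
  assumes A: "A \<in> carrier_mat m m" and kl: "k < m" "l < m" "k \<noteq> l"
    and sim: "\<And>j. j < m \<Longrightarrow> A $$ (k, j) = s * A $$ (l, j)"
  shows "det A = 0"
proof -
  have "det (addrow (- s) k l A) = 0"
    by (rule det_zero_block[where R = "{k}" and C = "{..<m}" and n = m]) (use A kl sim in \<open>auto simp: mat_addrow_def\<close>)
  then show ?thesis using det_addrow[OF kl(2,3) A, of "- s"] by simp
qed

section \<open>Orthogonality and nondegeneracy\<close>

context
  fixes F1 F2 F3 :: "nat set"
begin

private abbreviation (input) "U1 \<equiv> I_set F1"
private abbreviation (input) "U2 \<equiv> I_set F2"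
private abbreviation (input) "U3 \<equiv> I_set F3"
private abbreviation (input) "mF \<equiv> num_rows U1 U2 U3"
private abbreviation (input) "lab \<equiv> row_labels U1 U2 U3"
private abbreviation (input) "as \<alpha> \<equiv> \<alpha> + real (set_len F2) + real (set_len F3)"
private abbreviation (input) "bs \<beta> \<equiv> \<beta> + real (set_len F2) - real (set_len F3)"
private abbreviation (input) "cs N \<equiv> N - real (set_len F1) - real (set_len F2)"

text \<open>The first row of the matrix of \<open>q_poly\<close> is replaced by the values of the
  functional on its entries times \<Theta> t^j, so that the determinant is the j-th moment of
  q_n.\<close>

definition orth_entry :: "real \<Rightarrow> real \<Rightarrow> real \<Rightarrow> nat \<Rightarrow> nat \<Rightarrow> nat \<Rightarrow> nat \<Rightarrow> real" where
  "orth_entry \<alpha> \<beta> N n j k i = (if k = 0 then (-1) ^ i * (if i \<le> n then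
      cdh_fun (par1 \<alpha> \<beta> N) (par2 \<alpha> \<beta> N) (par3 \<alpha> \<beta> N) (theta F1 F2 F3 (par1 \<alpha> \<beta> N) (par2 \<alpha> \<beta> N) (par3 \<alpha> \<beta> N) *
        monom 1 j * cdh (par1 (as \<alpha>) (bs \<beta>) (cs N)) (par2 (as \<alpha>) (bs \<beta>) (cs N)) (par3 (as \<alpha>) (bs \<beta>) (cs N)) (n - i))
        / pochhammer (as \<alpha> + 1) (n - i) else 0)
      else q_row (as \<alpha>) (bs \<beta>) (cs N) U1 U2 U3 (real n) (k - 1) i)"

definition orth_det :: "real \<Rightarrow> real \<Rightarrow> real \<Rightarrow> nat \<Rightarrow> nat \<Rightarrow> real" where
  "orth_det \<alpha> \<beta> N n j = det (mat (Suc mF) (Suc mF) (\<lambda>(k, i). orth_entry \<alpha> \<beta> N n j k i))"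

context
  assumes F: "finite F1" "finite F2" "finite F3" "0 \<notin> F1" "0 \<notin> F2" "0 \<notin> F3"
begin

lemma finU: "finite U1" "finite U2" "finite U3"
  using F finite_I_set by auto

text \<open>Explains the parameters of the statement: each of the three parameters moves by the
  number of consecutive nodes that it absorbs.\<close>

lemma par_after:
  fixes \<alpha> \<beta> N :: real
  defines "a \<equiv> \<alpha> + real (set_len F2) + real (set_len F3)" and "b \<equiv> \<beta> + real (set_len F2) - real (set_len F3)"
    and "c \<equiv> N - real (set_len F1) - real (set_len F2)"
  shows "par1 a b c = par1 \<alpha> \<beta> N + real (set_len F2)" "par2 a b c = par2 \<alpha> \<beta> N + real (set_len F3)"
    "par3 a b c = par3 \<alpha> \<beta> N + real (set_len F1)"
  by (simp_all add: par_defs a_def b_def c_def field_simps)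

text \<open>The Christoffel factor times the product of all row nodes is the full product of
  consecutive nodes. Cancelling the linear factor of row l leaves the situation of
  \<open>cdh_fun_row\<close>, up to the symmetry of the three parameters.\<close>

lemma row_functional:
  fixes \<alpha> \<beta> N :: real
  defines "a \<equiv> \<alpha> + real (set_len F2) + real (set_len F3)" and "b \<equiv> \<beta> + real (set_len F2) - real (set_len F3)"
    and "c \<equiv> N - real (set_len F1) - real (set_len F2)"
  assumes l: "l < mF" and lu: "lab ! l = (fam, u)"
  shows "\<exists>k. \<forall>n. cdh_fun (par1 \<alpha> \<beta> N) (par2 \<alpha> \<beta> N) (par3 \<alpha> \<beta> N) (theta F1 F2 F3 (par1 \<alpha> \<beta> N) (par2 \<alpha> \<beta> N) (par3 \<alpha> \<beta> N) *
      lagrange_basis mF (row_node F1 F2 F3 a b c) l * cdh (par1 a b c) (par2 a b c) (par3 a b c) n)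
    = k * (pochhammer (gauge_par a b c fam) n * hahn_n (fam_p a b c fam) (fam_q a b c fam) (fam_r a b c fam) u (real n))"
proof -
  define p1 where "p1 = par1 \<alpha> \<beta> N"
  define p2 where "p2 = par2 \<alpha> \<beta> N"
  define p3 where "p3 = par3 \<alpha> \<beta> N"
  note par = par_after[where \<alpha> = \<alpha> and \<beta> = \<beta> and N = N, folded a_def b_def c_def p1_def p2_def p3_def]
  define full where "full = node_prod p3 {..<set_len F1} * node_prod p1 {..<set_len F2} * node_prod p2 {..<set_len F3}"
  define X where "X = theta F1 F2 F3 p1 p2 p3 * lagrange_basis mF (row_node F1 F2 F3 a b c) l"
  have "(\<Prod>l<mF. [:- row_node F1 F2 F3 a b c l, 1:]) = (\<Prod>u\<in>U1. [:- (p3 + real (set_len F1) - 1 - real u)\<^sup>2, 1:])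
      * (\<Prod>u\<in>U2. [:- (p1 + real (set_len F2) - 1 - real u)\<^sup>2, 1:]) * (\<Prod>u\<in>U3. [:- (p2 + real (set_len F3) - 1 - real u)\<^sup>2, 1:])"
    unfolding row_node_def
    using prod_rows[OF finU, of "\<lambda>p. [:- (fam_p a b c (fst p) - 1 - real (snd p))\<^sup>2, 1:]"] by (simp add: par)
  then have fullW: "theta F1 F2 F3 p1 p2 p3 * (\<Prod>l<mF. [:- row_node F1 F2 F3 a b c l, 1:]) = full"
    unfolding full_def theta_def node_prod_split[OF F(1,4)] node_prod_split[OF F(2,5)] node_prod_split[OF F(3,6)]
    by (simp only: mult_ac)
  have "(\<Prod>l<mF. [:- row_node F1 F2 F3 a b c l, 1:]) = [:- row_node F1 F2 F3 a b c l, 1:] * (\<Prod>l'\<in>{..<mF} - {l}. [:- row_node F1 F2 F3 a b c l', 1:])"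
    using l by (subst prod.remove[of _ l]) auto
  then have X: "[:- row_node F1 F2 F3 a b c l, 1:] * X = full"
    unfolding X_def lagrange_basis_def fullW[symmetric] by (simp only: mult_ac)
  have u: "u \<in> (case fam of First \<Rightarrow> U1 | Second \<Rightarrow> U2 | Third \<Rightarrow> U3)"
    by (rule row_label_in[OF finU l lu])
  have rem: "node_prod p {..<k} = [:- (p + real k - 1 - real u)\<^sup>2, 1:] * node_prod p ({..<k} - {k - 1 - u})" if "u < k" for p k
    unfolding node_prod_def using that by (subst prod.remove[of _ "k - 1 - u"]) (auto simp: of_nat_diff algebra_simps)
  have canc: "X = Z" if "[:- row_node F1 F2 F3 a b c l, 1:] * Z = full" for Z
  proof -
    have "[:- row_node F1 F2 F3 a b c l, 1:] * X = [:- row_node F1 F2 F3 a b c l, 1:] * Z" unfolding X that ..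
    then show ?thesis by (subst (asm) mult_left_cancel) auto
  qed
  show ?thesis
    unfolding p1_def[symmetric] p2_def[symmetric] p3_def[symmetric] X_def[symmetric]
  proof (cases fam)
    case First
    then have u: "u < set_len F1" using u I_set_iff[OF F(1,4)] by simp
    have "X = node_prod p1 {..<set_len F2} * node_prod p2 {..<set_len F3} * node_prod p3 ({..<set_len F1} - {set_len F1 - 1 - u})"
      by (rule canc) (unfold full_def rem[OF u, of p3] row_node_def lu First, simp only: fst_conv snd_conv fam_p.simps par mult_ac)
    then show "\<exists>k. \<forall>n. cdh_fun p1 p2 p3 (X * cdh (par1 a b c) (par2 a b c) (par3 a b c) n)
        = k * (pochhammer (gauge_par a b c fam) n * hahn_n (fam_p a b c fam) (fam_q a b c fam) (fam_r a b c fam) u (real n))"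
      using cdh_fun_row[OF u, of p3 p1 p2 "set_len F2" "set_len F3"]
      unfolding First gauge_par_fam fam_p.simps fam_q.simps fam_r.simps par
      by (simp only: cdh_fun_sym(1)[of p3 p1] cdh_fun_sym(2)[of p1 p3] cdh_sym(1)[of "p3 + _" "p1 + _"] cdh_sym(2)[of "p1 + _" "p3 + _"])
  next
    case Second
    then have u: "u < set_len F2" using u I_set_iff[OF F(2,5)] by simp
    have "X = node_prod p3 {..<set_len F1} * node_prod p2 {..<set_len F3} * node_prod p1 ({..<set_len F2} - {set_len F2 - 1 - u})"
      by (rule canc) (unfold full_def rem[OF u, of p1] row_node_def lu Second, simp only: fst_conv snd_conv fam_p.simps par mult_ac)
    then show "\<exists>k. \<forall>n. cdh_fun p1 p2 p3 (X * cdh (par1 a b c) (par2 a b c) (par3 a b c) n)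
        = k * (pochhammer (gauge_par a b c fam) n * hahn_n (fam_p a b c fam) (fam_q a b c fam) (fam_r a b c fam) u (real n))"
      using cdh_fun_row[OF u, of p1 p3 p2 "set_len F1" "set_len F3"]
      unfolding Second gauge_par_fam fam_p.simps fam_q.simps fam_r.simps par
      by (simp only: cdh_fun_sym(2)[of p1 p3] cdh_sym(2)[of "p1 + _" "p3 + _"])
  next
    case Third
    then have u: "u < set_len F3" using u I_set_iff[OF F(3,6)] by simp
    have "X = node_prod p3 {..<set_len F1} * node_prod p1 {..<set_len F2} * node_prod p2 ({..<set_len F3} - {set_len F3 - 1 - u})"
      by (rule canc) (unfold full_def rem[OF u, of p2] row_node_def lu Third, simp only: fst_conv snd_conv fam_p.simps par mult_ac)
    then show "\<exists>k. \<forall>n. cdh_fun p1 p2 p3 (X * cdh (par1 a b c) (par2 a b c) (par3 a b c) n)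
        = k * (pochhammer (gauge_par a b c fam) n * hahn_n (fam_p a b c fam) (fam_q a b c fam) (fam_r a b c fam) u (real n))"
      using cdh_fun_row[OF u, of p2 p3 p1 "set_len F1" "set_len F2"]
      unfolding Third gauge_par_fam fam_p.simps fam_q.simps fam_r.simps par
      by (simp only: cdh_fun_sym(2)[of p2 p3] cdh_fun_sym(1)[of p2 p1] cdh_sym(2)[of "p2 + _" "p3 + _"] cdh_sym(1)[of "p2 + _" "p1 + _"])
  qed
qed

lemma generic_orthogonality:
  fixes \<alpha> \<beta> N :: real and n j :: nat
  defines "a \<equiv> \<alpha> + real (set_len F2) + real (set_len F3)" and "b \<equiv> \<beta> + real (set_len F2) - real (set_len F3)"
    and "c \<equiv> N - real (set_len F1) - real (set_len F2)"
  assumes inj: "inj_on (row_node F1 F2 F3 a b c) {..<mF}"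
    and C: "\<And>k. 1 \<le> k \<Longrightarrow> k \<le> mF \<Longrightarrow> jacC (par1 a b c) (par2 a b c) (par3 a b c) (real k - real mF) \<noteq> 0"
    and a: "pochhammer (a + 1 - real mF) (n + mF) \<noteq> 0"
    and g: "\<And>fam. pochhammer (gauge_par a b c fam - real mF) (n + mF) \<noteq> 0"
    and j: "j < n"
  shows "orth_det \<alpha> \<beta> N n j = 0"
proof -
  define P where "P = par1 a b c"
  define Q where "Q = par2 a b c"
  define R where "R = par3 a b c"
  define L where "L = cdh_fun (par1 \<alpha> \<beta> N) (par2 \<alpha> \<beta> N) (par3 \<alpha> \<beta> N)"
  define \<Theta> where "\<Theta> = theta F1 F2 F3 (par1 \<alpha> \<beta> N) (par2 \<alpha> \<beta> N) (par3 \<alpha> \<beta> N)"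
  define gm where "gm l = gauge_par a b c (fst (lab ! l)) - real mF" for l
  define H where "H l y = hahn_n (fam_p a b c (fst (lab ! l))) (fam_q a b c (fst (lab ! l))) (fam_r a b c (fst (lab ! l))) (snd (lab ! l)) y" for l y
  define \<Psi> where "\<Psi> l k = pochhammer (gm l) k * H l (real k - real mF)" for l k
  have fam_jac: "jacB (fam_p a b c fam) (fam_q a b c fam) (fam_r a b c fam) y = jacB P Q R y"
    "jacC (fam_p a b c fam) (fam_q a b c fam) (fam_r a b c fam) y = jacC P Q R y" for fam y
    by (cases fam; simp add: P_def Q_def R_def jacB_def jacC_def algebra_simps)+
  have pnz: "pochhammer z i \<noteq> 0" if "pochhammer z k \<noteq> 0" "i \<le> k" for z :: real and i k
    using pochhammer_product[of i k z] that by auto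
  have "\<exists>k. \<forall>n. L (\<Theta> * lagrange_basis mF (row_node F1 F2 F3 a b c) l * cdh P Q R n) = k * \<Psi> l (n + mF)" if l: "l < mF" for l
  proof -
    obtain k where k: "\<And>n. L (\<Theta> * lagrange_basis mF (row_node F1 F2 F3 a b c) l * cdh P Q R n) = k * (pochhammer (gauge_par a b c (fst (lab ! l))) n * H l (real n))"
      using row_functional[OF l, of "fst (lab ! l)" "snd (lab ! l)" \<alpha> \<beta> N] unfolding a_def b_def c_def L_def \<Theta>_def P_def Q_def R_def H_def by auto
    have "pochhammer (gm l) (n + mF) = pochhammer (gm l) mF * pochhammer (gauge_par a b c (fst (lab ! l))) n" for n
      using pochhammer_product[of mF "n + mF" "gm l"] by (simp add: gm_def)
    moreover have "pochhammer (gm l) mF \<noteq> 0" unfolding gm_def by (rule pnz[OF g]) simp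
    ultimately show ?thesis
      by (intro exI[of _ "k / pochhammer (gm l) mF"]) (simp add: k \<Psi>_def)
  qed
  then obtain cc where cc: "\<And>l n. l < mF \<Longrightarrow> L (\<Theta> * lagrange_basis mF (row_node F1 F2 F3 a b c) l * cdh P Q R n) = cc l * \<Psi> l (n + mF)"
    by metis
  have J: "(real k - real mF + 1) * \<Psi> l (Suc k) + jacB P Q R (real k - real mF) * \<Psi> l k
      + jacC P Q R (real k - real mF) * \<Psi> l (k - 1) = row_node F1 F2 F3 a b c l * \<Psi> l k" if l: "l < mF" and k: "1 \<le> k" for l k
  proof -
    obtain k' where k': "k = Suc k'" using k by (cases k) auto
    define fam where "fam = fst (lab ! l)"
    define p where "p = fam_p a b c fam"
    define q where "q = fam_q a b c fam"
    define r where "r = fam_r a b c fam"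
    define y where "y = real k - real mF"
    have gm: "gm l = q + r - real mF" by (simp add: gm_def gauge_par_fam fam_def q_def r_def)
    have 1: "pochhammer (gm l) (Suc k) = pochhammer (gm l) k * (y + q + r)" "pochhammer (gm l) k = pochhammer (gm l) (k - 1) * (y + q + r - 1)"
      by (simp_all add: k' pochhammer_Suc gm y_def algebra_simps)
    have Hh: "(y + 1) * (y + q + r) * H l (y + 1) + jacB P Q R y * H l y + (y + p + q - 1) * (y + p + r - 1) * H l (y - 1) = row_node F1 F2 F3 a b c l * H l y"
      using hahn_n_difference[of y q r p "snd (lab ! l)"] fam_jac(1)[of fam y]
      by (simp add: H_def row_node_def fam_def p_def q_def r_def)
    have Cc: "jacC P Q R y = (y + q + r - 1) * (y + p + q - 1) * (y + p + r - 1)"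
      using fam_jac(2)[of fam y] by (simp add: jacC_def p_def q_def r_def)
    have arg: "real (Suc k) - real mF = y + 1" "real (k - 1) - real mF = y - 1" using k' by (simp_all add: y_def)
    have "(y + 1) * \<Psi> l (Suc k) + jacB P Q R y * \<Psi> l k + jacC P Q R y * \<Psi> l (k - 1)
      = pochhammer (gm l) k * ((y + 1) * (y + q + r) * H l (y + 1) + jacB P Q R y * H l y + (y + p + q - 1) * (y + p + r - 1) * H l (y - 1))"
      unfolding \<Psi>_def arg 1(1) Cc y_def[symmetric]
      by (simp add: 1(2) algebra_simps)
    then show ?thesis unfolding Hh by (simp add: \<Psi>_def y_def)
  qed
  \<comment> \<open>Without rows all three sets are empty, since a nonempty F has max F in I(F); the
    polynomials are then those of the functional itself.\<close>
  have zero: "L (\<Theta> * cdh P Q R n) = 0" if m0: "mF = 0" and n1: "1 \<le> n" for n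
  proof -
    have e: "F = {}" if "finite F" "0 \<notin> F" "card (I_set F) = 0" for F
    proof (rule ccontr)
      assume "F \<noteq> {}"
      then have "Max F \<in> I_set F" using that by (simp add: I_set_iff[OF that(1,2)] set_len_def)
      then show False using that finite_I_set[OF that(1,2)] by auto
    qed
    have E: "F1 = {}" "F2 = {}" "F3 = {}" using e F m0 by (auto simp: num_rows_def)
    have "\<Theta> = 1" unfolding \<Theta>_def theta_def by (simp add: E node_prod_def)
    then show ?thesis
      using n1 cdh_fun_cdh[of "par1 \<alpha> \<beta> N" "par2 \<alpha> \<beta> N" "par3 \<alpha> \<beta> N" n]
      by (simp add: L_def P_def Q_def R_def a_def b_def c_def set_len_def E)
  qed
  obtain \<rho> where \<rho>: "\<And>j k. 1 + j \<le> k \<Longrightarrow> (\<Sum>l<mF. \<rho> l * row_node F1 F2 F3 a b c l ^ j * \<Psi> l k)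
      = (if mF \<le> k then L (\<Theta> * monom 1 j * cdh P Q R (k - mF)) else 0)"
    using row_combination[OF inj, where P = P and Q = Q and R = R and \<Psi> = \<Psi> and p = "par1 \<alpha> \<beta> N" and q = "par2 \<alpha> \<beta> N"
        and r = "par3 \<alpha> \<beta> N" and \<Theta> = \<Theta> and cc = cc]
      J C[folded P_def Q_def R_def] cc[unfolded L_def] zero[unfolded L_def] unfolding L_def by blast
  \<comment> \<open>Removes the factor that depends only on the row in
    \<open>row_entry_pochhammer\<close>; the factor of the column is shared with the first
    row.\<close>
  define w where "w l = pochhammer (gm l) n * (-1) ^ snd (lab ! l) * (\<rho> l * row_node F1 F2 F3 a b c l ^ j)" for l
  define A where "A = pochhammer (a + 1 - real mF) n"
  define A0 where "A0 = pochhammer (a + 1 - real mF) mF"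
  have A: "A \<noteq> 0" "A0 \<noteq> 0" unfolding A_def A0_def by (rule pnz[OF a]; simp)+
  have row: "w l * q_row a b c U1 U2 U3 (real n) l i = (-1) ^ (mF - i) * A / pochhammer (a + 1 - real mF) (n + mF - i) * (\<rho> l * row_node F1 F2 F3 a b c l ^ j * \<Psi> l (n + mF - i))"
    if "l < mF" "i \<le> mF" for l i
  proof -
    have gn: "pochhammer (gm l) n \<noteq> 0" unfolding gm_def by (rule pnz[OF g]) simp
    have s: "(-1 :: real) ^ k * (-1) ^ k = 1" for k by (simp flip: power_add)
    have arg: "real (n + mF - i) - real mF = real n - real i" using that by (simp add: of_nat_diff)
    have "q_row a b c U1 U2 U3 (real n) l i = (-1) ^ (mF - i) * (-1) ^ snd (lab ! l) * (A / pochhammer (gm l) n) *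
      (pochhammer (gm l) (n + mF - i) / pochhammer (a + 1 - real mF) (n + mF - i)) * H l (real n - real i)"
      unfolding q_row_def
      using row_entry_pochhammer[where n = n and m = mF and i = i and l = l and fam = "fst (lab ! l)" and u = "snd (lab ! l)" and a = a and b = b and c = c and ?U1.0 = U1 and ?U2.0 = U2 and ?U3.0 = U3]
        that a gn by (simp add: A_def gm_def H_def)
    then have "w l * q_row a b c U1 U2 U3 (real n) l i = ((-1) ^ snd (lab ! l) * (-1) ^ snd (lab ! l)) * ((-1) ^ (mF - i) * A / pochhammer (a + 1 - real mF) (n + mF - i) * (\<rho> l * row_node F1 F2 F3 a b c l ^ j * (pochhammer (gm l) (n + mF - i) * H l (real n - real i))))"
      using gn by (simp add: w_def)
    then show ?thesis unfolding s \<Psi>_def arg by simp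
  qed
  have comb: "(-1) ^ i * (if i \<le> n then L (\<Theta> * monom 1 j * cdh P Q R (n - i)) / pochhammer (a + 1) (n - i) else 0)
      = (\<Sum>l<mF. ((-1) ^ mF * A0 / A * w l) * q_row a b c U1 U2 U3 (real n) l i)" if i: "i \<le> mF" for i
  proof -
    \<comment> \<open>The place where j < n enters: even in the last column, i = m, the index stays
      within the range of the row combination.\<close>
    have k: "1 + j \<le> n + mF - i" using i j by simp
    have "(\<Sum>l<mF. ((-1) ^ mF * A0 / A * w l) * q_row a b c U1 U2 U3 (real n) l i) = (-1) ^ mF * A0 / A * (\<Sum>l<mF. w l * q_row a b c U1 U2 U3 (real n) l i)"
      by (simp add: sum_distrib_left mult_ac)
    also have "(\<Sum>l<mF. w l * q_row a b c U1 U2 U3 (real n) l i) = (-1) ^ (mF - i) * A / pochhammer (a + 1 - real mF) (n + mF - i) * (\<Sum>l<mF. \<rho> l * row_node F1 F2 F3 a b c l ^ j * \<Psi> l (n + mF - i))"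
      using row i by (simp add: sum_distrib_left)
    also have "\<dots> = (-1) ^ (mF - i) * A / pochhammer (a + 1 - real mF) (n + mF - i) * (if i \<le> n then L (\<Theta> * monom 1 j * cdh P Q R (n - i)) else 0)"
    proof -
      have e: "mF \<le> n + mF - i \<longleftrightarrow> i \<le> n" "i \<le> n \<Longrightarrow> n + mF - i - mF = n - i" using i by linarith+
      show ?thesis unfolding \<rho>[OF k] e(1) using e(2) by simp
    qed
    finally have S: "(\<Sum>l<mF. ((-1) ^ mF * A0 / A * w l) * q_row a b c U1 U2 U3 (real n) l i) = (-1) ^ mF * A0 / A *
      ((-1) ^ (mF - i) * A / pochhammer (a + 1 - real mF) (n + mF - i) * (if i \<le> n then L (\<Theta> * monom 1 j * cdh P Q R (n - i)) else 0))" .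
    show ?thesis
    proof (cases "i \<le> n")
      case False
      then show ?thesis unfolding S by simp
    next
      case True
      have p: "pochhammer (a + 1 - real mF) (n + mF - i) = A0 * pochhammer (a + 1) (n - i)"
        using pochhammer_product[of mF "n + mF - i" "a + 1 - real mF"] True by (simp add: A0_def)
      have "(-1 :: real) ^ mF * (-1) ^ (mF - i) = (-1) ^ i"
        using i by (simp add: power_add[symmetric] uminus_power_if)
      then show ?thesis unfolding S p using A True by (simp add: mult.assoc[symmetric])
    qed
  qed
  have entry: "orth_entry \<alpha> \<beta> N n j 0 i = (-1) ^ i * (if i \<le> n then L (\<Theta> * monom 1 j * cdh P Q R (n - i)) / pochhammer (a + 1) (n - i) else 0)"
    "orth_entry \<alpha> \<beta> N n j (Suc l) i = q_row a b c U1 U2 U3 (real n) l i" for l i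
    unfolding orth_entry_def L_def \<Theta>_def P_def Q_def R_def a_def b_def c_def by simp_all
  let ?M = "mat (Suc mF) (Suc mF) (\<lambda>(k, i). orth_entry \<alpha> \<beta> N n j k i)"
  show ?thesis
    unfolding orth_det_def
  proof (rule det_row_combination)
    fix i assume i: "i \<le> mF"
    have "?M $$ (0, i) = orth_entry \<alpha> \<beta> N n j 0 i" using i by simp
    also have "\<dots> = (\<Sum>l<mF. ((-1) ^ mF * A0 / A * w l) * q_row a b c U1 U2 U3 (real n) l i)"
      unfolding entry by (rule comb[OF i])
    also have "\<dots> = (\<Sum>l<mF. ((-1) ^ mF * A0 / A * w l) * ?M $$ (Suc l, i))"
      using i by (intro sum.cong refl) (simp add: entry)
    finally show "?M $$ (0, i) = \<dots>" .
  qed simp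
qed

end

section \<open>Passage to the given parameters\<close>

context
  assumes F: "finite F1" "finite F2" "finite F3" "0 \<notin> F1" "0 \<notin> F2" "0 \<notin> F3"
begin

lemma isCont_orth_det:
  assumes a: "\<And>k. as \<alpha> + 1 + real k \<noteq> 0"
    and den: "\<And>h i. h < mF \<Longrightarrow> i < mF \<Longrightarrow> as \<alpha> + (real n - real i) \<noteq> 0 \<or> fst (lab ! h) = First"
  shows "isCont (\<lambda>\<tau>. orth_det (\<alpha> + 4 * \<tau>) (\<beta> - 2 * \<tau>) (N - 10 * \<tau>) n j) 0"
  unfolding orth_det_def
proof (rule isCont_det)
  fix k i assume ki: "k < Suc mF" "i < Suc mF"
  have par: "isCont (\<lambda>\<tau>. par1 (u + 4 * \<tau>) (v - 2 * \<tau>) (w - 10 * \<tau>)) 0" "isCont (\<lambda>\<tau>. par2 (u + 4 * \<tau>) (v - 2 * \<tau>) (w - 10 * \<tau>)) 0"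
      "isCont (\<lambda>\<tau>. par3 (u + 4 * \<tau>) (v - 2 * \<tau>) (w - 10 * \<tau>)) 0" for u v w :: real
    unfolding par_defs by (intro continuous_intros; simp)+
  have sh: "as (\<alpha> + 4 * \<tau>) = as \<alpha> + 4 * \<tau>" "bs (\<beta> - 2 * \<tau>) = bs \<beta> - 2 * \<tau>" "cs (N - 10 * \<tau>) = cs N - 10 * \<tau>" for \<tau> by simp_all
  show "isCont (\<lambda>\<tau>. orth_entry (\<alpha> + 4 * \<tau>) (\<beta> - 2 * \<tau>) (N - 10 * \<tau>) n j k i) 0"
  proof (cases "k = 0")
    case True
    have "pochhammer (as \<alpha> + 4 * 0 + 1) (n - i) \<noteq> 0" using pochhammer_nz[OF a, of "n - i"] by simp
    then show ?thesis
      using True unfolding orth_entry_def sh theta_def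
      by (cases "i \<le> n") (auto intro!: continuous_intros isCont_pochhammer isCont_cdh_fun par cont_poly_mult cont_poly_node_prod cont_poly_const cont_poly_cdh)
  next
    case False
    obtain fam u where lu: "lab ! (k - 1) = (fam, u)" by fastforce
    have xi: "isCont (\<lambda>\<tau>. xi (as \<alpha> + 4 * \<tau>) (bs \<beta> - 2 * \<tau>) (cs N - 10 * \<tau>) U1 U2 U3 (k - 1) (real n - real i) (mF - i)) 0"
      unfolding xi_def lu fst_conv
    proof (intro continuous_intros)
      fix s assume s: "s \<in> {..<mF - i}"
      have "as \<alpha> + (real n - real i - real s) \<noteq> 0 \<or> fam = First"
      proof -
        have "k - 1 < mF" "i + s < mF" using False ki s by auto
        from den[OF this, unfolded lu fst_conv] show ?thesis by (simp add: algebra_simps)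
      qed
      then show "isCont (\<lambda>\<tau>. eps (as \<alpha> + 4 * \<tau>) (bs \<beta> - 2 * \<tau>) (cs N - 10 * \<tau>) fam (real n - real i - real s)) 0"
        by (cases fam) (auto intro!: continuous_intros)
    qed
    have p: "isCont (\<lambda>\<tau>. fam_p (as \<alpha> + 4 * \<tau>) (bs \<beta> - 2 * \<tau>) (cs N - 10 * \<tau>) fam) 0"
      "isCont (\<lambda>\<tau>. fam_q (as \<alpha> + 4 * \<tau>) (bs \<beta> - 2 * \<tau>) (cs N - 10 * \<tau>) fam) 0"
      "isCont (\<lambda>\<tau>. fam_r (as \<alpha> + 4 * \<tau>) (bs \<beta> - 2 * \<tau>) (cs N - 10 * \<tau>) fam) 0"
      by (cases fam; simp only: fam_p.simps fam_q.simps fam_r.simps; intro par)+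
    have "isCont (\<lambda>\<tau>. q_row (as \<alpha> + 4 * \<tau>) (bs \<beta> - 2 * \<tau>) (cs N - 10 * \<tau>) U1 U2 U3 (real n) (k - 1) i) 0"
      unfolding q_row_def poly_Y[OF lu] by (intro continuous_intros xi isCont_hahn_n p)
    then show ?thesis
      using False unfolding orth_entry_def sh by simp
  qed
qed

text \<open>The perturbation adds \<open>\<tau>\<close>, \<open>3 * \<tau>\<close> and \<open>9 * \<tau>\<close> to the three parameters of the \<open>cdh\<close>, so that
  no coincidence between the parameters survives.\<close>

lemma eventually_orth_det_0:
  assumes "j < n"
  shows "\<forall>\<^sub>F \<tau> in cofinite. orth_det (\<alpha> + 4 * \<tau>) (\<beta> - 2 * \<tau>) (N - 10 * \<tau>) n j = 0"
proof -
  define a where "a \<tau> = as \<alpha> + 4 * \<tau>" for \<tau>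
  define b where "b \<tau> = bs \<beta> - 2 * \<tau>" for \<tau>
  define c where "c \<tau> = cs N - 10 * \<tau>" for \<tau>
  have par: "par1 (a \<tau>) (b \<tau>) (c \<tau>) = par1 (a 0) (b 0) (c 0) + \<tau>" "par2 (a \<tau>) (b \<tau>) (c \<tau>) = par2 (a 0) (b 0) (c 0) + 3 * \<tau>"
    "par3 (a \<tau>) (b \<tau>) (c \<tau>) = par3 (a 0) (b 0) (c 0) + 9 * \<tau>" for \<tau>
    by (simp_all add: par_defs a_def b_def c_def field_simps)
  define w :: "family \<Rightarrow> real" where "w fam = (case fam of First \<Rightarrow> 9 | Second \<Rightarrow> 1 | Third \<Rightarrow> 3)" for fam
  have fam: "fam_p (a \<tau>) (b \<tau>) (c \<tau>) fam = fam_p (a 0) (b 0) (c 0) fam + w fam * \<tau>" for fam \<tau>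
    by (cases fam) (simp_all add: par[of \<tau>] w_def)
  have w: "w f + w f' \<noteq> 0" "w f - w f' = 0 \<Longrightarrow> f = f'" for f f' by (cases f; cases f'; simp add: w_def)+
  have lin: "\<forall>\<^sub>F \<tau> in cofinite. s + k * \<tau> \<noteq> 0" if "k \<noteq> 0 \<or> s \<noteq> 0" for s k :: real
    using that eventually_cofinite_linear_neq[of k s] by (cases "k = 0") auto
  have inj: "\<forall>\<^sub>F \<tau> in cofinite. inj_on (row_node F1 F2 F3 (a \<tau>) (b \<tau>) (c \<tau>)) {..<mF}"
  proof -
    have "\<forall>\<^sub>F \<tau> in cofinite. \<forall>l\<in>{..<mF}. \<forall>l'\<in>{..<mF}. l \<noteq> l' \<longrightarrow> row_node F1 F2 F3 (a \<tau>) (b \<tau>) (c \<tau>) l \<noteq> row_node F1 F2 F3 (a \<tau>) (b \<tau>) (c \<tau>) l'"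
    proof (intro eventually_cofinite_ball finite_lessThan)
      fix l l' assume l: "l \<in> {..<mF}" "l' \<in> {..<mF}"
      define s where "s l = fam_p (a 0) (b 0) (c 0) (fst (lab ! l)) - 1 - real (snd (lab ! l))" for l
      define W where "W l = w (fst (lab ! l))" for l
      have node: "row_node F1 F2 F3 (a \<tau>) (b \<tau>) (c \<tau>) l = (s l + W l * \<tau>)\<^sup>2" for l \<tau>
        unfolding row_node_def fam[of \<tau>] s_def W_def by (simp add: algebra_simps)
      show "\<forall>\<^sub>F \<tau> in cofinite. l \<noteq> l' \<longrightarrow> row_node F1 F2 F3 (a \<tau>) (b \<tau>) (c \<tau>) l \<noteq> row_node F1 F2 F3 (a \<tau>) (b \<tau>) (c \<tau>) l'"
      proof (cases "l = l'")
        case False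
        have "W l - W l' \<noteq> 0 \<or> s l - s l' \<noteq> 0"
        proof (rule ccontr)
          assume "\<not> ?thesis"
          then have "fst (lab ! l) = fst (lab ! l')" "s l = s l'" using w(2) by (auto simp: W_def)
          then have "lab ! l = lab ! l'" by (intro prod_eqI) (auto simp: s_def)
          then show False using row_labels_inj[of U1 U2 U3 l l'] finU[OF F] l False by simp
        qed
        have "W l + W l' \<noteq> 0" using w(1) by (simp add: W_def)
        then have "\<forall>\<^sub>F \<tau> in cofinite. s l + s l' + (W l + W l') * \<tau> \<noteq> 0" by (intro lin) simp
        moreover from \<open>W l - W l' \<noteq> 0 \<or> s l - s l' \<noteq> 0\<close> have "\<forall>\<^sub>F \<tau> in cofinite. s l - s l' + (W l - W l') * \<tau> \<noteq> 0" by (rule lin)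
        ultimately show ?thesis
        proof eventually_elim
          case (elim \<tau>)
          have "(s l + W l * \<tau>)\<^sup>2 - (s l' + W l' * \<tau>)\<^sup>2 = (s l + s l' + (W l + W l') * \<tau>) * (s l - s l' + (W l - W l') * \<tau>)"
            by (simp add: power2_eq_square algebra_simps)
          with elim show ?case unfolding node by auto
        qed
      qed simp
    qed
    then show ?thesis by eventually_elim (auto simp: inj_on_def)
  qed
  moreover have "\<forall>\<^sub>F \<tau> in cofinite. \<forall>k\<in>{1..mF}. jacC (par1 (a \<tau>) (b \<tau>) (c \<tau>)) (par2 (a \<tau>) (b \<tau>) (c \<tau>)) (par3 (a \<tau>) (b \<tau>) (c \<tau>)) (real k - real mF) \<noteq> 0"
  proof (intro eventually_cofinite_ball)
    fix k
    define P where "P = par1 (a 0) (b 0) (c 0)"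
    define Q where "Q = par2 (a 0) (b 0) (c 0)"
    define R where "R = par3 (a 0) (b 0) (c 0)"
    have "\<forall>\<^sub>F \<tau> in cofinite. real k - real mF + Q + R - 1 + 12 * \<tau> \<noteq> 0" "\<forall>\<^sub>F \<tau> in cofinite. real k - real mF + P + Q - 1 + 4 * \<tau> \<noteq> 0"
      "\<forall>\<^sub>F \<tau> in cofinite. real k - real mF + P + R - 1 + 10 * \<tau> \<noteq> 0"
      by (intro lin; simp)+
    then show "\<forall>\<^sub>F \<tau> in cofinite. jacC (par1 (a \<tau>) (b \<tau>) (c \<tau>)) (par2 (a \<tau>) (b \<tau>) (c \<tau>)) (par3 (a \<tau>) (b \<tau>) (c \<tau>)) (real k - real mF) \<noteq> 0"
    proof eventually_elim
      case (elim \<tau>)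
      have e: "real k - real mF + (Q + 3 * \<tau>) + (R + 9 * \<tau>) - 1 = real k - real mF + Q + R - 1 + 12 * \<tau>"
        "real k - real mF + (P + \<tau>) + (Q + 3 * \<tau>) - 1 = real k - real mF + P + Q - 1 + 4 * \<tau>"
        "real k - real mF + (P + \<tau>) + (R + 9 * \<tau>) - 1 = real k - real mF + P + R - 1 + 10 * \<tau>" by simp_all
      show ?case unfolding jacC_def par[of \<tau>] P_def[symmetric] Q_def[symmetric] R_def[symmetric] e mult_eq_0_iff
        using elim by blast
    qed
  qed simp
  moreover have "\<forall>\<^sub>F \<tau> in cofinite. pochhammer (as \<alpha> + 1 - real mF + 4 * \<tau>) (n + mF) \<noteq> 0"
    by (rule eventually_pochhammer_neq_0) simp
  moreover have "\<forall>\<^sub>F \<tau> in cofinite. \<forall>fam\<in>{First, Second, Third}. pochhammer (gauge_par (a \<tau>) (b \<tau>) (c \<tau>) fam - real mF) (n + mF) \<noteq> 0"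
  proof (intro eventually_cofinite_ball)
    fix fam
    obtain k where k: "k \<noteq> 0" "\<And>\<tau>. gauge_par (a \<tau>) (b \<tau>) (c \<tau>) fam - real mF = gauge_par (a 0) (b 0) (c 0) fam - real mF + k * \<tau>"
    proof (cases fam)
      case First
      have "gauge_par (a \<tau>) (b \<tau>) (c \<tau>) fam - real mF = gauge_par (a 0) (b 0) (c 0) fam - real mF + 4 * \<tau>" for \<tau>
        unfolding First gauge_par.simps par[of \<tau>] by simp
      then show ?thesis by (rule that[rotated]) simp
    next
      case Second
      have "gauge_par (a \<tau>) (b \<tau>) (c \<tau>) fam - real mF = gauge_par (a 0) (b 0) (c 0) fam - real mF + 12 * \<tau>" for \<tau>
        unfolding Second gauge_par.simps par[of \<tau>] by simp
      then show ?thesis by (rule that[rotated]) simp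
    next
      case Third
      have "gauge_par (a \<tau>) (b \<tau>) (c \<tau>) fam - real mF = gauge_par (a 0) (b 0) (c 0) fam - real mF + 10 * \<tau>" for \<tau>
        unfolding Third gauge_par.simps par[of \<tau>] by simp
      then show ?thesis by (rule that[rotated]) simp
    qed
    show "\<forall>\<^sub>F \<tau> in cofinite. pochhammer (gauge_par (a \<tau>) (b \<tau>) (c \<tau>) fam - real mF) (n + mF) \<noteq> 0"
      using eventually_pochhammer_neq_0[OF k(1), of "gauge_par (a 0) (b 0) (c 0) fam - real mF" "n + mF"] unfolding k(2)[symmetric] .
  qed simp
  ultimately show ?thesis
  proof eventually_elim
    case (elim \<tau>)
    have sh: "as (\<alpha> + 4 * \<tau>) = a \<tau>" "bs (\<beta> - 2 * \<tau>) = b \<tau>" "cs (N - 10 * \<tau>) = c \<tau>" by (simp_all add: a_def b_def c_def)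
    show ?case
    proof (rule generic_orthogonality[OF F _ _ _ _ assms], unfold sh)
      show "inj_on (row_node F1 F2 F3 (a \<tau>) (b \<tau>) (c \<tau>)) {..<mF}" by (rule elim)
      show "jacC (par1 (a \<tau>) (b \<tau>) (c \<tau>)) (par2 (a \<tau>) (b \<tau>) (c \<tau>)) (par3 (a \<tau>) (b \<tau>) (c \<tau>)) (real k - real mF) \<noteq> 0" if "1 \<le> k" "k \<le> mF" for k
        using elim(2) that by simp
      show "pochhammer (a \<tau> + 1 - real mF) (n + mF) \<noteq> 0" using elim(3) by (simp add: a_def algebra_simps)
      show "pochhammer (gauge_par (a \<tau>) (b \<tau>) (c \<tau>) fam - real mF) (n + mF) \<noteq> 0" for fam
        using elim(4) by (cases fam) simp_all
    qed
  qed
qed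

text \<open>\<open>orth_det\<close> vanishes for almost all \<tau> and is continuous at \<tau> = 0.
  Expanding it along the first row and using linearity gives the moment of q_n.\<close>

theorem q_poly_orthogonal:
  assumes a: "\<And>k. as \<alpha> + 1 + real k \<noteq> 0"
    and den: "\<And>h i. h < mF \<Longrightarrow> i < mF \<Longrightarrow> as \<alpha> + (real n - real i) \<noteq> 0 \<or> fst (lab ! h) = First"
    and j: "j < n"
  shows "cdh_fun (par1 \<alpha> \<beta> N) (par2 \<alpha> \<beta> N) (par3 \<alpha> \<beta> N) (theta F1 F2 F3 (par1 \<alpha> \<beta> N) (par2 \<alpha> \<beta> N) (par3 \<alpha> \<beta> N) * monom 1 j *
    pcompose (q_poly (as \<alpha>) (bs \<beta>) (cs N) U1 U2 U3 n) [:- (par1 (as \<alpha>) (bs \<beta>) (cs N))\<^sup>2, 1:]) = 0"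
proof -
  define L where "L = cdh_fun (par1 \<alpha> \<beta> N) (par2 \<alpha> \<beta> N) (par3 \<alpha> \<beta> N)"
  define X where "X = theta F1 F2 F3 (par1 \<alpha> \<beta> N) (par2 \<alpha> \<beta> N) (par3 \<alpha> \<beta> N) * monom 1 j"
  define K where "K = cdh (par1 (as \<alpha>) (bs \<beta>) (cs N)) (par2 (as \<alpha>) (bs \<beta>) (cs N)) (par3 (as \<alpha>) (bs \<beta>) (cs N))"
  define w where "w = q_row (as \<alpha>) (bs \<beta>) (cs N) U1 U2 U3 (real n)"
  have "orth_det (\<alpha> + 4 * 0) (\<beta> - 2 * 0) (N - 10 * 0) n j = 0"
    by (rule isCont_eq_0[OF isCont_orth_det[OF a den] eventually_orth_det_0[OF j]])
  then have "orth_det \<alpha> \<beta> N n j = 0" by simp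
  also have "orth_det \<alpha> \<beta> N n j = (\<Sum>i\<le>mF. ((-1) ^ i * (if i \<le> n then L (X * K (n - i)) / pochhammer (as \<alpha> + 1) (n - i) else 0)) * row_minor w mF i)"
    unfolding orth_det_def orth_entry_def L_def X_def K_def w_def
    by (rule det_first_row) (unfold_locales; simp)
  also have "\<dots> = (\<Sum>i\<le>mF. L (X * (if i \<le> n then smult ((-1) ^ i * row_minor w mF i / pochhammer (as \<alpha> + 1) (n - i)) (K (n - i)) else 0)))"
    by (intro sum.cong refl) (simp add: L_def cdh_fun_smult cdh_fun_0)
  also have "\<dots> = L (X * (\<Sum>i\<le>mF. if i \<le> n then smult ((-1) ^ i * row_minor w mF i / pochhammer (as \<alpha> + 1) (n - i)) (K (n - i)) else 0))"
    by (simp add: L_def cdh_fun_sum sum_distrib_left)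
  also have "(\<Sum>i\<le>mF. if i \<le> n then smult ((-1) ^ i * row_minor w mF i / pochhammer (as \<alpha> + 1) (n - i)) (K (n - i)) else 0)
    = pcompose (q_poly (as \<alpha>) (bs \<beta>) (cs N) U1 U2 U3 n) [:- (par1 (as \<alpha>) (bs \<beta>) (cs N))\<^sup>2, 1:]"
    unfolding q_poly_eq pcompose_sum
    by (intro sum.cong refl) (simp add: pcompose_smult pcompose_dual_hahn[OF a] K_def w_def)
  finally show ?thesis by (simp add: L_def X_def)
qed

end

section \<open>Orthogonality with respect to the weight\<close>

context
  fixes \<alpha> \<beta> :: real and N :: nat
begin

private abbreviation (input) "a \<equiv> as \<alpha>"
private abbreviation (input) "b \<equiv> bs \<beta>"
private abbreviation (input) "c \<equiv> cs (real N)"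

context
  assumes F: "finite F1" "finite F2" "finite F3" "0 \<notin> F1" "0 \<notin> F2" "0 \<notin> F3"
    and \<alpha>: "\<And>k. \<alpha> + 1 + real k \<noteq> 0" and \<beta>: "\<And>k. \<beta> + 1 + real k \<noteq> 0" and \<alpha>\<beta>: "\<And>k. \<alpha> + \<beta> + 1 + real k \<noteq> 0"
begin

lemma a_nz: "a + 1 + real k \<noteq> 0"
  using \<alpha>[of "set_len F2 + set_len F3 + k"] by (simp add: algebra_simps)

lemma I_set_empty: "I_set {} = {}"
  by (simp add: I_set_def)

text \<open>The first column of \<Omega> guarantees the factors with 1 \<le> i < m. For i = 0 the
  factor is \<alpha> plus a positive integer, because a row outside the first family makes F2 or F3
  nonempty.\<close>

lemma denominators_nz:
  assumes O: "Omega_defined a U1 U2 U3 (real n)" and h: "h < mF" and i: "i < mF"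
  shows "a + (real n - real i) \<noteq> 0 \<or> fst (lab ! h) = First"
proof (cases "fst (lab ! h) = First")
  case False
  obtain fam u where lu: "lab ! h = (fam, u)" by fastforce
  have ne: "U2 \<noteq> {} \<or> U3 \<noteq> {}"
    using row_label_in[OF finU[OF F] h lu] False by (cases fam) (auto simp: lu)
  then have "F2 \<noteq> {} \<or> F3 \<noteq> {}" by (auto simp: I_set_empty)
  then have len: "1 \<le> set_len F2 + set_len F3" by (auto simp: set_len_def)
  have "a + (real n - real i) \<noteq> 0"
  proof (cases i)
    case 0
    then show ?thesis using \<alpha>[of "set_len F2 + set_len F3 + n - 1"] len by (simp add: of_nat_diff algebra_simps)
  next
    case (Suc i')
    have "pochhammer (a + real n - real mF + 1) (mF - 1) \<noteq> 0" using O ne i by (auto simp: Omega_defined_def)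
    then have "a + real n - real mF + 1 \<noteq> - real (mF - 1 - i)"
    proof -
      have k: "mF - 1 - i < mF - 1" using Suc i by simp
      show ?thesis
        using \<open>pochhammer (a + real n - real mF + 1) (mF - 1) \<noteq> 0\<close> k unfolding pochhammer_eq_0_iff by blast
    qed
    moreover have "real (mF - 1 - i) = real mF - 1 - real i" using i by (simp add: of_nat_diff)
    ultimately show ?thesis by (simp add: algebra_simps)
  qed
  then show ?thesis ..
qed simp

theorem orthogonality:
  assumes O: "\<And>n. n \<le> N \<Longrightarrow> Omega_defined a U1 U2 U3 (real n) \<and> Omega a b c U1 U2 U3 (real n) \<noteq> 0"
  shows "orthogonal_sequence (rho_F F1 F2 F3 \<alpha> \<beta> N) N (lam \<alpha> \<beta>)
    (\<lambda>n. pcompose (q_poly a b c U1 U2 U3 n) [:- lam \<alpha> \<beta> (real (set_len F2)), 1:])"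
proof (rule orthogonal_sequenceI)
  let ?q = "\<lambda>n. pcompose (q_poly a b c U1 U2 U3 n) [:- lam \<alpha> \<beta> (real (set_len F2)), 1:]"
  define P1 where "P1 = par1 \<alpha> \<beta> (real N)"
  show "inj_on (\<lambda>x. lam \<alpha> \<beta> (real x)) {0..N}"
  proof (rule inj_onI)
    fix x y assume "x \<in> {0..N}" "y \<in> {0..N}" "lam \<alpha> \<beta> (real x) = lam \<alpha> \<beta> (real y)"
    then have *: "(real x - real y) * (real x + real y + \<alpha> + \<beta> + 1) = 0" by (simp add: lam_def algebra_simps)
    have "real x + real y + \<alpha> + \<beta> + 1 \<noteq> 0" using \<alpha>\<beta>[of "x + y"] by (simp add: algebra_simps)
    with * show "x = y" by simp
  qed
  fix n assume n: "n \<le> N"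
  note q = degree_q_poly[OF a_nz Omega_D_nz[OF conjunct2[OF O[OF n]]]]
  show "degree (?q n) = n" using q by (simp add: degree_pcompose)
  show "?q n \<noteq> 0" using q(2) by (simp add: pcompose_eq_0_iff)
  fix g :: "real poly" assume g: "degree g < n"
  define G where "G = pcompose g [:- P1\<^sup>2, 1:]"
  define Q where "Q = pcompose (q_poly a b c U1 U2 U3 n) [:- (par1 a b c)\<^sup>2, 1:]"
  define \<Theta> where "\<Theta> = theta F1 F2 F3 P1 (par2 \<alpha> \<beta> (real N)) (par3 \<alpha> \<beta> (real N))"
  have lam: "lam \<alpha> \<beta> x = (x + P1)\<^sup>2 - P1\<^sup>2" for x unfolding P1_def by (rule lam_eq)
  have par: "par1 a b c = P1 + real (set_len F2)" unfolding P1_def by (rule par_after[OF F])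
  have "integral_lam (rho_F F1 F2 F3 \<alpha> \<beta> N) N (lam \<alpha> \<beta>) (?q n * g)
      = (\<Sum>x=0..N. dual_hahn_weight \<alpha> \<beta> N x * poly (\<Theta> * G * Q) ((real x + P1)\<^sup>2))"
    unfolding integral_lam_def
  proof (intro sum.cong refl)
    fix x
    \<comment> \<open>The translation by \<open>set_len F2\<close> moves the centre of the square
      from \<open>par1\<close> of the original to \<open>par1\<close> of the shifted parameters, so
      both lattices have the same t.\<close>
    have e: "- lam \<alpha> \<beta> (real (set_len F2)) + lam \<alpha> \<beta> (real x) = (real x + P1)\<^sup>2 - (par1 a b c)\<^sup>2"
      unfolding lam par by (simp add: add.commute)
    show "rho_F F1 F2 F3 \<alpha> \<beta> N x * poly (?q n * g) (lam \<alpha> \<beta> (real x))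
        = dual_hahn_weight \<alpha> \<beta> N x * poly (\<Theta> * G * Q) ((real x + P1)\<^sup>2)"
      unfolding rho_F_theta[OF \<alpha> \<beta> \<alpha>\<beta>] \<Theta>_def[symmetric] P1_def[symmetric]
    proof -
      have "poly (?q n) (lam \<alpha> \<beta> (real x)) = poly Q ((real x + P1)\<^sup>2)"
        using e by (simp add: poly_pcompose Q_def del: add_uminus_conv_diff)
      moreover have "poly g (lam \<alpha> \<beta> (real x)) = poly G ((real x + P1)\<^sup>2)"
        using lam[of "real x"] by (simp add: poly_pcompose G_def)
      ultimately show "poly \<Theta> ((real x + P1)\<^sup>2) * dual_hahn_weight \<alpha> \<beta> N x * poly (?q n * g) (lam \<alpha> \<beta> (real x))
        = dual_hahn_weight \<alpha> \<beta> N x * poly (\<Theta> * G * Q) ((real x + P1)\<^sup>2)"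
        by (simp only: poly_mult mult_ac)
    qed
  qed
  also have "\<dots> = (\<Sum>x=0..N. dual_hahn_weight \<alpha> \<beta> N x) * cdh_fun P1 (par2 \<alpha> \<beta> (real N)) (par3 \<alpha> \<beta> (real N)) (\<Theta> * G * Q)"
    unfolding P1_def by (rule weight_functional[OF \<alpha> \<beta> \<alpha>\<beta>])
  also have "cdh_fun P1 (par2 \<alpha> \<beta> (real N)) (par3 \<alpha> \<beta> (real N)) (\<Theta> * G * Q) = 0"
  proof -
    have "G = (\<Sum>j\<le>degree G. monom (coeff G j) j)" by (rule poly_as_sum_of_monoms[symmetric])
    then have "\<Theta> * G * Q = \<Theta> * (\<Sum>j\<le>degree G. monom (coeff G j) j) * Q" by simp
    also have "\<dots> = (\<Sum>j\<le>degree G. smult (coeff G j) (\<Theta> * monom 1 j * Q))"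
      unfolding sum_distrib_left sum_distrib_right
    proof (intro sum.cong refl)
      fix j
      have "monom (coeff G j) j = smult (coeff G j) (monom 1 j)" by (simp add: smult_monom)
      then show "\<Theta> * monom (coeff G j) j * Q = smult (coeff G j) (\<Theta> * monom 1 j * Q)" by simp
    qed
    finally have *: "\<Theta> * G * Q = \<dots>" .
    have "cdh_fun P1 (par2 \<alpha> \<beta> (real N)) (par3 \<alpha> \<beta> (real N)) (\<Theta> * monom 1 j * Q) = 0" if "j \<le> degree G" for j
      unfolding \<Theta>_def Q_def P1_def
    proof (rule q_poly_orthogonal[OF F a_nz])
      show "a + (real n - real i) \<noteq> 0 \<or> fst (lab ! h) = First" if "h < mF" "i < mF" for h i
        using denominators_nz O n that by blast
      show "j < n" using that g by (simp add: G_def degree_pcompose)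
    qed
    then show ?thesis unfolding * cdh_fun_sum cdh_fun_smult by simp
  qed
  finally show "integral_lam (rho_F F1 F2 F3 \<alpha> \<beta> N) N (lam \<alpha> \<beta>) (?q n * g) = 0" by simp
qed

end

section \<open>Leading coefficients of the rows and distinctness of their numbers\<close>

context
  assumes F: "finite F1" "finite F2" "finite F3" "0 \<notin> F1" "0 \<notin> F2" "0 \<notin> F3"
    and \<alpha>: "\<And>k. \<alpha> + 1 + real k \<noteq> 0" and \<alpha>\<beta>: "\<And>k. \<alpha> + \<beta> + 1 + real k \<noteq> 0"
    and \<beta>: "\<And>k. \<beta> + real k \<noteq> real (set_len F3) - 1"
    and F2: "\<And>k. F2 \<noteq> {} \<Longrightarrow> \<alpha> + \<beta> + 2 * real (set_len F2) - 1 \<noteq> real k"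
    and F3: "\<And>k. F3 \<noteq> {} \<Longrightarrow> \<alpha> - \<beta> + 2 * real (set_len F3) - 1 \<noteq> real k"
begin

text \<open>Negative integers are excluded by the general assumption, nonnegative ones by the
  assumption for nonempty F2.\<close>

lemma alpha_beta_not_int:
  assumes "F2 \<noteq> {}"
  shows "\<alpha> + \<beta> \<noteq> real i - real j"
proof
  assume e: "\<alpha> + \<beta> = real i - real j"
  have s: "1 \<le> set_len F2" using assms by (simp add: set_len_def)
  show False
  proof (cases "j \<le> i")
    case True
    then show ?thesis using F2[OF assms, of "i - j + 2 * set_len F2 - 1"] e s by (simp add: of_nat_diff algebra_simps)
  next
    case False
    then show ?thesis using \<alpha>\<beta>[of "j - i - 1"] e by (simp add: of_nat_diff algebra_simps)
  qed
qed

lemma row_index_less: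
  assumes "l < mF" "lab ! l = (fam, u)"
  shows "u < set_len (case fam of First \<Rightarrow> F1 | Second \<Rightarrow> F2 | Third \<Rightarrow> F3)" "(case fam of First \<Rightarrow> F1 | Second \<Rightarrow> F2 | Third \<Rightarrow> F3) \<noteq> {}"
proof -
  have "u \<in> I_set (case fam of First \<Rightarrow> F1 | Second \<Rightarrow> F2 | Third \<Rightarrow> F3)"
    using row_label_in[OF finU[OF F] assms] by (cases fam) auto
  then show "u < set_len (case fam of First \<Rightarrow> F1 | Second \<Rightarrow> F2 | Third \<Rightarrow> F3)"
    using F I_set_iff by (cases fam) auto
  then show "(case fam of First \<Rightarrow> F1 | Second \<Rightarrow> F2 | Third \<Rightarrow> F3) \<noteq> {}" by (auto simp: set_len_def)
qed

text \<open>If \<open>Max F1 > N\<close>, then \<open>Omega 0\<close> has a zero block that is too large, because the polynomials of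
  the first family vanish at the first integers.\<close>

lemma First_set_bound:
  assumes F2: "F2 = {}" and O: "Omega a b c U1 U2 U3 0 \<noteq> 0"
  shows "set_len F1 \<le> N + 1"
proof (rule ccontr)
  assume "\<not> ?thesis"
  then obtain h where h: "set_len F1 = N + 2 + h" by (metis not_le Suc_eq_plus1 add_2_eq_Suc' add_Suc less_iff_Suc_add)
  have s2: "set_len F2 = 0" "U2 = {}" using F2 by (simp_all add: set_len_def I_set_def)
  have c: "c = - 2 - real h" using h s2 by simp
  have mF1: "set_len F1 - 1 \<in> U1" using I_set_iff[OF F(1,4)] F(4) h by simp
  define A where "A = mat mF mF (\<lambda>(l, i). let j = i + 1 in
     Omega_factor a b c U1 U2 U3 (fst (lab ! l)) j 0 * poly (hahn_row a b c (lab ! l)) (- 0 + real j - 1))"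
  have A: "A \<in> carrier_mat mF mF" by (simp add: A_def)
  have first: "A $$ (l, i) = 0" if "l < mF" "i < mF" "lab ! l = (First, u)" "h < u" "i \<le> h" for l i u
  proof -
    have "hahn_coeff (par3 a b c) (par1 a b c) (par2 a b c) u j * pochhammer (- real i) j = 0" if j: "j \<le> u" for j
    proof (cases "j \<le> i")
      case False
      then show ?thesis by (simp add: pochhammer_of_nat_eq_0_iff)
    next
      case True
      have "2 - par3 a b c - par1 a b c + real j = - real (h - j)"
        using True \<open>i \<le> h\<close> c by (simp add: par_defs of_nat_diff field_simps)
      moreover have "pochhammer (- real (h - j)) (u - j) = 0"
        unfolding pochhammer_eq_0_iff using True \<open>i \<le> h\<close> \<open>h < u\<close> by (intro exI[of _ "h - j"]) auto
      ultimately show ?thesis by (simp add: hahn_coeff_def)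
    qed
    then have "hahn3 (par3 a b c) (par1 a b c) (par2 a b c) u (real i) = 0"
      unfolding hahn3_def by (intro sum.neutral) auto
    moreover have "poly (hahn_row a b c (First, u)) (real i) = hahn3 (par3 a b c) (par1 a b c) (par2 a b c) u (real i)"
      unfolding poly_hahn_row by simp
    ultimately show ?thesis using that by (simp add: A_def Let_def del: hahn_row.simps)
  qed
  \<comment> \<open>In the third family the vanishing comes from the numerator factor: the
    Pochhammer symbol starts at -(h - i) and has more than h - i factors.\<close>
  have third: "A $$ (l, i) = 0" if "l < mF" "i < mF" "fst (lab ! l) = Third" "i \<le> h" "h + 1 < mF" for l i
  proof -
    have "c - 0 + real (i + 1) + 1 = - real (h - i)" using c that by (simp add: of_nat_diff)
    moreover have "pochhammer (- real (h - i)) (mF - (i + 1)) = 0"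
      unfolding pochhammer_eq_0_iff using that by (intro exI[of _ "h - i"]) auto
    ultimately have "Omega_factor a b c U1 U2 U3 Third (i + 1) 0 = 0" by (simp only: Omega_factor.simps div_0)
    then show ?thesis using that by (simp add: A_def Let_def del: Omega_factor.simps)
  qed
  have "det A = 0"
  proof (cases "h + 1 < mF")
    case True
    \<comment> \<open>Rows of the first family with index at most h need not vanish, but since 0 is
      not in I(F1) there are at most h of them; all other rows vanish on the first h + 1
      columns.\<close>
    define B where "B = {l\<in>{..<mF}. \<exists>u. lab ! l = (First, u) \<and> u \<le> h}"
    have "inj_on (\<lambda>l. snd (lab ! l)) B"
    proof (rule inj_onI)
      fix l l' assume "l \<in> B" "l' \<in> B" "snd (lab ! l) = snd (lab ! l')"
      then show "l = l'" using row_labels_inj[OF finU[OF F], of l l'] by (auto simp: B_def)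
    qed
    moreover have "(\<lambda>l. snd (lab ! l)) ` B \<subseteq> {1..h}"
    proof clarify
      fix l assume l: "l \<in> B"
      then obtain u where u: "lab ! l = (First, u)" "u \<le> h" "l < mF" by (auto simp: B_def)
      then have "u \<in> U1" using row_label_in[OF finU[OF F], of l First u] by simp
      then have "u \<noteq> 0" using F(1) by (auto simp: I_set_def split: if_splits)
      then show "snd (lab ! l) \<in> {1..h}" using u by simp
    qed
    ultimately have "card B \<le> card {1..h}" by (metis card_image card_mono finite_atLeastAtMost)
    moreover have "card ({..<mF} - B) = mF - card B" by (subst card_Diff_subset) (auto simp: B_def)
    moreover have "card B \<le> mF" using card_mono[of "{..<mF}" B] by (auto simp: B_def)
    ultimately have card: "card ({..<mF} - B) + card {..<h + 1} > mF" by simp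
    show ?thesis
    proof (rule det_zero_block[OF A _ _ _ card])
      fix l i assume l: "l \<in> {..<mF} - B" and i: "i \<in> {..<h + 1}"
      obtain fam u where lu: "lab ! l = (fam, u)" by fastforce
      show "A $$ (l, i) = 0"
      proof (cases fam)
        case First
        then show ?thesis using first[of l i u] lu l i True by (auto simp: B_def)
      next
        case Second
        then show ?thesis using row_label_in[OF finU[OF F], of l fam u] lu l s2 by auto
      next
        case Third
        then show ?thesis using third[of l i] lu l i True by auto
      qed
    qed (use True in auto)
  next
    case False
    \<comment> \<open>With at most h + 1 columns, the row of index max F1 already vanishes
      entirely.\<close>
    have "(First, set_len F1 - 1) \<in> set lab" using mF1 finU[OF F] by (simp add: row_labels_def)
    then obtain l where l: "l < mF" "lab ! l = (First, set_len F1 - 1)"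
      using length_row_labels[OF finU[OF F]] by (metis in_set_conv_nth)
    show ?thesis
      by (rule det_zero_block[OF A, of "{l}" "{..<mF}"]) (use l first[OF l(1) _ l(2)] False h in auto)
  qed
  then show False using O unfolding Omega_def A_def by simp
qed

text \<open>Ensures that Y_h has full degree. A resonance means \<open>2 * p = u + k + 2\<close>
  with k < u. The second and third family exclude it by their own assumptions; in the first it would
  make \<alpha> + \<beta> an integer, and if F2 is empty the bound max F1 \<le> N makes this integer
  negative.\<close>

lemma nonresonant:
  assumes O: "Omega a b c U1 U2 U3 0 \<noteq> 0" and l: "l < mF" and lu: "lab ! l = (fam, u)"
  shows "pochhammer (real u + 2 - 2 * fam_p a b c fam) u \<noteq> 0"
proof
  assume "pochhammer (real u + 2 - 2 * fam_p a b c fam) u = 0"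
  then obtain k where k: "k < u" "real u + 2 - 2 * fam_p a b c fam = - real k" by (auto simp: pochhammer_eq_0_iff)
  note less = row_index_less[OF l lu]
  show False
  proof (cases fam)
    case First
    have e: "\<alpha> + \<beta> + 3 + real u + real k + 2 * real N - 2 * real (set_len F1) = 0"
      using k(2) First by (simp add: par_defs field_simps)
    show False
    proof (cases "F2 = {}")
      case True
      have "set_len F1 \<le> N + 1" by (rule First_set_bound[OF True O])
      then show False using \<alpha>\<beta>[of "u + k + 2 * (N + 1 - set_len F1)"] e by (simp add: of_nat_diff algebra_simps)
    next
      case False
      show False using alpha_beta_not_int[OF False, of "2 * set_len F1" "3 + u + k + 2 * N"] e by simp
    qed
  next
    case Second
    then have "F2 \<noteq> {}" using less by simp
    from F2[OF this, of "u + k"] show False using k(2) Second by (simp add: par_defs field_simps)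
  next
    case Third
    then have "F3 \<noteq> {}" using less by simp
    from F3[OF this, of "u + k"] show False using k(2) Third by (simp add: par_defs field_simps)
  qed
qed

text \<open>The coincidence makes \<open>par3\<close> and \<open>par2\<close> differ by u - w. By
  \<open>hahn_n_resonance\<close> one Hahn polynomial is then a Pochhammer factor times the other,
  and this factor matches the quotient of the products \<xi>. The two rows at 0 are therefore
  proportional.\<close>

lemma First_Third_distinct:
  assumes D: "Omega_defined a U1 U2 U3 0" and O: "Omega a b c U1 U2 U3 0 \<noteq> 0"
    and l: "l < mF" "lab ! l = (First, u)" and l': "l' < mF" "lab ! l' = (Third, w)"
  shows "a + c + 1 \<noteq> real w - real u"
proof
  assume e: "a + c + 1 = real w - real u"
  define G where "G = hahn_n (par3 a b c) (par1 a b c) (par2 a b c) u"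
  define H where "H = hahn_n (par2 a b c) (par3 a b c) (par1 a b c) w"
  define y where "y j = - real (j + 1)" for j
  define M where "M j = mF - (j + 1)" for j
  define z where "z = a - real mF + 1"
  have yM: "y j = z + real (M j) - 1 - a" if "j < mF" for j
    using that by (simp add: y_def M_def z_def of_nat_diff)
  have "U3 \<noteq> {}" using row_label_in[OF finU[OF F] l'] by auto
  then have znz: "pochhammer z (M j) \<noteq> 0" if "j < mF" for j
    using D that by (auto simp: Omega_defined_def z_def M_def)
  have rev: "(\<Prod>k<M j. s + (y j - real k)) = pochhammer (s + y j + 1 - real (M j)) (M j)" for s j
    unfolding pochhammer_prod
    by (rule prod.reindex_bij_witness[of _ "\<lambda>k. M j - 1 - k" "\<lambda>k. M j - 1 - k"]) (auto simp: of_nat_diff)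
  have C1: "Casorati a b c U1 U2 U3 0 $$ (l, j) = (-1) ^ M j * ((-1) ^ u * G (y j))" if "j < mF" for j
    using l that by (simp add: Casorati_def Let_def xi_def poly_Y[OF l(2)] G_def y_def M_def)
  have C3: "Casorati a b c U1 U2 U3 0 $$ (l', j) = (-1) ^ M j * (pochhammer (z + real u - real w) (M j) / pochhammer z (M j)) * ((-1) ^ w * H (y j))"
    if j: "j < mF" for j
  proof -
    have ep: "eps a b c Third (y j - real k) = (-1) * ((a + real u - real w + (y j - real k)) / (a + (y j - real k)))" for k
    proof -
      have "c - (y j - real k) + 1 = - (a + real u - real w + (y j - real k))" using e by simp
      then show ?thesis unfolding eps.simps by (simp only: minus_divide_left mult_minus1)
    qed
    have s: "a + real u - real w + y j + 1 - real (M j) = z + real u - real w" "a + y j + 1 - real (M j) = z"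
      using yM[OF j] by simp_all
    have "(\<Prod>k<M j. eps a b c Third (y j - real k)) = (-1) ^ M j * (pochhammer (z + real u - real w) (M j) / pochhammer z (M j))"
      unfolding ep prod.distrib prod_dividef rev s by simp
    then show ?thesis
      using l' j by (simp add: Casorati_def Let_def xi_def poly_Y[OF l'(2)] H_def y_def M_def del: eps.simps)
  qed
  have carrier: "Casorati a b c U1 U2 U3 0 \<in> carrier_mat mF mF" by (simp add: Casorati_def)
  have ne: "l \<noteq> l'" using l l' by auto
  \<comment> \<open>Two ways to split the Pochhammer symbol of s with M + d factors; this identifies
    the factor from the resonance with the quotient of gauge factors up to a constant in j.\<close>
  have shift: "pochhammer (s + real (M j)) d * pochhammer s (M j) = pochhammer s d * pochhammer (s + real d) (M j)" for s d j
    using pochhammer_product'[of s "M j" d] pochhammer_product'[of s d "M j"] by (simp add: add.commute)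
  have sq: "(-1 :: real) ^ i * (-1) ^ i = 1" for i by (simp flip: power_add)
  have cancel: "s * (t * (k * ((Q * r) * x))) = (t * v * k * Q) * (s * r * (v * x))" if "v * v = 1" for s t k Q r x v :: real
  proof -
    have "(t * v * k * Q) * (s * r * (v * x)) = (v * v) * (s * (t * (k * ((Q * r) * x))))" by (simp only: mult_ac)
    then show ?thesis unfolding that by (simp only: mult_1_left)
  qed
  have cancel': "s * Q * (v * (k * x)) = (t * v * k * Q) * (s * (t * x))" if "t * t = 1" for s t k Q x v :: real
  proof -
    have "(t * v * k * Q) * (s * (t * x)) = (t * t) * (s * Q * (v * (k * x)))" by (simp only: mult_ac)
    then show ?thesis unfolding that by (simp only: mult_1_left)
  qed
  have "det (Casorati a b c U1 U2 U3 0) = 0"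
  proof (cases "w \<le> u")
    case True
    then obtain d where d: "u = w + d" by (auto simp: le_iff_add)
    have p: "par3 a b c = par2 a b c + real d" "par1 a b c + par2 a b c = a + 1" using e d by (simp_all add: par_defs field_simps)
    obtain k where k: "\<And>n. hahn_n (par2 a b c + real d) (par2 a b c) (par1 a b c) (w + d) n
        = k * (pochhammer (n + par2 a b c + par1 a b c) d * hahn_n (par2 a b c) (par2 a b c + real d) (par1 a b c) w n)"
      using hahn_n_resonance[of w d "par2 a b c" "par1 a b c"] nonresonant[OF O l] nonresonant[OF O l'] p d by auto
    have GH: "G n = k * (pochhammer (n + a + 1) d * H n)" for n
      using k[of n] p hahn_n_commute[of "par3 a b c" "par1 a b c" "par2 a b c" u n]
      unfolding G_def H_def p(1)[symmetric] d[symmetric] by (simp add: add_ac)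
    show ?thesis
    proof (rule det_proportional_rows[OF carrier l(1) l'(1) ne])
      fix j assume j: "j < mF"
      have "pochhammer (y j + a + 1) d * pochhammer z (M j) = pochhammer z d * pochhammer (z + real u - real w) (M j)"
        using shift[of z j d] yM[OF j] d by simp
      then have E: "pochhammer (y j + a + 1) d = pochhammer z d * (pochhammer (z + real u - real w) (M j) / pochhammer z (M j))"
        using znz[OF j] by (simp add: field_simps)
      show "Casorati a b c U1 U2 U3 0 $$ (l, j) = ((-1) ^ u * (-1) ^ w * k * pochhammer z d) * Casorati a b c U1 U2 U3 0 $$ (l', j)"
        unfolding C1[OF j] C3[OF j] GH E by (rule cancel[OF sq])
    qed
  next
    case False
    then obtain d where d: "w = u + d" by (metis le_iff_add nat_le_linear)
    have p: "par2 a b c = par3 a b c + real d" "par1 a b c + par3 a b c = a + 1 - real d" using e d by (simp_all add: par_defs field_simps)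
    obtain k where k: "\<And>n. hahn_n (par3 a b c + real d) (par3 a b c) (par1 a b c) (u + d) n
        = k * (pochhammer (n + par3 a b c + par1 a b c) d * hahn_n (par3 a b c) (par3 a b c + real d) (par1 a b c) u n)"
      using hahn_n_resonance[of u d "par3 a b c" "par1 a b c"] nonresonant[OF O l] nonresonant[OF O l'] p d by auto
    have HG: "H n = k * (pochhammer (n + a + 1 - real d) d * G n)" for n
    proof -
      have e2: "n + par3 a b c + par1 a b c = n + a + 1 - real d" using p(2) by linarith
      then show ?thesis
        using k[of n] hahn_n_commute[of "par3 a b c" "par1 a b c" "par2 a b c" u n]
        unfolding G_def H_def e2 p(1)[symmetric] d[symmetric] by (simp only:)
    qed
    show ?thesis
    proof (rule det_proportional_rows[OF carrier l'(1) l(1) ne[symmetric]])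
      fix j assume j: "j < mF"
      have "pochhammer (y j + a + 1 - real d) d * pochhammer (z + real u - real w) (M j) = pochhammer (z - real d) d * pochhammer z (M j)"
        using shift[of "z - real d" j d] yM[OF j] d by (simp add: algebra_simps)
      then have "pochhammer (z + real u - real w) (M j) / pochhammer z (M j) * pochhammer (y j + a + 1 - real d) d = pochhammer (z - real d) d"
        using znz[OF j] by (simp add: field_simps)
      then have Q: "pochhammer (z + real u - real w) (M j) / pochhammer z (M j) * pochhammer (y j + a + 1 - real d) d = pochhammer (z - real d) d" .
      have "s * R * (v * (k * (p * x))) = s * (R * p) * (v * (k * x))" for s R v p x :: real by (simp only: mult_ac)
      from this[of "(-1) ^ M j" "pochhammer (z + real u - real w) (M j) / pochhammer z (M j)" "(-1) ^ w" "pochhammer (y j + a + 1 - real d) d" "G (y j)", unfolded Q]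
      have x: "(-1) ^ M j * (pochhammer (z + real u - real w) (M j) / pochhammer z (M j)) * ((-1) ^ w * (k * (pochhammer (y j + a + 1 - real d) d * G (y j))))
        = (-1) ^ M j * pochhammer (z - real d) d * ((-1) ^ w * (k * G (y j)))" .
      show "Casorati a b c U1 U2 U3 0 $$ (l', j) = ((-1) ^ u * (-1) ^ w * k * pochhammer (z - real d) d) * Casorati a b c U1 U2 U3 0 $$ (l, j)"
        unfolding C1[OF j] C3[OF j] HG x by (rule cancel'[OF sq])
    qed
  qed
  then show False using Omega_D_nz[OF O] by (simp add: Omega_D_def)
qed

text \<open>First against second family, a coincidence would make \<alpha> + \<beta> an integer;
  second against third, it would make \<beta> an integer not exceeding max F3. Only first against
  third needs the determinant.\<close>

lemma kap_distinct:
  assumes D: "Omega_defined a U1 U2 U3 0" and O: "Omega a b c U1 U2 U3 0 \<noteq> 0"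
  shows "inj_on (\<lambda>l. kap a b c (fst (lab ! l)) - real (snd (lab ! l))) {..<mF}"
proof -
  have FS: "- real u \<noteq> a + b + c + 1 - real v" if "l' < mF" "lab ! l' = (Second, v)" for l' u v
  proof
    assume "- real u = a + b + c + 1 - real v"
    then have "\<alpha> + \<beta> = real (v + set_len F1) - real (u + N + 1 + set_len F2)" by simp
    moreover have "F2 \<noteq> {}" using row_index_less(2)[OF that] by simp
    ultimately show False using alpha_beta_not_int by blast
  qed
  have ST: "a + b + c + 1 - real v \<noteq> a + c + 1 - real w" if "l < mF" "lab ! l = (Second, v)" for l v w
  proof
    assume "a + b + c + 1 - real v = a + c + 1 - real w"
    moreover have "v < set_len F2" using row_index_less(1)[OF that] by simp
    ultimately show False using \<beta>[of "w + (set_len F2 - 1 - v)"] by (simp add: of_nat_diff)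
  qed
  have FT: "- real u \<noteq> a + c + 1 - real w" if "l < mF" "lab ! l = (First, u)" "l' < mF" "lab ! l' = (Third, w)" for l l' u w
  proof
    assume "- real u = a + c + 1 - real w"
    then have "a + c + 1 = real w - real u" by linarith
    with First_Third_distinct[OF D O that] show False by contradiction
  qed
  have neq: "kap a b c fam - real u \<noteq> kap a b c fam' - real u'"
    if "l < mF" "lab ! l = (fam, u)" "l' < mF" "lab ! l' = (fam', u')" "(fam, fam') \<in> {(First, Second), (First, Third), (Second, Third)}" for l l' fam fam' u u'
  proof -
    from that(5) consider "fam = First \<and> fam' = Second" | "fam = First \<and> fam' = Third" | "fam = Second \<and> fam' = Third" by blast
    then show ?thesis
    proof cases
      case 1
      then show ?thesis using FS[of l' u' u] that by simp
    next
      case 2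
      then show ?thesis using FT[of l u l' u'] that by simp
    next
      case 3
      then show ?thesis using ST[of l u u'] that by simp
    qed
  qed
  show ?thesis
  proof (rule inj_onI)
    fix l l' assume l: "l \<in> {..<mF}" "l' \<in> {..<mF}"
      and eq: "kap a b c (fst (lab ! l)) - real (snd (lab ! l)) = kap a b c (fst (lab ! l')) - real (snd (lab ! l'))"
    obtain fam u fam' u' where lu: "lab ! l = (fam, u)" "lab ! l' = (fam', u')" by (metis surj_pair)
    then have eq': "kap a b c fam - real u = kap a b c fam' - real u'" using eq by simp
    then have "(fam, fam') \<notin> {(First, Second), (First, Third), (Second, Third)}"
      "(fam', fam) \<notin> {(First, Second), (First, Third), (Second, Third)}"
      using neq[OF _ lu(1) _ lu(2)] neq[OF _ lu(2) _ lu(1)] l by auto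
    then have "fst (lab ! l) = fst (lab ! l')"
      unfolding lu by (cases fam; cases fam') simp_all
    moreover from this eq have "snd (lab ! l) = snd (lab ! l')" by simp
    ultimately have "lab ! l = lab ! l'" by (rule prod_eqI)
    then show "l = l'" using row_labels_inj[OF finU[OF F]] l by simp
  qed
qed

lemma degree_Y:
  assumes O: "Omega a b c U1 U2 U3 0 \<noteq> 0" and l: "l < mF"
  shows "degree (Y a b c U1 U2 U3 l) \<le> snd (lab ! l)" "coeff (Y a b c U1 U2 U3 l) (snd (lab ! l)) \<noteq> 0"
proof -
  obtain fam u where lu: "lab ! l = (fam, u)" by fastforce
  show "degree (Y a b c U1 U2 U3 l) \<le> snd (lab ! l)"
    unfolding Y_hahn_n_poly[OF lu] lu by (simp add: hahn_n_poly_lead order.trans[OF degree_smult_le])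
  show "coeff (Y a b c U1 U2 U3 l) (snd (lab ! l)) \<noteq> 0"
    unfolding Y_hahn_n_poly[OF lu] lu using nonresonant[OF O l lu] by (simp add: hahn_n_poly_lead)
qed

end

end

end

section \<open>The order in terms of the sets F1, F2, F3\<close>

text \<open>F and the reflected I(F) partition {0, ..., max F}, so counting and summing this
  interval relates both sides. It converts the degree count over the rows into the stated
  order.\<close>

lemma sum_minus_choose_I_set:
  assumes "finite F" "0 \<notin> F"
  shows "int (\<Sum>F) - int (card F choose 2) = int (\<Sum>(I_set F)) - int (card (I_set F) choose 2)"
proof -
  define n where "n = set_len F"
  define U where "U = I_set F"
  note split = set_len_split[OF assms, folded n_def U_def]
  have fin: "finite U" unfolding U_def by (rule finite_I_set[OF assms])
  have less: "u < n" if "u \<in> U" for u using that I_set_iff[OF assms] by (simp add: n_def U_def)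
  have "(\<Sum>i<n. int i) = (\<Sum>i\<in>F. int i) + (\<Sum>i\<in>(\<lambda>u. n - 1 - u) ` U. int i)"
    unfolding split(1) using split(2) assms(1) fin by (intro sum.union_disjoint) auto
  also have "(\<Sum>i\<in>(\<lambda>u. n - 1 - u) ` U. int i) = (\<Sum>u\<in>U. int n - 1 - int u)"
    unfolding sum.reindex[OF split(3)]
  proof (intro sum.cong refl)
    fix u assume "u \<in> U"
    then have "u < n" by (rule less)
    then show "(int \<circ> (\<lambda>u. n - 1 - u)) u = int n - 1 - int u" by simp
  qed
  finally have 1: "(\<Sum>i<n. int i) = int (\<Sum>F) + (int n - 1) * int (card U) - int (\<Sum>U)"
    by (simp add: sum_subtractf mult.commute)
  have "card {..<n} = card F + card U"
    unfolding split(1) using split(2,3) assms(1) fin by (subst card_Un_disjoint) (auto simp: card_image)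
  then have n: "int n = int (card F) + int (card U)" by simp
  have "2 * (\<Sum>i<n. int i) = int n * (int n - 1)"
    by (induction n) (auto simp: algebra_simps)
  then have "2 * (int (\<Sum>F) - int (card F choose 2)) = 2 * (int (\<Sum>U) - int (card U choose 2))"
    using two_choose_two[of "card F"] two_choose_two[of "card U"] unfolding 1 n by (simp add: algebra_simps)
  then show ?thesis by (simp add: U_def)
qed

theorem corollary5p2:
  fixes N :: nat and F1 F2 F3 :: "nat set" and \<alpha> \<beta> :: real
  assumes "N > 0"
    and "finite F1" "finite F2" "finite F3"
    and "0 \<notin> F1" "0 \<notin> F2" "0 \<notin> F3"
    and "\<alpha> \<notin> integers_upto (-1)" "\<alpha> + \<beta> \<notin> integers_upto (-1)"
    and "\<beta> \<notin> integers_upto (maxF F3)"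
    and "F2 \<noteq> {} \<Longrightarrow> \<alpha> + \<beta> + 2 * real_of_int (maxF F2) + 1 \<notin> \<nat>"
    and "F3 \<noteq> {} \<Longrightarrow> \<alpha> - \<beta> + 2 * real_of_int (maxF F3) + 1 \<notin> \<nat>"
    and Omega_nonzero:
      "\<forall>n \<le> N + card (I_set F1) + card (I_set F2) + 1.
         Omega_defined (\<alpha> + maxF F2 + maxF F3 + 2)
           (I_set F1) (I_set F2) (I_set F3) (real n) \<and>
         Omega (\<alpha> + maxF F2 + maxF F3 + 2) (\<beta> + maxF F2 - maxF F3) (real N - maxF F1 - maxF F2 - 2)
           (I_set F1) (I_set F2) (I_set F3) (real n) \<noteq> 0"
  shows
    "let a = \<alpha> + maxF F2 + maxF F3 + 2;
         b = \<beta> + maxF F2 - maxF F3;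
         c = real N - maxF F1 - maxF F2 - 2;
         U1 = I_set F1; U2 = I_set F2; U3 = I_set F3;
         \<rho> = rho_F F1 F2 F3 \<alpha> \<beta> N;
         s = real_of_int (maxF F2 + 1);
         q = (\<lambda>n. pcompose (q_poly a b c U1 U2 U3 n) [:- lam \<alpha> \<beta> s, 1:]);
         r = int (\<Sum>F1) + int (\<Sum>F2) + int (\<Sum>F3)
               - int (card F1 choose 2) - int (card F2 choose 2) - int (card F3 choose 2) + 1
     in orthogonal_sequence \<rho> N (lam \<alpha> \<beta>) q \<and>
        (\<exists>P M. D_procedure_data a b c U1 U2 U3 P M \<and>
          (let T = translate_operator s (D_procedure_op a b c U1 U2 U3 P M)
           in difference_operator T (- r) r \<and>
              (\<forall>n < card {x \<in> {0..N}. \<rho> x \<noteq> 0}. \<forall>\<^sub>F x in cofinite.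
                 T (\<lambda>y. poly (q n) (lam \<alpha> \<beta> y)) x =
                 poly P (real n) * poly (q n) (lam \<alpha> \<beta> x))))"
proof -
  note F = assms(2-7)
  define s1 where "s1 = real (set_len F1)"
  define s2 where "s2 = real (set_len F2)"
  define s3 where "s3 = real (set_len F3)"
  have mx: "real_of_int (maxF F1) = s1 - 1" "real_of_int (maxF F2) = s2 - 1" "real_of_int (maxF F3) = s3 - 1"
    by (simp_all add: maxF_set_len s1_def s2_def s3_def)
  define a where "a = \<alpha> + s2 + s3"
  define b where "b = \<beta> + s2 - s3"
  define c where "c = real N - s1 - s2"
  have abc: "\<alpha> + real_of_int (maxF F2) + real_of_int (maxF F3) + 2 = a" "\<beta> + real_of_int (maxF F2) - real_of_int (maxF F3) = b"
    "real N - real_of_int (maxF F1) - real_of_int (maxF F2) - 2 = c" "real_of_int (maxF F2 + 1) = s2"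
    by (simp_all add: mx a_def b_def c_def)
  define U1 where "U1 = I_set F1"
  define U2 where "U2 = I_set F2"
  define U3 where "U3 = I_set F3"
  define m where "m = num_rows U1 U2 U3"
  have int_upto: "real_of_int j - real k \<in> integers_upto j" for j k
    unfolding integers_upto_def by (rule CollectI, rule exI[of _ "j - int k"]) simp
  have \<alpha>: "\<alpha> + 1 + real k \<noteq> 0" for k
  proof
    assume "\<alpha> + 1 + real k = 0"
    then have "\<alpha> = real_of_int (- 1) - real k" by simp
    then show False using assms(8) int_upto[of "-1" k] by metis
  qed
  have \<alpha>\<beta>: "\<alpha> + \<beta> + 1 + real k \<noteq> 0" for k
  proof
    assume "\<alpha> + \<beta> + 1 + real k = 0"
    then have "\<alpha> + \<beta> = real_of_int (- 1) - real k" by simp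
    then show False using assms(9) int_upto[of "-1" k] by metis
  qed
  have \<beta>: "\<beta> + real k \<noteq> real (set_len F3) - 1" for k
  proof
    assume "\<beta> + real k = real (set_len F3) - 1"
    then have "\<beta> = real_of_int (maxF F3) - real k" by (simp add: mx s3_def)
    then show False using assms(10) int_upto[of "maxF F3" k] by metis
  qed
  \<comment> \<open>As max F3 \<ge> -1, the excluded range of \<beta> contains all negative
    integers.\<close>
  have \<beta>': "\<beta> + 1 + real k \<noteq> 0" for k using \<beta>[of "k + set_len F3"] by simp
  have F2: "\<alpha> + \<beta> + 2 * real (set_len F2) - 1 \<noteq> real k" if "F2 \<noteq> {}" for k
  proof
    assume "\<alpha> + \<beta> + 2 * real (set_len F2) - 1 = real k"
    then have "\<alpha> + \<beta> + 2 * real_of_int (maxF F2) + 1 = real k" by (simp add: mx s2_def)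
    then show False using assms(11)[OF that] by (metis of_nat_in_Nats)
  qed
  have F3: "\<alpha> - \<beta> + 2 * real (set_len F3) - 1 \<noteq> real k" if "F3 \<noteq> {}" for k
  proof
    assume "\<alpha> - \<beta> + 2 * real (set_len F3) - 1 = real k"
    then have "\<alpha> - \<beta> + 2 * real_of_int (maxF F3) + 1 = real k" by (simp add: mx s3_def)
    then show False using assms(12)[OF that] by (metis of_nat_in_Nats)
  qed
  have O: "Omega_defined a U1 U2 U3 (real n) \<and> Omega a b c U1 U2 U3 (real n) \<noteq> 0" if "n \<le> N" for n
    using Omega_nonzero[unfolded abc, folded U1_def U2_def U3_def] that by simp
  note defs = a_def b_def c_def s1_def s2_def s3_def U1_def U2_def U3_def
  have O0: "Omega_defined a U1 U2 U3 0" "Omega a b c U1 U2 U3 0 \<noteq> 0" using O[of 0] by simp_all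
  have fin: "finite U1" "finite U2" "finite U3" using finU[OF F] by (simp_all add: U1_def U2_def U3_def)
  define q where "q = (\<lambda>n. pcompose (q_poly a b c U1 U2 U3 n) [:- lam \<alpha> \<beta> s2, 1:])"
  have orth: "orthogonal_sequence (rho_F F1 F2 F3 \<alpha> \<beta> N) N (lam \<alpha> \<beta>) q"
    using orthogonality[OF F \<alpha> \<beta>' \<alpha>\<beta>] O unfolding q_def defs by blast
  define idx where "idx l = snd (row_labels U1 U2 U3 ! l)" for l
  define D where "D = int (\<Sum>l<m. idx l) - int (card U1 choose 2) - int (card U2 choose 2) - int (card U3 choose 2)"
  have degY: "degree (Y a b c U1 U2 U3 l) \<le> idx l" "coeff (Y a b c U1 U2 U3 l) (idx l) \<noteq> 0" if "l < m" for l
    using degree_Y[OF F \<alpha> \<alpha>\<beta> \<beta> F2 F3 O0(2)[unfolded defs] that[unfolded m_def defs]] unfolding idx_def defs by blast+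
  have "inj_on (\<lambda>l. kap a b c (fst (row_labels U1 U2 U3 ! l)) - real (idx l)) {..<m}"
    using kap_distinct[OF F \<alpha> \<alpha>\<beta> \<beta> F2 F3 O0[unfolded defs]] unfolding idx_def m_def defs by blast
  from D_procedure_data_exists[OF fin degY[unfolded m_def idx_def] this[unfolded m_def idx_def] D_def[unfolded m_def idx_def]]
  obtain P M where data: "D_procedure_data a b c U1 U2 U3 P M" and D0: "D \<ge> 0" and P: "degree P \<le> Suc (nat D)" "coeff P (Suc (nat D)) \<noteq> 0"
    and M: "\<And>h i. h < m \<Longrightarrow> int i > D - int (idx h) \<Longrightarrow> coeff (M h) i = 0"
    unfolding m_def idx_def by blast
  define T where "T = translate_operator s2 (D_procedure_op a b c U1 U2 U3 P M)"
  have "dop (D_procedure_op a b c U1 U2 U3 P M) (Suc (nat D)) (coeff P (Suc (nat D)) * (1 / 4) ^ Suc (nat D)) (coeff P (Suc (nat D)) * (- 1 / 4) ^ Suc (nat D))"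
    by (rule dop_D_procedure_op[OF D0 P(1) degY(1)[unfolded m_def] M[unfolded m_def]])
  from difference_operator_translate[OF this, of s2] have dT: "difference_operator T (- int (Suc (nat D))) (int (Suc (nat D)))"
    unfolding T_def using P(2) by simp
  have r: "int (Suc (nat D)) = int (\<Sum>F1) + int (\<Sum>F2) + int (\<Sum>F3)
      - int (card F1 choose 2) - int (card F2 choose 2) - int (card F3 choose 2) + 1"
  proof -
    have "(\<Sum>l<m. idx l) = \<Sum>U1 + \<Sum>U2 + \<Sum>U3"
      unfolding m_def idx_def sum_rows[OF fin, of snd] by simp
    then show ?thesis
      using sum_minus_choose_I_set[OF F(1,4)] sum_minus_choose_I_set[OF F(2,5)] sum_minus_choose_I_set[OF F(3,6)] D0
      unfolding D_def U1_def[symmetric] U2_def[symmetric] U3_def[symmetric] by simp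
  qed
  have eig: "\<forall>\<^sub>F x in cofinite. T (\<lambda>y. poly (q n) (lam \<alpha> \<beta> y)) x = poly P (real n) * poly (q n) (lam \<alpha> \<beta> x)"
    if n: "n < card {x \<in> {0..N}. rho_F F1 F2 F3 \<alpha> \<beta> N x \<noteq> 0}" for n
  proof -
    have "card {x \<in> {0..N}. rho_F F1 F2 F3 \<alpha> \<beta> N x \<noteq> 0} \<le> card {0..N}" by (intro card_mono) auto
    then have nN: "n \<le> N" using n by simp
    \<comment> \<open>Because a + b = \<alpha> + \<beta> + 2 s2, translating the argument by s2
      changes \<lambda> only by a constant, which the composition in q removes.\<close>
    have lam: "lam \<alpha> \<beta> (y + s2) - lam \<alpha> \<beta> s2 = lam a b y" for y
      by (simp add: lam_def a_def b_def algebra_simps)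
    have q: "poly (q n) (lam \<alpha> \<beta> (y + s2)) = poly (q_poly a b c U1 U2 U3 n) (lam a b y)" for y
      using lam[of y] by (simp add: q_def poly_pcompose)
    have a: "a + 1 + real k \<noteq> 0" for k using a_nz[OF F \<alpha> \<beta>' \<alpha>\<beta>] unfolding a_def s2_def s3_def .
    have den: "a + (real n - real i) \<noteq> 0 \<or> fst (row_labels U1 U2 U3 ! h) = First" if "h < m" "i < m" for h i
      using denominators_nz[OF F \<alpha> \<beta>' \<alpha>\<beta>] O[OF nN] that unfolding m_def defs by blast
    have "\<forall>\<^sub>F x in cofinite. D_procedure_op a b c U1 U2 U3 P M (\<lambda>y. poly (q_poly a b c U1 U2 U3 n) (lam a b y)) x
        = poly P (real n) * poly (q_poly a b c U1 U2 U3 n) (lam a b x)"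
      by (rule D_procedure_eigenfunction[OF data a]) (use den in \<open>auto simp: m_def\<close>)
    from eventually_cofinite_shift[OF this, of "- s2"] show ?thesis
    proof eventually_elim
      case (elim x)
      then show ?case using q[of "x - s2"] by (simp add: T_def translate_operator_def q)
    qed
  qed
  show ?thesis
    unfolding Let_def abc U1_def[symmetric] U2_def[symmetric] U3_def[symmetric] q_def[symmetric]
    by (intro conjI orth exI[of _ P] exI[of _ M] data dT[unfolded r T_def] allI impI)
       (rule eig[unfolded T_def q_def])
qed

end
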